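(* Let $C=\operatorname{Spec}A_0$ be a smooth affine curve over $\mathbb{C}$, let $D_+,D_-$ be $\mathbb{Q}$-divisors on $C$ with $D_++D_-\le0$, let $A=A_0[D_+,D_-]$, $V=\operatorname{Spec}A$, and let $\pi:V\to C$ be the canonical projection. (a) The set of singular points $\operatorname{Sing}V$ is contained in the fixed point set $F$ of the $\mathbb{C}^*$-action, which is the zero locus $F=V(I)$ of the ideal $I:=A_+A+A_-A$ of $A$, where $A_+=\bigoplus_{i>0}A_i$ and $A_-=\bigoplus_{i<0}A_i$. (b) The map $\pi|F:F\to C$ is injective, and $\pi(F)=\{a\in C\mid D_+(a)+D_-(a)<0\}$. (c) For a point $a'\in F$ with image $a:=\pi(a')\in C$ write $$D_+(a)=-\frac{e_+}{m_+}\quad\text{and}\quad D_-(a)=\frac{e_-}{m_-}$$ with integers such that $m_+>0$, $m_-<0$, $\gcd(e_+,m_+)=\gcd(e_-,m_-)=1$, and $m_+=1$ if $D_+(a)=0$, $m_-=-1$ if $D_-(a)=0$. Let $p,q\in\mathbb{Z}$ with $\begin{vmatrix} p & e_+ \\ q & m_+ \end{vmatrix}=1$. Then $a'\in F$ is a quotient singularity of type $$(\Delta(a),e),\quad\text{where}\quad \Delta(a):=-\begin{vmatrix} e_+ & e_- \\ m_+ & m_- \end{vmatrix}\quad\text{and}\quad e\equiv\begin{vmatrix} p & e_- \\ q & m_- \end{vmatrix}\mod\Delta(a).$$ In particular, $a'\in\operatorname{Sing}V$ if and only if $\Delta(a)\ne1$.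
   Context: For a $\mathbb{Q}$-divisor $D=\sum D(a)\,a$ on $C$, $\lfloor D\rfloor=\sum\lfloor D(a)\rfloor a$. For $\mathbb{Q}$-divisors with $D_++D_-\le0$, the normal graded $A_0$-algebra $A=A_0[D_+,D_-]=\bigoplus_{n\in\mathbb{Z}}A_n\subseteq\operatorname{Frac}(A_0)[u,u^{-1}]$ ($u$ an indeterminate of degree $1$) is defined by $A_n=H^0(C,\mathcal{O}_C(\lfloor nD_+\rfloor))\cdot u^n$ and $A_{-n}=H^0(C,\mathcal{O}_C(\lfloor nD_-\rfloor))\cdot u^{-n}$ for $n\ge0$. The grading defines a $\mathbb{C}^*$-action on $V=\operatorname{Spec}A$, and $\pi:V\to C$ is induced by $A_0\subseteq A$. A point of a surface is called a quotient singularity of type $(d,e)$, where $d\ge1$, $0\le e<d$ and $\gcd(e,d)=1$, if the surface is there locally (i.e. after completion of the local ring) isomorphic to $\mathbb{A}^2_{\mathbb{C}}/\mathbb{Z}_d$ at the image of the origin, where the generator $\zeta$ (a primitive $d$-th root of unity) of $\mathbb{Z}_d$ acts by $\zeta.(x,y)=(\zeta x,\zeta^e y)$; type $(1,0)$ means a smooth point. *)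

theory Defs
  imports
    "HOL-Algebra.Ring_Divisibility"
    "HOL-Algebra.Ideal_Product"
    "HOL-Algebra.Generated_Rings"
    "HOL-Computational_Algebra.Polynomial"
    "HOL-Computational_Algebra.Fraction_Field"
    "HOL-Library.Poly_Mapping"
    "HOL-Library.Extended_Nat"
    "HOL-Number_Theory.Cong"
begin

text \<open>
  Affine varieties over the complex numbers are given by their coordinate rings, and a point means
  a closed point, i.e. a maximal ideal. A coordinate ring is a subset of an integral domain,
  turned into a ring record by \<^emph>\<open>ring_of\<close>; its localizations then live in the
  fraction field of that domain.
\<close>

definition ring_of :: "'r::comm_ring_1 set \<Rightarrow> 'r ring" where
  "ring_of R = \<lparr>carrier = R, mult = (*), one = 1, zero = 0, add = (+)\<rparr>"

definition points :: "'r::comm_ring_1 set \<Rightarrow> 'r set set" where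
  "points R = {M. maximalideal M (ring_of R)}"

definition zero_locus :: "'r::comm_ring_1 set \<Rightarrow> 'r set \<Rightarrow> 'r set set" where
  "zero_locus R I = {M \<in> points R. I \<subseteq> M}"


section \<open>Local rings, regularity, completion\<close>

definition local_ring :: "'r::idom set \<Rightarrow> 'r set \<Rightarrow> 'r fract ring" where
  "local_ring R M = ring_of {Fraction_Field.Fract a s | a s. a \<in> R \<and> s \<in> R - M}"

definition local_max :: "'r::idom set \<Rightarrow> 'r set \<Rightarrow> 'r fract set" where
  "local_max R M = {Fraction_Field.Fract a s | a s. a \<in> M \<and> s \<in> R - M}"

definition krull_dim :: "('r, 'm) ring_scheme \<Rightarrow> enat" where
  "krull_dim R = Sup {enat n | n.
     \<exists>P. (\<forall>i\<le>n. primeideal (P i) R) \<and> (\<forall>i<n. P i \<subset> P (Suc i))}"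

definition regular_local_ring :: "('r, 'm) ring_scheme \<Rightarrow> bool" where
  "regular_local_ring R \<longleftrightarrow> cring R \<and> noetherian_ring R \<and>
     (\<exists>m. {I. maximalideal I R} = {m} \<and>
        (\<exists>S. finite S \<and> S \<subseteq> carrier R \<and> m = genideal R S \<and> enat (card S) = krull_dim R))"

definition Sing :: "'r::idom set \<Rightarrow> 'r set set" where
  "Sing R = {M \<in> points R. \<not> regular_local_ring (local_ring R M)}"

text \<open>
  The inverse limit of the rings \<^emph>\<open>R / m^n\<close>: an element is a compatible sequence of cosets,
  and a coset modulo \<^emph>\<open>m^(n+1)\<close> maps to the coset modulo \<^emph>\<open>m^n\<close> containing it.
\<close>

definition completion :: "('r, 'm) ring_scheme \<Rightarrow> 'r set \<Rightarrow> (nat \<Rightarrow> 'r set) ring" where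
  "completion R m = (let Q = (\<lambda>n::nat. R Quot (m [^]\<^bsub>ideals_set R\<^esub> n)) in
     \<lparr>carrier = {x. (\<forall>n. x n \<in> carrier (Q n)) \<and> (\<forall>n. x (Suc n) \<subseteq> x n)},
      mult = (\<lambda>x y n. x n \<otimes>\<^bsub>Q n\<^esub> y n),
      one = (\<lambda>n. \<one>\<^bsub>Q n\<^esub>),
      zero = (\<lambda>n. \<zero>\<^bsub>Q n\<^esub>),
      add = (\<lambda>x y n. x n \<oplus>\<^bsub>Q n\<^esub> y n)\<rparr>)"

definition to_completion :: "('r, 'm) ring_scheme \<Rightarrow> 'r set \<Rightarrow> 'r \<Rightarrow> (nat \<Rightarrow> 'r set)" where
  "to_completion R m r = (\<lambda>n::nat. (m [^]\<^bsub>ideals_set R\<^esub> n) +>\<^bsub>R\<^esub> r)"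

definition completed_local_ring :: "'r::idom set \<Rightarrow> 'r set \<Rightarrow> (nat \<Rightarrow> 'r fract set) ring" where
  "completed_local_ring R M = completion (local_ring R M) (local_max R M)"

text \<open>
  The structure map of the completed local ring as a complex algebra, where
  \<^emph>\<open>s\<close> is the structure map of \<^emph>\<open>R\<close>.
\<close>

definition completed_embed ::
    "(complex \<Rightarrow> 'r) \<Rightarrow> 'r::idom set \<Rightarrow> 'r set \<Rightarrow> complex \<Rightarrow> (nat \<Rightarrow> 'r fract set)" where
  "completed_embed s R M c =
     to_completion (local_ring R M) (local_max R M) (Fraction_Field.Fract (s c) 1)"


section \<open>Quotient singularities\<close>

text \<open>
  A polynomial in \<^emph>\<open>x\<close> and \<^emph>\<open>y\<close> is a polynomial in \<^emph>\<open>y\<close> with coefficients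
  polynomials in \<^emph>\<open>x\<close>. Substituting \<^emph>\<open>(z x, z^e y)\<close> for \<^emph>\<open>(x, y)\<close>:
\<close>

definition plane_act :: "nat \<Rightarrow> complex \<Rightarrow> complex poly poly \<Rightarrow> complex poly poly" where
  "plane_act e z f = pcompose (map_poly (\<lambda>g. pcompose g [:0, z:]) f) [:0, [:z ^ e:]:]"

text \<open>The cyclic group of order \<^emph>\<open>d\<close> is the group of all complex \<^emph>\<open>d\<close>-th roots of unity.\<close>

definition plane_quotient :: "nat \<Rightarrow> nat \<Rightarrow> complex poly poly set" where
  "plane_quotient d e = {f. \<forall>z. z ^ d = 1 \<longrightarrow> plane_act e z f = f}"

definition plane_quotient_origin :: "nat \<Rightarrow> nat \<Rightarrow> complex poly poly set" where
  "plane_quotient_origin d e = {f \<in> plane_quotient d e. poly (poly f 0) 0 = 0}"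

definition quotient_singularity ::
    "(complex \<Rightarrow> 'r) \<Rightarrow> 'r::idom set \<Rightarrow> 'r set \<Rightarrow> nat \<Rightarrow> nat \<Rightarrow> bool" where
  "quotient_singularity s R M d e \<longleftrightarrow> 1 \<le> d \<and> e < d \<and> coprime e d \<and>
     (\<exists>h \<in> ring_iso (completed_local_ring R M)
             (completed_local_ring (plane_quotient d e) (plane_quotient_origin d e)).
        \<forall>c. h (completed_embed s R M c) =
          completed_embed (\<lambda>c. [:[:c:]:]) (plane_quotient d e) (plane_quotient_origin d e) c)"


section \<open>Smooth affine curves and divisors\<close>

text \<open>
  The coordinate ring \<^emph>\<open>A0\<close> of the curve is the whole type \<^emph>\<open>'a\<close>, a complex algebra
  via \<^emph>\<open>s\<close>.
\<close>

definition smooth_affine_curve :: "(complex \<Rightarrow> 'a::idom) \<Rightarrow> bool" where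
  "smooth_affine_curve s \<longleftrightarrow>
     s \<in> ring_hom (ring_of UNIV) (ring_of UNIV) \<and>
     (\<exists>S. finite S \<and> generate_ring (ring_of (UNIV :: 'a set)) (range s \<union> S) = UNIV) \<and>
     krull_dim (ring_of (UNIV :: 'a set)) = 1 \<and>
     Sing (UNIV :: 'a set) = {}"

definition qdivisor :: "('a::idom set \<Rightarrow> rat) \<Rightarrow> bool" where
  "qdivisor D \<longleftrightarrow> finite {P. D P \<noteq> 0} \<and> {P. D P \<noteq> 0} \<subseteq> points UNIV"

text \<open>
  The order of a nonzero rational function \<^emph>\<open>f\<close> at a smooth point of a curve: the \<^emph>\<open>n\<close> with
  \<^emph>\<open>f = t^n v\<close> for a local parameter \<^emph>\<open>t\<close> and a unit \<^emph>\<open>v\<close> of the local ring.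
\<close>

definition ord_at :: "'a::idom set \<Rightarrow> 'a fract \<Rightarrow> int" where
  "ord_at P f = (THE n. \<exists>t v. t \<in> carrier (local_ring UNIV P) \<and>
     PIdl\<^bsub>local_ring UNIV P\<^esub> t = local_max UNIV P \<and>
     v \<in> Units (local_ring UNIV P) \<and> f = t powi n * v)"

definition global_sections :: "('a::idom set \<Rightarrow> int) \<Rightarrow> 'a fract set" where
  "global_sections E = {f. f = 0 \<or> (\<forall>P \<in> points UNIV. ord_at P f + E P \<ge> 0)}"


section \<open>The graded algebra and its surface\<close>

text \<open>
  \<^typ>\<open>int \<Rightarrow>\<^sub>0 'k\<close> with its convolution product is the ring of Laurent polynomials in
  \<^emph>\<open>u\<close> over \<^emph>\<open>'k\<close>.
\<close>

type_synonym 'a laurent = "int \<Rightarrow>\<^sub>0 'a fract"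

definition dpd_algebra ::
    "('a::idom set \<Rightarrow> rat) \<Rightarrow> ('a set \<Rightarrow> rat) \<Rightarrow> 'a laurent set" where
  "dpd_algebra Dp Dm = {f.
     (\<forall>n::nat. Poly_Mapping.lookup f (int n) \<in> global_sections (\<lambda>P. \<lfloor>of_nat n * Dp P\<rfloor>)) \<and>
     (\<forall>n::nat. Poly_Mapping.lookup f (- int n) \<in> global_sections (\<lambda>P. \<lfloor>of_nat n * Dm P\<rfloor>))}"

definition base_embed :: "'a::idom \<Rightarrow> 'a laurent" where
  "base_embed a = Poly_Mapping.single 0 (Fraction_Field.Fract a 1)"

definition proj :: "'a::idom laurent set \<Rightarrow> 'a set" where
  "proj M = {a. base_embed a \<in> M}"

text \<open>
  A nonzero complex number \<^emph>\<open>z\<close> acts on the graded algebra by \<^emph>\<open>z^n\<close> in degree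
  \<^emph>\<open>n\<close>, and on points by taking preimages under this automorphism.
\<close>

definition torus_act :: "(complex \<Rightarrow> 'a) \<Rightarrow> complex \<Rightarrow> 'a::idom laurent \<Rightarrow> 'a laurent" where
  "torus_act s z f = Poly_Mapping.mapp (\<lambda>n c. Fraction_Field.Fract (s (z powi n)) 1 * c) f"

definition torus_act_point ::
    "(complex \<Rightarrow> 'a) \<Rightarrow> 'a::idom laurent set \<Rightarrow> complex \<Rightarrow> 'a laurent set \<Rightarrow> 'a laurent set" where
  "torus_act_point s A z M = {f \<in> A. torus_act s z f \<in> M}"

definition fixed_points :: "(complex \<Rightarrow> 'a) \<Rightarrow> 'a::idom laurent set \<Rightarrow> 'a laurent set set" where
  "fixed_points s A = {M \<in> points A. \<forall>z. z \<noteq> 0 \<longrightarrow> torus_act_point s A z M = M}"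

definition positive_part :: "'a::idom laurent set \<Rightarrow> 'a laurent set" where
  "positive_part A = {f \<in> A. \<forall>n\<le>0. Poly_Mapping.lookup f n = 0}"

definition negative_part :: "'a::idom laurent set \<Rightarrow> 'a laurent set" where
  "negative_part A = {f \<in> A. \<forall>n\<ge>0. Poly_Mapping.lookup f n = 0}"

definition fixed_ideal :: "'a::idom laurent set \<Rightarrow> 'a laurent set" where
  "fixed_ideal A =
     genideal (ring_of A) (positive_part A) <+>\<^bsub>ring_of A\<^esub> genideal (ring_of A) (negative_part A)"

definition det2 :: "int \<Rightarrow> int \<Rightarrow> int \<Rightarrow> int \<Rightarrow> int" where
  \<comment> \<open>the rows are \<^emph>\<open>(a, b)\<close> and \<^emph>\<open>(c, d)\<close>\<close>
  "det2 a b c d = a * d - b * c"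

end

theory Submission
  imports Defs
    "HOL-Computational_Algebra.Fundamental_Theorem_Algebra"
    "HOL-Library.Product_Plus"
    "HOL-Analysis.Continuum_Not_Denumerable"
begin

text \<open>
  Over a point \<open>a\<close> of the curve with local parameter \<open>t\<close>, the algebra becomes the ring \<open>B\<close> spanned over the
  discrete valuation ring at \<open>a\<close> by the monomials \<open>t^i u^n\<close> with \<open>i + n D\<^sub>+(a) \<ge> 0\<close> and
  \<open>i - n D\<^sub>-(a) \<ge> 0\<close>, that is, with exponent in a two-dimensional rational cone. A maximal ideal over \<open>a\<close>
  is fixed by the torus iff it contains every nonconstant monomial, which is possible iff the cone is
  strictly convex, i.e. \<open>D\<^sub>+(a) + D\<^sub>-(a) < 0\<close>.

  If some nonconstant monomial is a unit at the point, it lies on an edge of the cone; with a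
  lattice basis adapted to this edge the local ring is a localization of a polynomial ring in
  two variables over the valuation ring modulo one equation, and its maximal ideal is generated by
  two elements. At a fixed point the two linear forms that define the cone identify the semigroup of
  exponents with the semigroup of invariant monomials of the cyclic group of order \<open>\<Delta>(a)\<close>; the residues of
  both local rings modulo powers of the maximal ideals have the same monomial basis, so the
  completions agree. For \<open>\<Delta>(a) \<ge> 2\<close> the semigroup has three irreducible elements, whereas the Krull
  dimension is two. That maximal ideals of the algebra lie over maximal ideals of the curve uses that the
  complex numbers are uncountable while the algebra has a countable basis.
\<close>

section \<open>Subrings and their ideals as sets\<close>

text \<open>With \<open>a1 = m_+\<close>, \<open>a2 = - e_+\<close>, \<open>b1 = - m_-\<close> and
  \<open>b2 = e_-\<close> the cone is cut out by the forms \<open>al\<close> and \<open>be\<close>,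
  and \<Delta>(a) is their determinant: the index in the integer plane of the lattice of pairs
  \<open>(be, al)\<close>. The pair \<open>(p, q)\<close> is a lattice point with
  \<open>al p q = 1\<close>, and \<open>e\<close> is the residue of \<open>- be p q\<close>; this is
  the origin of the weights (1, e).

  No ring of power series is built. The monoid algebra of the exponent semigroup maps to both local
  rings, and both completions are presented by Cauchy sequences in it, so that only preimages of
  powers of the maximal ideals have to be compared.

  Regularity compares a number of generators with the Krull dimension, so the dimension has to be
  exact. It is found without a dimension theory: primes of \<open>B\<close> that omit
  \<open>t\<close> come from polynomials over a field, and those containing \<open>t\<close> are
  classified. Noetherianity comes from a subring generated by two monomials over the valuation ring,
  to which every element moves after multiplication by a unit of the local ring.\<close>

definition is_subring :: "'r::comm_ring_1 set \<Rightarrow> bool" where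
  "is_subring R \<longleftrightarrow> 1 \<in> R \<and> (\<forall>x\<in>R. \<forall>y\<in>R. x - y \<in> R \<and> x * y \<in> R)"

definition is_ideal :: "'r::comm_ring_1 set \<Rightarrow> 'r set \<Rightarrow> bool" where
  "is_ideal R I \<longleftrightarrow> I \<subseteq> R \<and> 0 \<in> I \<and> (\<forall>x\<in>I. \<forall>y\<in>I. x + y \<in> I) \<and> (\<forall>r\<in>R. \<forall>x\<in>I. r * x \<in> I)"

definition is_prime :: "'r::comm_ring_1 set \<Rightarrow> 'r set \<Rightarrow> bool" where
  "is_prime R I \<longleftrightarrow> is_ideal R I \<and> 1 \<notin> I \<and> (\<forall>x\<in>R. \<forall>y\<in>R. x * y \<in> I \<longrightarrow> x \<in> I \<or> y \<in> I)"

text \<open>Maximality in elementwise form: every element outside \<open>I\<close> has an inverse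
  modulo \<open>I\<close>. Later proofs mostly use the witness \<open>r\<close> rather than a
  comparison with larger ideals.\<close>

definition is_max :: "'r::comm_ring_1 set \<Rightarrow> 'r set \<Rightarrow> bool" where
  "is_max R I \<longleftrightarrow> is_ideal R I \<and> 1 \<notin> I \<and> (\<forall>x\<in>R - I. \<exists>r\<in>R. 1 - r * x \<in> I)"

lemma ring_of_simps [simp]:
  "carrier (ring_of R) = R" "mult (ring_of R) = (*)" "one (ring_of R) = 1"
  "zero (ring_of R) = 0" "add (ring_of R) = (+)"
  by (simp_all add: ring_of_def)

lemma subringD:
  assumes "is_subring R"
  shows "1 \<in> R" "0 \<in> R" "x \<in> R \<Longrightarrow> y \<in> R \<Longrightarrow> x - y \<in> R" "x \<in> R \<Longrightarrow> y \<in> R \<Longrightarrow> x * y \<in> R"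
    "x \<in> R \<Longrightarrow> - x \<in> R" "x \<in> R \<Longrightarrow> y \<in> R \<Longrightarrow> x + y \<in> R" "x \<in> R \<Longrightarrow> x ^ n \<in> R"
proof -
  show one: "1 \<in> R" and d: "\<And>x y. x \<in> R \<Longrightarrow> y \<in> R \<Longrightarrow> x - y \<in> R"
    and m: "\<And>x y. x \<in> R \<Longrightarrow> y \<in> R \<Longrightarrow> x * y \<in> R"
    using assms by (auto simp: is_subring_def)
  show z: "0 \<in> R" using d[OF one one] by simp
  show u: "\<And>x. x \<in> R \<Longrightarrow> - x \<in> R" using d[OF z] by simp
  show "\<And>x y. x \<in> R \<Longrightarrow> y \<in> R \<Longrightarrow> x + y \<in> R" using d u by force
  show "x \<in> R \<Longrightarrow> x ^ n \<in> R" by (induction n) (auto intro: one m)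
qed

lemma subring_UNIV [simp]: "is_subring UNIV"
  by (simp add: is_subring_def)

lemma subring_sum: "is_subring R \<Longrightarrow> (\<And>i. i \<in> A \<Longrightarrow> f i \<in> R) \<Longrightarrow> sum f A \<in> R"
  by (induction A rule: infinite_finite_induct) (auto intro: subringD)

lemma idealD:
  assumes "is_ideal R I" "is_subring R"
  shows "I \<subseteq> R" "x \<in> I \<Longrightarrow> x \<in> R" "0 \<in> I" "x \<in> I \<Longrightarrow> y \<in> I \<Longrightarrow> x + y \<in> I" "r \<in> R \<Longrightarrow> x \<in> I \<Longrightarrow> r * x \<in> I"
    "r \<in> R \<Longrightarrow> x \<in> I \<Longrightarrow> x * r \<in> I" "x \<in> I \<Longrightarrow> - x \<in> I" "x \<in> I \<Longrightarrow> y \<in> I \<Longrightarrow> x - y \<in> I"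
proof -
  show "I \<subseteq> R" "x \<in> I \<Longrightarrow> x \<in> R" "0 \<in> I"
    and a: "\<And>x y. x \<in> I \<Longrightarrow> y \<in> I \<Longrightarrow> x + y \<in> I" and m: "\<And>r x. r \<in> R \<Longrightarrow> x \<in> I \<Longrightarrow> r * x \<in> I"
    using assms(1) by (auto simp: is_ideal_def)
  show "r \<in> R \<Longrightarrow> x \<in> I \<Longrightarrow> x * r \<in> I" using m[of r x] by (simp add: mult.commute)
  have "- 1 \<in> R" by (intro subringD[OF assms(2)])
  then show u: "\<And>x. x \<in> I \<Longrightarrow> - x \<in> I" using m[of "- 1"] by simp
  show s: "\<And>x y. x \<in> I \<Longrightarrow> y \<in> I \<Longrightarrow> x - y \<in> I" using a u by force
qed

lemma ideal_diff_cancel: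
  assumes "is_ideal R I" "is_subring R" "x - y \<in> I"
  shows "x \<in> I \<longleftrightarrow> y \<in> I"
  using idealD(4)[OF assms(1,2), of "x - y" y] idealD(8)[OF assms(1,2), of x "x - y"] assms(3) by auto

lemma ideal_sum: "is_ideal R I \<Longrightarrow> (\<And>i. i \<in> A \<Longrightarrow> f i \<in> I) \<Longrightarrow> sum f A \<in> I"
  by (induction A rule: infinite_finite_induct) (auto simp: is_ideal_def)

lemma is_idealI:
  "I \<subseteq> R \<Longrightarrow> 0 \<in> I \<Longrightarrow> (\<And>x y. x \<in> I \<Longrightarrow> y \<in> I \<Longrightarrow> x + y \<in> I) \<Longrightarrow> (\<And>r x. r \<in> R \<Longrightarrow> x \<in> I \<Longrightarrow> r * x \<in> I)
    \<Longrightarrow> is_ideal R I"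
  by (auto simp: is_ideal_def)

lemma is_idealD1: "is_ideal R I \<Longrightarrow> I \<subseteq> R" by (simp add: is_ideal_def)

lemma cring_ring_of: assumes "is_subring R" shows "cring (ring_of R)"
proof (rule cringI)
  note s = subringD[OF assms]
  show "abelian_group (ring_of R)"
    by (rule abelian_groupI) (auto simp: s algebra_simps intro!: bexI[of _ "- x" for x])
  show "Group.comm_monoid (ring_of R)"
    by (rule comm_monoidI) (auto simp: s algebra_simps)
qed (auto simp: algebra_simps)

lemma minus_ring_of:
  assumes "is_subring R" "x \<in> R" shows "\<ominus>\<^bsub>ring_of R\<^esub> x = - x"
proof -
  interpret cring "ring_of R" using assms(1) by (rule cring_ring_of)
  show ?thesis using assms by (intro minus_equality) (auto intro: subringD)
qed

lemma ideal_ring_of: assumes R: "is_subring R" shows "ideal I (ring_of R) \<longleftrightarrow> is_ideal R I"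
proof
  assume "ideal I (ring_of R)"
  then interpret I: ideal I "ring_of R" .
  show "is_ideal R I"
    using I.a_subset additive_subgroup.zero_closed[OF I.is_additive_subgroup]
      additive_subgroup.a_closed[OF I.is_additive_subgroup] I.I_l_closed by (intro is_idealI) auto
next
  assume I: "is_ideal R I"
  interpret cring "ring_of R" using R by (rule cring_ring_of)
  note s = idealD[OF I R]
  have "subgroup I (add_monoid (ring_of R))"
  proof (rule group.subgroupI)
    show "Group.group (add_monoid (ring_of R))" by (rule a_group)
    fix a assume "a \<in> I"
    then show "inv\<^bsub>add_monoid (ring_of R)\<^esub> a \<in> I"
      using minus_ring_of[OF R, of a] s by (auto simp: a_inv_def)
  qed (use s in auto)
  then show "ideal I (ring_of R)"
    by (intro idealI) (auto simp: s ring_axioms)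
qed

lemma prime_ring_of: assumes R: "is_subring R" shows "primeideal I (ring_of R) \<longleftrightarrow> is_prime R I"
proof
  assume "primeideal I (ring_of R)"
  then interpret primeideal I "ring_of R" .
  have "1 \<notin> I" using I_notcarr one_imp_carrier by auto
  then show "is_prime R I" using I_prime is_ideal ideal_ring_of[OF R]
    by (auto simp: is_prime_def)
next
  assume I: "is_prime R I"
  then show "primeideal I (ring_of R)"
    using subringD(1)[OF R]
    by (intro primeidealI) (auto simp: is_prime_def ideal_ring_of[OF R] cring_ring_of[OF R])
qed

lemma max_ring_of: assumes R: "is_subring R" shows "maximalideal I (ring_of R) \<longleftrightarrow> is_max R I"
proof
  assume "maximalideal I (ring_of R)"
  then interpret maximalideal I "ring_of R" .
  have 1: "1 \<notin> I" using I_notcarr one_imp_carrier by auto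
  have I: "is_ideal R I" using is_ideal ideal_ring_of[OF R] by simp
  note s = idealD[OF I R] and r = subringD[OF R]
  have "\<exists>r\<in>R. 1 - r * x \<in> I" if "x \<in> R - I" for x
  proof -
    \<comment> \<open>The ideal generated by \<open>I\<close> and \<open>x\<close>. Maximality makes
      it the whole ring, and writing 1 as a member of it gives the inverse of
      \<open>x\<close>.\<close>
    define J where "J = {i + r * x | i r. i \<in> I \<and> r \<in> R}"
    have JI: "i + r * x \<in> J" if "i \<in> I" "r \<in> R" for i r using that by (auto simp: J_def)
    have iJ: "i \<in> J" if "i \<in> I" for i using JI[OF that r(2)] by simp
    have "is_ideal R J"
    proof (rule is_idealI)
      show "J \<subseteq> R" using s(2) r(4,6) \<open>x \<in> R - I\<close> by (auto simp: J_def)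
      show "0 \<in> J" using iJ s by auto
    next
      fix a b assume "a \<in> J" "b \<in> J"
      then obtain i r i' r' where "a = i + r * x" "b = i' + r' * x" "i \<in> I" "i' \<in> I" "r \<in> R" "r' \<in> R"
        by (auto simp: J_def)
      then show "a + b \<in> J" using JI[OF s(4) r(6), of i i' r r'] by (simp add: algebra_simps)
    next
      fix c a assume "a \<in> J" "c \<in> R"
      then obtain i r where "a = i + r * x" "i \<in> I" "r \<in> R" by (auto simp: J_def)
      then show "c * a \<in> J" using JI[OF s(5) r(4), of c i c r] \<open>c \<in> R\<close> by (simp add: algebra_simps)
    qed
    moreover have "x \<in> J" using JI[OF s(3) r(1)] by simp
    ultimately have "J = R"
      using I_maximal[of J] iJ that by (auto simp: ideal_ring_of[OF R] dest: is_idealD1)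
    then have "1 \<in> J" using r by auto
    then obtain i t where "1 = i + t * x" "i \<in> I" "t \<in> R" by (auto simp: J_def)
    then have "1 - t * x \<in> I" by (metis add_diff_cancel_right')
    then show ?thesis using \<open>t \<in> R\<close> by blast
  qed
  then show "is_max R I" using 1 I by (auto simp: is_max_def)
next
  assume M: "is_max R I"
  then have I: "is_ideal R I" by (simp add: is_max_def)
  note s = idealD[OF I R] and r = subringD[OF R]
  show "maximalideal I (ring_of R)"
  proof (rule maximalidealI)
    show "ideal I (ring_of R)" by (simp add: ideal_ring_of[OF R] I)
    show "carrier (ring_of R) \<noteq> I" using M r by (auto simp: is_max_def)
    fix J assume J: "ideal J (ring_of R)" "I \<subseteq> J" "J \<subseteq> carrier (ring_of R)"
    then have J': "is_ideal R J" by (simp add: ideal_ring_of[OF R])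
    note j = idealD[OF J' R]
    show "J = I \<or> J = carrier (ring_of R)"
    proof (rule ccontr)
      assume n: "\<not> ?thesis"
      then obtain x where x: "x \<in> J" "x \<notin> I" using J by auto
      then obtain t where "t \<in> R" "1 - t * x \<in> I" using M[unfolded is_max_def] j(2)[OF x(1)] by blast
      then have "1 \<in> J" using ideal_diff_cancel[OF J' R, of 1 "t * x"] x j(5)[of t x] J by auto
      then have "J = R" using j(1) j(5)[of _ 1] by auto
      then show False using n by simp
    qed
  qed
qed

lemma points_iff: "is_subring R \<Longrightarrow> M \<in> points R \<longleftrightarrow> is_max R M"
  by (simp add: points_def max_ring_of)

lemma max_ideal: "is_max R M \<Longrightarrow> is_ideal R M" by (simp add: is_max_def)
lemma prime_ideal: "is_prime R M \<Longrightarrow> is_ideal R M" by (simp add: is_prime_def)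
lemma prime_one: "is_prime R M \<Longrightarrow> 1 \<notin> M" by (simp add: is_prime_def)
lemma primeD: "is_prime R M \<Longrightarrow> x * y \<in> M \<Longrightarrow> x \<in> R \<Longrightarrow> y \<in> R \<Longrightarrow> x \<in> M \<or> y \<in> M"
  by (simp add: is_prime_def)

lemma max_imp_prime: assumes R: "is_subring R" and M: "is_max R M" shows "is_prime R M"
proof -
  note s = idealD[OF max_ideal[OF M] R]
  have "y \<in> M" if h: "x \<in> R" "y \<in> R" "x * y \<in> M" "x \<notin> M" for x y
  proof -
    obtain r where r: "r \<in> R" "1 - r * x \<in> M" using M h by (auto simp: is_max_def)
    have "y = (1 - r * x) * y + r * (x * y)" by (simp add: algebra_simps)
    also have "\<dots> \<in> M" using r h s by auto
    finally show ?thesis .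
  qed
  then show ?thesis using M by (auto simp: is_prime_def is_max_def)
qed

lemma prime_power: "is_subring R \<Longrightarrow> is_prime R M \<Longrightarrow> x \<in> R \<Longrightarrow> x ^ n \<in> M \<Longrightarrow> x \<in> M"
  by (induction n) (auto dest: primeD prime_one subringD(7)[of R x])

lemma max_maximal:
  assumes R: "is_subring R" and M: "is_max R M" and J: "is_ideal R J" and "M \<subseteq> J" "1 \<notin> J"
  shows "J = M"
proof (rule ccontr)
  assume "J \<noteq> M"
  then obtain x where x: "x \<in> J" "x \<notin> M" using assms by auto
  note j = idealD[OF J R]
  obtain t where "t \<in> R" "1 - t * x \<in> M" using M[unfolded is_max_def] j(2)[OF x(1)] x(2) by blast
  then have "1 \<in> J" using ideal_diff_cancel[OF J R, of 1 "t * x"] x j(5)[of t x] assms by auto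
  then show False using assms by simp
qed

abbreviation idl :: "'r::comm_ring_1 set \<Rightarrow> 'r set \<Rightarrow> 'r set" where
  "idl R S \<equiv> genideal (ring_of R) S"

lemma idl_eq: "is_subring R \<Longrightarrow> idl R S = \<Inter>{I. is_ideal R I \<and> S \<subseteq> I}"
  by (simp add: genideal_def ideal_ring_of)

lemma idl_ideal: "is_subring R \<Longrightarrow> S \<subseteq> R \<Longrightarrow> is_ideal R (idl R S)"
  using ring.genideal_ideal[of "ring_of R" S] cring_ring_of[of R]
  by (simp add: ideal_ring_of cring_def)

lemma idl_self: "x \<in> S \<Longrightarrow> is_subring R \<Longrightarrow> x \<in> idl R S"
  by (auto simp: idl_eq)

lemma idl_least: "is_subring R \<Longrightarrow> is_ideal R I \<Longrightarrow> S \<subseteq> I \<Longrightarrow> idl R S \<subseteq> I"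
  by (auto simp: idl_eq)

lemma idl_empty: assumes R: "is_subring R" shows "idl R {} = {0}"
proof
  have "is_ideal R {0}" using subringD[OF R] by (intro is_idealI) auto
  then show "idl R {} \<subseteq> {0}" by (rule idl_least[OF R]) simp
qed (use idealD(3)[OF idl_ideal[OF R] R] in auto)

lemma idl_insert:
  assumes R: "is_subring R" and x: "x \<in> R" and S: "S \<subseteq> R"
  shows "idl R (insert x S) = {r * x + y | r y. r \<in> R \<and> y \<in> idl R S}" (is "?L = ?J")
proof
  note r = subringD[OF R] and s = idealD[OF idl_ideal[OF R S] R]
  have J: "is_ideal R ?J"
  proof (rule is_idealI)
    show "?J \<subseteq> R" using x s r by auto
    show "0 \<in> ?J" using s r by (intro CollectI exI[of _ 0]) auto
  next
    fix a b assume "a \<in> ?J" "b \<in> ?J"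
    then obtain p q p' q' where "a = p * x + q" "b = p' * x + q'" "p \<in> R" "p' \<in> R" "q \<in> idl R S" "q' \<in> idl R S"
      by auto
    then show "a + b \<in> ?J" using s r
      by (intro CollectI exI[of _ "p + p'"] exI[of _ "q + q'"]) (auto simp: algebra_simps)
  next
    fix c a assume "c \<in> R" "a \<in> ?J"
    then obtain p q where "a = p * x + q" "p \<in> R" "q \<in> idl R S" by auto
    then show "c * a \<in> ?J" using s r \<open>c \<in> R\<close>
      by (intro CollectI exI[of _ "c * p"] exI[of _ "c * q"]) (auto simp: algebra_simps)
  qed
  have "x \<in> ?J" using s r by (intro CollectI exI[of _ 1] exI[of _ 0]) auto
  moreover have "S \<subseteq> ?J"
  proof
    fix y assume "y \<in> S" then show "y \<in> ?J" using idl_self[of y S R] R r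
      by (intro CollectI exI[of _ 0] exI[of _ y]) auto
  qed
  ultimately show "?L \<subseteq> ?J" using J by (intro idl_least[OF R]) auto
  have L: "is_ideal R ?L" by (rule idl_ideal[OF R]) (use x S in auto)
  have "idl R S \<subseteq> ?L" by (rule idl_least[OF R L]) (auto intro: idl_self R)
  then show "?J \<subseteq> ?L" using idealD[OF L R] idl_self[of x "insert x S" R] R by blast
qed

lemma idl_pair:
  assumes R: "is_subring R" and "x \<in> R" "y \<in> R"
  shows "idl R {x, y} = {a * x + b * y | a b. a \<in> R \<and> b \<in> R}"
  using assms by (auto simp: idl_insert idl_empty)

lemma idl_single:
  assumes R: "is_subring R" and "x \<in> R"
  shows "idl R {x} = {a * x | a. a \<in> R}"
  using assms by (auto simp: idl_insert idl_empty)

definition noeth :: "'r::comm_ring_1 set \<Rightarrow> bool" where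
  "noeth R \<longleftrightarrow> (\<forall>I. is_ideal R I \<longrightarrow> (\<exists>A\<subseteq>R. finite A \<and> I = idl R A))"

lemma noeth_ring_of: assumes "is_subring R" shows "noetherian_ring (ring_of R) \<longleftrightarrow> noeth R"
proof
  assume "noetherian_ring (ring_of R)"
  then interpret noetherian_ring "ring_of R" .
  show "noeth R" unfolding noeth_def using finetely_gen assms by (simp add: ideal_ring_of)
next
  assume n: "noeth R"
  have "ring (ring_of R)" using cring_ring_of[OF assms] by (simp add: cring_def)
  then show "noetherian_ring (ring_of R)"
    by (rule ring.noetherian_ringI) (use n assms in \<open>auto simp: noeth_def ideal_ring_of\<close>)
qed

subsection \<open>Powers of ideals\<close>

text \<open>A name for the power that occurs in \<open>completion\<close>; in the monoid of ideals
  the power 0 is the ring itself.\<close>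

definition ipow :: "'r::comm_ring_1 set \<Rightarrow> 'r set \<Rightarrow> nat \<Rightarrow> 'r set" where
  "ipow R I n = I [^]\<^bsub>ideals_set (ring_of R)\<^esub> n"

lemma ipow_0 [simp]: "ipow R I 0 = R"
  by (simp add: ipow_def nat_pow_def ideals_set_def)

lemma ipow_Suc: "ipow R I (Suc n) = ideal_prod (ring_of R) (ipow R I n) I"
  by (simp add: ipow_def nat_pow_def ideals_set_def)

lemma ipow_ideal:
  assumes R: "is_subring R" and I: "is_ideal R I" shows "is_ideal R (ipow R I n)"
proof (induction n)
  case 0
  show ?case using subringD[OF R] by (intro is_idealI) auto
next
  case (Suc n)
  interpret cring "ring_of R" using R by (rule cring_ring_of)
  show ?case unfolding ipow_Suc ideal_ring_of[OF R, symmetric]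
    by (rule ideal_prod_is_ideal) (simp_all add: ideal_ring_of[OF R] Suc I)
qed

lemma ipow_SucI: "a \<in> ipow R I n \<Longrightarrow> b \<in> I \<Longrightarrow> a * b \<in> ipow R I (Suc n)"
  unfolding ipow_Suc using ideal_prod.prod[of a "ipow R I n" b I "ring_of R"] by simp

lemma ipow_Suc_induct:
  assumes "x \<in> ipow R I (Suc n)"
    and "\<And>a b. a \<in> ipow R I n \<Longrightarrow> b \<in> I \<Longrightarrow> P (a * b)" and "\<And>a b. P a \<Longrightarrow> P b \<Longrightarrow> P (a + b)"
  shows "P x"
  using assms(1)[unfolded ipow_Suc] by (induction rule: ideal_prod.induct) (use assms in auto)

text \<open>The powers of \<open>I\<close> form the smallest multiplicative filtration. Upper bounds
  on powers are obtained by taking for \<open>F\<close> a filtration by supports or by extended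
  ideals.\<close>

lemma ipow_least:
  assumes "R \<subseteq> F 0" and "\<And>n a b. a \<in> F n \<Longrightarrow> b \<in> I \<Longrightarrow> a * b \<in> F (Suc n)"
    and "\<And>n a b. a \<in> F (Suc n) \<Longrightarrow> b \<in> F (Suc n) \<Longrightarrow> a + b \<in> F (Suc n)"
  shows "ipow R I n \<subseteq> F n"
proof (induction n)
  case (Suc n)
  show ?case
  proof
    fix x assume "x \<in> ipow R I (Suc n)"
    then show "x \<in> F (Suc n)" by (rule ipow_Suc_induct) (use Suc assms in auto)
  qed
qed (use assms in simp)

lemma ipow_1: assumes R: "is_subring R" and I: "is_ideal R I" shows "ipow R I (Suc 0) = I"
proof
  show "ipow R I (Suc 0) \<subseteq> I"
  proof
    fix x assume "x \<in> ipow R I (Suc 0)"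
    then show "x \<in> I" by (rule ipow_Suc_induct) (use idealD[OF I R] in auto)
  qed
  show "I \<subseteq> ipow R I (Suc 0)"
    using ipow_SucI[of 1 R I 0] subringD[OF R] by auto
qed

lemma ipow_antimono_Suc:
  assumes R: "is_subring R" and I: "is_ideal R I" shows "ipow R I (Suc n) \<subseteq> ipow R I n"
proof
  fix x assume "x \<in> ipow R I (Suc n)"
  then show "x \<in> ipow R I n"
    by (rule ipow_Suc_induct) (use idealD[OF ipow_ideal[OF R I] R] idealD(1)[OF I R] in auto)
qed

text \<open>If \<open>1 - q * s\<close> lies in the n-th power and \<open>1 - r * s\<close> in
  \<open>M\<close>, their product lies in the next power and is again 1 minus a multiple of
  \<open>s\<close>. Hence denominators outside \<open>M\<close> are invertible modulo every power of
  \<open>M\<close>.\<close>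

lemma max_power_comaximal:
  assumes R: "is_subring R" and M: "is_max R M" and s: "s \<in> R - M"
  shows "\<exists>r\<in>R. 1 - r * s \<in> ipow R M n"
proof -
  obtain r where r: "r \<in> R" "1 - r * s \<in> M" using M s by (auto simp: is_max_def)
  have "\<exists>q\<in>R. 1 - q * s \<in> ipow R M n"
  proof (induction n)
    case (Suc n)
    then obtain q where q: "q \<in> R" "1 - q * s \<in> ipow R M n" by auto
    have "1 - (q + r - q * s * r) * s = (1 - q * s) * (1 - r * s)" by (simp add: algebra_simps)
    also have "\<dots> \<in> ipow R M (Suc n)" using q r by (intro ipow_SucI)
    finally show ?case using subringD[OF R] q r s by (intro bexI[of _ "q + r - q * s * r"]) auto
  next
    case 0 show ?case using subringD[OF R] s by (intro bexI[of _ 0]) auto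
  qed
  then show ?thesis .
qed

subsection \<open>Krull dimension\<close>

definition prime_chain :: "'r::comm_ring_1 set \<Rightarrow> nat \<Rightarrow> (nat \<Rightarrow> 'r set) \<Rightarrow> bool" where
  "prime_chain R n P \<longleftrightarrow> (\<forall>i\<le>n. is_prime R (P i)) \<and> (\<forall>i<n. P i \<subset> P (Suc i))"

lemma krull_dim_ring_of:
  "is_subring R \<Longrightarrow> krull_dim (ring_of R) = Sup {enat n | n. \<exists>P. prime_chain R n P}"
  by (simp add: krull_dim_def prime_chain_def prime_ring_of)

lemma prime_chain_mono: "prime_chain R n P \<Longrightarrow> m \<le> n \<Longrightarrow> prime_chain R m P"
  by (auto simp: prime_chain_def)

text \<open>Chains can be truncated, so excluding the single length \<open>Suc n\<close> excludes
  all larger lengths. A chain of length \<open>n\<close> has \<open>n + 1\<close> primes.\<close>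

lemma krull_dim_eqI:
  assumes R: "is_subring R" and "prime_chain R n P" and "\<And>Q. \<not> prime_chain R (Suc n) Q"
  shows "krull_dim (ring_of R) = enat n"
  unfolding krull_dim_ring_of[OF R]
proof (rule antisym)
  show "enat n \<le> Sup {enat n | n. \<exists>P. prime_chain R n P}" by (rule Sup_upper) (use assms in auto)
  show "Sup {enat n | n. \<exists>P. prime_chain R n P} \<le> enat n"
  proof (rule Sup_least, clarsimp)
    fix m Q assume "prime_chain R m Q"
    then show "m \<le> n" using assms(3)[of Q] prime_chain_mono[of R m Q "Suc n"] by (cases "m \<le> n") auto
  qed
qed

lemma krull_dim_no_chain:
  assumes R: "is_subring R" and "krull_dim (ring_of R) = enat n" shows "\<not> prime_chain R (Suc n) Q"
proof
  assume "prime_chain R (Suc n) Q"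
  then have "enat (Suc n) \<le> Sup {enat n | n. \<exists>P. prime_chain R n P}" by (intro Sup_upper) auto
  then show False using assms by (simp add: krull_dim_ring_of)
qed

lemma krull_dim_chain:
  assumes R: "is_subring R" and "krull_dim (ring_of R) = enat (Suc n)" shows "\<exists>Q. prime_chain R (Suc n) Q"
proof (rule ccontr)
  assume n: "\<not> ?thesis"
  have "Sup {enat n | n. \<exists>P. prime_chain R n P} \<le> enat n"
  proof (rule Sup_least, clarsimp)
    fix m Q assume "prime_chain R m Q"
    then show "m \<le> n" using n prime_chain_mono[of R m Q "Suc n"] by (cases "m \<le> n") auto
  qed
  then show False using assms by (simp add: krull_dim_ring_of)
qed

section \<open>Localization at a maximal ideal\<close>

definition loc :: "'r::idom set \<Rightarrow> 'r set \<Rightarrow> 'r fract set" where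
  "loc R M = {Fraction_Field.Fract a s | a s. a \<in> R \<and> s \<in> R - M}"

lemma local_ring_eq: "local_ring R M = ring_of (loc R M)"
  by (simp add: local_ring_def loc_def)

locale localization =
  fixes R M :: "'r::idom set"
  assumes R: "is_subring R" and M: "is_prime R M"
begin

lemmas rc = subringD[OF R]
lemmas mc = idealD[OF prime_ideal[OF M] R]

abbreviation "F \<equiv> Fraction_Field.Fract"
abbreviation "L \<equiv> loc R M"
abbreviation "mm \<equiv> local_max R M"

lemma nz: "s \<in> R - M \<Longrightarrow> s \<noteq> 0" using mc by auto
lemma one_S: "1 \<in> R - M" using rc prime_one[OF M] by auto
lemma mult_S: "s \<in> R - M \<Longrightarrow> t \<in> R - M \<Longrightarrow> s * t \<in> R - M"
  using rc(4) primeD[OF M] by blast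

lemma locE: "x \<in> L \<Longrightarrow> (\<And>a s. x = F a s \<Longrightarrow> a \<in> R \<Longrightarrow> s \<in> R - M \<Longrightarrow> s \<noteq> 0 \<Longrightarrow> P) \<Longrightarrow> P"
  unfolding loc_def using nz by blast

lemma locI: "a \<in> R \<Longrightarrow> s \<in> R - M \<Longrightarrow> F a s \<in> L"
  unfolding loc_def by blast

lemma loc1: "a \<in> R \<Longrightarrow> F a 1 \<in> L" using locI one_S by blast

lemma L_subring: "is_subring L"
proof -
  have "x - y \<in> L \<and> x * y \<in> L" if h: "x \<in> L" "y \<in> L" for x y
  proof -
    obtain a s b t where *: "x = F a s" "y = F b t" "a \<in> R" "b \<in> R" "s \<in> R - M" "t \<in> R - M" "s \<noteq> 0" "t \<noteq> 0"
      by (meson h locE)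
    have "x - y = F (a * t - b * s) (s * t)" "x * y = F (a * b) (s * t)" using * by auto
    then show ?thesis using * mult_S rc by (auto intro!: locI)
  qed
  then show ?thesis using loc1[OF rc(1)] by (auto simp: is_subring_def One_fract_def)
qed

lemma F_eq0: "s \<noteq> 0 \<Longrightarrow> F a s = 0 \<longleftrightarrow> a = 0" by (simp add: Zero_fract_def eq_fract)

text \<open>The extension of an ideal to the localization: denominators are closed under products,
  so fractions with numerator in \<open>Q\<close> already form an ideal.\<close>

definition ext :: "'r set \<Rightarrow> 'r fract set" where
  "ext Q = {F a s | a s. a \<in> Q \<and> s \<in> R - M}"

lemma extE: "x \<in> ext Q \<Longrightarrow> (\<And>a s. x = F a s \<Longrightarrow> a \<in> Q \<Longrightarrow> s \<in> R - M \<Longrightarrow> s \<noteq> 0 \<Longrightarrow> P) \<Longrightarrow> P"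
  unfolding ext_def using nz by blast

lemma extI: "a \<in> Q \<Longrightarrow> s \<in> R - M \<Longrightarrow> F a s \<in> ext Q"
  unfolding ext_def by blast

lemma mm_ext: "mm = ext M" by (simp add: local_max_def ext_def)

lemma ext_ideal: assumes Q: "is_ideal R Q" shows "is_ideal L (ext Q)"
proof (rule is_idealI)
  note q = idealD[OF Q R]
  show "ext Q \<subseteq> L" using q by (auto simp: ext_def loc_def)
  show "0 \<in> ext Q" using extI[OF q(3) one_S] by (simp add: Zero_fract_def)
next
  note q = idealD[OF Q R]
  fix x y assume "x \<in> ext Q" "y \<in> ext Q"
  then obtain a s b t where *: "x = F a s" "y = F b t" "a \<in> Q" "b \<in> Q" "s \<in> R - M" "t \<in> R - M" "s \<noteq> 0" "t \<noteq> 0"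
    by (metis extE)
  have "x + y = F (a * t + b * s) (s * t)" using * by auto
  then show "x + y \<in> ext Q" using * mult_S q by (auto intro!: extI)
next
  note q = idealD[OF Q R]
  fix x y assume "x \<in> L" "y \<in> ext Q"
  then obtain a s b t where *: "x = F a s" "y = F b t" "a \<in> R" "b \<in> Q" "s \<in> R - M" "t \<in> R - M"
    by (metis extE locE)
  have "x * y = F (a * b) (s * t)" using * by auto
  then show "x * y \<in> ext Q" using * mult_S q by (auto intro!: extI)
qed

text \<open>A fraction has many representations. Primality of \<open>Q\<close> and
  \<open>Q \<subseteq> M\<close> allow the denominator of another representation to be cancelled, so
  membership can be read off from any numerator.\<close>

lemma F_mem_ext: assumes Q: "is_prime R Q" "Q \<subseteq> M" and "a \<in> R" "s \<in> R - M"
  shows "F a s \<in> ext Q \<longleftrightarrow> a \<in> Q"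
proof
  assume "F a s \<in> ext Q"
  then obtain b t where bt: "F a s = F b t" "b \<in> Q" "t \<in> R - M" "t \<noteq> 0" by (metis extE)
  then have "a * t = b * s" using assms nz by (simp add: eq_fract)
  then have "a * t \<in> Q" using bt assms idealD[OF prime_ideal[OF Q(1)] R] by auto
  then show "a \<in> Q" using primeD[OF Q(1), of a t] assms bt by auto
qed (use assms extI in auto)

lemma ext_prime: assumes Q: "is_prime R Q" "Q \<subseteq> M" shows "is_prime L (ext Q)"
proof -
  have 1: "1 \<notin> ext Q" using F_mem_ext[OF Q rc(1) one_S] prime_one[OF Q(1)] by (simp add: One_fract_def)
  have "x \<in> ext Q \<or> y \<in> ext Q" if h: "x \<in> L" "y \<in> L" "x * y \<in> ext Q" for x y
  proof -
    obtain a s b t where *: "x = F a s" "y = F b t" "a \<in> R" "b \<in> R" "s \<in> R - M" "t \<in> R - M"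
      by (meson h locE)
    then show ?thesis using F_mem_ext[OF Q, of "a * b" "s * t"] F_mem_ext[OF Q, of a s] F_mem_ext[OF Q, of b t]
       h mult_S rc primeD[OF Q(1), of a b] by auto
  qed
  then show ?thesis using 1 ext_ideal[OF prime_ideal[OF Q(1)]] by (auto simp: is_prime_def)
qed

lemma mm_prime: "is_prime L mm" unfolding mm_ext by (rule ext_prime[OF M]) simp

lemma F_mem_mm: "a \<in> R \<Longrightarrow> s \<in> R - M \<Longrightarrow> F a s \<in> mm \<longleftrightarrow> a \<in> M"
  unfolding mm_ext by (rule F_mem_ext[OF M]) auto

lemma F1_mem_mm: "a \<in> R \<Longrightarrow> F a 1 \<in> mm \<longleftrightarrow> a \<in> M"
  using F_mem_mm one_S by blast

lemma inverse_L: assumes "x \<in> L" "x \<notin> mm" shows "inverse x \<in> L"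
proof -
  obtain a s where *: "x = F a s" "a \<in> R" "s \<in> R - M" using assms by (metis locE)
  then have "a \<notin> M" using F_mem_mm[of a s] assms by auto
  then show ?thesis using * by (auto intro: locI)
qed

lemma mm_max: "is_max L mm"
proof -
  have "\<exists>r\<in>L. 1 - r * x \<in> mm" if "x \<in> L - mm" for x
  proof (intro bexI[of _ "inverse x"])
    have "x \<noteq> 0" using that idealD(3)[OF prime_ideal[OF mm_prime] L_subring] by auto
    then show "1 - inverse x * x \<in> mm"
      using idealD(3)[OF prime_ideal[OF mm_prime] L_subring] by simp
    show "inverse x \<in> L" using that inverse_L by auto
  qed
  then show ?thesis using mm_prime by (auto simp: is_max_def is_prime_def)
qed

lemma mem_mm_proper: assumes J: "is_ideal L J" "1 \<notin> J" shows "J \<subseteq> mm"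
proof
  note j = idealD[OF J(1) L_subring]
  fix x assume x: "x \<in> J"
  show "x \<in> mm"
  proof (rule ccontr)
    assume "x \<notin> mm"
    then have "inverse x \<in> L" "x \<noteq> 0"
      using inverse_L x j idealD(3)[OF prime_ideal[OF mm_prime] L_subring] by auto
    then have "1 \<in> J" using j(5)[OF _ x] by force
    then show False using J by simp
  qed
qed

lemma unique_max: "{I. maximalideal I (local_ring R M)} = {mm}"
proof -
  have "I = mm" if "is_max L I" for I
    using max_maximal[OF L_subring that, of mm] mem_mm_proper[of I] that mm_prime
    by (auto simp: is_max_def is_prime_def)
  then show ?thesis by (auto simp: local_ring_eq max_ring_of[OF L_subring] mm_max)
qed

definition contr :: "'r fract set \<Rightarrow> 'r set" where
  "contr Q = {a \<in> R. F a 1 \<in> Q}"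

lemma F_mem_iff: assumes J: "is_ideal L J" and "a \<in> R" "s \<in> R - M"
  shows "F a s \<in> J \<longleftrightarrow> F a 1 \<in> J"
proof -
  note j = idealD[OF J L_subring]
  have "F a 1 = F s 1 * F a s" "F a s = F 1 s * F a 1" using nz[OF assms(3)] by (auto simp: eq_fract)
  then show ?thesis using j(5)[of "F s 1" "F a s"] j(5)[of "F 1 s" "F a 1"] assms loc1[of s] locI[of 1 s] rc(1)
    by (metis DiffD1)
qed

lemma ext_contr: assumes J: "is_ideal L J" shows "ext (contr J) = J"
proof
  show "ext (contr J) \<subseteq> J" using F_mem_iff[OF J] by (auto simp: ext_def contr_def)
  show "J \<subseteq> ext (contr J)"
  proof
    fix x assume x: "x \<in> J"
    then obtain a s where *: "x = F a s" "a \<in> R" "s \<in> R - M" using is_idealD1[OF J] by (metis locE subsetD)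
    then show "x \<in> ext (contr J)" using F_mem_iff[OF J, of a s] x by (auto simp: contr_def intro: extI)
  qed
qed

lemma contr_ideal: assumes J: "is_ideal L J" shows "is_ideal R (contr J)"
proof -
  note j = idealD[OF J L_subring]
  have "F (r * x) 1 \<in> J" if "r \<in> R" "F x 1 \<in> J" for r x
    using j(5)[OF loc1[OF that(1)] that(2)] by simp
  moreover have "F (x + y) 1 \<in> J" if "F x 1 \<in> J" "F y 1 \<in> J" for x y
    using j(4)[OF that] by simp
  moreover have "F 0 1 \<in> J" using j(3) by (simp add: Zero_fract_def)
  ultimately show ?thesis
    by (intro is_idealI) (auto simp: contr_def rc(2,4,6))
qed

lemma contr_prime: assumes J: "is_prime L J" shows "is_prime R (contr J)" "contr J \<subseteq> M"
proof -
  show "is_prime R (contr J)"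
    unfolding is_prime_def
  proof (intro conjI ballI impI)
    show "is_ideal R (contr J)" by (rule contr_ideal[OF prime_ideal[OF J]])
    show "1 \<notin> contr J" using prime_one[OF J] by (simp add: contr_def One_fract_def)
    fix x y assume *: "x \<in> R" "y \<in> R" "x * y \<in> contr J"
    then have "F x 1 * F y 1 \<in> J" by (simp add: contr_def)
    then show "x \<in> contr J \<or> y \<in> contr J"
      using primeD[OF J, of "F x 1" "F y 1"] * loc1 by (simp add: contr_def)
  qed
  have "J \<subseteq> mm" using J by (intro mem_mm_proper) (auto simp: is_prime_def)
  then show "contr J \<subseteq> M" using F1_mem_mm by (auto simp: contr_def)
qed

lemma contr_strict:
  assumes "is_ideal L J" "is_ideal L J'" "J \<subset> J'" shows "contr J \<subset> contr J'"
proof -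
  have "contr J \<subseteq> contr J'" using assms(3) unfolding contr_def by blast
  moreover have "contr J \<noteq> contr J'" using ext_contr[OF assms(1)] ext_contr[OF assms(2)] assms(3) by (metis psubset_eq)
  ultimately show ?thesis by blast
qed

lemma contr_ext: assumes Q: "is_prime R Q" "Q \<subseteq> M" shows "contr (ext Q) = Q"
proof -
  have "contr (ext Q) = {a \<in> R. a \<in> Q}" unfolding contr_def using F_mem_ext[OF Q _ one_S] by blast
  then show ?thesis using is_idealD1[OF prime_ideal[OF Q(1)]] by blast
qed

lemma ext_strict:
  assumes "is_prime R Q" "Q \<subseteq> M" "is_prime R Q'" "Q' \<subseteq> M" "Q \<subset> Q'" shows "ext Q \<subset> ext Q'"
proof -
  have "ext Q \<subseteq> ext Q'" using assms(5) unfolding ext_def by blast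
  moreover have "ext Q \<noteq> ext Q'" using contr_ext[OF assms(1,2)] contr_ext[OF assms(3,4)] assms(5) by (metis psubset_eq)
  ultimately show ?thesis by blast
qed

lemma loc_chain_contr:
  assumes P: "prime_chain L n P" shows "prime_chain R n (\<lambda>i. contr (P i))" "\<And>i. i \<le> n \<Longrightarrow> contr (P i) \<subseteq> M"
proof -
  have p: "is_prime L (P i)" if "i \<le> n" for i using P that by (simp add: prime_chain_def)
  show "prime_chain R n (\<lambda>i. contr (P i))" unfolding prime_chain_def
  proof (intro conjI allI impI)
    fix i assume i: "i < n"
    then have "P i \<subset> P (Suc i)" using P by (simp add: prime_chain_def)
    then show "contr (P i) \<subset> contr (P (Suc i))"
      using contr_strict[OF prime_ideal[OF p[of i]] prime_ideal[OF p[of "Suc i"]]] i by simp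
  qed (rule contr_prime(1)[OF p])
  show "contr (P i) \<subseteq> M" if "i \<le> n" for i by (rule contr_prime(2)[OF p[OF that]])
qed

lemma loc_chain_ext:
  assumes P: "prime_chain R n P" and M: "\<And>i. i \<le> n \<Longrightarrow> P i \<subseteq> M" shows "prime_chain L n (\<lambda>i. ext (P i))"
proof -
  have p: "is_prime R (P i)" if "i \<le> n" for i using P that by (simp add: prime_chain_def)
  show ?thesis unfolding prime_chain_def
  proof (intro conjI allI impI)
    fix i assume i: "i < n"
    then have "P i \<subset> P (Suc i)" using P by (simp add: prime_chain_def)
    then show "ext (P i) \<subset> ext (P (Suc i))"
      using ext_strict[OF p[of i] M[of i] p[of "Suc i"] M[of "Suc i"]] i by simp
  qed (rule ext_prime[OF p M])
qed

lemma ext_idl: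
  assumes S: "S \<subseteq> R" shows "ext (idl R S) = idl L ((\<lambda>a. F a 1) ` S)"
proof
  have SL: "(\<lambda>a. F a 1) ` S \<subseteq> L" using S loc1 by auto
  have I: "is_ideal L (idl L ((\<lambda>a. F a 1) ` S))" by (rule idl_ideal[OF L_subring SL])
  have "S \<subseteq> contr (idl L ((\<lambda>a. F a 1) ` S))" using S idl_self[OF _ L_subring] by (auto simp: contr_def)
  then have "idl R S \<subseteq> contr (idl L ((\<lambda>a. F a 1) ` S))" by (intro idl_least[OF R contr_ideal[OF I]])
  then show "ext (idl R S) \<subseteq> idl L ((\<lambda>a. F a 1) ` S)" using ext_contr[OF I] by (auto simp: ext_def)
  show "idl L ((\<lambda>a. F a 1) ` S) \<subseteq> ext (idl R S)"
    using ext_ideal[OF idl_ideal[OF R S]] extI[OF idl_self[OF _ R] one_S]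
    by (intro idl_least[OF L_subring]) auto
qed

text \<open>An ideal of the localization is recovered from its contraction to the noetherian subring
  \<open>R'\<close>, because every element of \<open>R\<close> enters \<open>R'\<close> after
  multiplication by a unit of the localization. In the applications \<open>R'\<close> is generated
  by two monomials over a valuation ring.\<close>

lemma noeth_loc:
  assumes R': "is_subring R'" "R' \<subseteq> R" "noeth R'"
    and frac: "\<And>a. a \<in> R \<Longrightarrow> \<exists>s\<in>R - M. s * a \<in> R'"
  shows "noeth L"
  unfolding noeth_def
proof (intro allI impI)
  fix J assume J: "is_ideal L J"
  define I where "I = contr J \<inter> R'"
  note c = idealD[OF contr_ideal[OF J] R]
  have "is_ideal R' I" using c R' subringD[OF R'(1)] by (intro is_idealI) (auto simp: I_def)
  then obtain A where A: "A \<subseteq> R'" "finite A" "I = idl R' A" using R' by (auto simp: noeth_def)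
  have AR: "A \<subseteq> R" using A R' by auto
  have AL: "(\<lambda>a. F a 1) ` A \<subseteq> L" using AR loc1 by auto
  have K: "is_ideal R (idl R A)" by (rule idl_ideal[OF R AR])
  have IK: "I \<subseteq> idl R A" unfolding A(3) 
  proof -
    have "is_ideal R' (idl R A \<inter> R')"
      using idealD(3,4,5)[OF K R] R'(2) subringD[OF R'(1)] by (intro is_idealI) auto
    moreover have "A \<subseteq> idl R A \<inter> R'" using A idl_self[OF _ R] by auto
    ultimately show "idl R' A \<subseteq> idl R A" using idl_least[OF R'(1)] by blast
  qed
  have "J = idl L ((\<lambda>a. F a 1) ` A)"
  proof
    show "J \<subseteq> idl L ((\<lambda>a. F a 1) ` A)"
    proof
      fix x assume x: "x \<in> J"
      then obtain a s where *: "x = F a s" "a \<in> R" "s \<in> R - M" using is_idealD1[OF J] by (metis locE subsetD)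
      obtain s' where s': "s' \<in> R - M" "s' * a \<in> R'" using frac * by auto
      have "a \<in> contr J" using * x F_mem_iff[OF J] by (auto simp: contr_def)
      then have "s' * a \<in> I" using c s' by (auto simp: I_def)
      moreover have "x = F (s' * a) (s' * s)" using * s' nz by (auto simp: eq_fract)
      ultimately have "x \<in> ext (idl R A)" using IK mult_S[OF s'(1) *(3)] by (auto intro: extI)
      then show "x \<in> idl L ((\<lambda>a. F a 1) ` A)" using ext_idl[OF AR] by simp
    qed
    show "idl L ((\<lambda>a. F a 1) ` A) \<subseteq> J"
      using A idl_self[of _ A R'] R' by (intro idl_least[OF L_subring J]) (auto simp: I_def contr_def)
  qed
  then show "\<exists>A\<subseteq>L. finite A \<and> J = idl L A" using AL A by (intro exI[of _ "(\<lambda>a. F a 1) ` A"]) auto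
qed

end

lemma max_localization: "is_subring R \<Longrightarrow> is_max R M \<Longrightarrow> localization R M"
  by (simp add: localization_def max_imp_prime)

locale max_localization = localization +
  assumes Mx: "is_max R M"
begin

lemma ipow_mm: "ipow L mm n = ext (ipow R M n)"
proof
  have mmI: "is_ideal L mm" by (rule prime_ideal[OF mm_prime])
  note p = ipow_ideal[OF R prime_ideal[OF M]] 
  show "ipow L mm n \<subseteq> ext (ipow R M n)"
  proof (rule ipow_least[where F = "\<lambda>n. ext (ipow R M n)"])
    show "L \<subseteq> ext (ipow R M 0)" by (simp add: ext_def loc_def)
    fix n a b assume "a \<in> ext (ipow R M n)" "b \<in> mm"
    then obtain x s y t where "a = F x s" "b = F y t" "x \<in> ipow R M n" "y \<in> M" "s \<in> R - M" "t \<in> R - M"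
      unfolding mm_ext by (metis extE)
    then show "a * b \<in> ext (ipow R M (Suc n))" using mult_S by (auto intro!: extI ipow_SucI)
  next
    fix n a b assume "a \<in> ext (ipow R M (Suc n))" "b \<in> ext (ipow R M (Suc n))"
    then show "a + b \<in> ext (ipow R M (Suc n))" using ext_ideal[OF p] idealD(4)[OF _ L_subring] by blast
  qed
  show "ext (ipow R M n) \<subseteq> ipow L mm n"
  proof -
    note q = ipow_ideal[OF L_subring mmI]
    have "ipow R M n \<subseteq> contr (ipow L mm n)"
    proof (rule ipow_least[where F = "\<lambda>n. contr (ipow L mm n)"])
      show "R \<subseteq> contr (ipow L mm 0)" using loc1 by (auto simp: contr_def)
      fix n a b assume *: "a \<in> contr (ipow L mm n)" "b \<in> M"
      then have "F a 1 * F b 1 \<in> ipow L mm (Suc n)" using F1_mem_mm[of b] mc by (intro ipow_SucI) (auto simp: contr_def)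
      then show "a * b \<in> contr (ipow L mm (Suc n))" using * mc rc by (auto simp: contr_def)
    next
      fix n a b assume "a \<in> contr (ipow L mm (Suc n))" "b \<in> contr (ipow L mm (Suc n))"
      then show "a + b \<in> contr (ipow L mm (Suc n))" using idealD(4)[OF contr_ideal[OF q] R] by blast
    qed
    then show ?thesis using ext_contr[OF q, of n] by (auto simp: ext_def)
  qed
qed

text \<open>Together with \<open>loc_approx\<close> this identifies the quotients of
  \<open>R\<close> and of its localization by the n-th powers: a denominator \<open>t\<close> is
  removed by means of its inverse \<open>r\<close> modulo that power.\<close>

lemma F1_mem_ipow: assumes "a \<in> R" shows "F a 1 \<in> ipow L mm n \<longleftrightarrow> a \<in> ipow R M n"
proof
  note p = idealD[OF ipow_ideal[OF R prime_ideal[OF M]] R]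
  assume "F a 1 \<in> ipow L mm n"
  then obtain b t where bt: "F a 1 = F b t" "b \<in> ipow R M n" "t \<in> R - M" "t \<noteq> 0" unfolding ipow_mm by (metis extE)
  then have e: "a * t = b" by (simp add: eq_fract)
  obtain r where r: "r \<in> R" "1 - r * t \<in> ipow R M n" using max_power_comaximal[OF R Mx bt(3)] by auto
  have "a = a * (1 - r * t) + r * b" unfolding e[symmetric] by (simp add: algebra_simps)
  also have "\<dots> \<in> ipow R M n" using p r bt assms by blast
  finally show "a \<in> ipow R M n" .
qed (use one_S in \<open>auto simp: ipow_mm intro: extI\<close>)

lemma loc_approx: assumes "x \<in> L" shows "\<exists>a\<in>R. x - F a 1 \<in> ipow L mm n"
proof -
  obtain a s where *: "x = F a s" "a \<in> R" "s \<in> R - M" "s \<noteq> 0" using assms by (metis locE)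
  obtain r where r: "r \<in> R" "1 - r * s \<in> ipow R M n" using max_power_comaximal[OF R Mx *(3)] by auto
  have "x - F (r * a) 1 = F (a * (1 - r * s)) s" using * by (simp add: algebra_simps)
  also have "\<dots> \<in> ipow L mm n" unfolding ipow_mm
    using * r idealD[OF ipow_ideal[OF R prime_ideal[OF M]] R] by (intro extI) auto
  finally show ?thesis using * r rc by blast
qed

end

section \<open>Completions\<close>

lemma ipow_mult:
  assumes R: "is_subring R" and I: "is_ideal R I" and a: "a \<in> ipow R I m"
  shows "b \<in> ipow R I n \<Longrightarrow> a * b \<in> ipow R I (m + n)"
proof (induction n arbitrary: b)
  case 0
  then show ?case using idealD(6)[OF ipow_ideal[OF R I] R _ a] by simp
next
  case (Suc n)
  from Suc.prems show ?case
  proof (rule ipow_Suc_induct)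
    fix x y assume "x \<in> ipow R I n" "y \<in> I"
    then have "a * x * y \<in> ipow R I (Suc (m + n))" by (intro ipow_SucI Suc.IH)
    then show "a * (x * y) \<in> ipow R I (m + Suc n)" by (simp add: mult.assoc)
  next
    fix x y assume "a * x \<in> ipow R I (m + Suc n)" "a * y \<in> ipow R I (m + Suc n)"
    then show "a * (x + y) \<in> ipow R I (m + Suc n)"
      using idealD(4)[OF ipow_ideal[OF R I] R] by (simp add: distrib_left)
  qed
qed

definition cset :: "'r::comm_ring_1 set \<Rightarrow> 'r \<Rightarrow> 'r set" where
  "cset I a = {b. b - a \<in> I}"

lemma a_r_coset_ring_of: "I +>\<^bsub>ring_of R\<^esub> a = cset I a"
  by (auto simp: a_r_coset_def' cset_def algebra_simps)

lemma cset_eq_iff: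
  assumes "is_subring R" "is_ideal R I" shows "cset I a = cset I b \<longleftrightarrow> a - b \<in> I"
proof
  assume "cset I a = cset I b"
  moreover have "a \<in> cset I a" using idealD(3)[OF assms(2,1)] by (simp add: cset_def)
  ultimately have "a \<in> cset I b" by simp
  then show "a - b \<in> I" by (simp add: cset_def)
next
  assume ab: "a - b \<in> I"
  have "x - b \<in> I \<longleftrightarrow> x - a \<in> I" for x
    using ideal_diff_cancel[OF assms(2,1), of "x - b" "x - a"] ab by (simp add: algebra_simps)
  then show "cset I a = cset I b" by (simp add: cset_def)
qed

lemma carrier_Quot: "carrier (ring_of R Quot I) = cset I ` R"
  by (simp add: FactRing_def A_RCOSETS_def' a_r_coset_ring_of UNION_singleton_eq_range)

lemma mult_Quot:
  assumes "is_subring R" "is_ideal R I" "a \<in> R" "b \<in> R"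
  shows "cset I a \<otimes>\<^bsub>ring_of R Quot I\<^esub> cset I b = cset I (a * b)"
proof -
  interpret ideal I "ring_of R" using assms by (simp add: ideal_ring_of)
  show ?thesis using rcoset_mult_add[of a b] assms by (simp add: FactRing_def a_r_coset_ring_of)
qed

lemma add_Quot:
  assumes "is_subring R" "is_ideal R I" "a \<in> R" "b \<in> R"
  shows "cset I a \<oplus>\<^bsub>ring_of R Quot I\<^esub> cset I b = cset I (a + b)"
proof -
  interpret ideal I "ring_of R" using assms by (simp add: ideal_ring_of)
  show ?thesis using a_rcos_sum[of a b] assms by (simp add: FactRing_def a_r_coset_ring_of)
qed

lemma one_Quot: "\<one>\<^bsub>ring_of R Quot I\<^esub> = cset I 1"
  by (simp add: FactRing_def a_r_coset_ring_of)

text \<open>Here \<^emph>\<open>d\<close> presents every quotient of \<^emph>\<open>L\<close> by a power of \<^emph>\<open>m\<close> as a quotient of the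
  auxiliary ring \<^emph>\<open>W\<close>.\<close>

locale approx =
  fixes W :: "'w::comm_ring_1 set" and L :: "'x::comm_ring_1 set" and m :: "'x set" and d :: "'w \<Rightarrow> 'x"
  assumes W: "is_subring W" and L: "is_subring L" and m: "is_ideal L m"
    and dL: "w \<in> W \<Longrightarrow> d w \<in> L"
    and d_add: "w \<in> W \<Longrightarrow> v \<in> W \<Longrightarrow> d (w + v) = d w + d v"
    and d_mult: "w \<in> W \<Longrightarrow> v \<in> W \<Longrightarrow> d (w * v) = d w * d v"
    and d_one: "d 1 = 1"
    and approx: "f \<in> L \<Longrightarrow> \<exists>w\<in>W. f - d w \<in> ipow L m n"
begin

lemmas pI = ipow_ideal[OF L m]

lemma d_diff: assumes "w \<in> W" "v \<in> W" shows "d (w - v) = d w - d v"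
  using d_add[of "w - v" v] assms subringD(3)[OF W] by simp

text \<open>The sequence \<open>w\<close> is a Cauchy sequence in \<open>W\<close> that presents the
  point \<open>x\<close> of the completion. Elements of \<open>W\<close> stand for cosets, so the
  ring operations become termwise operations in \<open>W\<close>.\<close>

definition rep :: "(nat \<Rightarrow> 'w) \<Rightarrow> (nat \<Rightarrow> 'x set) \<Rightarrow> bool" where
  "rep w x \<longleftrightarrow> (\<forall>n. w n \<in> W \<and> x n = cset (ipow L m n) (d (w n)) \<and> d (w (Suc n) - w n) \<in> ipow L m n)"

abbreviation "C \<equiv> completion (ring_of L) m"

lemma carrier_rep: "x \<in> carrier C \<longleftrightarrow> (\<exists>w. rep w x)"
proof
  assume "x \<in> carrier C"
  then have x: "\<And>n. x n \<in> cset (ipow L m n) ` L" "\<And>n. x (Suc n) \<subseteq> x n"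
    by (auto simp: completion_def Let_def ipow_def[symmetric] carrier_Quot)
  have "\<exists>w\<in>W. x n = cset (ipow L m n) (d w)" for n
  proof -
    obtain f where f: "f \<in> L" "x n = cset (ipow L m n) f" using x(1)[of n] by auto
    obtain w where "w \<in> W" "f - d w \<in> ipow L m n" using approx[OF f(1)] by auto
    then show ?thesis using f cset_eq_iff[OF L pI] by blast
  qed
  then obtain w where w: "\<And>n. w n \<in> W" "\<And>n. x n = cset (ipow L m n) (d (w n))" by metis
  have "d (w (Suc n) - w n) \<in> ipow L m n" for n
  proof -
    have "d (w (Suc n)) \<in> x (Suc n)" using idealD(3)[OF pI L] by (simp add: w cset_def)
    then have "d (w (Suc n)) \<in> x n" using x(2) by blast
    then show ?thesis using w d_diff by (simp add: cset_def)
  qed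
  then show "\<exists>w. rep w x" unfolding rep_def using w by blast
next
  assume "\<exists>w. rep w x"
  then obtain w where w: "\<And>n. w n \<in> W" "\<And>n. x n = cset (ipow L m n) (d (w n))"
    "\<And>n. d (w (Suc n) - w n) \<in> ipow L m n" by (auto simp: rep_def)
  have "x (Suc n) \<subseteq> x n" for n
  proof
    fix f assume "f \<in> x (Suc n)"
    then have "f - d (w (Suc n)) \<in> ipow L m n"
      using ipow_antimono_Suc[OF L m, of n] by (auto simp: w cset_def)
    moreover have "d (w (Suc n)) - d (w n) \<in> ipow L m n" using w(3)[of n] by (simp add: d_diff w(1))
    ultimately have "f - d (w (Suc n)) + (d (w (Suc n)) - d (w n)) \<in> ipow L m n"
      by (rule idealD(4)[OF pI L])
    moreover have "f - d (w (Suc n)) + (d (w (Suc n)) - d (w n)) = f - d (w n)" by simp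
    ultimately show "f \<in> x n" by (simp add: w cset_def)
  qed
  then show "x \<in> carrier C"
    using w(1,2) dL by (auto simp: completion_def Let_def ipow_def[symmetric] carrier_Quot)
qed

lemma rep_mult: assumes "rep w x" "rep v y" shows "rep (\<lambda>n. w n * v n) (x \<otimes>\<^bsub>C\<^esub> y)"
proof -
  note w = assms(1)[unfolded rep_def, rule_format] and v = assms(2)[unfolded rep_def, rule_format]
  have "d (w (Suc n) * v (Suc n) - w n * v n) \<in> ipow L m n" for n
  proof -
    have wv: "w n \<in> W" "w (Suc n) \<in> W" "v n \<in> W" "v (Suc n) \<in> W" using w v by auto
    have "w (Suc n) * v (Suc n) - w n * v n = (w (Suc n) - w n) * v (Suc n) + w n * (v (Suc n) - v n)"
      by (simp add: algebra_simps)
    then have "d (w (Suc n) * v (Suc n) - w n * v n)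
        = d (w (Suc n) - w n) * d (v (Suc n)) + d (w n) * d (v (Suc n) - v n)"
      using wv by (simp add: d_add d_mult subringD[OF W])
    then show ?thesis using wv w[of n] v[of n] dL idealD(4,5,6)[OF pI L] by simp
  qed
  then show ?thesis using w v subringD(4)[OF W]
    by (auto simp: rep_def completion_def Let_def ipow_def[symmetric] mult_Quot[OF L pI] dL d_mult)
qed

lemma rep_add: assumes "rep w x" "rep v y" shows "rep (\<lambda>n. w n + v n) (x \<oplus>\<^bsub>C\<^esub> y)"
proof -
  note w = assms(1)[unfolded rep_def, rule_format] and v = assms(2)[unfolded rep_def, rule_format]
  have "d (w (Suc n) + v (Suc n) - (w n + v n)) \<in> ipow L m n" for n
  proof -
    have wv: "w n \<in> W" "w (Suc n) \<in> W" "v n \<in> W" "v (Suc n) \<in> W" using w v by auto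
    have "w (Suc n) + v (Suc n) - (w n + v n) = (w (Suc n) - w n) + (v (Suc n) - v n)"
      by (simp add: algebra_simps)
    then have "d (w (Suc n) + v (Suc n) - (w n + v n)) = d (w (Suc n) - w n) + d (v (Suc n) - v n)"
      using wv d_add[of "w (Suc n) - w n" "v (Suc n) - v n"] subringD(3)[OF W] by metis
    then show ?thesis using w[of n] v[of n] idealD(4)[OF pI L] by simp
  qed
  then show ?thesis using w v subringD(6)[OF W]
    by (auto simp: rep_def completion_def Let_def ipow_def[symmetric] add_Quot[OF L pI] dL d_add)
qed

lemma rep_const: assumes "c \<in> W" shows "rep (\<lambda>n. c) (to_completion (ring_of L) m (d c))"
proof -
  have "d (c - c) = 0" using d_diff[OF assms assms] by simp
  then show ?thesis
    using assms idealD(3)[OF pI L] by (auto simp: rep_def to_completion_def ipow_def[symmetric] a_r_coset_ring_of)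
qed

lemma rep_one: "rep (\<lambda>n. 1) \<one>\<^bsub>C\<^esub>"
proof -
  have "d (1 - 1) = 0" using d_diff[of 1 1] subringD(1)[OF W] by simp
  then show ?thesis
    using subringD(1)[OF W] idealD(3)[OF pI L]
    by (auto simp: rep_def completion_def Let_def ipow_def[symmetric] one_Quot d_one)
qed

lemma rep_unique:
  assumes "rep w x" "rep v y" shows "x = y \<longleftrightarrow> (\<forall>n. d (w n - v n) \<in> ipow L m n)"
  using assms cset_eq_iff[OF L pI] d_diff by (auto simp: rep_def fun_eq_iff)

end

text \<open>Both completions are quotients of the Cauchy sequences in \<open>W\<close>. By
  \<open>iff\<close> the two filtrations of \<open>W\<close> by preimages of ideal powers coincide,
  hence so do the Cauchy sequences and the null sequences.\<close>

theorem completion_iso: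
  assumes A: "approx W L m d" and A': "approx W L' m' d'"
    and iff: "\<And>w n. w \<in> W \<Longrightarrow> d w \<in> ipow L m n \<longleftrightarrow> d' w \<in> ipow L' m' n"
  shows "\<exists>h \<in> ring_iso (completion (ring_of L) m) (completion (ring_of L') m').
    \<forall>c\<in>W. h (to_completion (ring_of L) m (d c)) = to_completion (ring_of L') m' (d' c)"
proof -
  interpret A: approx W L m d by fact
  interpret B: approx W L' m' d' by fact
  have sub: "w - v \<in> W" if "w \<in> W" "v \<in> W" for w v using subringD(3)[OF A.W] that .
  \<comment> \<open>Any sequence that presents \<open>x\<close> may be used; \<open>uniq\<close>
    below shows that the choice does not matter.\<close>
  define h where "h x = (SOME y. \<exists>w. A.rep w x \<and> B.rep w y)" for x
  have transfer: "\<exists>y. B.rep w y" if "A.rep w x" for w x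
  proof -
    have w: "\<And>n. w n \<in> W" "\<And>n. d (w (Suc n) - w n) \<in> ipow L m n" using that by (auto simp: A.rep_def)
    then have "d' (w (Suc n) - w n) \<in> ipow L' m' n" for n using iff[OF sub[OF w(1) w(1)]] w(2) by blast
    then show ?thesis using w
      by (intro exI[of _ "\<lambda>n. cset (ipow L' m' n) (d' (w n))"]) (simp add: B.rep_def)
  qed
  have transfer': "\<exists>x. A.rep w x" if "B.rep w y" for w y
  proof -
    have w: "\<And>n. w n \<in> W" "\<And>n. d' (w (Suc n) - w n) \<in> ipow L' m' n" using that by (auto simp: B.rep_def)
    then have "d (w (Suc n) - w n) \<in> ipow L m n" for n using iff[OF sub[OF w(1) w(1)]] w(2) by blast
    then show ?thesis using w
      by (intro exI[of _ "\<lambda>n. cset (ipow L m n) (d (w n))"]) (simp add: A.rep_def)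
  qed
  have repW: "w n \<in> W" if "A.rep w x" for w x n using that by (simp add: A.rep_def)
  have uniq: "x = y \<longleftrightarrow> x' = y'" if "A.rep w x" "A.rep v y" "B.rep w x'" "B.rep v y'" for w v x y x' y'
    using A.rep_unique[OF that(1,2)] B.rep_unique[OF that(3,4)] repW[OF that(1)] repW[OF that(2)] iff sub by simp
  have h: "h x = y" if "A.rep w x" "B.rep w y" for w x y
  proof -
    have "\<exists>y. \<exists>w. A.rep w x \<and> B.rep w y" using that by blast
    then have "\<exists>w. A.rep w x \<and> B.rep w (h x)" unfolding h_def by (rule someI_ex)
    then obtain v where "A.rep v x" "B.rep v (h x)" by blast
    then show ?thesis using uniq[OF _ that(1) _ that(2)] by blast
  qed
  have "h \<in> ring_iso A.C B.C"
  proof (rule ring_iso_memI)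
    fix x assume "x \<in> carrier A.C"
    then obtain w where w: "A.rep w x" by (auto simp: A.carrier_rep)
    then obtain y where y: "B.rep w y" using transfer by blast
    then show "h x \<in> carrier B.C" using h[OF w y] by (auto simp: B.carrier_rep)
    fix x2 assume "x2 \<in> carrier A.C"
    then obtain v where v: "A.rep v x2" by (auto simp: A.carrier_rep)
    then obtain y2 where y2: "B.rep v y2" using transfer by blast
    show "h (x \<otimes>\<^bsub>A.C\<^esub> x2) = h x \<otimes>\<^bsub>B.C\<^esub> h x2"
      using h[OF A.rep_mult[OF w v] B.rep_mult[OF y y2]] h[OF w y] h[OF v y2] by simp
    show "h (x \<oplus>\<^bsub>A.C\<^esub> x2) = h x \<oplus>\<^bsub>B.C\<^esub> h x2"
      using h[OF A.rep_add[OF w v] B.rep_add[OF y y2]] h[OF w y] h[OF v y2] by simp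
  next
    show "h \<one>\<^bsub>A.C\<^esub> = \<one>\<^bsub>B.C\<^esub>" by (rule h[OF A.rep_one B.rep_one])
    show "bij_betw h (carrier A.C) (carrier B.C)"
    proof (rule bij_betw_imageI)
      show "inj_on h (carrier A.C)"
      proof (rule inj_onI)
        fix x y assume "x \<in> carrier A.C" "y \<in> carrier A.C" and e: "h x = h y"
        then obtain w v where wv: "A.rep w x" "A.rep v y" by (auto simp: A.carrier_rep)
        then obtain x' y' where xy: "B.rep w x'" "B.rep v y'" using transfer by metis
        then show "x = y" using uniq[OF wv xy] h wv e by simp
      qed
      show "h ` carrier A.C = carrier B.C"
      proof
        show "h ` carrier A.C \<subseteq> carrier B.C"
        proof (rule image_subsetI)
          fix x assume "x \<in> carrier A.C"
          then obtain w where w: "A.rep w x" by (auto simp: A.carrier_rep)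
          then obtain y where "B.rep w y" using transfer by blast
          then show "h x \<in> carrier B.C" using h[OF w] by (auto simp: B.carrier_rep)
        qed
        show "carrier B.C \<subseteq> h ` carrier A.C"
        proof
          fix y assume "y \<in> carrier B.C"
          then obtain w where w: "B.rep w y" by (auto simp: B.carrier_rep)
          then obtain x where x: "A.rep w x" using transfer' by blast
          then have "x \<in> carrier A.C" by (auto simp: A.carrier_rep)
          then show "y \<in> h ` carrier A.C" using h[OF x w] by blast
        qed
      qed
    qed
  qed
  moreover have "h (to_completion (ring_of L) m (d c)) = to_completion (ring_of L') m' (d' c)" if "c \<in> W" for c
    by (rule h[OF A.rep_const[OF that] B.rep_const[OF that]])
  ultimately show ?thesis by blast
qed

section \<open>Rings with a maximal ideal generated by monomials\<close>

lemma poly_mapping_sum_single: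
  "w = (\<Sum>k\<in>Poly_Mapping.keys w. Poly_Mapping.single k (Poly_Mapping.lookup w k))"
  for w :: "'i \<Rightarrow>\<^sub>0 'c::comm_monoid_add"
  by (rule poly_mapping_eqI) (auto simp: lookup_sum lookup_single when_def in_keys_iff)

text \<open>Off by one: \<^emph>\<open>spow S n\<close> consists of the sums of one element of \<^emph>\<open>S\<close> and \<^emph>\<open>n\<close> nonzero elements.\<close>

fun spow :: "'i::comm_monoid_add set \<Rightarrow> nat \<Rightarrow> 'i set" where
  "spow S 0 = S"
| "spow S (Suc n) = {a + b | a b. a \<in> spow S n \<and> b \<in> S - {0}}"

text \<open>The common shape of the two local rings: the residue field consists of constants, and
  the maximal ideal is generated by a monoid of elements \<open>chi\<close>. Linear independence of
  the \<open>chi\<close> enters later, as a hypothesis on the powers of \<open>M\<close>.\<close>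

locale monomial_ring = max_localization R M for R M :: "'r::idom set" +
  fixes c :: "complex \<Rightarrow> 'r" and S :: "'i::comm_monoid_add set" and chi :: "'i \<Rightarrow> 'r"
  assumes c_R: "c a \<in> R" and c_add: "c (a + b) = c a + c b" and c_mult: "c (a * b) = c a * c b" and c_one: "c 1 = 1"
    and S0: "0 \<in> S" and S_add: "s \<in> S \<Longrightarrow> s' \<in> S \<Longrightarrow> s + s' \<in> S"
    and chi_R: "s \<in> S \<Longrightarrow> chi s \<in> R" and chi0: "chi 0 = 1"
    and chi_add: "s \<in> S \<Longrightarrow> s' \<in> S \<Longrightarrow> chi (s + s') = chi s * chi s'"
    and chi_M: "s \<in> S \<Longrightarrow> s \<noteq> 0 \<Longrightarrow> chi s \<in> M"
    and residue: "f \<in> R \<Longrightarrow> \<exists>a. f - c a \<in> M"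
    and gen: "M \<subseteq> idl R (chi ` (S - {0}))"
begin

text \<open>The homomorphism from the monoid algebra of \<open>S\<close> to \<open>R\<close>,
  written as a total function; it is multiplicative on \<open>W\<close>, where supports lie in
  \<open>S\<close>.\<close>

definition ev :: "('i \<Rightarrow>\<^sub>0 complex) \<Rightarrow> 'r" where
  "ev w = (\<Sum>k\<in>Poly_Mapping.keys w. c (Poly_Mapping.lookup w k) * chi k)"

definition W :: "('i \<Rightarrow>\<^sub>0 complex) set" where "W = {w. Poly_Mapping.keys w \<subseteq> S}"

lemma c0: "c 0 = 0" by (metis add_cancel_right_right add.right_neutral c_add)

lemma ev_superset: "finite A \<Longrightarrow> Poly_Mapping.keys w \<subseteq> A \<Longrightarrow> ev w = (\<Sum>k\<in>A. c (Poly_Mapping.lookup w k) * chi k)"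
  unfolding ev_def by (rule sum.mono_neutral_left) (auto simp: c0 in_keys_iff)

lemma ev_add: "ev (w + v) = ev w + ev v"
proof -
  let ?A = "Poly_Mapping.keys w \<union> Poly_Mapping.keys v"
  have "ev (w + v) = (\<Sum>k\<in>?A. c (Poly_Mapping.lookup (w + v) k) * chi k)"
    by (rule ev_superset) (simp_all add: Poly_Mapping.keys_add)
  also have "\<dots> = ev w + ev v"
    by (simp add: ev_superset[of ?A w] ev_superset[of ?A v] lookup_add c_add algebra_simps sum.distrib)
  finally show ?thesis .
qed

lemma ev_0: "ev 0 = 0" by (simp add: ev_def)

lemma ev_single: "ev (Poly_Mapping.single k a) = c a * chi k"
  using ev_superset[of "{k}" "Poly_Mapping.single k a"] by simp

lemma ev_sum: "ev (sum f A) = (\<Sum>i\<in>A. ev (f i))"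
  by (induction A rule: infinite_finite_induct) (auto simp: ev_0 ev_add)

lemma ev_mult: assumes "w \<in> W" "v \<in> W" shows "ev (w * v) = ev w * ev v"
proof -
  have "w * v = (\<Sum>k\<in>Poly_Mapping.keys w. \<Sum>l\<in>Poly_Mapping.keys v.
      Poly_Mapping.single (k + l) (Poly_Mapping.lookup w k * Poly_Mapping.lookup v l))"
    by (subst (1) poly_mapping_sum_single[of w], subst (1) poly_mapping_sum_single[of v]) (simp add: sum_product mult_single)
  then have "ev (w * v) = (\<Sum>k\<in>Poly_Mapping.keys w. \<Sum>l\<in>Poly_Mapping.keys v.
      c (Poly_Mapping.lookup w k * Poly_Mapping.lookup v l) * chi (k + l))"
    by (simp add: ev_sum ev_single)
  also have "\<dots> = ev w * ev v" unfolding ev_def sum_product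
    using assms by (intro sum.cong refl) (auto simp: W_def c_mult chi_add subset_iff)
  finally show ?thesis .
qed

lemma W_subring: "is_subring W"
proof -
  have "w - v \<in> W" if "w \<in> W" "v \<in> W" for w v
  proof -
    have "Poly_Mapping.keys (w - v) \<subseteq> Poly_Mapping.keys w \<union> Poly_Mapping.keys v"
      by (auto simp: in_keys_iff lookup_minus)
    then show ?thesis using that by (auto simp: W_def)
  qed
  moreover have "w * v \<in> W" if "w \<in> W" "v \<in> W" for w v
    using that Poly_Mapping.keys_mult[of w v] S_add unfolding W_def by blast
  moreover have "1 \<in> W" using S0 by (simp add: W_def)
  ultimately show ?thesis by (auto simp: is_subring_def)
qed

lemma ev_R: "w \<in> W \<Longrightarrow> ev w \<in> R"
  unfolding ev_def W_def by (intro subring_sum[OF R] rc(4) c_R chi_R) auto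

lemma W_single: "k \<in> S \<Longrightarrow> Poly_Mapping.single k a \<in> W"
  by (auto simp: W_def)

lemma ev_const: "ev (Poly_Mapping.single 0 a) = c a" by (simp add: ev_single chi0)

lemmas MI = prime_ideal[OF M]
lemmas pI = ipow_ideal[OF R MI]

lemma spow_S: "spow S n \<subseteq> S"
  by (induction n) (use S_add in auto)

lemma chi_spow: "s \<in> spow S n \<Longrightarrow> chi s \<in> ipow R M n"
proof (induction n arbitrary: s)
  case (Suc n)
  then obtain a b where "s = a + b" "a \<in> spow S n" "b \<in> S - {0}" by auto
  then show ?case using Suc.IH[of a] chi_M[of b] spow_S[of n] by (auto simp: chi_add intro!: ipow_SucI)
qed (auto simp: chi_R)

lemma ev_spow: assumes "Poly_Mapping.keys w \<subseteq> spow S n" shows "ev w \<in> ipow R M n"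
  unfolding ev_def using assms chi_spow c_R
  by (intro ideal_sum[OF pI] idealD(5)[OF pI R]) auto

lemma M_step: assumes "f \<in> M" shows "\<exists>w\<in>W. f - ev w \<in> ipow R M (Suc (Suc 0))"
proof -
  \<comment> \<open>The elements of \<open>M\<close> that agree with a monomial sum modulo the
    square form an ideal: a factor \<open>r\<close> may be replaced by its residue constant, as
    \<open>(r - c a) * x\<close> lies in the square.\<close>
  let ?J = "{f \<in> M. \<exists>w\<in>W. f - ev w \<in> ipow R M (Suc (Suc 0))}"
  note p = idealD[OF pI R]
  have "is_ideal R ?J"
  proof (rule is_idealI)
    show "?J \<subseteq> R" using mc(1) by blast
    have "0 \<in> W" using subringD(2)[OF W_subring] .
    then show "0 \<in> ?J" using mc(3) p(3) ev_0 by force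
  next
    fix x y assume "x \<in> ?J" "y \<in> ?J"
    then obtain w v where wv: "w \<in> W" "v \<in> W" "x - ev w \<in> ipow R M (Suc (Suc 0))" "y - ev v \<in> ipow R M (Suc (Suc 0))"
      "x \<in> M" "y \<in> M" by auto
    have "x + y - ev (w + v) \<in> ipow R M (Suc (Suc 0))"
      using p(4)[OF wv(3,4)] by (simp add: ev_add algebra_simps)
    then show "x + y \<in> ?J" using wv mc(4) subringD(6)[OF W_subring, of w v] by blast
  next
    fix r x assume r: "r \<in> R" and "x \<in> ?J"
    then obtain w where w: "w \<in> W" "x - ev w \<in> ipow R M (Suc (Suc 0))" "x \<in> M" by auto
    obtain a where a: "r - c a \<in> M" using residue[OF r] by auto
    have "(r - c a) * x \<in> ipow R M (Suc (Suc 0))" 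
      using a w(3) by (intro ipow_SucI) (auto simp: ipow_1[OF R MI])
    moreover have "c a * (x - ev w) \<in> ipow R M (Suc (Suc 0))" by (rule p(5)[OF c_R w(2)])
    ultimately have "(r - c a) * x + c a * (x - ev w) \<in> ipow R M (Suc (Suc 0))" by (rule p(4))
    also have "(r - c a) * x + c a * (x - ev w) = r * x - ev (Poly_Mapping.single 0 a * w)"
      using w by (simp add: ev_mult W_single S0 ev_const algebra_simps)
    finally show "r * x \<in> ?J"
      using mc(5)[OF r w(3)] subringD(4)[OF W_subring W_single[OF S0] w(1)] by blast
  qed
  moreover have "chi ` (S - {0}) \<subseteq> ?J"
  proof (intro subsetI CollectI conjI)
    fix x assume x: "x \<in> chi ` (S - {0})"
    then show "x \<in> M" using chi_M by auto
    obtain s where s: "x = chi s" "s \<in> S" using x by auto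
    then show "\<exists>w\<in>W. x - ev w \<in> ipow R M (Suc (Suc 0))"
      using W_single[of s 1] p(3) by (intro bexI[of _ "Poly_Mapping.single s 1"]) (auto simp: ev_single c_one)
  qed
  ultimately have "idl R (chi ` (S - {0})) \<subseteq> ?J" by (rule idl_least[OF R])
  then show ?thesis using gen assms by blast
qed

lemma ipow_step: "f \<in> ipow R M n \<Longrightarrow> \<exists>w\<in>W. f - ev w \<in> ipow R M (Suc n)"
proof (induction n arbitrary: f)
  case 0
  then obtain a where "f - c a \<in> M" using residue by auto
  then show ?case using W_single[OF S0, of a] ev_const ipow_1[OF R MI] by force
next
  case (Suc n)
  note p = idealD[OF pI R]
  from Suc.prems show ?case
  proof (rule ipow_Suc_induct)
    fix a b assume a: "a \<in> ipow R M n" and b: "b \<in> M"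
    \<comment> \<open>The factor \<open>a\<close> is approximated one order better and
      \<open>b\<close> modulo the square; the error of \<open>ev w * ev v\<close> then splits into
      two terms of order \<open>Suc (Suc n)\<close>.\<close>
    obtain w where w: "w \<in> W" "a - ev w \<in> ipow R M (Suc n)" using Suc.IH[OF a] by auto
    obtain v where v: "v \<in> W" "b - ev v \<in> ipow R M (Suc (Suc 0))" using M_step[OF b] by auto
    have "a - ev w \<in> ipow R M n" using w(2) ipow_antimono_Suc[OF R MI] by blast
    then have "ev w \<in> ipow R M n" using ideal_diff_cancel[OF pI R] a by blast
    then have "ev w * (b - ev v) \<in> ipow R M (Suc (Suc n))" using ipow_mult[OF R MI _ v(2), of "ev w" n] by simp
    moreover have "(a - ev w) * b \<in> ipow R M (Suc (Suc n))" using w b by (intro ipow_SucI)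
    ultimately have "(a - ev w) * b + ev w * (b - ev v) \<in> ipow R M (Suc (Suc n))" using p(4) by blast
    also have "(a - ev w) * b + ev w * (b - ev v) = a * b - ev (w * v)"
      using w v by (simp add: ev_mult algebra_simps)
    finally show "\<exists>w\<in>W. a * b - ev w \<in> ipow R M (Suc (Suc n))"
      using subringD(4)[OF W_subring w(1) v(1)] by blast
  next
    fix a b assume "\<exists>w\<in>W. a - ev w \<in> ipow R M (Suc (Suc n))" "\<exists>w\<in>W. b - ev w \<in> ipow R M (Suc (Suc n))"
    then obtain w v where *: "w \<in> W" "v \<in> W" "a - ev w \<in> ipow R M (Suc (Suc n))" "b - ev v \<in> ipow R M (Suc (Suc n))"
      by auto
    have "a + b - ev (w + v) \<in> ipow R M (Suc (Suc n))"
      using p(4)[OF *(3,4)] by (simp add: ev_add algebra_simps)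
    then show "\<exists>w\<in>W. a + b - ev w \<in> ipow R M (Suc (Suc n))"
      using subringD(6)[OF W_subring *(1,2)] by blast
  qed
qed

lemma R_approx: assumes f: "f \<in> R" shows "\<exists>w\<in>W. f - ev w \<in> ipow R M n"
proof (induction n)
  case 0
  show ?case using f ev_0 subringD(2)[OF W_subring] by (intro bexI[of _ 0]) auto
next
  case (Suc n)
  then obtain w where w: "w \<in> W" "f - ev w \<in> ipow R M n" by auto
  obtain v where v: "v \<in> W" "f - ev w - ev v \<in> ipow R M (Suc n)" using ipow_step[OF w(2)] by auto
  then show ?case using subringD(6)[OF W_subring w(1) v(1)] by (metis diff_diff_eq ev_add)
qed

lemma approx_loc: "approx W (loc R M) (local_max R M) (\<lambda>w. F (ev w) 1)"
proof (rule approx.intro)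
  fix f n assume "f \<in> L"
  then obtain a where a: "a \<in> R" "f - F a 1 \<in> ipow L mm n" using loc_approx by blast
  obtain w where w: "w \<in> W" "a - ev w \<in> ipow R M n" using R_approx[OF a(1)] by blast
  have "F (a - ev w) 1 \<in> ipow L mm n"
    using F1_mem_ipow[of "a - ev w" n] w a ev_R rc(3) by simp
  then have "F a 1 - F (ev w) 1 \<in> ipow L mm n" by simp
  with a(2) have "(f - F a 1) + (F a 1 - F (ev w) 1) \<in> ipow L mm n"
    by (rule idealD(4)[OF ipow_ideal[OF L_subring prime_ideal[OF mm_prime]] L_subring])
  moreover have "x - y + (y - z) = x - z" for x y z :: "'r fract" by simp
  ultimately have "f - F (ev w) 1 \<in> ipow L mm n" by metis
  then show "\<exists>w\<in>W. f - F (ev w) 1 \<in> ipow L mm n" using w by blast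
next
  have "ev 1 = 1" using ev_const[of 1] by (simp add: c_one)
  then show "F (ev 1) 1 = 1" by (simp add: One_fract_def)
qed (use W_subring L_subring prime_ideal[OF mm_prime] loc1 ev_R in \<open>auto simp: ev_add ev_mult\<close>)

end

text \<open>The converse of \<open>indep\<close> is \<open>ev_spow\<close>. So on both sides a
  monomial sum lies in the n-th power iff its support lies in \<open>spow S n\<close>, a set that
  depends on the semigroup alone.\<close>

theorem monomial_completion_iso:
  fixes S :: "'i::comm_monoid_add set"
  assumes A: "monomial_ring R M c S chi" and A': "monomial_ring R' M' c' S chi'"
    and indep: "\<And>w n. Poly_Mapping.keys w \<subseteq> S \<Longrightarrow> monomial_ring.ev c chi w \<in> ipow R M n \<Longrightarrow> Poly_Mapping.keys w \<subseteq> spow S n"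
    and indep': "\<And>w n. Poly_Mapping.keys w \<subseteq> S \<Longrightarrow> monomial_ring.ev c' chi' w \<in> ipow R' M' n \<Longrightarrow> Poly_Mapping.keys w \<subseteq> spow S n"
  shows "\<exists>h \<in> ring_iso (completed_local_ring R M) (completed_local_ring R' M').
    \<forall>a. h (completed_embed c R M a) = completed_embed c' R' M' a"
proof -
  interpret A: monomial_ring R M c S chi by fact
  interpret B: monomial_ring R' M' c' S chi' by fact
  have 1: "A.ev w \<in> ipow R M n \<longleftrightarrow> B.ev w \<in> ipow R' M' n" if "w \<in> A.W" for w n
    using indep[of w n] indep'[of w n] A.ev_spow[of w n] B.ev_spow[of w n] that[unfolded A.W_def] by blast
  have 2: "A.F (A.ev w) 1 \<in> ipow A.L A.mm n \<longleftrightarrow> B.F (B.ev w) 1 \<in> ipow B.L B.mm n" if "w \<in> A.W" for w n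
    using 1[OF that] A.F1_mem_ipow[OF A.ev_R[OF that]] B.F1_mem_ipow[OF B.ev_R[OF that]] by simp
  obtain h where h: "h \<in> ring_iso (completion (ring_of A.L) A.mm) (completion (ring_of B.L) B.mm)"
    "\<forall>w\<in>A.W. h (to_completion (ring_of A.L) A.mm (A.F (A.ev w) 1)) = to_completion (ring_of B.L) B.mm (B.F (B.ev w) 1)"
    using completion_iso[OF A.approx_loc B.approx_loc 2] by blast
  have "h (completed_embed c R M a) = completed_embed c' R' M' a" for a
    using h(2)[rule_format, OF A.W_single[OF A.S0, of a]]
    by (simp add: completed_embed_def local_ring_eq A.ev_const B.ev_const)
  then show ?thesis using h(1) by (auto simp: completed_local_ring_def local_ring_eq)
qed

section \<open>Hilbert's basis theorem\<close>

definition adj :: "'r::comm_ring_1 set \<Rightarrow> 'r \<Rightarrow> 'r set" where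
  "adj S g = {poly p g | p. \<forall>i. coeff p i \<in> S}"

locale adjoin =
  fixes S :: "'r::comm_ring_1 set" and g :: 'r
  assumes S: "is_subring S"
begin

lemmas sc = subringD[OF S]

definition SX :: "'r poly set" where "SX = {p. \<forall>i. coeff p i \<in> S}"

lemma adj_SX: "adj S g = (\<lambda>p. poly p g) ` SX"
  by (auto simp: adj_def SX_def)

lemma SX_subring: "is_subring SX"
proof -
  have "p * q \<in> SX" if "p \<in> SX" "q \<in> SX" for p q
    using that by (auto simp: SX_def coeff_mult intro!: subring_sum[OF S] sc(4))
  then show ?thesis using sc by (auto simp: is_subring_def SX_def coeff_1 simp del: One_nat_def)
qed

lemma adj_subring: "is_subring (adj S g)"
proof -
  note r = subringD[OF SX_subring]
  have "poly p g - poly q g \<in> adj S g \<and> poly p g * poly q g \<in> adj S g" if "p \<in> SX" "q \<in> SX" for p q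
    unfolding adj_SX using r(3,4)[OF that] by (metis image_eqI poly_diff poly_mult)
  moreover have "1 \<in> adj S g" unfolding adj_SX using r(1) by (metis image_eqI poly_1)
  ultimately show ?thesis unfolding is_subring_def by (auto simp: adj_SX)
qed

lemma const_SX: "a \<in> S \<Longrightarrow> [:a:] \<in> SX"
  using sc(2) by (auto simp: SX_def coeff_pCons split: nat.split)

lemma X_SX: "[:0, 1:] \<in> SX"
  using sc(1,2) by (auto simp: SX_def coeff_pCons split: nat.split)

lemma adj_base: "S \<subseteq> adj S g"
proof
  fix a assume "a \<in> S"
  then have "poly [:a:] g \<in> adj S g" unfolding adj_SX by (intro imageI const_SX)
  then show "a \<in> adj S g" by simp
qed

lemma adj_gen: "g \<in> adj S g"
proof -
  have "poly [:0, 1:] g \<in> adj S g" unfolding adj_SX by (intro imageI X_SX)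
  then show ?thesis by simp
qed

lemma adj_least:
  assumes T: "is_subring T" "S \<subseteq> T" "g \<in> T" shows "adj S g \<subseteq> T"
proof
  fix x assume "x \<in> adj S g"
  then obtain p where p: "x = poly p g" "\<And>i. coeff p i \<in> S" by (auto simp: adj_def)
  show "x \<in> T" unfolding p(1) poly_altdef
    using p(2) T(2,3) by (intro subring_sum[OF T(1)] subringD(4,7)[OF T(1)]) auto
qed

theorem hilbert_basis:
  assumes n: "noeth S" shows "noeth (adj S g)"
  unfolding noeth_def
proof (intro allI impI)
  fix J assume J: "is_ideal (adj S g) J"
  note j = idealD[OF J adj_subring]
  note x = subringD[OF SX_subring]
  \<comment> \<open>Different polynomials may have the same value at \<open>g\<close>, so degrees
    and leading coefficients are taken among the polynomials with value in \<open>J\<close>.\<close>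
  define J' where "J' = {p \<in> SX. poly p g \<in> J}"
  have adjI: "poly p g \<in> adj S g" if "p \<in> SX" for p using that by (auto simp: adj_SX)
  \<comment> \<open>The bound on the degree, instead of equality, makes this an ideal containing 0
    and lets it grow with \<open>d\<close>. The parameter \<open>K\<close> allows the ideal spanned
    by the chosen generators to be compared with \<open>J\<close>.\<close>
  define lead where "lead K d = {a. \<exists>p\<in>J'. poly p g \<in> K \<and> degree p \<le> d \<and> coeff p d = a}" for K d
  have lead_ideal: "is_ideal S (lead K d)" if K: "is_ideal (adj S g) K" for K d
  proof (rule is_idealI)
    note k = idealD[OF K adj_subring]
    show "lead K d \<subseteq> S" by (auto simp: lead_def J'_def SX_def)
    have "0 \<in> J'" using x(2) j(3) by (simp add: J'_def)
    then show "0 \<in> lead K d" unfolding lead_def using k(3) by (intro CollectI bexI[of _ 0]) auto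
    fix a b assume "a \<in> lead K d" "b \<in> lead K d"
    then obtain p q where pq: "p \<in> J'" "q \<in> J'" "poly p g \<in> K" "poly q g \<in> K" "degree p \<le> d" "degree q \<le> d" "coeff p d = a" "coeff q d = b"
      by (auto simp: lead_def)
    then have "p + q \<in> J'" using x(6) j(4) by (auto simp: J'_def)
    then show "a + b \<in> lead K d" unfolding lead_def using pq k(4)
      by (intro CollectI bexI[of _ "p + q"]) (auto simp: degree_add_le)
  next
    note k = idealD[OF K adj_subring]
    fix r a assume r: "r \<in> S" and "a \<in> lead K d"
    then obtain p where p: "p \<in> J'" "poly p g \<in> K" "degree p \<le> d" "coeff p d = a"
      by (auto simp: lead_def)
    have rA: "r \<in> adj S g" using r adj_base by blast
    have "smult r p \<in> J'" using x(4)[OF const_SX[OF r], of p] j(5)[OF rA] p(1) by (auto simp: J'_def)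
    then show "r * a \<in> lead K d" unfolding lead_def using p k(5)[OF rA p(2)] degree_smult_le[of r p]
      by (intro CollectI bexI[of _ "smult r p"]) auto
  qed
  have lead_Suc: "lead K d \<subseteq> lead K (Suc d)" if K: "is_ideal (adj S g) K" for K d
  proof
    note k = idealD[OF K adj_subring]
    fix a assume "a \<in> lead K d"
    then obtain p where p: "p \<in> J'" "poly p g \<in> K" "degree p \<le> d" "coeff p d = a"
      by (auto simp: lead_def)
    have e: "pCons 0 p = [:0, 1:] * p" by simp
    have "pCons 0 p \<in> SX" unfolding e using x(4)[OF X_SX] p(1) by (auto simp: J'_def)
    then have "pCons 0 p \<in> J'" using p(1) j(5)[OF adj_gen] by (auto simp: J'_def)
    then show "a \<in> lead K (Suc d)" unfolding lead_def using p k(5)[OF adj_gen p(2)]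
      by (intro CollectI bexI[of _ "pCons 0 p"]) (auto simp: degree_pCons_le[THEN le_trans])
  qed
  have lead_mono: "lead K d \<subseteq> lead K e" if K: "is_ideal (adj S g) K" and "d \<le> e" for K d e
    using that(2) by (induction rule: dec_induct) (use lead_Suc[OF K] in auto)
  let ?U = "\<Union>d. lead J d"
  have "is_ideal S ?U"
  proof (rule is_idealI)
    note i = idealD[OF lead_ideal[OF J] S]
    show "?U \<subseteq> S" using i(1) by blast
    show "0 \<in> ?U" using i(3) by blast
    fix a b assume "a \<in> ?U" "b \<in> ?U"
    then obtain d e where "a \<in> lead J d" "b \<in> lead J e" by auto
    then have "a \<in> lead J (max d e)" "b \<in> lead J (max d e)"
      using lead_mono[OF J, of d "max d e"] lead_mono[OF J, of e "max d e"] by auto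
    then show "a + b \<in> ?U" using i(4) by blast
  next
    note i = idealD[OF lead_ideal[OF J] S]
    fix r a assume "r \<in> S" "a \<in> ?U"
    then show "r * a \<in> ?U" using i(5) by blast
  qed
  then obtain A where A: "A \<subseteq> S" "finite A" "?U = idl S A" using n unfolding noeth_def by meson
  have "\<exists>N. A \<subseteq> lead J N"
  proof -
    have "\<exists>d. a \<in> lead J d" if "a \<in> A" for a using idl_self[OF that S] A(3) by blast
    then obtain f where f: "\<And>a. a \<in> A \<Longrightarrow> a \<in> lead J (f a)" by metis
    have "A \<subseteq> lead J (Max (insert 0 (f ` A)))"
    proof
      fix a assume a: "a \<in> A"
      have "f a \<le> Max (insert 0 (f ` A))" using a A(2) by (intro Max_ge) auto
      then show "a \<in> lead J (Max (insert 0 (f ` A)))" using f[OF a] lead_mono[OF J] by blast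
    qed
    then show ?thesis by blast
  qed
  then obtain N where N: "A \<subseteq> lead J N" by blast
  have "\<exists>B. B \<subseteq> S \<and> finite B \<and> lead J d = idl S B" for d
    using n lead_ideal[OF J] unfolding noeth_def by meson
  then obtain B where B: "\<And>d. B d \<subseteq> S" "\<And>d. finite (B d)" "\<And>d. lead J d = idl S (B d)" by metis
  \<comment> \<open>Generators of the leading ideals of index below \<open>N\<close>, and at
    \<open>N\<close> generators of their union, which serve all higher indices as well.\<close>
  define A' where "A' d = (if d < N then B d else if d = N then A else {})" for d
  have A'lead: "a \<in> lead J d" if "a \<in> A' d" for a d
    using that N B(3)[of d] idl_self[OF _ S] by (auto simp: A'_def split: if_splits)
  have "\<exists>p. p \<in> J' \<and> degree p \<le> d \<and> coeff p d = a" if "a \<in> A' d" for a d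
    using A'lead[OF that] by (auto simp: lead_def)
  then obtain P where P: "\<And>a d. a \<in> A' d \<Longrightarrow> P a d \<in> J' \<and> degree (P a d) \<le> d \<and> coeff (P a d) d = a"
    by metis
  define G where "G = (\<lambda>(d, a). poly (P a d) g) ` (SIGMA d : {..N}. A' d)"
  have finG: "finite G" using A(2) B(2) by (auto simp: G_def A'_def intro!: finite_SigmaI)
  have GJ: "G \<subseteq> J" using P by (auto simp: G_def J'_def)
  then have GA: "G \<subseteq> adj S g" using j(1) by blast
  define K where "K = idl (adj S g) G"
  have K: "is_ideal (adj S g) K" unfolding K_def by (rule idl_ideal[OF adj_subring GA])
  note k = idealD[OF K adj_subring]
  have A'K: "A' d \<subseteq> lead K d" if "d \<le> N" for d
  proof
    fix a assume a: "a \<in> A' d"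
    then have "poly (P a d) g \<in> G" using that by (force simp: G_def)
    then have "poly (P a d) g \<in> K" unfolding K_def by (rule idl_self[OF _ adj_subring])
    then show "a \<in> lead K d" unfolding lead_def using P[OF a] by blast
  qed
  have leadK: "lead J d \<subseteq> lead K d" for d
  proof (cases "d < N")
    case True
    then have "B d \<subseteq> lead K d" using A'K[of d] by (simp add: A'_def)
    then show ?thesis unfolding B(3) by (rule idl_least[OF S lead_ideal[OF K]])
  next
    case False
    then have "A \<subseteq> lead K d" using A'K[of N] lead_mono[OF K, of N d] by (auto simp: A'_def)
    then have "?U \<subseteq> lead K d" unfolding A(3) by (rule idl_least[OF S lead_ideal[OF K]])
    then show ?thesis by blast
  qed
  \<comment> \<open>Induction on the degree bound: a polynomial with value in \<open>K\<close> and
    the same coefficient of index \<open>Suc d\<close> is subtracted.\<close>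
  have "poly p g \<in> K" if "p \<in> J'" "degree p \<le> d" for p d
    using that
  proof (induction d arbitrary: p)
    case 0
    have "coeff p 0 \<in> lead J 0" unfolding lead_def using 0 by (auto simp: J'_def)
    then have "coeff p 0 \<in> lead K 0" using leadK by blast
    then obtain q where q: "poly q g \<in> K" "degree q \<le> 0" "coeff q 0 = coeff p 0" by (auto simp: lead_def)
    have "p = q" using q 0(2) by (metis bot_nat_0.extremum_uniqueI degree_0_id)
    then show ?case using q by simp
  next
    case (Suc d)
    have "coeff p (Suc d) \<in> lead J (Suc d)" unfolding lead_def using Suc by (auto simp: J'_def)
    then have "coeff p (Suc d) \<in> lead K (Suc d)" using leadK by blast
    then obtain q where q: "q \<in> J'" "poly q g \<in> K" "degree q \<le> Suc d" "coeff q (Suc d) = coeff p (Suc d)"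
      by (auto simp: lead_def)
    have "degree (p - q) \<le> Suc d" using Suc.prems q by (intro degree_diff_le) auto
    then have "degree (p - q) \<le> d" using q(4)
      by (metis coeff_diff diff_self le_SucE leading_coeff_0_iff degree_0 le0)
    moreover have "p - q \<in> J'" using Suc.prems q x(3) j(8) by (auto simp: J'_def)
    ultimately have "poly (p - q) g \<in> K" by (intro Suc.IH)
    then have "poly (p - q) g + poly q g \<in> K" using k(4) q by blast
    then show ?case by simp
  qed
  then have "J \<subseteq> K" using j(1) by (force simp: J'_def adj_SX)
  moreover have "K \<subseteq> J" unfolding K_def by (rule idl_least[OF adj_subring J GJ])
  ultimately show "\<exists>A\<subseteq>adj S g. finite A \<and> J = idl (adj S g) A" using finG GA K_def by blast
qed

end

section \<open>Evaluation of polynomials along a ring homomorphism\<close>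

locale ring_eval =
  fixes h :: "'a::comm_ring_1 \<Rightarrow> 'b::comm_ring_1"
  assumes h_add: "h (a + b) = h a + h b" and h_mult: "h (a * b) = h a * h b" and h_one: "h 1 = 1"
begin

lemma h0: "h 0 = 0" by (metis add_cancel_right_right add.right_neutral h_add)
lemma h_minus: "h (- a) = - h a"
  by (metis add.inverse_unique add.right_inverse h0 h_add)
lemma h_diff: "h (a - b) = h a - h b"
  using h_add[of "a - b" b] by simp

definition ep :: "'b \<Rightarrow> 'a poly \<Rightarrow> 'b" where "ep y p = poly (map_poly h p) y"

lemma ep_0: "ep y 0 = 0" by (simp add: ep_def)
lemma ep_pCons: "ep y (pCons a p) = h a + y * ep y p"
  by (simp add: ep_def map_poly_pCons[of h, OF h0])
lemma ep_add: "ep y (p + q) = ep y p + ep y q"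
proof -
  have "map_poly h (p + q) = map_poly h p + map_poly h q"
    by (rule poly_eqI) (simp add: coeff_map_poly[of h, OF h0] h_add)
  then show ?thesis by (simp add: ep_def)
qed
lemma ep_smult: "ep y (smult a q) = h a * ep y q"
proof -
  have "map_poly h (smult a q) = smult (h a) (map_poly h q)"
    by (rule poly_eqI) (simp add: coeff_map_poly[of h, OF h0] h_mult)
  then show ?thesis by (simp add: ep_def)
qed
lemma ep_mult: "ep y (p * q) = ep y p * ep y q"
  by (induction p) (simp_all add: ep_0 ep_pCons ep_add ep_smult h0 algebra_simps)
lemma ep_1: "ep y 1 = 1" by (simp add: ep_def map_poly_1' h_one)
lemma ep_const: "ep y [:a:] = h a" by (simp add: ep_pCons ep_0)
lemma ep_sum: "ep y (sum f A) = (\<Sum>i\<in>A. ep y (f i))"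
  by (induction A rule: infinite_finite_induct) (auto simp: ep_0 ep_add)
lemma ep_monom: "ep y (monom a n) = h a * y ^ n"
  by (induction n) (simp_all add: monom_0 ep_const monom_Suc ep_pCons ep_0 h0 ac_simps)

lemma ep_in: "is_subring B \<Longrightarrow> (\<And>a. h a \<in> B) \<Longrightarrow> y \<in> B \<Longrightarrow> ep y p \<in> B"
  by (induction p) (auto simp: ep_0 ep_pCons subringD)

end

text \<open>A complex polynomial splits into linear factors, and a prime that contains its value
  contains the value of one of them; a nonzero constant factor is a unit and cannot lie in the
  prime.\<close>

lemma prime_linear_factor:
  fixes h :: "complex \<Rightarrow> 'b::comm_ring_1"
  assumes h: "ring_eval h" and B: "is_subring B" and Q: "is_prime B Q" and hB: "\<And>a. h a \<in> B" and y: "y \<in> B"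
  shows "p \<noteq> 0 \<Longrightarrow> ring_eval.ep h y p \<in> Q \<Longrightarrow> \<exists>r. y - h r \<in> Q"
proof (induction "degree p" arbitrary: p)
  interpret ring_eval h by fact
  case 0
  then obtain a where a: "p = [:a:]" "a \<noteq> 0" by (metis degree_eq_zeroE pCons_0_0)
  then have "h (inverse a) * h a \<in> Q"
    using 0 idealD(5)[OF prime_ideal[OF Q] B hB] by (simp add: ep_const)
  moreover have "h (inverse a) * h a = 1" using a by (simp add: h_mult[symmetric] h_one)
  ultimately show ?case using prime_one[OF Q] by simp
next
  interpret ring_eval h by fact
  case (Suc n)
  have "\<not> constant (poly p)" using Suc by (simp add: constant_degree)
  then obtain r where "poly p r = 0" using fundamental_theorem_of_algebra by blast
  then obtain q where q: "p = [:- r, 1:] * q" by (metis dvdE poly_eq_0_iff_dvd)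
  have "ep y p = (y - h r) * ep y q" unfolding q ep_mult by (simp add: ep_pCons ep_0 h_minus h_one)
  then have "y - h r \<in> Q \<or> ep y q \<in> Q"
    using Suc.prems(2) primeD[OF Q, of "y - h r" "ep y q"] ep_in[OF B hB y, of q] subringD(3)[OF B y hB] by simp
  moreover have "q \<noteq> 0" using Suc.prems q by auto
  moreover have "degree q = n"
    using Suc.hyps(2) \<open>q \<noteq> 0\<close> unfolding q by (subst (asm) degree_mult_eq) auto
  ultimately show ?case using Suc.hyps(1)[of q] by blast
qed

text \<open>Nonzero primes of a polynomial ring over a field are maximal. Both primes are generated
  by elements \<open>q1\<close>, \<open>q2\<close> of least degree with \<open>q1 = q2 * r\<close>;
  if \<open>q2\<close> were outside \<open>P1\<close>, then \<open>q1\<close> would divide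
  \<open>r\<close> and \<open>q2\<close> would be constant.\<close>

lemma field_poly_prime_ideals:
  fixes P1 P2 :: "'k::field poly set"
  assumes P1: "is_prime UNIV P1" and P2: "is_prime UNIV P2" and sub: "P1 \<subseteq> P2" and p: "p \<in> P1" "p \<noteq> 0"
  shows "P2 \<subseteq> P1"
proof -
  note i1 = idealD[OF prime_ideal[OF P1] subring_UNIV] and i2 = idealD[OF prime_ideal[OF P2] subring_UNIV]
  have gen: "\<exists>q\<in>P. q \<noteq> 0 \<and> (\<forall>x\<in>P. q dvd x)" if P: "is_prime UNIV P" "p \<in> P" for P
  proof -
    note i = idealD[OF prime_ideal[OF P(1)] subring_UNIV]
    obtain q where q: "q \<in> P" "q \<noteq> 0" and min: "\<And>x. x \<in> P \<Longrightarrow> x \<noteq> 0 \<Longrightarrow> degree q \<le> degree x"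
      using ex_has_least_nat[of "\<lambda>q. q \<in> P \<and> q \<noteq> 0" p degree] P(2) p(2) by blast
    have "q dvd x" if x: "x \<in> P" for x
    proof (rule ccontr)
      assume n: "\<not> q dvd x"
      have "x mod q = x - (x div q) * q" by (simp add: minus_div_mult_eq_mod)
      then have "x mod q \<in> P" using i(8)[OF x] i(5)[OF _ q(1)] by simp
      moreover have "x mod q \<noteq> 0" using n by (simp add: dvd_eq_mod_eq_0)
      ultimately show False using min[of "x mod q"] degree_mod_less[OF q(2), of x] by auto
    qed
    then show ?thesis using q by blast
  qed
  obtain q1 where q1: "q1 \<in> P1" "q1 \<noteq> 0" "\<And>x. x \<in> P1 \<Longrightarrow> q1 dvd x" using gen[OF P1 p(1)] by blast
  obtain q2 where q2: "q2 \<in> P2" "q2 \<noteq> 0" "\<And>x. x \<in> P2 \<Longrightarrow> q2 dvd x" using gen[OF P2] p(1) sub by blast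
  obtain r where r: "q1 = q2 * r" using q2(3)[of q1] q1(1) sub by (auto elim: dvdE)
  have "q2 \<in> P1"
  proof (rule ccontr)
    assume n: "q2 \<notin> P1"
    then have "r \<in> P1" using primeD[OF P1, of q2 r] q1(1) r by auto
    then have "q1 dvd r" by (rule q1(3))
    then have "degree q1 \<le> degree r" using r q1(2) by (intro dvd_imp_degree_le) auto
    then have "degree q2 = 0" using r q1(2) by (auto simp: degree_mult_eq)
    then obtain a where a: "q2 = [:a:]" by (metis degree_eq_zeroE)
    then have "[:inverse a:] * q2 = 1" using q2(2) by simp
    then have "1 \<in> P2" using i2(5)[OF _ q2(1), of "[:inverse a:]"] by simp
    then show False using prime_one[OF P2] by simp
  qed
  then show ?thesis using q2(3) i1(5)[of _ q2] by (metis UNIV_I dvdE mult.commute subsetI)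
qed

section \<open>Discrete valuations with complex residue field\<close>

abbreviation "lk \<equiv> Poly_Mapping.lookup"
abbreviation "sg \<equiv> Poly_Mapping.single"

locale cdvr =
  fixes v :: "'k::field \<Rightarrow> int" and t :: 'k and s :: "complex \<Rightarrow> 'k"
  assumes v_mult: "x \<noteq> 0 \<Longrightarrow> y \<noteq> 0 \<Longrightarrow> v (x * y) = v x + v y"
    and v_add: "x \<noteq> 0 \<Longrightarrow> y \<noteq> 0 \<Longrightarrow> x + y \<noteq> 0 \<Longrightarrow> min (v x) (v y) \<le> v (x + y)"
    and vt: "v t = 1" and t0: "t \<noteq> 0"
    and s_add: "s (a + b) = s a + s b" and s_mult: "s (a * b) = s a * s b" and s_one: "s 1 = 1"
    and v_s: "a \<noteq> 0 \<Longrightarrow> v (s a) = 0"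
    and residue: "x \<noteq> 0 \<Longrightarrow> v x \<ge> 0 \<Longrightarrow> \<exists>a. x = s a \<or> v (x - s a) \<ge> 1"
begin

sublocale S: ring_eval s
  by unfold_locales (auto simp: s_add s_mult s_one)

declare t0 [simp]
lemma s0 [simp]: "s 0 = 0" by (rule S.h0)
lemma s_nz: "a \<noteq> 0 \<Longrightarrow> s a \<noteq> 0"
  by (metis mult_zero_left right_inverse s_mult s_one zero_neq_one)

lemma v1 [simp]: "v 1 = 0" using v_mult[of 1 1] by simp
lemma v_inverse: "x \<noteq> 0 \<Longrightarrow> v (inverse x) = - v x"
  using v_mult[of x "inverse x"] by simp
lemma v_divide: "x \<noteq> 0 \<Longrightarrow> y \<noteq> 0 \<Longrightarrow> v (x / y) = v x - v y"
  by (simp add: divide_inverse v_mult v_inverse)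
lemma v_power: "x \<noteq> 0 \<Longrightarrow> v (x ^ n) = int n * v x"
  by (induction n) (auto simp: v_mult algebra_simps)
lemma v_t_powi [simp]: "v (t powi n) = n"
  using t0 by (cases "0 \<le> n") (auto simp: power_int_def v_power v_inverse vt)
lemma t_powi_nz [simp]: "t powi n \<noteq> 0" using t0 by simp
lemma v_neg: "v (- x) = v x"
proof (cases "x = 0")
  case False
  have "v (-1) + v (-1) = 0" using v_mult[of "-1" "-1"] by simp
  then show ?thesis using v_mult[of "-1" x] False by simp
qed simp

text \<open>The value \<open>v 0\<close> carries no information; this relation treats 0 as having
  infinite order.\<close>

definition ge :: "'k \<Rightarrow> int \<Rightarrow> bool" where "ge x k \<longleftrightarrow> x = 0 \<or> v x \<ge> k"

lemma ge_0 [simp]: "ge 0 k" by (simp add: ge_def)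
lemma ge_add: "ge x k \<Longrightarrow> ge y k \<Longrightarrow> ge (x + y) k"
  using v_add[of x y] by (cases "x = 0"; cases "y = 0"; cases "x + y = 0") (auto simp: ge_def)
lemma ge_neg: "ge x k \<Longrightarrow> ge (- x) k" by (auto simp: ge_def v_neg)
lemma ge_diff: "ge x k \<Longrightarrow> ge y k \<Longrightarrow> ge (x - y) k"
  using ge_add[of x k "- y"] ge_neg by simp
lemma ge_mult: "ge x k \<Longrightarrow> ge y l \<Longrightarrow> ge (x * y) (k + l)"
  by (cases "x = 0"; cases "y = 0") (auto simp: ge_def v_mult)

lemma ge_s [simp]: "ge (s a) 0" using v_s[of a] by (cases "a = 0") (auto simp: ge_def)
lemma residue': "ge x 0 \<Longrightarrow> \<exists>a. ge (x - s a) 1"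
  using residue[of x] by (cases "x = 0") (auto simp: ge_def intro!: exI[of _ 0])
lemma ge_sum: "(\<And>i. i \<in> A \<Longrightarrow> ge (f i) k) \<Longrightarrow> ge (sum f A) k"
  by (induction A rule: infinite_finite_induct) (auto intro: ge_add)

lemma v_add_gt: assumes "x \<noteq> 0" "ge y (v x + 1)" shows "x + y \<noteq> 0 \<and> v (x + y) = v x"
proof (cases "y = 0")
  case False
  then have y: "v y > v x" using assms by (auto simp: ge_def)
  have nz: "x + y \<noteq> 0"
  proof
    assume "x + y = 0" then have "y = - x" by (simp add: eq_neg_iff_add_eq_0 add.commute)
    then show False using y by (simp add: v_neg)
  qed
  have "min (v (x + y)) (v (- y)) \<le> v (x + y + - y)" using assms False nz by (intro v_add) auto
  then show ?thesis using nz y v_add[OF assms(1) False nz] by (auto simp: v_neg)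
qed (use assms in auto)

subsection \<open>Laurent polynomials\<close>

text \<open>Admissible exponents are given by a predicate on the order of a coefficient and its
  degree in \<open>u\<close>. When the predicate is stable under raising the order
  (\<open>up\<close>), this is the span of the admissible monomials over the valuation ring.\<close>

definition LS :: "(int \<Rightarrow> int \<Rightarrow> bool) \<Rightarrow> (int \<Rightarrow>\<^sub>0 'k) set" where
  "LS P = {f. \<forall>n. lk f n = 0 \<or> P (v (lk f n)) n}"

definition up :: "(int \<Rightarrow> int \<Rightarrow> bool) \<Rightarrow> bool" where
  "up P \<longleftrightarrow> (\<forall>i j n. P i n \<longrightarrow> i \<le> j \<longrightarrow> P j n)"

lemma LS_0: "0 \<in> LS P" by (simp add: LS_def)

lemma LS_add: assumes P: "up P" and "f \<in> LS P" "g \<in> LS P" shows "f + g \<in> LS P"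
proof -
  have "lk f n + lk g n = 0 \<or> P (v (lk f n + lk g n)) n" for n
  proof -
    consider "lk f n = 0" | "lk g n = 0" | "lk f n + lk g n = 0" | "lk f n \<noteq> 0" "lk g n \<noteq> 0" "lk f n + lk g n \<noteq> 0" by blast
    then show ?thesis
    proof cases
      case 4
      have *: "P (v (lk f n)) n" "P (v (lk g n)) n" using assms 4 by (auto simp: LS_def)
      then have "P (min (v (lk f n)) (v (lk g n))) n" by (simp add: min_def)
      then show ?thesis using v_add[OF 4] P unfolding up_def by blast
    qed (use assms in \<open>auto simp: LS_def\<close>)
  qed
  then show ?thesis by (simp add: LS_def lookup_add)
qed

lemma LS_uminus: "f \<in> LS P \<Longrightarrow> - f \<in> LS P" by (simp add: LS_def v_neg)

lemma LS_diff: "up P \<Longrightarrow> f \<in> LS P \<Longrightarrow> g \<in> LS P \<Longrightarrow> f - g \<in> LS P"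
  using LS_add[of P f "- g"] LS_uminus by simp

lemma LS_single: "sg n x \<in> LS P \<longleftrightarrow> x = 0 \<or> P (v x) n"
  by (auto simp: LS_def lookup_single when_def)

lemma LS_induct:
  assumes "f \<in> LS P" and "T 0" and "\<And>n x. x \<noteq> 0 \<Longrightarrow> P (v x) n \<Longrightarrow> T (sg n x)" and "\<And>f g. T f \<Longrightarrow> T g \<Longrightarrow> T (f + g)"
  shows "T f"
proof -
  have "T (\<Sum>k\<in>A. sg k (lk f k))" if "finite A" for A
    using that
  proof (induction A rule: finite_induct)
    case (insert k A)
    have "T (sg k (lk f k))" using assms by (cases "lk f k = 0") (auto simp: LS_def)
    then show ?case using insert assms(4) by simp
  qed (simp add: assms(2))
  then show ?thesis using poly_mapping_sum_single[of f] by (metis finite_keys)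
qed

lemma LS_mult:
  assumes f: "f \<in> LS P" and g: "g \<in> LS Q" and T: "up T"
    and PQ: "\<And>i n j m. P i n \<Longrightarrow> Q j m \<Longrightarrow> T (i + j) (n + m)"
  shows "f * g \<in> LS T"
  using f
proof (rule LS_induct)
  fix n x assume x: "x \<noteq> 0" "P (v x) n"
  from g show "sg n x * g \<in> LS T"
  proof (rule LS_induct)
    fix m y assume "y \<noteq> 0" "Q (v y) m"
    then show "sg n x * sg m y \<in> LS T" using x PQ[OF x(2)] by (simp add: mult_single LS_single v_mult)
  qed (auto simp: LS_0 distrib_left intro: LS_add[OF T])
qed (auto simp: LS_0 distrib_right intro: LS_add[OF T])

lemma LS_mono: "(\<And>i n. P i n \<Longrightarrow> Q i n) \<Longrightarrow> LS P \<subseteq> LS Q" by (auto simp: LS_def)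

definition mon :: "int \<Rightarrow> int \<Rightarrow> (int \<Rightarrow>\<^sub>0 'k)" where "mon i n = sg n (t powi i)"

lemma mon_mult: "mon i n * mon j m = mon (i + j) (n + m)"
  using t0 by (simp add: mon_def mult_single power_int_add)
lemma mon_0: "mon 0 0 = 1" by (simp add: mon_def)
lemma mon_power: "mon i n ^ k = mon (int k * i) (int k * n)"
  by (induction k) (auto simp: mon_0 mon_mult algebra_simps)
lemma mon_LS: "mon i n \<in> LS P \<longleftrightarrow> P i n" by (simp add: mon_def LS_single)

lemma mon_nz: "mon i n \<noteq> 0" unfolding mon_def by (metis lookup_single_eq lookup_zero t_powi_nz)

lemma sg_const_mon: "sg n x = sg 0 (x / t powi i) * mon i n"
  by (simp add: mon_def mult_single)

definition sc :: "complex \<Rightarrow> (int \<Rightarrow>\<^sub>0 'k)" where "sc a = sg 0 (s a)"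

sublocale C: ring_eval sc
  by unfold_locales (simp_all add: sc_def s_add single_add s_mult mult_single s_one)

lemma sc_unit: "a \<noteq> 0 \<Longrightarrow> sc a * sc (inverse a) = 1"
  by (metis C.h_mult C.h_one right_inverse)

lemma lookup_mult_sum:
  fixes f g :: "int \<Rightarrow>\<^sub>0 'k"
  shows "lk (f * g) k = (\<Sum>i\<in>Poly_Mapping.keys f. lk f i * lk g (k - i))"
proof -
  have 1: "lk (sg i x * g) k = x * lk g (k - i)" for i x
  proof -
    have "sg i x * g = (\<Sum>j\<in>Poly_Mapping.keys g. sg (i + j) (x * lk g j))"
      by (subst poly_mapping_sum_single[of g]) (simp add: sum_distrib_left mult_single)
    then have "lk (sg i x * g) k = (\<Sum>j\<in>Poly_Mapping.keys g. lk (sg (i + j) (x * lk g j)) k)"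
      by (simp only: lookup_sum)
    also have "\<dots> = (\<Sum>j\<in>Poly_Mapping.keys g. if j = k - i then x * lk g j else 0)"
      by (intro sum.cong refl) (auto simp: lookup_single when_def)
    also have "\<dots> = (if k - i \<in> Poly_Mapping.keys g then x * lk g (k - i) else 0)"
      by (rule sum.delta) simp
    also have "\<dots> = x * lk g (k - i)" by (auto simp: in_keys_iff)
    finally show ?thesis .
  qed
  have "f * g = (\<Sum>i\<in>Poly_Mapping.keys f. sg i (lk f i) * g)"
    by (subst poly_mapping_sum_single[of f]) (simp add: sum_distrib_right)
  then show ?thesis by (simp add: lookup_sum 1)
qed

end

section \<open>Two-dimensional cones over a discrete valuation ring\<close>

text \<open>The ring \<^emph>\<open>B\<close> is spanned by the \<^emph>\<open>t^i u^n\<close> with exponent \<^emph>\<open>(i, n)\<close> in the cone where the linear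
  forms \<^emph>\<open>al\<close> and \<^emph>\<open>be\<close> are nonnegative.\<close>

locale cone = cdvr +
  fixes a1 a2 b1 b2 :: int
  assumes a1: "a1 > 0" and b1: "b1 > 0" and cop_a: "coprime a1 a2" and cop_b: "coprime b1 b2"
begin

definition al :: "int \<Rightarrow> int \<Rightarrow> int" where "al i n = a1 * i + a2 * n"
definition be :: "int \<Rightarrow> int \<Rightarrow> int" where "be i n = b1 * i + b2 * n"
definition inB :: "int \<Rightarrow> int \<Rightarrow> bool" where "inB i n \<longleftrightarrow> 0 \<le> al i n \<and> 0 \<le> be i n"
definition B :: "(int \<Rightarrow>\<^sub>0 'a) set" where "B = LS inB"
definition inQ :: "int \<Rightarrow> int \<Rightarrow> bool" where "inQ i n \<longleftrightarrow> 0 < al i n \<and> 0 \<le> be i n"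
definition Qal :: "(int \<Rightarrow>\<^sub>0 'a) set" where "Qal = LS inQ"

lemma al_add: "al (i + j) (n + m) = al i n + al j m" by (simp add: al_def algebra_simps)
lemma be_add: "be (i + j) (n + m) = be i n + be j m" by (simp add: be_def algebra_simps)
lemma al_scale: "al (k * i) (k * n) = k * al i n" by (simp add: al_def algebra_simps)
lemma be_scale: "be (k * i) (k * n) = k * be i n" by (simp add: be_def algebra_simps)
lemma al_mono: "i \<le> j \<Longrightarrow> al i n \<le> al j n" using a1 by (simp add: al_def)
lemma be_mono: "i \<le> j \<Longrightarrow> be i n \<le> be j n" using b1 by (simp add: be_def)
lemma al_0: "al i 0 = a1 * i" by (simp add: al_def)
lemma be_0: "be i 0 = b1 * i" by (simp add: be_def)

lemma up_inB: "up inB" unfolding up_def inB_def by (meson al_mono be_mono order_trans)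
lemma up_inQ: "up inQ" unfolding up_def inQ_def by (meson al_mono be_mono order_trans less_le_trans)

lemma inB_add: "inB i n \<Longrightarrow> inB j m \<Longrightarrow> inB (i + j) (n + m)" by (simp add: inB_def al_add be_add)

lemma inB_0: "inB i 0 \<longleftrightarrow> 0 \<le> i" using a1 b1 by (auto simp: inB_def al_0 be_0 zero_le_mult_iff)

lemma mon_B: "mon i n \<in> B \<longleftrightarrow> inB i n" by (simp add: B_def mon_LS)

lemma B_subring: "is_subring B"
proof -
  have "1 \<in> B" using mon_B[of 0 0] inB_0 by (simp add: mon_0)
  then show ?thesis unfolding is_subring_def B_def
    using LS_diff[OF up_inB] LS_mult[OF _ _ up_inB, of _ inB _ inB] inB_add by blast
qed

lemmas bc = subringD[OF B_subring]

lemma const_B: "ge x 0 \<Longrightarrow> sg 0 x \<in> B"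
  by (auto simp: B_def LS_single ge_def inB_0)
lemma sc_B: "sc a \<in> B" by (simp add: sc_def const_B)

lemma tt_B: "mon 1 0 \<in> B" by (simp add: mon_B inB_0)

lemma Qal_B: "Qal \<subseteq> B" unfolding Qal_def B_def by (rule LS_mono) (simp add: inQ_def inB_def)

lemma Qal_ideal: "is_ideal B Qal"
proof (rule is_idealI)
  show "Qal \<subseteq> B" by (rule Qal_B)
  show "0 \<in> Qal" by (simp add: Qal_def LS_0)
  show "x \<in> Qal \<Longrightarrow> y \<in> Qal \<Longrightarrow> x + y \<in> Qal" for x y unfolding Qal_def by (rule LS_add[OF up_inQ])
  show "r \<in> B \<Longrightarrow> x \<in> Qal \<Longrightarrow> r * x \<in> Qal" for r x unfolding Qal_def B_def
    by (rule LS_mult[of r inB x inQ inQ, OF _ _ up_inQ]) (auto simp: inB_def inQ_def al_add be_add)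
qed

lemma tt_Qal: "mon 1 0 \<in> Qal" using a1 b1 by (simp add: Qal_def mon_LS inQ_def al_0 be_0)

lemma tt_power: "mon 1 0 ^ k = mon (int k) 0" by (simp add: mon_power)

lemma ker_al: assumes "al i n = 0" shows "\<exists>l. i = - l * a2 \<and> n = l * a1"
proof -
  have e: "a1 * i = - (a2 * n)" using assms by (simp add: al_def)
  then have "a1 dvd a2 * n" by (metis dvd_minus_iff dvd_triv_left)
  then obtain l where "n = a1 * l" using cop_a by (auto simp: coprime_dvd_mult_right_iff elim: dvdE)
  moreover then have "a1 * i = a1 * (- l * a2)" using e by simp
  ultimately show ?thesis using a1 by (intro exI[of _ l]) (metis less_irrefl mult.commute mult_cancel_left)
qed

text \<open>The two forms play symmetric roles and the ring \<open>B\<close> stays the same under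
  the exchange, so every result on the edge \<open>al = 0\<close> transfers to the edge
  \<open>be = 0\<close>.\<close>

lemma swap: "cone v t s b1 b2 a1 a2"
  by unfold_locales (use a1 b1 cop_a cop_b in auto)

lemma swap_inB: "cone.inB b1 b2 a1 a2 = inB"
  by (auto simp: fun_eq_iff cone.inB_def[OF swap] cone.al_def[OF swap] cone.be_def[OF swap] inB_def al_def be_def)

lemma swap_B: "cone.B v b1 b2 a1 a2 = B"
  by (simp add: cone.B_def[OF swap] swap_inB B_def)

section \<open>Primes that contain the local parameter\<close>

context
  fixes Q assumes Q: "is_prime B Q" and tQ: "mon 1 0 \<in> Q"
begin

lemmas qc = idealD[OF prime_ideal[OF Q] B_subring]

lemma const_Q: assumes "ge x 1" shows "sg 0 x \<in> Q"
proof -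
  have "sg 0 x = sg 0 (x / t) * mon 1 0" by (simp add: mon_def mult_single)
  moreover have "ge (x / t) 0" using assms by (cases "x = 0") (auto simp: ge_def v_divide vt)
  ultimately show ?thesis using qc(5)[OF const_B tQ] by simp
qed

lemma comp_Q: assumes "x \<noteq> 0" "mon (v x) n \<in> Q" shows "sg n x \<in> Q"
proof -
  have "ge (x / t powi (v x)) 0" using assms by (simp add: ge_def v_divide)
  then show ?thesis using qc(5)[OF const_B assms(2)] sg_const_mon[of n x "v x"] by simp
qed

lemma interior_Q: assumes "0 < al i n" "0 < be i n" shows "mon i n \<in> Q"
proof -
  \<comment> \<open>Removing one factor \<open>t\<close> lowers \<open>al\<close> by
    \<open>a1\<close> and \<open>be\<close> by \<open>b1\<close>. Both forms are at least
    \<open>k\<close> on the \<open>k\<close>-th power of the monomial, so that power is divisible by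
    \<open>t\<close> in \<open>B\<close>.\<close>
  define k where "k = nat (a1 + b1)"
  have k: "int k = a1 + b1" using a1 b1 by (simp add: k_def)
  have "al (int k * i - 1) (int k * n) = int k * al i n - a1" by (simp add: al_def algebra_simps)
  moreover have "int k * al i n \<ge> int k * 1" using assms by (intro mult_left_mono) auto
  moreover have "be (int k * i - 1) (int k * n) = int k * be i n - b1" by (simp add: be_def algebra_simps)
  moreover have "int k * be i n \<ge> int k * 1" using assms by (intro mult_left_mono) auto
  ultimately have "0 \<le> al (int k * i - 1) (int k * n)" "0 \<le> be (int k * i - 1) (int k * n)"
    using k a1 b1 by linarith+
  then have "inB (int k * i - 1) (int k * n)" by (simp add: inB_def)
  then have "mon (int k * i - 1) (int k * n) * mon 1 0 \<in> Q" using mon_B tQ by (intro qc(5)) auto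
  then have "mon i n ^ k \<in> Q" by (simp add: mon_mult mon_power)
  then show ?thesis using prime_power[OF B_subring Q] assms by (auto simp: mon_B inB_def)
qed

lemma max_from_residue: assumes "\<And>f. f \<in> B \<Longrightarrow> \<exists>a. f - sc a \<in> Q" shows "is_max B Q"
proof -
  have "\<exists>r\<in>B. 1 - r * x \<in> Q" if x: "x \<in> B - Q" for x
  proof -
    obtain a where a: "x - sc a \<in> Q" using assms x by auto
    have "a \<noteq> 0" using a x by (auto simp: C.h0)
    then have "1 - sc (inverse a) * x = - (sc (inverse a) * (x - sc a))"
      using sc_unit[of a] by (simp add: algebra_simps)
    also have "\<dots> \<in> Q" using a sc_B qc(5,7) by auto
    finally show ?thesis using sc_B by blast
  qed
  then show ?thesis using Q by (auto simp: is_max_def is_prime_def)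
qed

lemma residue_Q_fixed:
  assumes "\<And>i n. inB i n \<Longrightarrow> (i, n) \<noteq> (0, 0) \<Longrightarrow> mon i n \<in> Q" and f: "f \<in> B"
  shows "\<exists>a. f - sc a \<in> Q"
  using f unfolding B_def
proof (rule LS_induct)
  show "\<exists>a. 0 - sc a \<in> Q" using qc(3) by (intro exI[of _ 0]) (simp add: C.h0)
  fix n x assume x: "x \<noteq> 0" "inB (v x) n"
  show "\<exists>a. sg n x - sc a \<in> Q"
  proof (cases "(v x, n) = (0, 0)")
    case True
    then obtain a where "ge (x - s a) 1" using residue'[of x] by (auto simp: ge_def)
    then have "sg 0 (x - s a) \<in> Q" by (rule const_Q)
    then show ?thesis using True by (auto simp: sc_def single_diff)
  next
    case False
    then have "sg n x \<in> Q" using assms(1) x comp_Q by blast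
    then show ?thesis by (intro exI[of _ 0]) (simp add: C.h0)
  qed
next
  fix f g assume "\<exists>a. f - sc a \<in> Q" "\<exists>a. g - sc a \<in> Q"
  then obtain a b where "f - sc a \<in> Q" "g - sc b \<in> Q" by auto
  then have "(f - sc a) + (g - sc b) \<in> Q" by (rule qc(4))
  then show "\<exists>a. f + g - sc a \<in> Q" by (intro exI[of _ "a + b"]) (simp add: C.h_add algebra_simps)
qed

end

subsection \<open>Primes away from \<open>t\<close>\<close>

text \<open>Inverting \<open>t\<close> turns \<open>B\<close> into the Laurent polynomials over a field, where nonzero primes are maximal.\<close>

interpretation E: ring_eval "sg 0 :: 'a \<Rightarrow> (int \<Rightarrow>\<^sub>0 'a)"
  by unfold_locales (simp_all add: single_add mult_single)

lemma E_shift: "\<exists>p (m::nat). sg (int m) 1 * f = E.ep (sg 1 1) p" for f :: "int \<Rightarrow>\<^sub>0 'a"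
proof -
  have "f \<in> LS (\<lambda>i n. True)" by (simp add: LS_def)
  then show ?thesis
  proof (rule LS_induct)
    show "\<exists>p (m::nat). sg (int m) 1 * 0 = E.ep (sg 1 1) p" by (intro exI[of _ 0]) (simp add: E.ep_0)
    have pw: "sg 1 1 ^ k = (sg (int k) 1 :: int \<Rightarrow>\<^sub>0 'a)" for k
      by (induction k) (auto simp: mult_single)
    fix n :: int and x :: 'a
    have "int (nat \<bar>n\<bar>) + n = int (nat (\<bar>n\<bar> + n))" by simp
    then have "sg (int (nat \<bar>n\<bar>)) 1 * sg n x = E.ep (sg 1 1) (monom x (nat (\<bar>n\<bar> + n)))"
      by (simp add: E.ep_monom pw mult_single del: int_nat_eq)
    then show "\<exists>p (m::nat). sg (int m) 1 * sg n x = E.ep (sg 1 1) p" by blast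
  next
    fix f g :: "int \<Rightarrow>\<^sub>0 'a"
    assume "\<exists>p (m::nat). sg (int m) 1 * f = E.ep (sg 1 1) p" "\<exists>p (m::nat). sg (int m) 1 * g = E.ep (sg 1 1) p"
    then obtain p q and m l :: nat where *: "sg (int m) 1 * f = E.ep (sg 1 1) p" "sg (int l) 1 * g = E.ep (sg 1 1) q"
      by auto
    have X: "sg (int k) 1 = E.ep (sg 1 1) (monom 1 k)" for k
    proof -
      have "sg 1 1 ^ k = (sg (int k) 1 :: int \<Rightarrow>\<^sub>0 'a)" by (induction k) (auto simp: mult_single)
      then show ?thesis by (simp add: E.ep_monom)
    qed
    have "sg (int (m + l)) 1 * (f + g) = sg (int l) 1 * (sg (int m) 1 * f) + sg (int m) 1 * (sg (int l) 1 * g)"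
      by (simp add: algebra_simps mult_single mult.assoc[symmetric])
    also have "\<dots> = E.ep (sg 1 1) (monom 1 l * p + monom 1 m * q)"
      unfolding E.ep_add E.ep_mult X[symmetric] *[symmetric] by (rule refl)
    finally show "\<exists>p (m::nat). sg (int m) 1 * (f + g) = E.ep (sg 1 1) p" by blast
  qed
qed

lemma clear_denominators: "\<exists>k::nat. mon (int k) 0 * f \<in> B"
proof -
  have "f \<in> LS (\<lambda>i n. True)" by (simp add: LS_def)
  then show ?thesis
  proof (rule LS_induct)
    fix n x assume x: "x \<noteq> (0::'a)"
    \<comment> \<open>As \<open>a1\<close> and \<open>b1\<close> are at least 1, an exponent of
      \<open>t\<close> that is at least \<open>\<bar>a2 * n\<bar>\<close> and at least
      \<open>\<bar>b2 * n\<bar>\<close> makes both forms nonnegative.\<close>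
    define k where "k = nat (\<bar>v x\<bar> + \<bar>a2 * n\<bar> + \<bar>b2 * n\<bar>)"
    have p: "0 \<le> int k + v x" by (simp add: k_def)
    have "a1 * (int k + v x) \<ge> 1 * (int k + v x)" "b1 * (int k + v x) \<ge> 1 * (int k + v x)"
      using a1 b1 p mult_right_mono[of 1 a1 "int k + v x"] mult_right_mono[of 1 b1 "int k + v x"] by auto
    moreover have "int k + v x \<ge> \<bar>a2 * n\<bar>" "int k + v x \<ge> \<bar>b2 * n\<bar>" by (simp_all add: k_def)
    moreover have "- (a2 * n) \<le> \<bar>a2 * n\<bar>" "- (b2 * n) \<le> \<bar>b2 * n\<bar>" by simp_all
    ultimately have "- (a2 * n) \<le> a1 * (int k + v x)" "- (b2 * n) \<le> b1 * (int k + v x)"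
      by (metis mult_1 order_trans)+
    then have "0 \<le> al (int k + v x) n" "0 \<le> be (int k + v x) n"
      unfolding al_def be_def by simp_all
    then have "inB (int k + v x) n" by (simp add: inB_def)
    then have "mon (int k) 0 * sg n x \<in> B" using x by (simp add: mon_def mult_single B_def LS_single v_mult v_power vt)
    then show "\<exists>k::nat. mon (int k) 0 * sg n x \<in> B" by blast
  next
    fix f g assume "\<exists>k::nat. mon (int k) 0 * f \<in> B" "\<exists>k::nat. mon (int k) 0 * g \<in> B"
    then obtain k l :: nat where *: "mon (int k) 0 * f \<in> B" "mon (int l) 0 * g \<in> B" by auto
    have "mon (int (k + l)) 0 * (f + g) = mon (int l) 0 * (mon (int k) 0 * f) + mon (int k) 0 * (mon (int l) 0 * g)"
      by (simp add: algebra_simps mon_mult mult.assoc[symmetric])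
    also have "\<dots> \<in> B" by (rule bc(6)[OF bc(4)[OF _ *(1)] bc(4)[OF _ *(2)]]) (simp_all add: mon_B inB_0)
    finally show "\<exists>k::nat. mon (int k) 0 * (f + g) \<in> B" by blast
  qed (auto simp: bc)
qed

text \<open>The contraction to polynomials in \<open>u\<close> of the extension of \<open>Q\<close>
  to \<open>B\<close> with \<open>t\<close> inverted; the power of \<open>t\<close> replaces the
  passage to that localization.\<close>

definition pull :: "(int \<Rightarrow>\<^sub>0 'a) set \<Rightarrow> 'a poly set" where
  "pull Q = {p. \<exists>k::nat. mon (int k) 0 * E.ep (sg 1 1) p \<in> Q}"

text \<open>Every monomial of \<open>B\<close> divides a power of \<open>t\<close> in
  \<open>B\<close>, because its inverse enters \<open>B\<close> after multiplication by a power of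
  \<open>t\<close>. So a prime that omits \<open>t\<close> omits all monomials.\<close>

lemma tt_not: assumes Q: "is_prime B Q" and tQ: "mon 1 0 \<notin> Q" and ij: "inB i n" shows "mon i n \<notin> Q"
proof
  assume m: "mon i n \<in> Q"
  obtain k :: nat where k: "mon (int k) 0 * mon 0 (- n) \<in> B" using clear_denominators by blast
  define j where "j = int k + \<bar>i\<bar>"
  have "inB (int k) (- n)" using k by (simp add: mon_mult mon_B)
  then have "inB j (- n)" using up_inB unfolding up_def j_def by (meson abs_ge_zero add_increasing2 le_add_same_cancel1)
  then have "mon j (- n) * mon i n \<in> Q" using m idealD(5)[OF prime_ideal[OF Q] B_subring] mon_B by blast
  then have "mon (j + i) 0 \<in> Q" by (simp add: mon_mult)
  moreover have "j + i = int (nat (j + i))" by (simp add: j_def)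
  ultimately have "mon 1 0 ^ nat (j + i) \<in> Q" unfolding tt_power by metis
  then show False using prime_power[OF B_subring Q tt_B] tQ by blast
qed

lemma pull_prime: assumes Q: "is_prime B Q" and tQ: "mon 1 0 \<notin> Q" shows "is_prime UNIV (pull Q)"
proof -
  note q = idealD[OF prime_ideal[OF Q] B_subring]
  have monk: "mon (int k) 0 \<in> B" for k by (simp add: mon_B inB_0)
  have "is_ideal UNIV (pull Q)"
  proof (rule is_idealI)
    show "0 \<in> pull Q" using q(3) by (simp add: pull_def E.ep_0)
    fix x y assume "x \<in> pull Q" "y \<in> pull Q"
    then obtain k l :: nat where *: "mon (int k) 0 * E.ep (sg 1 1) x \<in> Q" "mon (int l) 0 * E.ep (sg 1 1) y \<in> Q"
      by (auto simp: pull_def)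
    have "mon (int (k + l)) 0 * E.ep (sg 1 1) (x + y)
        = mon (int l) 0 * (mon (int k) 0 * E.ep (sg 1 1) x) + mon (int k) 0 * (mon (int l) 0 * E.ep (sg 1 1) y)"
      by (simp add: E.ep_add algebra_simps mon_mult mult.assoc[symmetric])
    also have "\<dots> \<in> Q" by (rule q(4)[OF q(5)[OF monk *(1)] q(5)[OF monk *(2)]])
    finally show "x + y \<in> pull Q" unfolding pull_def by blast
  next
    fix r x assume "x \<in> pull Q"
    then obtain k :: nat where k: "mon (int k) 0 * E.ep (sg 1 1) x \<in> Q" by (auto simp: pull_def)
    obtain l :: nat where l: "mon (int l) 0 * E.ep (sg 1 1) r \<in> B" using clear_denominators by blast
    have "(mon (int l) 0 * E.ep (sg 1 1) r) * (mon (int k) 0 * E.ep (sg 1 1) x) \<in> Q" by (rule q(5)[OF l k])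
    also have "(mon (int l) 0 * E.ep (sg 1 1) r) * (mon (int k) 0 * E.ep (sg 1 1) x)
       = (mon (int l) 0 * mon (int k) 0) * E.ep (sg 1 1) (r * x)" unfolding E.ep_mult by (simp only: ac_simps)
    also have "mon (int l) 0 * mon (int k) 0 = mon (int (l + k)) 0" by (simp add: mon_mult)
    finally show "r * x \<in> pull Q" unfolding pull_def by blast
  qed simp
  moreover have "1 \<notin> pull Q" using tt_not[OF Q tQ] by (auto simp: pull_def E.ep_1 inB_0)
  moreover have "x \<in> pull Q \<or> y \<in> pull Q" if xy: "x * y \<in> pull Q" for x y
  proof -
    obtain k :: nat where k: "mon (int k) 0 * E.ep (sg 1 1) (x * y) \<in> Q" using xy by (auto simp: pull_def)
    obtain l :: nat where l: "mon (int l) 0 * E.ep (sg 1 1) x \<in> B" using clear_denominators by blast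
    obtain m :: nat where m: "mon (int m) 0 * E.ep (sg 1 1) y \<in> B" using clear_denominators by blast
    have "(mon (int l) 0 * mon (int m) 0) * (mon (int k) 0 * E.ep (sg 1 1) (x * y)) \<in> Q"
      by (rule q(5)[OF bc(4)[OF monk monk] k])
    also have "(mon (int l) 0 * mon (int m) 0) * (mon (int k) 0 * E.ep (sg 1 1) (x * y)) =
      mon (int k) 0 * ((mon (int l) 0 * E.ep (sg 1 1) x) * (mon (int m) 0 * E.ep (sg 1 1) y))"
      unfolding E.ep_mult by (simp only: ac_simps)
    finally have "(mon (int l) 0 * E.ep (sg 1 1) x) * (mon (int m) 0 * E.ep (sg 1 1) y) \<in> Q"
      using primeD[OF Q _ monk bc(4)[OF l m]] tt_not[OF Q tQ, of "int k" 0] by (auto simp: inB_0)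
    then show ?thesis using primeD[OF Q _ l m] unfolding pull_def by blast
  qed
  ultimately show ?thesis by (auto simp: is_prime_def)
qed

text \<open>The contractions of \<open>Q1\<close> and \<open>Q2\<close> to polynomials over a field
  are nonzero nested primes, hence equal. The monomial factors that lead from \<open>B\<close> to
  polynomials and back are cancelled by \<open>tt_not\<close>.\<close>

lemma primes_away:
  assumes Q1: "is_prime B Q1" and Q2: "is_prime B Q2" and sub: "Q1 \<subseteq> Q2" and tQ: "mon 1 0 \<notin> Q2"
    and f: "f \<in> Q1" "f \<noteq> 0"
  shows "Q2 \<subseteq> Q1"
proof -
  note q1 = idealD[OF prime_ideal[OF Q1] B_subring] and q2 = idealD[OF prime_ideal[OF Q2] B_subring]
  have inB_ex: "\<exists>j::nat. inB (int j) m" for m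
    using clear_denominators[of "mon 0 m"] by (simp add: mon_mult mon_B)
  have into: "\<exists>p m. sg (int m) 1 * g = E.ep (sg 1 1) p \<and> p \<in> pull Q" if "is_prime B Q" "g \<in> Q" for g Q
  proof -
    obtain p and m :: nat where pm: "sg (int m) 1 * g = E.ep (sg 1 1) p" using E_shift by blast
    obtain j :: nat where j: "inB (int j) (int m)" using inB_ex by blast
    have "mon (int j) (int m) * g \<in> Q" using idealD(5)[OF prime_ideal[OF that(1)] B_subring _ that(2)] j mon_B by blast
    also have "mon (int j) (int m) * g = mon (int j) 0 * (sg (int m) 1 * g)"
      by (simp add: mon_def mult_single mult.assoc[symmetric])
    finally show ?thesis using pm by (auto simp: pull_def)
  qed
  obtain p and m :: nat where pm: "sg (int m) 1 * f = E.ep (sg 1 1) p" "p \<in> pull Q1" using into[OF Q1 f(1)] by blast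
  have "sg (int m) (1::'a) \<noteq> 0" using mon_nz[of 0 "int m"] by (simp add: mon_def)
  then have "p \<noteq> 0" using pm f(2) by (auto simp: E.ep_0)
  moreover have "mon 1 0 \<notin> Q1" using tQ sub by blast
  moreover have "pull Q1 \<subseteq> pull Q2" using sub by (auto simp: pull_def)
  ultimately have le: "pull Q2 \<subseteq> pull Q1"
    using field_poly_prime_ideals[OF pull_prime[OF Q1] pull_prime[OF Q2 tQ] _ pm(2)] by blast
  show ?thesis
  proof
    fix g assume g: "g \<in> Q2"
    obtain p and m :: nat where pm: "sg (int m) 1 * g = E.ep (sg 1 1) p" "p \<in> pull Q2" using into[OF Q2 g] by blast
    then obtain k :: nat where k: "mon (int k) 0 * E.ep (sg 1 1) p \<in> Q1" using le by (auto simp: pull_def)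
    obtain j :: nat where j: "inB (int j) (int m)" using inB_ex by blast
    then have kj: "inB (int j + int k) (int m)" using up_inB unfolding up_def by (metis le_add_same_cancel1 of_nat_0_le_iff)
    have "mon (int j) 0 * (mon (int k) 0 * E.ep (sg 1 1) p) \<in> Q1" by (rule q1(5)[OF _ k]) (simp add: mon_B inB_0)
    also have "mon (int j) 0 * (mon (int k) 0 * E.ep (sg 1 1) p) = mon (int j + int k) (int m) * g"
      unfolding pm(1)[symmetric] mon_def mult_single mult.assoc[symmetric] by (simp add: power_int_add)
    finally have "mon (int j + int k) (int m) \<in> Q1 \<or> g \<in> Q1"
      using primeD[OF Q1] kj mon_B q2(2)[OF g] by blast
    then show "g \<in> Q1" using tt_not[OF Q2 tQ kj] sub by blast
  qed
qed

end

text \<open>\<open>(z1, z2)\<close> spans the edge \<open>al = 0\<close> of the cone and is completed by \<open>(w1, w2)\<close> to a lattice basis.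
  The second alternative in \<open>dich\<close> is the degenerate cone, a half plane.\<close>

locale cone_ray = cone +
  fixes z1 z2 w1 w2 :: int
  assumes al_z: "al z1 z2 = 0" and be_z: "0 \<le> be z1 z2" and z2: "z2 \<noteq> 0"
    and al_w: "al w1 w2 = 1" and be_w: "0 \<le> be w1 w2"
    and lat: "\<exists>l. i = al i n * w1 + l * z1 \<and> n = al i n * w2 + l * z2"
    and dich: "0 < be z1 z2 \<or> (\<forall>i n. be i n = al i n)"
begin

abbreviation "Z \<equiv> mon z1 z2"
abbreviation "X \<equiv> mon w1 w2"

lemma zB: "inB z1 z2" using al_z be_z by (simp add: inB_def)
lemma wB: "inB w1 w2" using al_w be_w by (simp add: inB_def)
lemma Z_B: "Z \<in> B" using zB by (simp add: mon_B)
lemma X_B: "X \<in> B" using wB by (simp add: mon_B)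

lemma Z_power: "Z ^ k = mon (int k * z1) (int k * z2)" by (simp add: mon_power)
lemma Z_power_B: "Z ^ k \<in> B" using bc(7)[OF Z_B] .

lemma Z_Qal: "Z \<notin> Qal" by (simp add: Qal_def mon_LS inQ_def al_z)

context
  fixes Q assumes Q: "is_prime B Q" and tQ: "mon 1 0 \<in> Q" and ZQ: "Z \<notin> Q"
begin

lemmas qc' = idealD[OF prime_ideal[OF Q] B_subring]

lemma Z_power_Q: "Z ^ k \<notin> Q" using prime_power[OF B_subring Q Z_B] ZQ by blast

text \<open>Multiplication by \<open>Z\<close> moves an exponent on the edge \<open>be = 0\<close>
  into the interior; in the degenerate cone the condition \<open>inQ\<close> already means
  interior.\<close>

lemma mon_Q: assumes "inQ i n" shows "mon i n \<in> Q"
proof (cases "0 < be z1 z2")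
  case True
  have "mon (i + z1) (n + z2) \<in> Q"
    using assms True al_z by (intro interior_Q[OF Q tQ]) (auto simp: al_add be_add inQ_def)
  then have "mon i n * Z \<in> Q" by (simp add: mon_mult)
  then show ?thesis using primeD[OF Q _ _ Z_B] ZQ assms by (auto simp: mon_B inB_def inQ_def)
next
  case False
  then show ?thesis using assms dich by (intro interior_Q[OF Q tQ]) (auto simp: inQ_def)
qed

lemma Qal_sub: "Qal \<subseteq> Q"
proof
  fix f assume "f \<in> Qal"
  then show "f \<in> Q" unfolding Qal_def
    by (rule LS_induct) (use qc' mon_Q comp_Q[OF Q tQ] in auto)
qed

end

lemma sg_zero_al:
  assumes "x \<noteq> 0" "inB (v x) n" "al (v x) n = 0"
  shows "\<exists>l y. sg n x = sg 0 y * mon (l * z1) (l * z2) \<and> ge y 0 \<and> v x = l * z1 \<and> n = l * z2"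
proof -
  obtain l where l: "v x = l * z1" "n = l * z2" using lat[of "v x" n] assms by auto
  have "ge (x / t powi (v x)) 0" using assms by (simp add: ge_def v_divide)
  then show ?thesis using sg_const_mon[of n x "v x"] l by auto
qed

text \<open>Modulo \<open>Qal\<close> only exponents on the edge survive, and these are multiples of
  \<open>(z1, z2)\<close>; elements of the valuation ring become constants. The factor
  \<open>Z ^ L\<close> removes negative multiples, which occur in the degenerate cone.\<close>

lemma Qal_approx: assumes "f \<in> B" shows "\<exists>L p. Z ^ L * f - C.ep Z p \<in> Qal"
  using assms unfolding B_def
proof (rule LS_induct)
  note q = idealD[OF Qal_ideal B_subring]
  show "\<exists>L p. Z ^ L * 0 - C.ep Z p \<in> Qal" using q(3) by (intro exI[of _ 0]) (simp add: C.ep_0)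
  fix n x assume x: "x \<noteq> 0" "inB (v x) n"
  show "\<exists>L p. Z ^ L * sg n x - C.ep Z p \<in> Qal"
  proof (cases "al (v x) n = 0")
    case False
    then have "sg n x \<in> Qal" using x by (simp add: Qal_def LS_single inQ_def inB_def)
    then show ?thesis by (intro exI[of _ 0]) (simp add: C.ep_0)
  next
    case True
    then obtain l y where l: "sg n x = sg 0 y * mon (l * z1) (l * z2)" "ge y 0" using sg_zero_al x by blast
    obtain a where a: "ge (y - s a) 1" using residue'[OF l(2)] by auto
    define L where "L = nat (- l)"
    define k where "k = nat (l + int L)"
    have k: "int k = l + int L" by (simp add: k_def L_def)
    have "Z ^ L * sg n x = sg 0 y * mon ((l + int L) * z1) ((l + int L) * z2)"
      unfolding l Z_power by (simp add: mon_mult algebra_simps mult.left_commute)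
    also have "\<dots> = sg 0 y * Z ^ k" by (simp add: Z_power k)
    finally have "Z ^ L * sg n x - C.ep Z (monom a k) = sg 0 (y - s a) * Z ^ k"
      by (simp add: C.ep_monom sc_def single_diff algebra_simps)
    moreover have "sg 0 (y - s a) \<in> Qal"
      using a a1 b1 by (auto simp: Qal_def LS_single ge_def inQ_def al_0 be_0)
    ultimately have "Z ^ L * sg n x - C.ep Z (monom a k) \<in> Qal" using q(6)[OF Z_power_B] by simp
    then show ?thesis by blast
  qed
next
  note q = idealD[OF Qal_ideal B_subring]
  fix f g assume "\<exists>L p. Z ^ L * f - C.ep Z p \<in> Qal" "\<exists>L p. Z ^ L * g - C.ep Z p \<in> Qal"
  then obtain L p M r where *: "Z ^ L * f - C.ep Z p \<in> Qal" "Z ^ M * g - C.ep Z r \<in> Qal" by auto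
  have "Z ^ M * (Z ^ L * f - C.ep Z p) + Z ^ L * (Z ^ M * g - C.ep Z r) \<in> Qal"
    using * by (intro q(4) q(5)[OF Z_power_B])
  also have "Z ^ M * (Z ^ L * f - C.ep Z p) + Z ^ L * (Z ^ M * g - C.ep Z r)
     = Z ^ (L + M) * (f + g) - C.ep Z (monom 1 M * p + monom 1 L * r)"
    by (simp add: C.ep_add C.ep_mult C.ep_monom C.h_one algebra_simps power_add)
  finally show "\<exists>L p. Z ^ L * (f + g) - C.ep Z p \<in> Qal" by blast
qed

lemma mon_mult_LS: "mon i n * f \<in> LS P \<longleftrightarrow> f \<in> LS (\<lambda>j m. P (i + j) (n + m))"
proof -
  have *: "lk (mon i n * f) m = t powi i * lk f (m - n)" for m
    by (simp add: lookup_mult_sum mon_def)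
  show ?thesis
  proof
    assume "mon i n * f \<in> LS P"
    then have h: "t powi i * lk f (m + n - n) = 0 \<or> P (v (t powi i * lk f (m + n - n))) (m + n)" for m
      unfolding LS_def mem_Collect_eq * by blast
    have "lk f m = 0 \<or> P (i + v (lk f m)) (n + m)" for m
      using h[of m] by (cases "lk f m = 0") (auto simp: v_mult add.commute)
    then show "f \<in> LS (\<lambda>j m. P (i + j) (n + m))" by (simp add: LS_def)
  next
    assume f: "f \<in> LS (\<lambda>j m. P (i + j) (n + m))"
    have h: "lk f (m - n) = 0 \<or> P (i + v (lk f (m - n))) (n + (m - n))" for m
      using f unfolding LS_def by blast
    have "lk (mon i n * f) m = 0 \<or> P (v (lk (mon i n * f) m)) m" for m
      using h[of m] unfolding * by (cases "lk f (m - n) = 0") (auto simp: v_mult)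
    then show "mon i n * f \<in> LS P" by (simp add: LS_def)
  qed
qed

lemma Z_mult_Qal: assumes "f \<in> B" "Z ^ L * f \<in> Qal" shows "f \<in> Qal"
proof -
  have "al (int L * z1 + j) (int L * z2 + m) = al j m" for j m by (simp add: al_add al_scale al_z)
  then show ?thesis using assms unfolding Z_power Qal_def B_def mon_mult_LS
    by (auto simp: LS_def inQ_def inB_def)
qed

text \<open>An element outside \<open>Qal\<close> yields a nonzero polynomial whose value at
  \<open>Z\<close> lies in \<open>Q\<close>, and then a linear factor of it does so too.\<close>

lemma ray_linear:
  assumes Q: "is_prime B Q" and tQ: "mon 1 0 \<in> Q" and ZQ: "Z \<notin> Q" and f: "f \<in> Q" "f \<notin> Qal"
  shows "\<exists>a. a \<noteq> 0 \<and> Z - sc a \<in> Q"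
proof -
  note q = idealD[OF prime_ideal[OF Q] B_subring]
  have fB: "f \<in> B" using q(2) f by blast
  obtain L p where p: "Z ^ L * f - C.ep Z p \<in> Qal" using Qal_approx[OF fB] by blast
  have "p \<noteq> 0" using p Z_mult_Qal[OF fB] f by (auto simp: C.ep_0)
  moreover have "C.ep Z p \<in> Q"
    using ideal_diff_cancel[OF prime_ideal[OF Q] B_subring, of "Z ^ L * f" "C.ep Z p"] p Qal_sub[OF Q tQ ZQ]
      q(5)[OF Z_power_B f(1)] by blast
  ultimately obtain r where r: "Z - sc r \<in> Q"
    using prime_linear_factor[OF C.ring_eval_axioms B_subring Q sc_B Z_B] by blast
  then show ?thesis using ZQ by (intro exI[of _ r]) (auto simp: C.h0)
qed

lemma residue_Q_ray:
  assumes Q: "is_prime B Q" and tQ: "mon 1 0 \<in> Q" and ZQ: "Z \<notin> Q" and a: "Z - sc a \<in> Q" "a \<noteq> 0"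
    and f: "f \<in> B"
  shows "\<exists>b. f - sc b \<in> Q"
  using f unfolding B_def
proof (rule LS_induct)
  note q = idealD[OF prime_ideal[OF Q] B_subring]
  have mult: "\<exists>b. f * g - sc b \<in> Q" if h: "\<exists>b. f - sc b \<in> Q" "\<exists>b. g - sc b \<in> Q" "f \<in> B" for f g
  proof -
    obtain b c where "f - sc b \<in> Q" "g - sc c \<in> Q" using h by blast
    then have "f * (g - sc c) + sc c * (f - sc b) \<in> Q" using q(4) q(5)[OF h(3)] q(5)[OF sc_B] by blast
    then show ?thesis by (intro exI[of _ "b * c"]) (simp add: C.h_mult algebra_simps)
  qed
  have pow: "\<exists>b. f ^ k - sc b \<in> Q" if h: "\<exists>b. f - sc b \<in> Q" "f \<in> B" for f and k :: nat
  proof (induction k)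
    case 0 show ?case using q(3) by (intro exI[of _ 1]) (simp add: C.h_one)
  next
    case (Suc k) show ?case using mult[OF h(1) Suc h(2)] by simp
  qed
  show "\<exists>b. 0 - sc b \<in> Q" using q(3) by (intro exI[of _ 0]) (simp add: C.h0)
  fix n x assume x: "x \<noteq> 0" "inB (v x) n"
  show "\<exists>b. sg n x - sc b \<in> Q"
  proof (cases "al (v x) n = 0")
    case False
    then have "sg n x \<in> Qal" using x by (simp add: Qal_def LS_single inQ_def inB_def)
    then show ?thesis using Qal_sub[OF Q tQ ZQ] by (intro exI[of _ 0]) (auto simp: C.h0)
  next
    case True
    then obtain l y where l: "sg n x = sg 0 y * mon (l * z1) (l * z2)" "ge y 0" "v x = l * z1" "n = l * z2"
      using sg_zero_al x by blast
    obtain c where "ge (y - s c) 1" using residue'[OF l(2)] by auto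
    then have "sg 0 (y - s c) \<in> Q" by (rule const_Q[OF Q tQ])
    then have 1: "\<exists>b. sg 0 y - sc b \<in> Q" by (auto simp: sc_def single_diff)
    have 2: "\<exists>b. mon (l * z1) (l * z2) - sc b \<in> Q"
    proof (cases "0 \<le> l")
      case True
      then have "mon (l * z1) (l * z2) = Z ^ nat l" by (simp add: Z_power)
      then show ?thesis using pow[of Z "nat l"] a Z_B by auto
    next
      case False
      \<comment> \<open>A negative multiple of \<open>(z1, z2)\<close> in the cone forces
        \<open>be z1 z2 = 0\<close>. Then \<open>Z\<close> is a unit of \<open>B\<close>, and its
        inverse has the residue \<open>inverse a\<close>.\<close>
      then have "0 \<le> l * be z1 z2" using x l by (simp add: inB_def be_scale)
      then have "be z1 z2 = 0" using be_z False by (auto simp: zero_le_mult_iff)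
      then have mB: "mon (- z1) (- z2) \<in> B"
        using al_scale[of "-1" z1 z2] be_scale[of "-1" z1 z2] al_z by (simp add: mon_B inB_def)
      have "mon (- z1) (- z2) * Z = 1" by (simp add: mon_mult mon_0)
      then have "mon (- z1) (- z2) - sc (inverse a) = - (sc (inverse a) * (mon (- z1) (- z2) * (Z - sc a)))"
        using sc_unit[OF a(2)] by (simp add: right_diff_distrib) (simp add: algebra_simps)
      also have "\<dots> \<in> Q" using q(5)[OF sc_B q(5)[OF mB a(1)]] q(7) by blast
      finally have "\<exists>b. mon (- z1) (- z2) - sc b \<in> Q" by blast
      moreover have "mon (l * z1) (l * z2) = mon (- z1) (- z2) ^ nat (- l)" using False by (simp add: mon_power)
      ultimately show ?thesis using pow[of "mon (- z1) (- z2)" "nat (- l)"] mB by simp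
    qed
    show ?thesis unfolding l(1) by (rule mult[OF 1 2 const_B[OF l(2)]])
  qed
next
  note q = idealD[OF prime_ideal[OF Q] B_subring]
  fix f g assume "\<exists>a. f - sc a \<in> Q" "\<exists>a. g - sc a \<in> Q"
  then obtain a b where "f - sc a \<in> Q" "g - sc b \<in> Q" by auto
  then have "(f - sc a) + (g - sc b) \<in> Q" by (rule q(4))
  then show "\<exists>a. f + g - sc a \<in> Q" by (intro exI[of _ "a + b"]) (simp add: C.h_add algebra_simps)
qed

lemma ray_prime_cases:
  assumes Q: "is_prime B Q" and tQ: "mon 1 0 \<in> Q" and ZQ: "Z \<notin> Q"
  shows "is_max B Q \<or> Q = Qal"
proof (cases "Q \<subseteq> Qal")
  case True
  then show ?thesis using Qal_sub[OF assms] by blast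
next
  case False
  then obtain f where f: "f \<in> Q" "f \<notin> Qal" by blast
  obtain a where a: "a \<noteq> 0" "Z - sc a \<in> Q" using ray_linear[OF assms f] by blast
  have "is_max B Q" by (rule max_from_residue[OF Q tQ residue_Q_ray[OF assms a(2,1)]])
  then show ?thesis ..
qed

text \<open>In the basis \<open>(w1, w2)\<close>, \<open>(z1, z2)\<close> the exponent
  \<open>(1, 0)\<close> of \<open>t\<close> is \<open>a1\<close> times the first vector plus a
  multiple of the second; the sign of that multiple decides on which side the power of
  \<open>Z\<close> stands.\<close>

lemma tt_XZ: "\<exists>k l. mon 1 0 * Z ^ k = X ^ nat a1 * Z ^ l"
proof -
  obtain l where l: "1 = a1 * w1 + l * z1" "0 = a1 * w2 + l * z2" using lat[of 1 0] by (auto simp: al_0)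
  have "1 + int (nat (- l)) * z1 = a1 * w1 + int (nat l) * z1"
    "int (nat (- l)) * z2 = a1 * w2 + int (nat l) * z2"
    using l by (cases "0 \<le> l"; simp)+
  then have "mon 1 0 * Z ^ nat (- l) = X ^ nat a1 * Z ^ nat l"
    using a1 by (simp add: mon_power mon_mult)
  then show ?thesis by blast
qed

text \<open>Multiplying by a power of \<open>Z\<close> and dividing by a power of \<open>X\<close> moves a nonzero element of a smaller
  prime out of \<open>Qal\<close>; hence that prime contains \<open>X\<close>, and with it \<open>t\<close>.\<close>

lemma Qal_height_one:
  assumes Q: "is_prime B Q" and sub: "Q \<subseteq> Qal" and f: "f \<in> Q" "f \<noteq> 0"
  shows "Qal \<subseteq> Q"
proof -
  note q = idealD[OF prime_ideal[OF Q] B_subring]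
  have ZQ: "Z \<notin> Q" using Z_Qal sub by blast
  have Zp: "Z ^ k \<notin> Q" for k using prime_power[OF B_subring Q Z_B] ZQ by blast
  define g where "g n = al (v (lk f n)) n" for n
  have fB: "f \<in> B" using q(2) f by blast
  have keys: "finite (g ` Poly_Mapping.keys f)" "g ` Poly_Mapping.keys f \<noteq> {}" using f(2) by auto
  \<comment> \<open>The least value of \<open>al\<close> on the terms of \<open>f\<close>, that is,
    the order of \<open>f\<close> along the edge.\<close>
  define a where "a = Min (g ` Poly_Mapping.keys f)"
  have a_le: "a \<le> al (v (lk f n)) n" if "lk f n \<noteq> 0" for n
    unfolding a_def using keys that by (intro Min_le) (auto simp: g_def in_keys_iff)
  obtain n0 where n0: "lk f n0 \<noteq> 0" "al (v (lk f n0)) n0 = a"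
    using Min_in[OF keys] by (auto simp: a_def g_def in_keys_iff)
  have a0: "0 \<le> a" using n0 fB by (auto simp: B_def LS_def inB_def)
  \<comment> \<open>Division by \<open>X ^ nat a\<close> lowers \<open>be\<close> by
    \<open>a * be w1 w2\<close>, and each factor \<open>Z\<close> raises it by at least 1 when
    \<open>be z1 z2\<close> is positive. In the degenerate cone \<open>be\<close> equals
    \<open>al\<close>, which stays nonnegative.\<close>
  define L where "L = nat a * nat (be w1 w2)"
  have L: "int L = a * be w1 w2" using a0 be_w by (simp add: L_def)
  define f' where "f' = mon (int L * z1 - a * w1) (int L * z2 - a * w2) * f"
  have alx: "al (int L * z1 - a * w1 + j) (int L * z2 - a * w2 + m) = al j m - a" for j m
    by (simp only: diff_conv_add_uminus al_add mult_minus_left[symmetric] al_scale al_z al_w)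
  have bex: "be (int L * z1 - a * w1 + j) (int L * z2 - a * w2 + m) = be j m + int L * be z1 z2 - a * be w1 w2" for j m
    by (simp add: be_def algebra_simps)
  have "inB (int L * z1 - a * w1 + v (lk f m)) (int L * z2 - a * w2 + m)" if m: "lk f m \<noteq> 0" for m
  proof -
    have 1: "0 \<le> al (v (lk f m)) m - a" using a_le[OF m] by simp
    have 2: "0 \<le> be (v (lk f m)) m" using m fB by (auto simp: B_def LS_def inB_def)
    from dich have "0 \<le> be (int L * z1 - a * w1 + v (lk f m)) (int L * z2 - a * w2 + m)"
    proof
      assume "0 < be z1 z2"
      then have "int L * be z1 z2 \<ge> int L * 1" by (intro mult_left_mono) auto
      then show ?thesis unfolding bex using 2 L by linarith
    next
      assume "\<forall>i n. be i n = al i n"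
      then show ?thesis using 1 alx by simp
    qed
    then show ?thesis using 1 alx by (simp add: inB_def)
  qed
  then have f'B: "f' \<in> B" unfolding f'_def B_def mon_mult_LS by (auto simp: LS_def)
  have f'Q: "f' \<notin> Qal"
  proof
    assume "f' \<in> Qal"
    then have "inQ (int L * z1 - a * w1 + v (lk f n0)) (int L * z2 - a * w2 + n0)"
      using n0 unfolding f'_def Qal_def mon_mult_LS by (auto simp: LS_def)
    then show False using n0 alx by (simp add: inQ_def)
  qed
  have "X ^ nat a * f' = Z ^ L * f"
    using a0 unfolding f'_def mult.assoc[symmetric] by (simp add: mon_power mon_mult)
  also have "\<dots> \<in> Q" using q(5)[OF Z_power_B f(1)] .
  finally have "X ^ nat a \<in> Q" using primeD[OF Q _ bc(7)[OF X_B] f'B] f'Q sub by blast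
  then have XQ: "X \<in> Q" by (rule prime_power[OF B_subring Q X_B])
  obtain k l where kl: "mon 1 0 * Z ^ k = X ^ nat a1 * Z ^ l" using tt_XZ by blast
  have "X ^ nat a1 = X * X ^ (nat a1 - 1)" using a1 by (simp add: power_eq_if)
  then have "X ^ nat a1 \<in> Q" using q(6)[OF bc(7)[OF X_B] XQ] by simp
  then have "mon 1 0 * Z ^ k \<in> Q" unfolding kl using q(6)[OF Z_power_B] by blast
  then have "mon 1 0 \<in> Q" using primeD[OF Q _ tt_B Z_power_B] Zp by blast
  then show ?thesis using Qal_sub[OF Q _ ZQ] by blast
qed

subsection \<open>The prime \<open>Qal\<close>\<close>

definition zc :: "(int \<Rightarrow>\<^sub>0 'a) \<Rightarrow> int \<Rightarrow> bool" where
  "zc f n \<longleftrightarrow> lk f n \<noteq> 0 \<and> al (v (lk f n)) n = 0"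

lemma zc_Qal: assumes "f \<in> B" shows "f \<in> Qal \<longleftrightarrow> (\<forall>n. \<not> zc f n)"
  using assms unfolding B_def Qal_def LS_def zc_def inB_def inQ_def
  by simp (metis less_irrefl order_le_less)

text \<open>With \<open>e = 1\<close> this selects the highest degree among the terms on the edge,
  with \<open>e = -1\<close> the lowest.\<close>

definition zmax :: "int \<Rightarrow> (int \<Rightarrow>\<^sub>0 'a) \<Rightarrow> int \<Rightarrow> bool" where
  "zmax e f n \<longleftrightarrow> zc f n \<and> (\<forall>m. zc f m \<longrightarrow> e * m \<le> e * n)"

lemma zmax_ex: assumes "f \<in> B" "f \<notin> Qal" shows "\<exists>n. zmax e f n"
proof -
  let ?S = "{n. zc f n}"
  have "finite ?S" by (rule finite_subset[of _ "Poly_Mapping.keys f"]) (auto simp: zc_def in_keys_iff)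
  moreover have "?S \<noteq> {}" using assms zc_Qal by auto
  ultimately have fin: "finite ((*) e ` ?S)" "(*) e ` ?S \<noteq> {}" by auto
  obtain n where "zc f n" "e * n = Max ((*) e ` ?S)" using Max_in[OF fin] by auto
  then show ?thesis using Max_ge[OF fin(1)] unfolding zmax_def by (intro exI[of _ n]) auto
qed

text \<open>The extreme edge terms of the factors multiply without cancellation: any other pair of
  terms of the same total degree has a larger sum of values of \<open>al\<close>, hence a
  coefficient of larger order.\<close>

lemma zmax_mult:
  assumes e: "e = 1 \<or> e = -1" and f: "f \<in> B" "zmax e f n" and g: "g \<in> B" "zmax e g m"
  shows "zc (f * g) (n + m)"
proof -
  define x where "x = lk f n * lk g m"
  have nz: "lk f n \<noteq> 0" "lk g m \<noteq> 0" using f g by (auto simp: zmax_def zc_def)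
  have vx: "v x = v (lk f n) + v (lk g m)" using nz by (simp add: x_def v_mult)
  have alx: "al (v x) (n + m) = 0" unfolding vx al_add using f g by (simp add: zmax_def zc_def)
  have "ge (lk f i * lk g (n + m - i)) (v x + 1)" if i: "i \<noteq> n" for i
  proof (cases "lk f i = 0 \<or> lk g (n + m - i) = 0")
    case False
    have p: "0 \<le> al (v (lk f i)) i" "0 \<le> al (v (lk g (n + m - i))) (n + m - i)"
      using False f(1) g(1) by (auto simp: B_def LS_def inB_def)
    have "\<not> (zc f i \<and> zc g (n + m - i))"
    proof
      assume "zc f i \<and> zc g (n + m - i)"
      then have "e * i \<le> e * n" "e * (n + m - i) \<le> e * m" using f g by (auto simp: zmax_def)
      then have "i = n" using e by auto
      then show False using i by simp
    qed
    then have "0 < al (v (lk f i)) i + al (v (lk g (n + m - i))) (n + m - i)"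
      using p False by (auto simp: zc_def)
    then have "al (v x) (n + m) < al (v (lk f i) + v (lk g (n + m - i))) (i + (n + m - i))"
      unfolding al_add alx .
    then have "a1 * v x < a1 * (v (lk f i) + v (lk g (n + m - i)))" by (simp add: al_def)
    then have "v x < v (lk f i) + v (lk g (n + m - i))" using a1 by simp
    then show ?thesis using False by (simp add: ge_def v_mult)
  qed auto
  then have r: "ge (\<Sum>i\<in>Poly_Mapping.keys f - {n}. lk f i * lk g (n + m - i)) (v x + 1)"
    by (intro ge_sum) auto
  have "lk (f * g) (n + m) = x + (\<Sum>i\<in>Poly_Mapping.keys f - {n}. lk f i * lk g (n + m - i))"
    unfolding lookup_mult_sum x_def using nz by (subst sum.remove[of _ n]) (auto simp: in_keys_iff)
  then show ?thesis using v_add_gt[OF _ r] nz alx by (simp add: zc_def x_def)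
qed

lemma Qal_prime: "is_prime B Qal"
proof -
  have "zc 1 0" by (simp add: zc_def al_def)
  then have "1 \<notin> Qal" using zc_Qal bc(1) by blast
  moreover have "f \<in> Qal \<or> g \<in> Qal" if fg: "f \<in> B" "g \<in> B" "f * g \<in> Qal" for f g
  proof (rule ccontr)
    assume "\<not> ?thesis"
    then obtain n m where "zmax 1 f n" "zmax 1 g m" using zmax_ex fg by meson
    then have "zc (f * g) (n + m)" using zmax_mult fg by blast
    then show False using fg zc_Qal bc(4) by blast
  qed
  ultimately show ?thesis using Qal_ideal by (auto simp: is_prime_def)
qed

lemma Qal_not_max: "\<not> is_max B Qal"
proof
  assume mx: "is_max B Qal"
  \<comment> \<open>A non-unit modulo \<open>Qal\<close>: it has edge terms in the two distinct
    degrees 0 and \<open>z2\<close>. If \<open>r * y\<close> were 1 modulo \<open>Qal\<close>, its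
    highest and lowest edge degrees would both be 0, although the spread of \<open>y\<close> is
    positive.\<close>
  define y where "y = Z - 1"
  have yB: "y \<in> B" using bc(3)[OF Z_B bc(1)] by (simp add: y_def)
  have "lk y 0 = -1" "lk y z2 = t powi z1" using z2 by (simp_all add: y_def mon_def lookup_minus lookup_single lookup_one when_def)
  then have zy: "zc y 0" "zc y z2" using al_z by (simp_all add: zc_def v_neg al_def)
  then have "y \<notin> Qal" using zc_Qal[OF yB] by blast
  then obtain r where r: "r \<in> B" "1 - r * y \<in> Qal" using mx yB by (auto simp: is_max_def)
  have rQ: "r \<notin> Qal"
  proof
    assume "r \<in> Qal"
    then have "r * y \<in> Qal" using idealD(6)[OF Qal_ideal B_subring yB] by blast
    then have "1 \<in> Qal" using ideal_diff_cancel[OF Qal_ideal B_subring r(2)] by blast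
    then show False using mx by (simp add: is_max_def)
  qed
  have zero: "k = 0" if "zc (r * y) k" for k
  proof (rule ccontr)
    assume "k \<noteq> 0"
    then have "lk (1 - r * y) k = - lk (r * y) k" by (simp add: lookup_minus lookup_one when_def)
    then have "zc (1 - r * y) k" using that by (simp add: zc_def v_neg)
    then show False using r zc_Qal Qal_B by blast
  qed
  obtain n n' m m' where *: "zmax 1 r n" "zmax (-1) r n'" "zmax 1 y m" "zmax (-1) y m'"
    using zmax_ex[OF r(1) rQ] zmax_ex[OF yB \<open>y \<notin> Qal\<close>] by blast
  have "n + m = 0" "n' + m' = 0" using zero zmax_mult[OF _ r(1) _ yB] * by blast+
  moreover have "n' \<le> n" "m \<ge> 0" "m \<ge> z2" "m' \<le> 0" "m' \<le> z2" using * zy by (auto simp: zmax_def)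
  ultimately show False using z2 by linarith
qed

end

subsection \<open>Classification of the primes over \<open>t\<close>\<close>

context cone
begin

text \<open>A lattice vector with \<open>al = 1\<close> exists by Bezout; adding multiples of the
  edge vector keeps \<open>al\<close> and makes \<open>be\<close> nonnegative.\<close>

lemma ray_ex:
  assumes e: "e = 1 \<or> e = - 1" and b: "0 \<le> be (- e * a2) (e * a1)"
  shows "\<exists>w1 w2. cone_ray v t s a1 a2 b1 b2 (- e * a2) (e * a1) w1 w2"
proof -
  define z1 where "z1 = - e * a2"
  define z2 where "z2 = e * a1"
  have bz: "0 \<le> be z1 z2" using b by (simp add: z1_def z2_def)
  have az: "al z1 z2 = 0" by (simp add: al_def z1_def z2_def)
  obtain x y where xy: "al x y = 1" using cop_a bezout_int[of a1 a2] by (auto simp: al_def coprime_iff_gcd_eq_1 mult.commute)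
  have dich: "0 < be z1 z2 \<or> (\<forall>i n. be i n = al i n)"
  proof (cases "be z1 z2 = 0")
    case True
    \<comment> \<open>Both forms vanish on the edge vector, so they are proportional; coprimality
      and positive leading coefficients make them equal.\<close>
    then have eq: "b2 * a1 = b1 * a2" using e by (auto simp: be_def z1_def z2_def algebra_simps)
    then have "a1 dvd b1 * a2" "b1 dvd b2 * a1" by (metis dvd_triv_right, metis dvd_triv_left)
    then have "a1 dvd b1" "b1 dvd a1" using cop_a cop_b
      by (metis coprime_dvd_mult_left_iff, metis coprime_dvd_mult_right_iff)
    then have "a1 = b1" using a1 b1 by (simp add: zdvd_antisym_nonneg)
    then have "a2 = b2" using eq b1 by simp
    have "be i n = al i n" for i n unfolding al_def be_def using \<open>a1 = b1\<close> \<open>a2 = b2\<close> by simp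
    then show ?thesis by blast
  qed (use bz in auto)
  obtain w1 w2 where w: "al w1 w2 = 1" "0 \<le> be w1 w2"
    using dich
  proof
    assume p: "0 < be z1 z2"
    have "be (x + \<bar>be x y\<bar> * z1) (y + \<bar>be x y\<bar> * z2) = be x y + \<bar>be x y\<bar> * be z1 z2"
      by (simp add: be_add be_scale)
    moreover have "\<bar>be x y\<bar> * be z1 z2 \<ge> \<bar>be x y\<bar> * 1" using p by (intro mult_left_mono) auto
    ultimately have "0 \<le> be (x + \<bar>be x y\<bar> * z1) (y + \<bar>be x y\<bar> * z2)" by linarith
    moreover have "al (x + \<bar>be x y\<bar> * z1) (y + \<bar>be x y\<bar> * z2) = 1" by (simp add: al_add al_scale az xy)
    ultimately show ?thesis using that by blast
  next
    assume "\<forall>i n. be i n = al i n"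
    then show ?thesis using that[of x y] xy by simp
  qed
  have "cone_ray v t s a1 a2 b1 b2 z1 z2 w1 w2"
  proof (intro cone_ray.intro cone_ray_axioms.intro)
    fix i n
    have "al (i - al i n * w1) (n - al i n * w2) = al i n - al i n * al w1 w2" by (simp add: al_def algebra_simps)
    then obtain l where l: "i - al i n * w1 = - l * a2" "n - al i n * w2 = l * a1" using ker_al w by force
    have "e * e = 1" using e by auto
    then have "- l * a2 = (l * e) * z1" "l * a1 = (l * e) * z2" by (simp_all add: z1_def z2_def)
    then show "\<exists>l. i = al i n * w1 + l * z1 \<and> n = al i n * w2 + l * z2" using l
      by (intro exI[of _ "l * e"]) auto
    show "z2 \<noteq> 0" using e a1 by (auto simp: z2_def)
  qed (use az bz w dich cone_axioms in auto)
  then show ?thesis unfolding z1_def z2_def by blast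
qed

lemma ray_from_mon:
  assumes Q: "is_prime B Q" and ij: "inB i n" "mon i n \<notin> Q" "n \<noteq> 0" "al i n = 0"
  shows "\<exists>z1 z2 w1 w2. cone_ray v t s a1 a2 b1 b2 z1 z2 w1 w2 \<and> mon z1 z2 \<notin> Q"
proof -
  obtain l where l: "i = - l * a2" "n = l * a1" using ker_al ij by blast
  define e where "e = sgn l"
  have l0: "l \<noteq> 0" using l ij by auto
  have e: "e = 1 \<or> e = -1" "l = \<bar>l\<bar> * e" using l0 by (auto simp: e_def sgn_if mult_sgn_abs)
  have in': "i = \<bar>l\<bar> * (- e * a2)" "n = \<bar>l\<bar> * (e * a1)" using l e(2) by (simp_all add: algebra_simps)
  have "0 \<le> \<bar>l\<bar> * be (- e * a2) (e * a1)" using ij unfolding in' inB_def be_scale by simp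
  then have b: "0 \<le> be (- e * a2) (e * a1)" using l0 by (simp add: zero_le_mult_iff)
  obtain w1 w2 where w: "cone_ray v t s a1 a2 b1 b2 (- e * a2) (e * a1) w1 w2" using ray_ex[OF e(1) b] by blast
  interpret R: cone_ray v t s a1 a2 b1 b2 "- e * a2" "e * a1" w1 w2 by (rule w)
  have "mon i n = R.Z ^ nat \<bar>l\<bar>" unfolding in' by (simp add: mon_power)
  also have "\<dots> = R.Z * R.Z ^ (nat \<bar>l\<bar> - 1)" using l0 by (simp add: power_eq_if)
  finally have "R.Z \<notin> Q" using ij idealD(6)[OF prime_ideal[OF Q] B_subring R.Z_power_B] by metis
  then show ?thesis using w by blast
qed

text \<open>Interior monomials and positive powers of \<open>t\<close> lie in \<open>Q\<close>. So a
  nonconstant monomial outside \<open>Q\<close> lies on one of the two edges, and then the primitive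
  generator of that edge is outside \<open>Q\<close> as well.\<close>

lemma prime_trichotomy:
  assumes Q: "is_prime B Q" and tQ: "mon 1 0 \<in> Q"
  shows "(\<forall>i n. inB i n \<longrightarrow> (i, n) \<noteq> (0, 0) \<longrightarrow> mon i n \<in> Q)
    \<or> (\<exists>z1 z2 w1 w2. cone_ray v t s a1 a2 b1 b2 z1 z2 w1 w2 \<and> mon z1 z2 \<notin> Q)
    \<or> (\<exists>z1 z2 w1 w2. cone_ray v t s b1 b2 a1 a2 z1 z2 w1 w2 \<and> mon z1 z2 \<notin> Q)"
proof (rule disjCI)
  assume no: "\<not> ((\<exists>z1 z2 w1 w2. cone_ray v t s a1 a2 b1 b2 z1 z2 w1 w2 \<and> mon z1 z2 \<notin> Q)
    \<or> (\<exists>z1 z2 w1 w2. cone_ray v t s b1 b2 a1 a2 z1 z2 w1 w2 \<and> mon z1 z2 \<notin> Q))"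
  interpret W: cone v t s b1 b2 a1 a2 by (rule swap)
  have WQ: "is_prime W.B Q" using Q swap_B by simp
  show "\<forall>i n. inB i n \<longrightarrow> (i, n) \<noteq> (0, 0) \<longrightarrow> mon i n \<in> Q"
  proof (intro allI impI, rule ccontr)
    fix i n assume ij: "inB i n" "(i, n) \<noteq> (0, 0)" "mon i n \<notin> Q"
    have n0: "n \<noteq> 0"
    proof
      assume n: "n = 0"
      then have "i > 0" using ij inB_0 by auto
      then have "mon (i - 1) 0 * mon 1 0 \<in> Q"
        using tQ by (intro idealD(5)[OF prime_ideal[OF Q] B_subring]) (auto simp: mon_B inB_0)
      then show False using ij n by (simp add: mon_mult)
    qed
    have "al i n = 0 \<or> be i n = 0" using interior_Q[OF Q tQ, of i n] ij by (force simp: inB_def)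
    then show False
    proof
      assume "al i n = 0"
      then show False using ray_from_mon[OF Q ij(1,3) n0] no by blast
    next
      assume "be i n = 0"
      then have "W.al i n = 0" by (simp add: W.al_def be_def)
      then show False using W.ray_from_mon[OF WQ _ ij(3) n0] ij(1) swap_inB no by metis
    qed
  qed
qed

lemma prime_height:
  assumes Q: "is_prime B Q" and tQ: "mon 1 0 \<in> Q" and nm: "\<not> is_max B Q"
    and Q': "is_prime B Q'" "Q' \<subseteq> Q" and f: "f \<in> Q'" "f \<noteq> 0"
  shows "Q \<subseteq> Q'"
  using prime_trichotomy[OF Q tQ]
proof (elim disjE exE conjE)
  assume "\<forall>i n. inB i n \<longrightarrow> (i, n) \<noteq> (0, 0) \<longrightarrow> mon i n \<in> Q"
  then have "is_max B Q" by (intro max_from_residue[OF Q tQ] residue_Q_fixed[OF Q tQ]) auto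
  then show ?thesis using nm by simp
next
  fix z1 z2 w1 w2 assume w: "cone_ray v t s a1 a2 b1 b2 z1 z2 w1 w2" "mon z1 z2 \<notin> Q"
  interpret R: cone_ray v t s a1 a2 b1 b2 z1 z2 w1 w2 by (rule w)
  have "Q = Qal" using R.ray_prime_cases[OF Q tQ w(2)] nm by blast
  then show ?thesis using R.Qal_height_one[OF Q'(1) _ f] Q'(2) by simp
next
  fix z1 z2 w1 w2 assume w: "cone_ray v t s b1 b2 a1 a2 z1 z2 w1 w2" "mon z1 z2 \<notin> Q"
  interpret R: cone_ray v t s b1 b2 a1 a2 z1 z2 w1 w2 by (rule w)
  have "Q = R.Qal" using R.ray_prime_cases[unfolded swap_B, OF Q tQ w(2)] nm by blast
  then show ?thesis using R.Qal_height_one[unfolded swap_B, OF Q'(1) _ f] Q'(2) by simp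
qed

lemma prime_between:
  assumes N: "is_max B N" and tN: "mon 1 0 \<in> N"
  shows "\<exists>Q. is_prime B Q \<and> Q \<subset> N \<and> Q \<noteq> {0}"
proof -
  have P: "is_prime B N" by (rule max_imp_prime[OF B_subring N])
  note q = idealD[OF prime_ideal[OF P] B_subring]
  have nz: "Q \<noteq> {0}" if "mon 1 0 \<in> Q" for Q using that mon_nz[of 1 0] by auto
  show ?thesis using prime_trichotomy[OF P tN]
  proof (elim disjE exE conjE)
    assume all: "\<forall>i n. inB i n \<longrightarrow> (i, n) \<noteq> (0, 0) \<longrightarrow> mon i n \<in> N"
    \<comment> \<open>One of the two directions along the line \<open>al = 0\<close> points into the
      half plane \<open>be \<ge> 0\<close>, so an edge always exists.\<close>
    have "0 \<le> be (- 1 * a2) (1 * a1) \<or> 0 \<le> be (- (- 1) * a2) (- 1 * a1)" by (simp add: be_def) linarith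
    then obtain z1 z2 w1 w2 where "cone_ray v t s a1 a2 b1 b2 z1 z2 w1 w2"
      using ray_ex[of 1] ray_ex[of "-1"] by blast
    then interpret R: cone_ray v t s a1 a2 b1 b2 z1 z2 w1 w2 .
    have "f \<in> N" if "f \<in> Qal" for f
      using that unfolding Qal_def
    proof (rule LS_induct)
      fix n x assume x: "x \<noteq> 0" "inQ (v x) n"
      then have "inB (v x) n" "(v x, n) \<noteq> (0, 0)" by (auto simp: inB_def inQ_def al_def)
      then show "sg n x \<in> N" using all comp_Q[OF P tN x(1)] by blast
    qed (use q in auto)
    then have "Qal \<subset> N" using R.Qal_not_max N by blast
    then show ?thesis using R.Qal_prime nz[OF tt_Qal] by blast
  next
    fix z1 z2 w1 w2 assume w: "cone_ray v t s a1 a2 b1 b2 z1 z2 w1 w2" "mon z1 z2 \<notin> N"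
    interpret R: cone_ray v t s a1 a2 b1 b2 z1 z2 w1 w2 by (rule w)
    have "Qal \<subset> N" using R.Qal_sub[OF P tN w(2)] R.Qal_not_max N by blast
    then show ?thesis using R.Qal_prime nz[OF tt_Qal] by blast
  next
    fix z1 z2 w1 w2 assume w: "cone_ray v t s b1 b2 a1 a2 z1 z2 w1 w2" "mon z1 z2 \<notin> N"
    interpret R: cone_ray v t s b1 b2 a1 a2 z1 z2 w1 w2 by (rule w)
    have "R.Qal \<subset> N" using R.Qal_sub[unfolded swap_B, OF P tN w(2)] R.Qal_not_max[unfolded swap_B] N by blast
    then show ?thesis using R.Qal_prime[unfolded swap_B] nz[OF R.tt_Qal] by blast
  qed
qed

lemma krull_dim_B:
  assumes N: "is_max B N" and tN: "mon 1 0 \<in> N"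
  shows "krull_dim (ring_of (loc B N)) = 2"
proof -
  have P: "is_prime B N" by (rule max_imp_prime[OF B_subring N])
  interpret localization B N by unfold_locales (rule B_subring, rule P)
  obtain Q where Q: "is_prime B Q" "Q \<subset> N" "Q \<noteq> {0}" using prime_between[OF assms] by blast
  have z: "is_prime B {0}" by (auto simp: is_prime_def is_ideal_def bc(2))
  define c :: "nat \<Rightarrow> (int \<Rightarrow>\<^sub>0 'a) set" where "c i = (if i = 0 then {0} else if i = 1 then Q else N)" for i
  have "{0} \<subset> Q" using Q idealD(3)[OF prime_ideal[OF Q(1)] B_subring] by auto
  then have "prime_chain B 2 c" using Q z P by (auto simp: prime_chain_def c_def)
  moreover have "c i \<subseteq> N" for i using Q idealD(3)[OF prime_ideal[OF P] B_subring] by (auto simp: c_def)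
  ultimately have "prime_chain (loc B N) 2 (\<lambda>i. ext (c i))" by (rule loc_chain_ext)
  moreover have "\<not> prime_chain (loc B N) (Suc 2) D" for D
  proof
    assume "prime_chain (loc B N) (Suc 2) D"
    then have ch: "prime_chain B (Suc 2) (\<lambda>i. contr (D i))" by (rule loc_chain_contr)
    define q where "q i = contr (D i)" for i
    have pr: "is_prime B (q 0)" "is_prime B (q 1)" "is_prime B (q 2)" "is_prime B (q 3)"
      using ch by (auto simp: prime_chain_def q_def)
    have st: "q 0 \<subset> q 1" "q 1 \<subset> q 2" "q 2 \<subset> q 3" using ch unfolding prime_chain_def q_def
      by (metis One_nat_def lessI less_Suc_eq numeral_2_eq_2 numeral_3_eq_3)+
    obtain f where "f \<in> q 1" "f \<notin> q 0" using st by blast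
    then have f: "f \<in> q 1" "f \<noteq> 0" using idealD(3)[OF prime_ideal[OF pr(1)] B_subring] by auto
    \<comment> \<open>The third of four primes is not maximal. If it contains \<open>t\<close>,
      \<open>prime_height\<close> applies, otherwise \<open>primes_away\<close>; both make it equal
      to the second one, which is nonzero.\<close>
    have nm: "\<not> is_max B (q 2)"
      using max_maximal[OF B_subring _ prime_ideal[OF pr(4)], of "q 2"] prime_one[OF pr(4)] st by blast
    show False
    proof (cases "mon 1 0 \<in> q 2")
      case True
      then show False using prime_height[OF pr(3) _ nm pr(2) _ f] st by blast
    next
      case False
      then show False using primes_away[OF pr(2,3) _ _ f] st by blast
    qed
  qed
  ultimately have "krull_dim (ring_of (loc B N)) = enat 2" by (rule krull_dim_eqI[OF L_subring])
  then show ?thesis by (simp add: numeral_eq_enat)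
qed

end

section \<open>Regularity\<close>

lemma diff_telescope: "x - y + (y - z) = x - z" for x y z :: "'b::ab_group_add"
  by simp

context max_localization
begin

text \<open>The elements congruent to a constant modulo the saturation \<open>J\<close> of the ideal
  of \<open>x\<close> and \<open>y\<close> form a subring. It contains the generators, hence all of
  \<open>?R'\<close>, into which every element moves after multiplication by a denominator. For an
  element of \<open>M\<close> the constant is 0, so \<open>M\<close> lies in \<open>J\<close>, and
  \<open>x\<close>, \<open>y\<close> generate the maximal ideal of the local ring.\<close>

lemma two_gen_regular:
  assumes h: "ring_eval h" and hR: "\<And>a::complex. h a \<in> R"
    and R0: "is_subring R0" "R0 \<subseteq> R" "noeth R0" and g: "g1 \<in> R" "g2 \<in> R"
    and frac: "\<And>f. f \<in> R \<Longrightarrow> \<exists>r\<in>R - M. r * f \<in> adj (adj R0 g1) g2"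
    and xy: "x \<in> M" "y \<in> M" "x \<noteq> y"
    and base: "\<And>f. f \<in> R0 \<union> {g1, g2} \<Longrightarrow> \<exists>a. \<exists>r\<in>R - M. r * (f - h a) \<in> idl R {x, y}"
    and dim: "krull_dim (ring_of L) = 2"
  shows "regular_local_ring (local_ring R M)"
proof -
  interpret h: ring_eval h by fact
  interpret A0: adjoin R0 g1 by unfold_locales (rule R0)
  interpret A1: adjoin "adj R0 g1" g2 by unfold_locales (rule A0.adj_subring)
  let ?R' = "adj (adj R0 g1) g2"
  have A1R: "adj R0 g1 \<subseteq> R" by (rule A0.adj_least[OF R R0(2) g(1)])
  have R'R: "?R' \<subseteq> R" by (rule A1.adj_least[OF R A1R g(2)])
  have noeth: "noeth L"
    by (rule noeth_loc[OF A1.adj_subring R'R A1.hilbert_basis[OF A0.hilbert_basis[OF R0(3)]] frac])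
  have MR: "M \<subseteq> R" by (rule mc(1))
  let ?I = "idl R {x, y}"
  have IR: "is_ideal R ?I" by (rule idl_ideal[OF R]) (use xy MR in auto)
  note i = idealD[OF IR R]
  have IM: "?I \<subseteq> M" by (rule idl_least[OF R prime_ideal[OF M]]) (use xy in auto)
  \<comment> \<open>Saturation with respect to \<open>R - M\<close>: the contraction of the ideal
    that \<open>x\<close> and \<open>y\<close> generate in the local ring.\<close>
  define J where "J = {f \<in> R. \<exists>r\<in>R - M. r * f \<in> ?I}"
  have J: "is_ideal R J"
  proof (rule is_idealI)
    show "J \<subseteq> R" by (auto simp: J_def)
    show "0 \<in> J" using i(3) rc(2) one_S by (auto simp: J_def)
    fix f g assume "f \<in> J" "g \<in> J"
    then obtain r q where *: "r \<in> R - M" "q \<in> R - M" "r * f \<in> ?I" "q * g \<in> ?I" "f \<in> R" "g \<in> R"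
      by (auto simp: J_def)
    have "(r * q) * (f + g) = q * (r * f) + r * (q * g)" by (simp add: algebra_simps)
    also have "\<dots> \<in> ?I" using i(4)[OF i(5)[OF _ *(3), of q] i(5)[OF _ *(4), of r]] * by blast
    finally show "f + g \<in> J" using mult_S[OF *(1,2)] rc(6) * by (auto simp: J_def)
  next
    fix c f assume c: "c \<in> R" and "f \<in> J"
    then obtain r where *: "r \<in> R - M" "r * f \<in> ?I" "f \<in> R" by (auto simp: J_def)
    have "r * (c * f) = c * (r * f)" by (simp add: algebra_simps)
    also have "\<dots> \<in> ?I" using i(5)[OF c] * by blast
    finally show "c * f \<in> J" using * c rc(4) by (auto simp: J_def)
  qed
  note j = idealD[OF J R]
  have JM: "J \<subseteq> M" using IM primeD[OF M] by (auto simp: J_def)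
  define T where "T = {f \<in> R. \<exists>a. f - h a \<in> J}"
  have T: "is_subring T"
  proof -
    have "f - g \<in> T \<and> f * g \<in> T" if fg: "f \<in> T" "g \<in> T" for f g
    proof -
      obtain a b where ab: "f - h a \<in> J" "g - h b \<in> J" "f \<in> R" "g \<in> R" using fg by (auto simp: T_def)
      have "(f - h a) - (g - h b) \<in> J" by (rule j(8)[OF ab(1,2)])
      then have 1: "f - g - h (a - b) \<in> J" by (simp add: h.h_diff algebra_simps)
      have "f * (g - h b) + h b * (f - h a) \<in> J" by (rule j(4)[OF j(5)[OF ab(3,2)] j(5)[OF hR ab(1)]])
      then have 2: "f * g - h (a * b) \<in> J" by (simp add: h.h_mult algebra_simps)
      show ?thesis using 1 2 rc(3,4) ab by (auto simp: T_def)
    qed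
    moreover have "1 \<in> T" using rc(1) j(3) h.h_one by (auto simp: T_def intro!: exI[of _ 1])
    ultimately show ?thesis by (auto simp: is_subring_def)
  qed
  have baseT: "f \<in> T" if f: "f \<in> R0 \<union> {g1, g2}" for f
  proof -
    have "f \<in> R" using f R0 g by auto
    obtain a r where "r \<in> R - M" "r * (f - h a) \<in> ?I" using base[OF f] by blast
    then have "f - h a \<in> J" using rc(3)[OF \<open>f \<in> R\<close> hR] by (auto simp: J_def)
    then show ?thesis using \<open>f \<in> R\<close> by (auto simp: T_def)
  qed
  have "adj R0 g1 \<subseteq> T" by (rule A0.adj_least[OF T]) (use baseT in auto)
  then have R'T: "?R' \<subseteq> T" by (rule A1.adj_least[OF T]) (use baseT in auto)
  have MJ: "M \<subseteq> J"
  proof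
    fix f assume f: "f \<in> M"
    then obtain r where r: "r \<in> R - M" "r * f \<in> ?R'" using frac MR by blast
    then obtain a where a: "r * f - h a \<in> J" using R'T by (auto simp: T_def)
    have "h a \<in> M"
      using ideal_diff_cancel[OF prime_ideal[OF M] R, of "r * f" "h a"] a JM mc(5)[OF _ f, of r] r by blast
    have "a = 0"
    proof (rule ccontr)
      assume "a \<noteq> 0"
      then have "h (inverse a) * h a = 1" by (simp add: h.h_mult[symmetric] h.h_one)
      then show False using mc(5)[OF hR \<open>h a \<in> M\<close>] prime_one[OF M] by metis
    qed
    then obtain q where q: "q \<in> R - M" "q * (r * f) \<in> ?I" using a by (auto simp: h.h0 J_def)
    then show "f \<in> J" using mult_S[OF q(1) r(1)] f MR by (auto simp: J_def mult.assoc intro!: bexI[of _ "q * r"])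
  qed
  have "mm = ext ?I"
  proof
    show "ext ?I \<subseteq> mm" using IM by (auto simp: mm_ext ext_def)
    show "mm \<subseteq> ext ?I"
    proof
      fix z assume "z \<in> mm"
      then obtain f u where fu: "z = F f u" "f \<in> M" "u \<in> R - M" unfolding mm_ext by (metis extE)
      obtain r where r: "r \<in> R - M" "r * f \<in> ?I" using MJ fu by (auto simp: J_def)
      have "z = F (r * f) (r * u)" using fu r nz by (auto simp: eq_fract)
      then show "z \<in> ext ?I" using extI[OF r(2) mult_S[OF r(1) fu(3)]] by simp
    qed
  qed
  then have mm_eq: "mm = idl L {F x 1, F y 1}" using ext_idl[of "{x, y}"] xy MR by auto
  have ne: "F x 1 \<noteq> F y 1" using xy by (simp add: eq_fract)
  show ?thesis unfolding regular_local_ring_def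
  proof (intro conjI exI)
    show "cring (local_ring R M)" unfolding local_ring_eq by (rule cring_ring_of[OF L_subring])
    show "noetherian_ring (local_ring R M)" unfolding local_ring_eq noeth_ring_of[OF L_subring] by (rule noeth)
    show "{I. maximalideal I (local_ring R M)} = {mm}" by (rule unique_max)
    show "finite {F x 1, F y 1}" by simp
    show "{F x 1, F y 1} \<subseteq> carrier (local_ring R M)" using loc1 xy MR by (auto simp: local_ring_eq)
    show "mm = Idl\<^bsub>local_ring R M\<^esub> {F x 1, F y 1}" using mm_eq by (simp add: local_ring_eq)
    show "enat (card {F x 1, F y 1}) = krull_dim (local_ring R M)"
      using ne dim by (simp add: local_ring_eq numeral_eq_enat)
  qed
qed

end

lemma three_vectors_dependent:
  fixes p1 p2 p3 q1 q2 q3 :: complex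
  shows "\<exists>l1 l2 l3. (l1, l2, l3) \<noteq> (0, 0, 0) \<and> l1 * p1 + l2 * p2 + l3 * p3 = 0 \<and> l1 * q1 + l2 * q2 + l3 * q3 = 0"
proof (cases "p2 * q3 - p3 * q2 = 0 \<and> p3 * q1 - p1 * q3 = 0 \<and> p1 * q2 - p2 * q1 = 0")
  case False
  \<comment> \<open>The cross product of the row of the \<open>p\<close> and the row of the
    \<open>q\<close> is orthogonal to both, and it is nonzero in this case.\<close>
  then show ?thesis
    by (intro exI[of _ "p2 * q3 - p3 * q2"] exI[of _ "p3 * q1 - p1 * q3"] exI[of _ "p1 * q2 - p2 * q1"])
      (auto simp: algebra_simps)
next
  case True
  consider "p1 = 0" "q1 = 0" | "p1 \<noteq> 0" | "p1 = 0" "q1 \<noteq> 0" by blast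
  then show ?thesis
  proof cases
    case 1
    then show ?thesis by (intro exI[of _ 1] exI[of _ 0]) auto
  next
    case 2
    then show ?thesis using True by (intro exI[of _ p2] exI[of _ "- p1"] exI[of _ 0]) (auto simp: algebra_simps)
  next
    case 3
    then show ?thesis using True by (intro exI[of _ q2] exI[of _ "- q1"] exI[of _ 0]) (auto simp: algebra_simps)
  qed
qed

context monomial_ring
begin

text \<open>Three irreducible exponents give embedding dimension at least three.\<close>

lemma not_regular:
  assumes indep: "\<And>w. Poly_Mapping.keys w \<subseteq> S \<Longrightarrow> ev w \<in> ipow R M (Suc (Suc 0)) \<Longrightarrow> Poly_Mapping.keys w \<subseteq> spow S (Suc (Suc 0))"
    and s: "s1 \<in> S - spow S (Suc (Suc 0))" "s2 \<in> S - spow S (Suc (Suc 0))" "s3 \<in> S - spow S (Suc (Suc 0))"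
    and s0: "s1 \<noteq> 0" "s2 \<noteq> 0" "s3 \<noteq> 0" and ne: "s1 \<noteq> s2" "s1 \<noteq> s3" "s2 \<noteq> s3"
    and dim: "krull_dim (ring_of L) = 2"
  shows "\<not> regular_local_ring (local_ring R M)"
proof
  assume "regular_local_ring (local_ring R M)"
  then obtain m G where G: "{I. maximalideal I (local_ring R M)} = {m}" "finite G" "G \<subseteq> L"
    "m = idl L G" "enat (card G) = krull_dim (ring_of L)"
    unfolding regular_local_ring_def local_ring_eq by auto
  have m: "m = mm" using G(1) unique_max by auto
  have "card G = 2" using G(5) dim by (simp add: numeral_eq_enat)
  then obtain g1 g2 where g: "G = {g1, g2}" by (meson card_2_iff)
  have gL: "g1 \<in> L" "g2 \<in> L" using G g by auto
  have mm_pair: "mm = {a * g1 + b * g2 | a b. a \<in> L \<and> b \<in> L}"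
    using G(4) m g idl_pair[OF L_subring gL] by simp
  note pI2 = ipow_ideal[OF L_subring prime_ideal[OF mm_prime]]
  note p = idealD[OF pI2 L_subring]
  have gm: "g1 \<in> mm" "g2 \<in> mm" using G(4) m g idl_self[OF _ L_subring] by auto
  have res: "\<exists>a. f - F (c a) 1 \<in> mm" if f: "f \<in> L" for f
  proof -
    obtain r where r: "r \<in> R" "f - F r 1 \<in> ipow L mm (Suc 0)" using loc_approx[OF f] by blast
    obtain a where a: "r - c a \<in> M" using residue[OF r(1)] by blast
    have "F (r - c a) 1 \<in> mm" using F1_mem_mm[of "r - c a"] a mc(2) by blast
    then have "F r 1 - F (c a) 1 \<in> mm" by simp
    moreover have "f - F r 1 \<in> mm" using r ipow_1[OF L_subring prime_ideal[OF mm_prime]] by simp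
    ultimately have "(f - F r 1) + (F r 1 - F (c a) 1) \<in> mm"
      by (intro idealD(4)[OF prime_ideal[OF mm_prime] L_subring])
    then show ?thesis unfolding diff_telescope by blast
  qed
  have lin: "\<exists>a b. F (chi k) 1 - (F (c a) 1 * g1 + F (c b) 1 * g2) \<in> ipow L mm (Suc (Suc 0))"
    if k: "k \<in> S" "k \<noteq> 0" for k
  proof -
    have "F (chi k) 1 \<in> mm" using F1_mem_mm chi_R[OF k(1)] chi_M[OF k] by blast
    then obtain A B where AB: "F (chi k) 1 = A * g1 + B * g2" "A \<in> L" "B \<in> L" unfolding mm_pair by blast
    obtain a b where ab: "A - F (c a) 1 \<in> mm" "B - F (c b) 1 \<in> mm" using res AB by meson
    have "(A - F (c a) 1) * g1 + (B - F (c b) 1) * g2 \<in> ipow L mm (Suc (Suc 0))"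
      using ab gm ipow_1[OF L_subring prime_ideal[OF mm_prime]] by (intro p(4) ipow_SucI) auto
    also have "(A - F (c a) 1) * g1 + (B - F (c b) 1) * g2 = F (chi k) 1 - (F (c a) 1 * g1 + F (c b) 1 * g2)"
      unfolding AB(1) by (simp add: algebra_simps del: diff_fract mult_fract add_fract)
    finally show ?thesis by blast
  qed
  have "s1 \<in> S" "s2 \<in> S" "s3 \<in> S" using s by auto
  obtain p1 q1 where 1: "F (chi s1) 1 - (F (c p1) 1 * g1 + F (c q1) 1 * g2) \<in> ipow L mm (Suc (Suc 0))"
    using lin[OF \<open>s1 \<in> S\<close> s0(1)] by blast
  obtain p2 q2 where 2: "F (chi s2) 1 - (F (c p2) 1 * g1 + F (c q2) 1 * g2) \<in> ipow L mm (Suc (Suc 0))"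
    using lin[OF \<open>s2 \<in> S\<close> s0(2)] by blast
  obtain p3 q3 where 3: "F (chi s3) 1 - (F (c p3) 1 * g1 + F (c q3) 1 * g2) \<in> ipow L mm (Suc (Suc 0))"
    using lin[OF \<open>s3 \<in> S\<close> s0(3)] by blast
  \<comment> \<open>Modulo the square the three monomials are complex combinations of the two
    generators, hence linearly dependent. The resulting relation \<open>w\<close> evaluates into the
    square, although its support contains an irreducible exponent.\<close>
  obtain l1 l2 l3 where l: "(l1, l2, l3) \<noteq> (0, 0, 0)" "l1 * p1 + l2 * p2 + l3 * p3 = 0" "l1 * q1 + l2 * q2 + l3 * q3 = 0"
    using three_vectors_dependent by blast
  define w where "w = Poly_Mapping.single s1 l1 + Poly_Mapping.single s2 l2 + Poly_Mapping.single s3 l3"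
  have evw: "ev w = c l1 * chi s1 + c l2 * chi s2 + c l3 * chi s3"
    by (simp add: w_def ev_add ev_single)
  define f where "f a = F (c a) 1" for a
  have fL: "f a \<in> L" for a unfolding f_def by (rule loc1[OF c_R])
  have f_add: "f (a + b) = f a + f b" and f_mult: "f (a * b) = f a * f b" for a b
    by (simp_all add: f_def c_add c_mult)
  have f0: "f 0 = 0" by (simp add: f_def c0 Zero_fract_def)
  have "f l1 * (F (chi s1) 1 - (f p1 * g1 + f q1 * g2)) + f l2 * (F (chi s2) 1 - (f p2 * g1 + f q2 * g2))
     + f l3 * (F (chi s3) 1 - (f p3 * g1 + f q3 * g2)) \<in> ipow L mm (Suc (Suc 0))"
    using 1 2 3 unfolding f_def[symmetric] by (intro p(4) p(5) fL)
  also have "f l1 * (F (chi s1) 1 - (f p1 * g1 + f q1 * g2)) + f l2 * (F (chi s2) 1 - (f p2 * g1 + f q2 * g2))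
     + f l3 * (F (chi s3) 1 - (f p3 * g1 + f q3 * g2))
    = f l1 * F (chi s1) 1 + f l2 * F (chi s2) 1 + f l3 * F (chi s3) 1
      - (f (l1 * p1 + l2 * p2 + l3 * p3) * g1 + f (l1 * q1 + l2 * q2 + l3 * q3) * g2)"
    by (simp add: f_add f_mult algebra_simps del: mult_fract add_fract diff_fract)
  also have "\<dots> = F (ev w) 1" unfolding l evw by (simp add: f0) (simp add: f_def)
  finally have "F (ev w) 1 \<in> ipow L mm (Suc (Suc 0))" .
  moreover have kw: "Poly_Mapping.keys w \<subseteq> S"
  proof -
    have "w \<in> W" unfolding w_def using \<open>s1 \<in> S\<close> \<open>s2 \<in> S\<close> \<open>s3 \<in> S\<close>
      by (intro subringD(6)[OF W_subring] W_single)
    then show ?thesis by (simp add: W_def)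
  qed
  ultimately have "ev w \<in> ipow R M (Suc (Suc 0))" using F1_mem_ipow ev_R by (simp add: W_def)
  then have "Poly_Mapping.keys w \<subseteq> spow S (Suc (Suc 0))" by (rule indep[OF kw])
  then have "lk w s1 = 0" "lk w s2 = 0" "lk w s3 = 0" using s unfolding subset_iff in_keys_iff by blast+
  then show False using ne l(1) by (simp add: w_def lookup_add lookup_single when_def)
qed

end

section \<open>The valuation ring in degree 0 and regularity along an edge\<close>

context cone
begin

definition R0 :: "(int \<Rightarrow>\<^sub>0 'a) set" where "R0 = {sg 0 x | x. ge x 0}"

lemma R0_subring: "is_subring R0"
proof -
  have "sg 0 x - sg 0 y \<in> R0" "sg 0 x * sg 0 y \<in> R0" if "ge x 0" "ge y 0" for x y
    using ge_diff[OF that] ge_mult[OF that] unfolding R0_def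
    by (auto simp: single_diff[symmetric] mult_single)
  moreover have "1 \<in> R0" unfolding R0_def by (rule CollectI, rule exI[of _ 1]) (simp add: ge_def)
  ultimately show ?thesis unfolding is_subring_def by (auto simp: R0_def)
qed

lemma R0_B: "R0 \<subseteq> B" using const_B by (auto simp: R0_def)

lemma R0_noeth: "noeth R0"
  unfolding noeth_def
proof (intro allI impI)
  fix I assume I: "is_ideal R0 I"
  note i = idealD[OF I R0_subring]
  show "\<exists>A\<subseteq>R0. finite A \<and> I = idl R0 A"
  proof (cases "I = {0}")
    case True
    then show ?thesis using idl_empty[OF R0_subring] by (intro exI[of _ "{}"]) auto
  next
    case False
    let ?P = "\<lambda>x. x \<noteq> 0 \<and> sg 0 x \<in> I"
    obtain f where "f \<in> I" "f \<noteq> 0" using False i(3) by blast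
    moreover obtain x0 where "f = sg 0 x0" using \<open>f \<in> I\<close> i(1) by (auto simp: R0_def)
    ultimately have "?P x0" by auto
    then obtain x where x: "?P x" and min: "\<And>y. ?P y \<Longrightarrow> nat (v x) \<le> nat (v y)"
      using ex_has_least_nat[of ?P x0 "\<lambda>x. nat (v x)"] by blast
    have inj: "ge y 0" if "sg 0 y \<in> R0" for y
      using that by (auto simp: R0_def) (metis lookup_single_eq)
    have xR: "sg 0 x \<in> R0" using x i(2) by blast
    have "I = idl R0 {sg 0 x}"
    proof
      show "idl R0 {sg 0 x} \<subseteq> I" by (rule idl_least[OF R0_subring I]) (use x in auto)
      show "I \<subseteq> idl R0 {sg 0 x}"
      proof
        fix f assume f: "f \<in> I"
        then obtain y where y: "f = sg 0 y" "ge y 0" using i(2) by (auto simp: R0_def)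
        have "ge (y / x) 0"
        proof (cases "y = 0")
          case False
          then have "nat (v x) \<le> nat (v y)" using min f y by blast
          then show ?thesis using y(2) False x inj[OF xR] by (auto simp: ge_def v_divide)
        qed simp
        then have "sg 0 (y / x) \<in> R0" by (auto simp: R0_def)
        moreover have "f = sg 0 (y / x) * sg 0 x" using x y by (simp add: mult_single)
        ultimately show "f \<in> idl R0 {sg 0 x}" using idl_single[OF R0_subring xR] by blast
      qed
    qed
    then show ?thesis using xR by (intro exI[of _ "{sg 0 x}"]) auto
  qed
qed

text \<open>An element of the valuation ring differs from its residue constant by a multiple of
  \<open>t\<close>. The factor \<open>r\<close> is the denominator that puts \<open>t\<close> into
  the ideal.\<close>

lemma R0_residue:
  assumes I: "is_ideal B I" and tI: "r * mon 1 0 \<in> I" and r: "r \<in> B" and f: "f \<in> R0"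
  shows "\<exists>a. r * (f - sc a) \<in> I"
proof -
  obtain x where x: "f = sg 0 x" "ge x 0" using f by (auto simp: R0_def)
  obtain a where a: "ge (x - s a) 1" using residue'[OF x(2)] by blast
  then have "ge ((x - s a) / t) 0" by (cases "x - s a = 0") (auto simp: ge_def v_divide vt)
  then have "sg 0 ((x - s a) / t) * (r * mon 1 0) \<in> I" by (rule idealD(5)[OF I B_subring const_B tI])
  also have "sg 0 ((x - s a) / t) * (r * mon 1 0) = r * (sg 0 ((x - s a) / t) * mon 1 0)" by (simp only: ac_simps)
  also have "sg 0 ((x - s a) / t) * mon 1 0 = f - sc a" by (simp add: x mon_def mult_single sc_def single_diff)
  finally show ?thesis by blast
qed

end

context cone_ray
begin

text \<open>In the lattice basis of the edge, each term is an element of the valuation ring times a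
  power of \<open>X\<close>, whose exponent is the value of \<open>al\<close>, times a power of
  \<open>Z\<close>; only the latter exponent can be negative.\<close>

lemma frac_ray: assumes "f \<in> B" shows "\<exists>k. Z ^ k * f \<in> adj (adj R0 X) Z"
proof -
  interpret A0: adjoin R0 X by unfold_locales (rule R0_subring)
  interpret A1: adjoin "adj R0 X" Z by unfold_locales (rule A0.adj_subring)
  note c = subringD[OF A1.adj_subring]
  show ?thesis using assms unfolding B_def
  proof (rule LS_induct)
    show "\<exists>k. Z ^ k * 0 \<in> adj (adj R0 X) Z" using c by simp
    fix n x assume x: "x \<noteq> 0" "inB (v x) n"
    obtain l where l: "v x = al (v x) n * w1 + l * z1" "n = al (v x) n * w2 + l * z2" using lat by blast
    define a where "a = nat (al (v x) n)"
    have a: "int a = al (v x) n" using x by (simp add: a_def inB_def)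
    define k where "k = nat (- l)"
    define j where "j = nat (l + int k)"
    have j: "int j = l + int k" by (simp add: j_def k_def)
    have 1: "v x = int a * w1 + l * z1" "n = int a * w2 + l * z2" using l by (simp_all only: a)
    have "Z ^ k * sg n x = sg 0 (x / t powi v x) * (mon (int k * z1) (int k * z2) * mon (v x) n)"
      unfolding sg_const_mon[of n x "v x"] mon_power by (rule mult.left_commute)
    also have "mon (int k * z1) (int k * z2) * mon (v x) n = mon (int a * w1 + int j * z1) (int a * w2 + int j * z2)"
      unfolding mon_mult j using 1 by (simp add: algebra_simps)
    also have "\<dots> = X ^ a * Z ^ j" by (simp add: mon_power mon_mult)
    finally have e: "Z ^ k * sg n x = sg 0 (x / t powi v x) * (X ^ a * Z ^ j)" .
    have "ge (x / t powi v x) 0" using x by (simp add: ge_def v_divide)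
    then have "sg 0 (x / t powi v x) \<in> adj (adj R0 X) Z" using A0.adj_base A1.adj_base by (auto simp: R0_def)
    moreover have "X \<in> adj (adj R0 X) Z" using A0.adj_gen A1.adj_base by blast
    ultimately have "Z ^ k * sg n x \<in> adj (adj R0 X) Z" unfolding e by (intro c(4) c(7) A1.adj_gen)
    then show "\<exists>k. Z ^ k * sg n x \<in> adj (adj R0 X) Z" by blast
  next
    fix f g assume "\<exists>k. Z ^ k * f \<in> adj (adj R0 X) Z" "\<exists>k. Z ^ k * g \<in> adj (adj R0 X) Z"
    then obtain k l where *: "Z ^ k * f \<in> adj (adj R0 X) Z" "Z ^ l * g \<in> adj (adj R0 X) Z" by blast
    have "Z ^ l * (Z ^ k * f) + Z ^ k * (Z ^ l * g) \<in> adj (adj R0 X) Z"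
      by (rule c(6)[OF c(4)[OF c(7)[OF A1.adj_gen] *(1)] c(4)[OF c(7)[OF A1.adj_gen] *(2)]])
    also have "Z ^ l * (Z ^ k * f) + Z ^ k * (Z ^ l * g) = Z ^ (k + l) * (f + g)"
      by (simp add: algebra_simps power_add)
    finally show "\<exists>k. Z ^ k * (f + g) \<in> adj (adj R0 X) Z" by blast
  qed
qed

text \<open>The local parameters are \<open>X\<close> and \<open>Z - sc a\<close>, where
  \<open>a\<close> is the nonzero residue of \<open>Z\<close>; the parameter \<open>t\<close> is a
  power of \<open>X\<close> up to powers of the local unit \<open>Z\<close>.\<close>

lemma regular_ray:
  assumes N: "is_max B N" and tN: "mon 1 0 \<in> N" and ZN: "Z \<notin> N"
  shows "regular_local_ring (local_ring B N)"
proof -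
  have P: "is_prime B N" by (rule max_imp_prime[OF B_subring N])
  interpret max_localization B N by unfold_locales (rule B_subring, rule P, rule N)
  have "Qal \<subset> N" using Qal_sub[OF P tN ZN] Qal_not_max N by blast
  then obtain f where f: "f \<in> N" "f \<notin> Qal" by blast
  obtain a where a: "a \<noteq> 0" "Z - sc a \<in> N" using ray_linear[OF P tN ZN f] by blast
  have XN: "X \<in> N" using mon_Q[OF P tN ZN] al_w be_w by (simp add: inQ_def)
  have Zk: "Z ^ k \<in> B - N" for k using Z_power_Q[OF P tN ZN] Z_power_B by blast
  let ?I = "idl B {X, Z - sc a}"
  have yB: "Z - sc a \<in> B" using a mc(2) by blast
  have I: "is_ideal B ?I" by (rule idl_ideal[OF B_subring]) (use X_B yB in auto)
  have xI: "X \<in> ?I" "Z - sc a \<in> ?I" by (simp_all add: idl_self[OF _ B_subring])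
  obtain k l where kl: "mon 1 0 * Z ^ k = X ^ nat a1 * Z ^ l" using tt_XZ by blast
  have "X ^ nat a1 = X ^ (nat a1 - 1) * X" using a1 by (simp add: power_eq_if mult.commute)
  then have "X ^ nat a1 \<in> ?I" using idealD(5)[OF I B_subring bc(7)[OF X_B] xI(1)] by simp
  then have tI: "Z ^ k * mon 1 0 \<in> ?I"
    using idealD(5)[OF I B_subring Z_power_B[of l]] kl by (metis mult.commute)
  have neq: "X \<noteq> Z - sc a"
  proof
    assume e: "X = Z - sc a"
    have "lk X z2 = lk (Z - sc a) z2" "lk X 0 = lk (Z - sc a) 0" using e by simp_all
    then show False using z2 s_nz[OF a(1)]
      by (auto simp: mon_def sc_def lookup_minus lookup_single when_def split: if_splits)
  qed
  show ?thesis
  proof (rule two_gen_regular[OF C.ring_eval_axioms sc_B R0_subring R0_B R0_noeth X_B Z_B _ XN a(2) neq _ krull_dim_B[OF N tN]])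
    show "\<exists>r\<in>B - N. r * f \<in> adj (adj R0 X) Z" if "f \<in> B" for f using frac_ray[OF that] Zk by blast
    fix f assume "f \<in> R0 \<union> {X, Z}"
    then consider "f \<in> R0" | "f = X" | "f = Z" by blast
    then show "\<exists>a'. \<exists>r\<in>B - N. r * (f - sc a') \<in> ?I"
    proof cases
      case 1
      then show ?thesis using R0_residue[OF I tI Z_power_B] Zk by blast
    next
      case 2
      then show ?thesis using xI one_S by (intro exI[of _ 0] bexI[of _ 1]) (auto simp: C.h0)
    next
      case 3
      then show ?thesis using xI one_S by (intro exI[of _ a] bexI[of _ 1]) auto
    qed
  qed
qed

end

context cone
begin

lemma regular_nonfixed:
  assumes N: "is_max B N" and tN: "mon 1 0 \<in> N" and ij: "inB i n" "(i, n) \<noteq> (0, 0)" "mon i n \<notin> N"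
  shows "regular_local_ring (local_ring B N)"
proof -
  have P: "is_prime B N" by (rule max_imp_prime[OF B_subring N])
  show ?thesis using prime_trichotomy[OF P tN]
  proof (elim disjE exE conjE)
    assume "\<forall>i n. inB i n \<longrightarrow> (i, n) \<noteq> (0, 0) \<longrightarrow> mon i n \<in> N"
    then show ?thesis using ij by blast
  next
    fix z1 z2 w1 w2 assume w: "cone_ray v t s a1 a2 b1 b2 z1 z2 w1 w2" "mon z1 z2 \<notin> N"
    show ?thesis by (rule cone_ray.regular_ray[OF w(1) N tN w(2)])
  next
    fix z1 z2 w1 w2 assume w: "cone_ray v t s b1 b2 a1 a2 z1 z2 w1 w2" "mon z1 z2 \<notin> N"
    show ?thesis using cone_ray.regular_ray[OF w(1), unfolded swap_B, OF N tN w(2)] .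
  qed
qed

end

section \<open>Cyclic quotients of the plane\<close>

text \<open>Exponents of the monomials \<open>x^a y^b\<close> that are invariant under the cyclic
  action with weights (1, e).\<close>

definition Sd :: "nat \<Rightarrow> nat \<Rightarrow> (nat \<times> nat) set" where
  "Sd d e = {(a, b). d dvd a + e * b}"

lemma Sd_0: "0 \<in> Sd d e" by (simp add: Sd_def zero_prod_def)

lemma Sd_add: "x \<in> Sd d e \<Longrightarrow> y \<in> Sd d e \<Longrightarrow> x + y \<in> Sd d e"
proof (cases x; cases y)
  fix a b a' b' assume "x \<in> Sd d e" "y \<in> Sd d e" "x = (a, b)" "y = (a', b')"
  then have "d dvd (a + e * b) + (a' + e * b')" by (auto simp: Sd_def intro: dvd_add)
  moreover have "(a + e * b) + (a' + e * b') = (a + a') + e * (b + b')" by (simp add: algebra_simps)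
  ultimately show "x + y \<in> Sd d e" using \<open>x = (a, b)\<close> \<open>y = (a', b')\<close> by (simp add: Sd_def)
qed

text \<open>Index 2 of \<open>spow\<close> asks for two nonzero summands besides an arbitrary member
  \<open>a\<close>; for the semigroups below, the elements outside are 0 and the irreducible
  ones.\<close>

lemma spow2_iff: "x \<in> spow S (Suc (Suc 0)) \<longleftrightarrow> (\<exists>a\<in>S. \<exists>b\<in>S - {0}. \<exists>c\<in>S - {0}. x = a + b + c)"
  by auto

lemma Sd_irreducible:
  assumes d: "d \<ge> 2" and cop: "coprime e d"
  shows "(d, 0) \<in> Sd d e - spow (Sd d e) (Suc (Suc 0))"
    and "(0, d) \<in> Sd d e - spow (Sd d e) (Suc (Suc 0))"
    and "\<exists>r>0. (r, 1) \<in> Sd d e - spow (Sd d e) (Suc (Suc 0))"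
proof -
  have ax: "d \<le> a" if "(a, 0) \<in> Sd d e" "(a, 0) \<noteq> 0" for a
    using that by (auto simp: Sd_def zero_prod_def intro: dvd_imp_le)
  have ay: "d \<le> b" if "(0, b) \<in> Sd d e" "(0, b) \<noteq> 0" for b
  proof -
    have "d dvd e * b" using that by (simp add: Sd_def)
    then have "d dvd b" using cop by (metis coprime_commute coprime_dvd_mult_right_iff)
    then show ?thesis using that by (auto simp: zero_prod_def intro: dvd_imp_le)
  qed
  show "(d, 0) \<in> Sd d e - spow (Sd d e) (Suc (Suc 0))"
  proof (intro DiffI notI)
    assume "(d, 0) \<in> spow (Sd d e) (Suc (Suc 0))"
    then obtain a b c where *: "b \<in> Sd d e - {0}" "c \<in> Sd d e - {0}" "(d, 0) = a + b + c"
      unfolding spow2_iff by blast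
    have "d = fst a + fst b + fst c" "0 = snd a + snd b + snd c"
      using arg_cong[OF *(3), of fst] arg_cong[OF *(3), of snd] by simp_all
    moreover have "b = (fst b, 0)" "c = (fst c, 0)" using calculation by (simp_all add: prod_eq_iff)
    then have "d \<le> fst b" "d \<le> fst c"
      using ax[of "fst b"] ax[of "fst c"] *(1,2) by (metis DiffD1 DiffD2 singletonI)+
    ultimately show False using d by linarith
  qed (simp add: Sd_def)
  show "(0, d) \<in> Sd d e - spow (Sd d e) (Suc (Suc 0))"
  proof (intro DiffI notI)
    assume "(0, d) \<in> spow (Sd d e) (Suc (Suc 0))"
    then obtain a b c where *: "b \<in> Sd d e - {0}" "c \<in> Sd d e - {0}" "(0, d) = a + b + c"
      unfolding spow2_iff by blast
    have "0 = fst a + fst b + fst c" "d = snd a + snd b + snd c"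
      using arg_cong[OF *(3), of fst] arg_cong[OF *(3), of snd] by simp_all
    moreover have "b = (0, snd b)" "c = (0, snd c)" using calculation by (simp_all add: prod_eq_iff)
    then have "d \<le> snd b" "d \<le> snd c"
      using ay[of "snd b"] ay[of "snd c"] *(1,2) by (metis DiffD1 DiffD2 singletonI)+
    ultimately show False using d by linarith
  qed (simp add: Sd_def)
  \<comment> \<open>The residue of \<open>- e\<close> between 1 and \<open>d - 1\<close>;
    \<open>e mod d\<close> is nonzero because \<open>e\<close> is coprime to
    \<open>d \<ge> 2\<close>. If \<open>(r, 1)\<close> had two nonzero summands, one of them would
    have second entry 0 and hence first entry at least \<open>d\<close>.\<close>
  define r where "r = d - e mod d"
  have em: "0 < e mod d"
  proof (rule ccontr)
    assume "\<not> ?thesis"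
    then have "d dvd e" by (simp add: dvd_eq_mod_eq_0)
    then have "d dvd 1" using cop by (metis coprime_common_divisor dvd_refl)
    then show False using d by simp
  qed
  have r: "0 < r" "r < d" using em d by (auto simp: r_def)
  have "r + e = d + d * (e div d)"
  proof -
    have "e mod d \<le> d" using d by (simp add: less_imp_le)
    then show ?thesis unfolding r_def using mult_div_mod_eq[of d e] by linarith
  qed
  then have "(r, 1) \<in> Sd d e" by (simp add: Sd_def)
  moreover have "(r, 1) \<notin> spow (Sd d e) (Suc (Suc 0))"
  proof
    assume "(r, 1) \<in> spow (Sd d e) (Suc (Suc 0))"
    then obtain a b c where *: "b \<in> Sd d e - {0}" "c \<in> Sd d e - {0}" "(r, 1) = a + b + c"
      unfolding spow2_iff by blast
    have e: "r = fst a + fst b + fst c" "1 = snd a + snd b + snd c"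
      using arg_cong[OF *(3), of fst] arg_cong[OF *(3), of snd] by simp_all
    then have "snd b = 0 \<or> snd c = 0" by linarith
    then have "b = (fst b, 0) \<or> c = (fst c, 0)" by (auto simp: prod_eq_iff)
    then have "d \<le> fst b \<or> d \<le> fst c" using ax[of "fst b"] ax[of "fst c"] *(1,2) by (metis DiffD1 DiffD2 singletonI)
    then show False using r e by linarith
  qed
  ultimately show "\<exists>r>0. (r, 1) \<in> Sd d e - spow (Sd d e) (Suc (Suc 0))" using r by blast
qed

text \<open>Pairs list the exponent of \<open>x\<close> first, whereas the nested polynomial is
  indexed by \<open>y\<close> first; hence the order in \<open>coeff (coeff f b) a\<close>.\<close>

definition PS :: "(nat \<times> nat) set \<Rightarrow> complex poly poly set" where
  "PS T = {f. \<forall>a b. coeff (coeff f b) a \<noteq> 0 \<longrightarrow> (a, b) \<in> T}"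

lemma PS_add: "f \<in> PS T \<Longrightarrow> g \<in> PS T \<Longrightarrow> f + g \<in> PS T"
  by (auto simp: PS_def) (metis add.right_neutral)

lemma PS_diff: "f \<in> PS T \<Longrightarrow> g \<in> PS T \<Longrightarrow> f - g \<in> PS T"
  by (auto simp: PS_def) (metis diff_zero)

lemma PS_mult:
  assumes f: "f \<in> PS T" and g: "g \<in> PS U" and V: "\<And>x y. x \<in> T \<Longrightarrow> y \<in> U \<Longrightarrow> x + y \<in> V"
  shows "f * g \<in> PS V"
  unfolding PS_def
proof (intro CollectI allI impI)
  fix a b assume "coeff (coeff (f * g) b) a \<noteq> 0"
  then have "(\<Sum>j\<le>b. \<Sum>i\<le>a. coeff (coeff f j) i * coeff (coeff g (b - j)) (a - i)) \<noteq> 0"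
    by (simp add: coeff_mult coeff_sum)
  then obtain j where j: "j \<le> b" "(\<Sum>i\<le>a. coeff (coeff f j) i * coeff (coeff g (b - j)) (a - i)) \<noteq> 0"
    by (metis (no_types, lifting) atMost_iff sum.not_neutral_contains_not_neutral)
  then obtain i where i: "i \<le> a" "coeff (coeff f j) i * coeff (coeff g (b - j)) (a - i) \<noteq> 0"
    by (metis (no_types, lifting) atMost_iff sum.not_neutral_contains_not_neutral)
  then have "(i, j) \<in> T" "(a - i, b - j) \<in> U" using f g by (auto simp: PS_def)
  then have "(i, j) + (a - i, b - j) \<in> V" by (rule V)
  then show "(a, b) \<in> V" using i j by simp
qed

lemma PS_const: "[:[:a:]:] \<in> PS T" if "(0, 0) \<in> T"
  using that by (auto simp: PS_def coeff_pCons split: nat.splits)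

lemma plane_act_coeff:
  "coeff (coeff (plane_act e z f) b) a = z ^ (a + e * b) * coeff (coeff f b) a"
proof -
  have "coeff (plane_act e z f) b = [:z ^ e:] ^ b * pcompose (coeff f b) [:0, z:]"
    unfolding plane_act_def coeff_pcompose_linear by (simp add: coeff_map_poly)
  also have "[:z ^ e:] ^ b = [:z ^ (e * b):]" by (simp add: poly_const_pow power_mult)
  finally show ?thesis by (simp add: coeff_pcompose_linear power_add mult.commute)
qed

lemma primitive_root: assumes "d > 0" shows "\<exists>z::complex. z ^ d = 1 \<and> (\<forall>k. z ^ k = 1 \<longrightarrow> d dvd k)"
proof -
  define z where "z = cis (2 * pi * real 1 / real d)"
  have bij: "bij_betw (\<lambda>k. cis (2 * pi * real k / real d)) {..<d} {z. z ^ d = 1}"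
    using assms by (rule bij_betw_roots_unity)
  have zk: "z ^ k = cis (2 * pi * real k / real d)" for k
    by (simp add: z_def Complex.DeMoivre mult.commute)
  have zd: "z ^ d = 1" using assms by (simp add: zk)
  have "d dvd k" if k: "z ^ k = 1" for k
  proof -
    have "z ^ k = (z ^ d) ^ (k div d) * z ^ (k mod d)" by (metis mult_div_mod_eq power_add power_mult)
    then have "z ^ (k mod d) = 1" using k zd by simp
    then have "cis (2 * pi * real (k mod d) / real d) = cis (2 * pi * real 0 / real d)" by (simp add: zk[symmetric])
    then have "k mod d = 0" using bij assms by (auto simp: bij_betw_def inj_on_def)
    then show ?thesis by (simp add: dvd_eq_mod_eq_0)
  qed
  then show ?thesis using zd by blast
qed

text \<open>The action multiplies the coefficient at \<open>(a, b)\<close> by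
  \<open>z ^ (a + e * b)\<close>. One primitive root detects divisibility of the weight by
  \<open>d\<close>, and this divisibility makes all \<open>d\<close>-th roots of unity act
  trivially.\<close>

lemma plane_quotient_PS: assumes "d > 0" shows "plane_quotient d e = PS (Sd d e)"
proof
  obtain z :: complex where z: "z ^ d = 1" "\<And>k. z ^ k = 1 \<Longrightarrow> d dvd k" using primitive_root[OF assms] by blast
  show "plane_quotient d e \<subseteq> PS (Sd d e)"
  proof
    fix f assume "f \<in> plane_quotient d e"
    then have "plane_act e z f = f" using z by (simp add: plane_quotient_def)
    then have "z ^ (a + e * b) * coeff (coeff f b) a = coeff (coeff f b) a" for a b
      by (metis plane_act_coeff)
    then show "f \<in> PS (Sd d e)" using z by (auto simp: PS_def Sd_def)
  qed
  show "PS (Sd d e) \<subseteq> plane_quotient d e"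
    unfolding plane_quotient_def
  proof (intro subsetI CollectI allI impI)
    fix f and z :: complex assume f: "f \<in> PS (Sd d e)" and z: "z ^ d = 1"
    have "z ^ (a + e * b) * coeff (coeff f b) a = coeff (coeff f b) a" for a b
    proof (cases "coeff (coeff f b) a = 0")
      case False
      then have "d dvd a + e * b" using f by (auto simp: PS_def Sd_def)
      then obtain k where "a + e * b = d * k" by (auto elim: dvdE)
      then have "z ^ (a + e * b) = 1" using z by (simp add: power_mult)
      then show ?thesis by simp
    qed simp
    then show "plane_act e z f = f" by (intro poly_eqI) (simp add: plane_act_coeff)
  qed
qed

lemma origin_PS: assumes "d > 0" shows "plane_quotient_origin d e = PS (Sd d e - {0})"
  unfolding plane_quotient_origin_def plane_quotient_PS[OF assms]
  by (auto simp: PS_def poly_0_coeff_0 zero_prod_def) (metis gr0I)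

definition pmon :: "nat \<times> nat \<Rightarrow> complex poly poly" where
  "pmon k = monom (monom 1 (fst k)) (snd k)"

lemma pmon_PS: "pmon k \<in> PS T \<longleftrightarrow> k \<in> T"
  by (cases k) (auto simp: PS_def pmon_def)

lemma pmon_coeff: "coeff (coeff ([:[:c:]:] * pmon k) b) a = (if k = (a, b) then c else 0)"
  by (cases k) (auto simp: pmon_def)

lemma pmon_add: "pmon (k + l) = pmon k * pmon l"
  by (simp add: pmon_def mult_monom)

lemma poly2_sum: "f = (\<Sum>k\<in>{..degree f}. \<Sum>i\<in>{..degree (coeff f k)}. [:[:coeff (coeff f k) i:]:] * pmon (i, k))"
proof (intro poly_eqI)
  fix b a
  have "coeff (coeff (\<Sum>k\<in>{..degree f}. \<Sum>i\<in>{..degree (coeff f k)}. [:[:coeff (coeff f k) i:]:] * pmon (i, k)) b) a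
    = (\<Sum>k\<in>{..degree f}. \<Sum>i\<in>{..degree (coeff f k)}. if (i, k) = (a, b) then coeff (coeff f k) i else 0)"
    unfolding coeff_sum pmon_coeff ..
  also have "\<dots> = (\<Sum>k\<in>{..degree f}. if k = b then (if a \<le> degree (coeff f b) then coeff (coeff f b) a else 0) else 0)"
    by (intro sum.cong refl) (auto simp: sum.delta)
  also have "\<dots> = (\<Sum>k\<in>{..degree f}. if k = b then coeff (coeff f b) a else 0)"
    by (intro sum.cong refl) (auto simp: coeff_eq_0)
  also have "\<dots> = coeff (coeff f b) a" by (auto simp: coeff_eq_0)
  finally show "coeff (coeff f b) a = coeff (coeff (\<Sum>k\<in>{..degree f}. \<Sum>i\<in>{..degree (coeff f k)}. [:[:coeff (coeff f k) i:]:] * pmon (i, k)) b) a"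
    by simp
qed

lemma PS_subring: "is_subring (PS (Sd d e))"
proof -
  have "1 \<in> PS (Sd d e)" using PS_const[of "Sd d e" 1] Sd_0[of d e] by (simp add: zero_prod_def one_pCons)
  then show ?thesis unfolding is_subring_def using PS_diff PS_mult[OF _ _ Sd_add] by blast
qed

lemma PS_max: "is_max (PS (Sd d e)) (PS (Sd d e - {0}))"
proof -
  let ?R = "PS (Sd d e)" and ?M = "PS (Sd d e - {0})"
  have I: "is_ideal ?R ?M"
  proof (rule is_idealI)
    show "?M \<subseteq> ?R" by (auto simp: PS_def)
    show "0 \<in> ?M" by (simp add: PS_def)
    show "x \<in> ?M \<Longrightarrow> y \<in> ?M \<Longrightarrow> x + y \<in> ?M" for x y by (rule PS_add)
    show "r * x \<in> ?M" if "r \<in> ?R" "x \<in> ?M" for r x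
    proof (rule PS_mult[OF that])
      fix a b assume "a \<in> Sd d e" "b \<in> Sd d e - {0}"
      then show "a + b \<in> Sd d e - {0}" using Sd_add[of a d e b] by (cases a; cases b) (auto simp: zero_prod_def)
    qed
  qed
  have diff: "f - [:[:coeff (coeff f 0) 0:]:] \<in> ?M" if "f \<in> ?R" for f
    using that by (auto simp: PS_def coeff_pCons zero_prod_def split: nat.splits)
  have "\<exists>r\<in>?R. 1 - r * f \<in> ?M" if f: "f \<in> ?R - ?M" for f
  proof -
    define c where "c = coeff (coeff f 0) 0"
    have c: "c \<noteq> 0" using f by (auto simp: PS_def c_def zero_prod_def)
    have k: "[:[:inverse c:]:] \<in> ?R" using PS_const[of "Sd d e"] Sd_0[of d e] by (simp add: zero_prod_def)
    have "1 - [:[:inverse c:]:] * f = - ([:[:inverse c:]:] * (f - [:[:c:]:]))"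
      using c by (simp add: smult_diff_right one_pCons)
    also have "\<dots> \<in> ?M"
      using idealD(5,7)[OF I PS_subring] k diff[of f] f unfolding c_def by blast
    finally show ?thesis using k by blast
  qed
  moreover have "1 \<notin> ?M" by (auto simp: PS_def zero_prod_def intro!: exI[of _ 0])
  ultimately show ?thesis using I by (simp add: is_max_def)
qed

interpretation plane: monomial_ring "PS (Sd d e)" "PS (Sd d e - {0})" "\<lambda>c. [:[:c:]:]" "Sd d e" pmon for d e
proof unfold_locales
  show "is_subring (PS (Sd d e))" by (rule PS_subring)
  show "is_prime (PS (Sd d e)) (PS (Sd d e - {0}))" by (rule max_imp_prime[OF PS_subring PS_max])
  show "is_max (PS (Sd d e)) (PS (Sd d e - {0}))" by (rule PS_max)
  show c: "[:[:a:]:] \<in> PS (Sd d e)" for a using PS_const[of "Sd d e"] Sd_0[of d e] by (simp add: zero_prod_def)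
  show "\<exists>a. f - [:[:a:]:] \<in> PS (Sd d e - {0})" if "f \<in> PS (Sd d e)" for f
    using that by (intro exI[of _ "coeff (coeff f 0) 0"]) (auto simp: PS_def coeff_pCons zero_prod_def split: nat.splits)
  show "PS (Sd d e - {0}) \<subseteq> idl (PS (Sd d e)) (pmon ` (Sd d e - {0}))"
  proof
    fix f assume f: "f \<in> PS (Sd d e - {0})"
    have I: "is_ideal (PS (Sd d e)) (idl (PS (Sd d e)) (pmon ` (Sd d e - {0})))"
      by (rule idl_ideal[OF PS_subring]) (auto simp: pmon_PS)
    have "[:[:coeff (coeff f k) i:]:] * pmon (i, k) \<in> idl (PS (Sd d e)) (pmon ` (Sd d e - {0}))" for i k
    proof (cases "coeff (coeff f k) i = 0")
      case True
      then show ?thesis using idealD(3)[OF I PS_subring] by simp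
    next
      case False
      then have "(i, k) \<in> Sd d e - {0}" using f by (auto simp: PS_def)
      then show ?thesis by (intro idealD(5)[OF I PS_subring c] idl_self[OF _ PS_subring]) auto
    qed
    then show "f \<in> idl (PS (Sd d e)) (pmon ` (Sd d e - {0}))"
      by (subst poly2_sum) (intro ideal_sum[OF I])
  qed
  show "pmon 0 = 1" by (simp add: pmon_def one_pCons monom_0)
qed (auto simp: pmon_PS Sd_0 Sd_add pmon_add one_pCons)

text \<open>Powers of the origin ideal have supports in \<open>spow\<close>, and distinct monomials
  of the plane do not interact, so a monomial sum keeps its support as a polynomial.\<close>

lemma plane_indep:
  assumes "Poly_Mapping.keys w \<subseteq> Sd d e" "plane.ev w \<in> ipow (PS (Sd d e)) (PS (Sd d e - {0})) n"
  shows "Poly_Mapping.keys w \<subseteq> spow (Sd d e) n"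
proof -
  have "ipow (PS (Sd d e)) (PS (Sd d e - {0})) n \<subseteq> PS (spow (Sd d e) n)"
  proof (rule ipow_least[where F = "\<lambda>n. PS (spow (Sd d e) n)"])
    fix n a b assume "a \<in> PS (spow (Sd d e) n)" "b \<in> PS (Sd d e - {0})"
    then show "a * b \<in> PS (spow (Sd d e) (Suc n))"
      by (rule PS_mult) (unfold spow.simps, blast)
  qed (auto intro: PS_add)
  then have "plane.ev w \<in> PS (spow (Sd d e) n)" using assms by blast
  moreover have "coeff (coeff (plane.ev w) b) a = lk w (a, b)" for a b
  proof -
    have "coeff (coeff (plane.ev w) b) a = (\<Sum>k\<in>Poly_Mapping.keys w. if k = (a, b) then lk w k else 0)"
      unfolding plane.ev_def coeff_sum pmon_coeff ..
    also have "\<dots> = lk w (a, b)" by (simp add: in_keys_iff)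
    finally show ?thesis .
  qed
  ultimately show ?thesis by (auto simp: PS_def in_keys_iff)
qed

section \<open>The vertex of a strictly convex cone\<close>

locale cone_fixed = cone +
  fixes N and D :: int
  assumes D: "D = a1 * b2 - a2 * b1" "0 < D"
    and N: "is_max B N" and fixed: "inB i n \<Longrightarrow> (i, n) \<noteq> (0, 0) \<Longrightarrow> mon i n \<in> N"
begin

lemma P: "is_prime B N" by (rule max_imp_prime[OF B_subring N])
lemma tN: "mon 1 0 \<in> N" by (rule fixed) (simp_all add: inB_0)
lemmas nc = idealD[OF prime_ideal[OF P] B_subring]

text \<open>The exponents of the cone in the coordinates \<open>(be, al)\<close>. In this order the
  first coordinate becomes the exponent of \<open>x\<close>, of weight 1, and the second that of
  \<open>y\<close>, of weight \<open>e\<close>. Natural numbers encode the two inequalities.\<close>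

definition S :: "(nat \<times> nat) set" where
  "S = {(a, b). \<exists>i n. al i n = int b \<and> be i n = int a}"

text \<open>\<open>chi (a, b)\<close> is the monomial whose exponent \<open>(i, n)\<close> solves \<open>be i n = a\<close> and \<open>al i n = b\<close>.\<close>

definition chi :: "nat \<times> nat \<Rightarrow> (int \<Rightarrow>\<^sub>0 'a)" where
  "chi k = mon ((b2 * int (snd k) - a2 * int (fst k)) div D) ((a1 * int (fst k) - b1 * int (snd k)) div D)"

text \<open>Cramer's rule, as \<open>D\<close> is the determinant of the two forms. It shows that
  the divisions by \<open>D\<close> in \<open>chi\<close> are exact on \<open>S\<close>.\<close>

lemma solve: "b2 * al i n - a2 * be i n = D * i" "a1 * be i n - b1 * al i n = D * n"
  by (simp_all add: al_def be_def D(1) algebra_simps)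

lemma chi_mon: "al i n = int b \<Longrightarrow> be i n = int a \<Longrightarrow> chi (a, b) = mon i n"
  using solve[of i n] D(2) by (simp add: chi_def)

lemma albe_inj: "al i n = al j m \<Longrightarrow> be i n = be j m \<Longrightarrow> i = j \<and> n = m"
  using solve[of i n] solve[of j m] D(2) by simp

lemma S_E: assumes "k \<in> S"
  obtains i n where "inB i n" "al i n = int (snd k)" "be i n = int (fst k)" "chi k = mon i n"
proof -
  obtain i n where *: "al i n = int (snd k)" "be i n = int (fst k)" using assms by (auto simp: S_def)
  then have "chi k = mon i n" using chi_mon[of i n "snd k" "fst k"] by simp
  then show ?thesis using that * by (simp add: inB_def)
qed

lemma inB_S: "inB i n \<Longrightarrow> (nat (be i n), nat (al i n)) \<in> S \<and> chi (nat (be i n), nat (al i n)) = mon i n"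
  using chi_mon[of i n "nat (al i n)" "nat (be i n)"] by (auto simp: S_def inB_def)

lemma S_zero: "(nat (be i n), nat (al i n)) = 0 \<Longrightarrow> inB i n \<Longrightarrow> (i, n) = (0, 0)"
  using albe_inj[of i n 0 0] by (auto simp: zero_prod_def inB_def al_def be_def)

lemma S_add: assumes "k \<in> S" "l \<in> S" shows "k + l \<in> S \<and> chi (k + l) = chi k * chi l"
proof -
  obtain i n where 1: "inB i n" "al i n = int (snd k)" "be i n = int (fst k)" "chi k = mon i n" using S_E[OF assms(1)] .
  obtain j m where 2: "inB j m" "al j m = int (snd l)" "be j m = int (fst l)" "chi l = mon j m" using S_E[OF assms(2)] .
  have 3: "al (i + j) (n + m) = int (snd (k + l))" "be (i + j) (n + m) = int (fst (k + l))"
    using 1 2 by (simp_all add: al_add be_add)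
  have "k + l \<in> S" using 3 unfolding S_def by (cases "k + l") auto
  moreover have "chi (k + l) = mon (i + j) (n + m)" using chi_mon[OF 3] by (simp only: prod.collapse)
  ultimately show ?thesis using 1 2 by (simp add: mon_mult)
qed

definition inN :: "int \<Rightarrow> int \<Rightarrow> bool" where "inN i n \<longleftrightarrow> inB i n \<and> (i, n) \<noteq> (0, 0)"

lemma N_LS: "N \<subseteq> LS inN"
proof
  fix f assume f: "f \<in> N"
  then have fB: "f \<in> B" using nc by blast
  \<comment> \<open>Otherwise the terms of \<open>f\<close> in nonzero degree lie in
    \<open>N\<close>, hence so does its term of degree 0, which is a unit.\<close>
  have "\<not> (lk f 0 \<noteq> 0 \<and> v (lk f 0) = 0)"
  proof
    assume u: "lk f 0 \<noteq> 0 \<and> v (lk f 0) = 0"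
    have "f - sg 0 (lk f 0) \<in> LS inN" using fB
      by (auto simp: LS_def B_def inN_def lookup_minus lookup_single when_def)
    then have "f - sg 0 (lk f 0) \<in> N"
      by (rule LS_induct) (use nc in \<open>auto simp: inN_def intro: comp_Q[OF P tN] fixed\<close>)
    then have "sg 0 (lk f 0) \<in> N" using ideal_diff_cancel[OF prime_ideal[OF P] B_subring] f by blast
    then have "sg 0 (inverse (lk f 0)) * sg 0 (lk f 0) \<in> N"
      using u by (intro nc(5) const_B) (auto simp: ge_def v_inverse)
    then show False using u prime_one[OF P] by (simp add: mult_single)
  qed
  then show "f \<in> LS inN" using fB by (auto simp: LS_def B_def inN_def)
qed

sublocale V: monomial_ring B N sc S chi
proof unfold_locales
  show "is_subring B" "is_prime B N" "is_max B N" by (rule B_subring P N)+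
  show "0 \<in> S" by (auto simp: S_def zero_prod_def al_def be_def intro!: exI[of _ 0])
  show "chi 0 = 1" by (simp add: chi_def mon_0)
  show "chi k \<in> B" if "k \<in> S" for k using S_E[OF that] mon_B by metis
  show "chi k \<in> N" if k: "k \<in> S" "k \<noteq> 0" for k
  proof -
    obtain i n where 1: "inB i n" "al i n = int (snd k)" "be i n = int (fst k)" "chi k = mon i n" using S_E[OF k(1)] .
    have "(i, n) \<noteq> (0, 0)" using 1 k(2) by (auto simp: al_def be_def zero_prod_def prod_eq_iff)
    then show ?thesis using fixed 1 by simp
  qed
  show "\<exists>a. f - sc a \<in> N" if "f \<in> B" for f by (rule residue_Q_fixed[OF P tN fixed that])
  show "N \<subseteq> idl B (chi ` (S - {0}))"
  proof
    fix f assume "f \<in> N"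
    then have "f \<in> LS inN" using N_LS by blast
    have "chi ` S \<subseteq> B" using S_E mon_B by (metis image_subsetI)
    then have I: "is_ideal B (idl B (chi ` (S - {0})))" by (intro idl_ideal[OF B_subring]) auto
    note i = idealD[OF I B_subring]
    from \<open>f \<in> LS inN\<close> show "f \<in> idl B (chi ` (S - {0}))"
    proof (rule LS_induct)
      fix n x assume x: "x \<noteq> 0" "inN (v x) n"
      then have "mon (v x) n \<in> chi ` (S - {0})"
        using inB_S[of "v x" n] S_zero[of "v x" n] unfolding inN_def by (metis DiffI image_eqI singletonD)
      then have "mon (v x) n \<in> idl B (chi ` (S - {0}))" by (rule idl_self[OF _ B_subring])
      moreover have "ge (x / t powi v x) 0" using x by (simp add: ge_def v_divide)
      ultimately show "sg n x \<in> idl B (chi ` (S - {0}))"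
        using i(5)[OF const_B] sg_const_mon[of n x "v x"] by metis
    qed (use i in auto)
  qed
qed (auto simp: sc_B C.h_add C.h_mult C.h_one S_add)

text \<open>Distinct powers of \<open>t\<close> with nonzero constant coefficients have distinct
  orders, so the smallest one dominates.\<close>

lemma sum_powers:
  assumes "finite A" "A \<noteq> {}" "\<And>i. i \<in> A \<Longrightarrow> c i \<noteq> 0"
  shows "(\<Sum>i\<in>A. s (c i) * t powi i) \<noteq> 0 \<and> v (\<Sum>i\<in>A. s (c i) * t powi i) = Min A"
proof -
  define m where "m = Min A"
  have m: "m \<in> A" using assms by (simp add: m_def)
  have nz: "s (c m) * t powi m \<noteq> 0" using s_nz[OF assms(3)[OF m]] by simp
  have vm: "v (s (c m) * t powi m) = m" using s_nz[OF assms(3)[OF m]] v_s[OF assms(3)[OF m]] by (simp add: v_mult)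
  have "ge (\<Sum>i\<in>A - {m}. s (c i) * t powi i) (m + 1)"
  proof (rule ge_sum)
    fix i assume i: "i \<in> A - {m}"
    then have "m \<le> i" unfolding m_def using assms by (intro Min_le) auto
    then have "m + 1 \<le> i" using i by auto
    then show "ge (s (c i) * t powi i) (m + 1)" using i s_nz[of "c i"] v_s[of "c i"] assms(3)[of i] by (auto simp: ge_def v_mult)
  qed
  then show ?thesis using v_add_gt[OF nz] m assms(1) unfolding vm m_def[symmetric]
    by (simp add: sum.remove[of A m])
qed

lemma spow_up: "k \<in> spow S m \<Longrightarrow> l \<in> S \<Longrightarrow> k + l \<in> spow S m"
proof (induction m arbitrary: k)
  case 0
  then show ?case using S_add by simp
next
  case (Suc m)
  then obtain a b where ab: "k = a + b" "a \<in> spow S m" "b \<in> S - {0}" by auto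
  have "k + l = (a + l) + b" using ab by (simp add: algebra_simps)
  then show ?case using Suc.IH[OF ab(2) Suc.prems(2)] ab(3) unfolding spow.simps by blast
qed

text \<open>Several monomials of the sum may have the same degree in \<open>u\<close> and merge into
  one coefficient, whose order reveals only the smallest exponent of \<open>t\<close>. As the
  condition \<open>Pm\<close> persists when that exponent grows, it holds for the other monomials
  too.\<close>

lemma vertex_indep:
  assumes w: "Poly_Mapping.keys w \<subseteq> S" "V.ev w \<in> ipow B N m"
  shows "Poly_Mapping.keys w \<subseteq> spow S m"
proof -
  \<comment> \<open>Exponents whose coordinates lie in \<open>spow S m\<close>; the powers of
    \<open>N\<close> are supported on them.\<close>
  define Pm where "Pm m i n \<longleftrightarrow> inB i n \<and> (nat (be i n), nat (al i n)) \<in> spow S m" for m i n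
  have albe: "(nat (be (i + j) (n + l)), nat (al (i + j) (n + l)))
     = (nat (be i n), nat (al i n)) + (nat (be j l), nat (al j l))" if "inB i n" "inB j l" for i j n l
    using that by (simp add: inB_def al_add be_add nat_add_distrib)
  have upP: "up (Pm m)" for m unfolding up_def
  proof (intro allI impI)
    fix i j n assume P: "Pm m i n" "i \<le> j"
    have b: "inB (j - i) 0" using \<open>i \<le> j\<close> by (simp add: inB_0)
    have c: "inB i n" "(nat (be i n), nat (al i n)) \<in> spow S m" using P by (auto simp: Pm_def)
    have "(nat (be (i + (j - i)) (n + 0)), nat (al (i + (j - i)) (n + 0))) \<in> spow S m"
      unfolding albe[OF c(1) b] by (rule spow_up[OF c(2)]) (use inB_S[OF b] in blast)
    then show "Pm m j n" using inB_add[OF c(1) b] by (simp add: Pm_def)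
  qed
  have "ipow B N m \<subseteq> LS (Pm m)"
  proof (rule ipow_least[where F = "\<lambda>m. LS (Pm m)"])
    show "B \<subseteq> LS (Pm 0)" unfolding B_def by (rule LS_mono) (use inB_S in \<open>auto simp: Pm_def\<close>)
    fix n a b assume a: "a \<in> LS (Pm n)" and "b \<in> N"
    then have "b \<in> LS inN" using N_LS by blast
    with a show "a * b \<in> LS (Pm (Suc n))"
    proof (rule LS_mult[OF _ _ upP])
      fix i k j l assume *: "Pm n i k" "inN j l"
      then have "(nat (be j l), nat (al j l)) \<in> S - {0}" using inB_S S_zero unfolding inN_def by blast
      then show "Pm (Suc n) (i + j) (k + l)" using * albe[of i k j l] inB_add[of i k j l]
        unfolding Pm_def inN_def spow.simps by blast
    qed
  qed (rule LS_add[OF upP])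
  then have ev: "V.ev w \<in> LS (Pm m)" using w by blast
  show ?thesis
  proof
    fix k0 assume k0: "k0 \<in> Poly_Mapping.keys w"
    define I where "I k = (b2 * int (snd k) - a2 * int (fst k)) div D" for k
    define J where "J k = (a1 * int (fst k) - b1 * int (snd k)) div D" for k
    have chi: "chi k = mon (I k) (J k)" for k by (simp add: chi_def I_def J_def)
    have IJ: "inB (I k) (J k) \<and> al (I k) (J k) = int (snd k) \<and> be (I k) (J k) = int (fst k)" if kS: "k \<in> S" for k
    proof -
      obtain i n where *: "inB i n" "al i n = int (snd k)" "be i n = int (fst k)" "chi k = mon i n" using S_E[OF kS] .
      then have "I k = i" "J k = n" using solve[of i n] D(2) by (simp_all add: I_def J_def)
      then show ?thesis using * by simp
    qed
    define n where "n = J k0"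
    define K where "K = {k \<in> Poly_Mapping.keys w. J k = n}"
    have injI: "inj_on I K"
    proof (rule inj_onI)
      fix k l assume kl: "k \<in> K" "l \<in> K" "I k = I l"
      then have "J k = J l" "k \<in> S" "l \<in> S" using w(1) by (auto simp: K_def)
      then have "int (snd k) = int (snd l)" "int (fst k) = int (fst l)" using IJ kl(3) by metis+
      then show "k = l" by (simp add: prod_eq_iff)
    qed
    have "lk (V.ev w) n = (\<Sum>k\<in>Poly_Mapping.keys w. if J k = n then s (lk w k) * t powi (I k) else 0)"
      by (simp add: V.ev_def chi sc_def mon_def mult_single lookup_sum lookup_single when_def)
    also have "\<dots> = (\<Sum>k\<in>K. s (lk w k) * t powi (I k))"
      by (simp add: K_def sum.inter_filter)
    also have "\<dots> = (\<Sum>i\<in>I ` K. s (lk w (inv_into K I i)) * t powi i)"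
      by (simp add: sum.reindex[OF injI] inv_into_f_f[OF injI])
    finally have l: "lk (V.ev w) n = (\<Sum>i\<in>I ` K. s (lk w (inv_into K I i)) * t powi i)" .
    have "k0 \<in> K" "finite K" using k0 by (simp_all add: K_def n_def)
    then have fin: "finite (I ` K)" "I ` K \<noteq> {}" by auto
    have nz: "lk w (inv_into K I i) \<noteq> 0" if "i \<in> I ` K" for i
      using inv_into_into[OF that] by (auto simp: K_def in_keys_iff)
    have "lk (V.ev w) n \<noteq> 0" "v (lk (V.ev w) n) = Min (I ` K)"
      using sum_powers[where c = "\<lambda>i. lk w (inv_into K I i)", OF fin nz] unfolding l by simp_all
    then have "Pm m (Min (I ` K)) n" using ev by (auto simp: LS_def)
    moreover have "Min (I ` K) \<le> I k0" using fin(1) \<open>k0 \<in> K\<close> by (intro Min_le) simp_all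
    ultimately have "Pm m (I k0) (J k0)" using upP[of m] unfolding up_def n_def by blast
    then show "k0 \<in> spow S m" using IJ[of k0] k0 w(1) by (auto simp: Pm_def)
  qed
qed

text \<open>The lattice points with \<open>al = b\<close> are \<open>b\<close> times
  \<open>(p, q)\<close> plus multiples \<open>l\<close> of \<open>(- a2, a1)\<close>, and there
  \<open>be\<close> takes the values \<open>b * be p q + l * D\<close>. As \<open>e\<close> is
  \<open>- be p q\<close> modulo \<open>D\<close>, the condition on \<open>(a, b)\<close> becomes
  divisibility of \<open>a + e * b\<close> by \<open>D\<close>.\<close>

lemma S_eq_Sd:
  assumes pq: "al p q = 1" and d: "int d = D" and e: "D dvd int e + be p q"
  shows "S = Sd d e"
proof -
  have bez: "be (- a2) a1 = D" "al (- a2) a1 = 0" by (simp_all add: al_def be_def D(1) algebra_simps)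
  have "(a, b) \<in> S \<longleftrightarrow> D dvd int a + int e * int b" for a b
  proof
    assume "(a, b) \<in> S"
    then obtain i n where in': "al i n = int b" "be i n = int a" by (auto simp: S_def)
    have "al (i - int b * p) (n - int b * q) = al i n - int b * al p q" by (simp add: al_def algebra_simps)
    then have "al (i - int b * p) (n - int b * q) = 0" using in' pq by simp
    then obtain l where l: "i - int b * p = - l * a2" "n - int b * q = l * a1" using ker_al by blast
    have "i = l * (- a2) + int b * p" "n = l * a1 + int b * q" using l by (simp_all add: algebra_simps)
    then have "be i n = l * D + int b * be p q" using bez(1) by (metis be_add be_scale)
    then have "int a + int e * int b = l * D + int b * (int e + be p q)" using in' by (simp add: algebra_simps)
    then show "D dvd int a + int e * int b" using e by simp
  next
    assume "D dvd int a + int e * int b"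
    then have "D dvd (int a + int e * int b) - int b * (int e + be p q)" using e by simp
    then have "D dvd int a - int b * be p q" by (simp add: algebra_simps)
    then obtain l where l: "int a - int b * be p q = l * D" by (metis dvdE mult.commute)
    have "al (l * (- a2) + int b * p) (l * a1 + int b * q) = int b" by (simp only: al_add al_scale bez pq; simp)
    moreover have "be (l * (- a2) + int b * p) (l * a1 + int b * q) = int a"
      using l by (simp only: be_add be_scale bez; simp)
    ultimately show "(a, b) \<in> S" unfolding S_def by blast
  qed
  moreover have "D dvd int a + int e * int b \<longleftrightarrow> d dvd a + e * b" for a b
    unfolding d[symmetric] by (metis int_dvd_int_iff of_nat_add of_nat_mult)
  ultimately show ?thesis by (auto simp: Sd_def)
qed

theorem vertex_quotient:
  assumes pq: "al p q = 1" and d: "int d = D" and e: "D dvd int e + be p q" "e < d" "coprime e d"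
  shows "quotient_singularity sc B N d e"
proof -
  have S: "S = Sd d e" by (rule S_eq_Sd[OF pq d e(1)])
  have d0: "d > 0" using d D(2) by simp
  note A = V.monomial_ring_axioms[unfolded S] and B = plane.monomial_ring_axioms[of d e]
  have "\<exists>h \<in> ring_iso (completed_local_ring B N) (completed_local_ring (PS (Sd d e)) (PS (Sd d e - {0}))).
    \<forall>a. h (completed_embed sc B N a) = completed_embed (\<lambda>c. [:[:c:]:]) (PS (Sd d e)) (PS (Sd d e - {0})) a"
    by (rule monomial_completion_iso[OF A B vertex_indep[unfolded S] plane_indep])
  then show ?thesis using d0 e by (simp add: quotient_singularity_def plane_quotient_PS origin_PS)
qed

theorem vertex_singular:
  assumes pq: "al p q = 1" and d: "int d = D" and e: "D dvd int e + be p q" "coprime e d" and d2: "d \<ge> 2"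
  shows "\<not> regular_local_ring (local_ring B N)"
proof -
  have S: "S = Sd d e" by (rule S_eq_Sd[OF pq d e(1)])
  obtain r where r: "r > 0" "(r, 1) \<in> Sd d e - spow (Sd d e) (Suc (Suc 0))" using Sd_irreducible(3)[OF d2 e(2)] by blast
  show ?thesis
  proof (rule V.not_regular)
    show "(d, 0) \<in> S - spow S (Suc (Suc 0))" "(0, d) \<in> S - spow S (Suc (Suc 0))" "(r, 1) \<in> S - spow S (Suc (Suc 0))"
      unfolding S by (rule Sd_irreducible(1,2)[OF d2 e(2)] r)+
    show "krull_dim (ring_of (loc B N)) = 2" by (rule krull_dim_B[OF N tN])
  next
    fix w assume "Poly_Mapping.keys w \<subseteq> S" "V.ev w \<in> ipow B N (Suc (Suc 0))"
    then show "Poly_Mapping.keys w \<subseteq> spow S (Suc (Suc 0))" by (rule vertex_indep)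
  qed (use r d2 in \<open>simp_all add: zero_prod_def\<close>)
qed

theorem vertex_regular:
  assumes D1: "D = 1"
  shows "regular_local_ring (local_ring B N)"
proof -
  \<comment> \<open>Exponents of the basis dual to the forms \<open>al\<close> and
    \<open>be\<close>, which is integral because the determinant is 1.\<close>
  let ?X = "mon b2 (- b1)" and ?Y = "mon (- a2) a1"
  have 1: "al b2 (- b1) = 1" "be b2 (- b1) = 0" "al (- a2) a1 = 0" "be (- a2) a1 = 1"
    using D(1) D1 by (simp_all add: al_def be_def algebra_simps)
  have B: "inB b2 (- b1)" "inB (- a2) a1" using 1 by (simp_all add: inB_def)
  have XB: "?X \<in> B" and YB: "?Y \<in> B" using B mon_B by auto
  have XN: "?X \<in> N" and YN: "?Y \<in> N" using fixed[OF B(1)] fixed[OF B(2)] a1 b1 by auto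
  interpret A0: adjoin R0 ?X by unfold_locales (rule R0_subring)
  interpret A1: adjoin "adj R0 ?X" ?Y by unfold_locales (rule A0.adj_subring)
  note c = subringD[OF A1.adj_subring]
  have XA: "?X \<in> adj (adj R0 ?X) ?Y" using A0.adj_gen A1.adj_base by blast
  have dec: "mon i n = ?X ^ nat (al i n) * ?Y ^ nat (be i n)" if "inB i n" for i n
  proof -
    have "i = al i n * b2 + be i n * (- a2)" "n = al i n * (- b1) + be i n * a1"
      using solve[of i n] D1 by (simp_all add: algebra_simps)
    then show ?thesis using that by (simp add: mon_power mon_mult inB_def)
  qed
  have frac: "f \<in> adj (adj R0 ?X) ?Y" if "f \<in> B" for f
    using that unfolding B_def
  proof (rule LS_induct)
    fix n x assume x: "x \<noteq> 0" "inB (v x) n"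
    have "ge (x / t powi v x) 0" using x by (simp add: ge_def v_divide)
    then have "sg 0 (x / t powi v x) \<in> adj (adj R0 ?X) ?Y" using A0.adj_base A1.adj_base by (auto simp: R0_def)
    then show "sg n x \<in> adj (adj R0 ?X) ?Y"
      unfolding sg_const_mon[of n x "v x"] dec[OF x(2)] by (intro c(4) c(7) XA A1.adj_gen)
  qed (use c in auto)
  let ?I = "idl B {?X, ?Y}"
  have I: "is_ideal B ?I" by (rule idl_ideal[OF B_subring]) (use XB YB in auto)
  have xI: "?X \<in> ?I" "?Y \<in> ?I" by (simp_all add: idl_self[OF _ B_subring])
  \<comment> \<open>The exponent of \<open>t\<close> has the coordinates \<open>al = a1\<close> and
    \<open>be = b1\<close>. Since \<open>a1\<close> is positive, one factor \<open>?X\<close> can be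
    split off.\<close>
  have "mon 1 0 = (?X ^ (nat a1 - 1) * ?Y ^ nat b1) * ?X"
    using dec[of 1 0] a1 b1 by (simp add: al_0 be_0 inB_0 power_eq_if mult.commute mult.left_commute)
  then have tI: "1 * mon 1 0 \<in> ?I"
    using idealD(5)[OF I B_subring bc(4)[OF bc(7)[OF XB] bc(7)[OF YB]] xI(1)] by simp
  have neq: "?X \<noteq> ?Y"
  proof
    assume e: "?X = ?Y"
    have "lk ?X a1 = lk ?Y a1" using e by simp
    then show False using a1 b1 by (auto simp: mon_def lookup_single when_def split: if_splits)
  qed
  show ?thesis
  proof (rule V.two_gen_regular[OF C.ring_eval_axioms sc_B R0_subring R0_B R0_noeth XB YB _ XN YN neq _ krull_dim_B[OF N tN]])
    show "\<exists>r\<in>B - N. r * f \<in> adj (adj R0 ?X) ?Y" if "f \<in> B" for f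
      using frac[OF that] V.one_S by (intro bexI[of _ 1]) auto
    fix f assume "f \<in> R0 \<union> {?X, ?Y}"
    then consider "f \<in> R0" | "f = ?X" | "f = ?Y" by blast
    then show "\<exists>a'. \<exists>r\<in>B - N. r * (f - sc a') \<in> ?I"
    proof cases
      case 1
      then show ?thesis using R0_residue[OF I tI bc(1)] V.one_S by blast
    qed (use xI V.one_S in \<open>auto simp: C.h0 intro!: exI[of _ 0] bexI[of _ 1]\<close>)
  qed
qed

end

section \<open>Residue fields\<close>

context ring_eval
begin

lemma ep_prod: "ep y (prod f A) = (\<Prod>i\<in>A. ep y (f i))"
  by (induction A rule: infinite_finite_induct) (auto simp: ep_1 ep_mult)

end

lemma ring_eval_vector_space: "ring_eval (h :: complex \<Rightarrow> 'b::comm_ring_1) \<Longrightarrow> vector_space (\<lambda>c x. h c * x)"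
  by unfold_locales (auto simp: ring_eval.h_add ring_eval.h_mult ring_eval.h_one algebra_simps)

text \<open>If \<open>x\<close> were not congruent to a constant, the inverses of the uncountably many \<open>x - c\<close> would be
  linearly independent modulo the maximal ideal.\<close>

lemma residue_field:
  fixes h :: "complex \<Rightarrow> 'b::comm_ring_1"
  assumes h: "ring_eval h" and A: "is_subring A" and hA: "\<And>c. h c \<in> A" and M: "is_max A M"
    and G: "countable G" and AG: "A \<subseteq> module.span (\<lambda>c x. h c * x) G" and x: "x \<in> A"
  shows "\<exists>c. x - h c \<in> M"
proof (rule ccontr)
  interpret h: ring_eval h by (rule h)
  interpret V: vector_space "\<lambda>c x. h c * x" by (rule ring_eval_vector_space[OF h])
  assume n: "\<not> ?thesis"
  note m = idealD[OF max_ideal[OF M] A] and a = subringD[OF A]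
  have P: "is_prime A M" by (rule max_imp_prime[OF A M])
  have "\<exists>y\<in>A. 1 - y * (x - h c) \<in> M" for c
    using M n a(3)[OF x hA] by (auto simp: is_max_def)
  then obtain y where y: "\<And>c. y c \<in> A" "\<And>c. 1 - y c * (x - h c) \<in> M" by metis
  have unit: "h c \<notin> M" if "c \<noteq> 0" for c
  proof
    assume "h c \<in> M"
    then have "h (inverse c) * h c \<in> M" using m(5) hA by blast
    moreover have "h (inverse c) * h c = 1" using that by (simp add: h.h_mult[symmetric] h.h_one)
    ultimately show False using prime_one[OF P] by simp
  qed
  have inj: "inj y"
  proof (rule injI, rule ccontr)
    fix c d assume e: "y c = y d" "c \<noteq> d"
    have "(1 - y c * (x - h d)) - (1 - y c * (x - h c)) \<in> M" using y(2)[of c] y(2)[of d] e m(8) by metis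
    also have "(1 - y c * (x - h d)) - (1 - y c * (x - h c)) = y c * h (d - c)" by (simp add: h.h_diff algebra_simps)
    finally have "y c \<in> M" using primeD[OF P _ y(1) hA] unit[of "d - c"] e by auto
    then have "y c * (x - h c) \<in> M" using m(6)[OF a(3)[OF x hA]] by blast
    then have "1 \<in> M" using ideal_diff_cancel[OF max_ideal[OF M] A y(2)] by blast
    then show False using prime_one[OF P] by simp
  qed
  \<comment> \<open>The finite subsets of \<open>G\<close> are countably many and their spans cover
    \<open>A\<close>. So one finite-dimensional span contains uncountably many of the elements
    \<open>y c\<close>, and hence there is a linear relation among them.\<close>
  have cover: "range y \<subseteq> (\<Union>F\<in>{F. finite F \<and> F \<subseteq> G}. range y \<inter> V.span F)"
  proof
    fix z assume z: "z \<in> range y"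
    then have "z \<in> V.span G" using y(1) AG by blast
    then obtain T r where T: "finite T" "T \<subseteq> G" "z = (\<Sum>a\<in>T. h (r a) * a)" unfolding V.span_explicit by blast
    then have "z \<in> V.span T" unfolding V.span_explicit by blast
    then show "z \<in> (\<Union>F\<in>{F. finite F \<and> F \<subseteq> G}. range y \<inter> V.span F)" using T z by blast
  qed
  have "countable {F. finite F \<and> F \<subseteq> G}" using countable_Collect_finite_subset[OF G] by (simp add: conj_commute)
  moreover have "uncountable (range y)"
    using countable_image_inj_on[OF _ inj] uncountable_UNIV_complex by blast
  ultimately have "\<not> (\<forall>F\<in>{F. finite F \<and> F \<subseteq> G}. countable (range y \<inter> V.span F))"
    using countable_subset[OF cover] countable_UN[of "{F. finite F \<and> F \<subseteq> G}" "\<lambda>F. range y \<inter> V.span F"] by metis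
  then obtain F where F: "finite F" "uncountable (range y \<inter> V.span F)" by blast
  then have "infinite (range y \<inter> V.span F)" by (meson countable_finite)
  then have "V.dependent (range y \<inter> V.span F)"
    using V.independent_span_bound[OF F(1), of "range y \<inter> V.span F"] by blast
  then obtain T u where T: "finite T" "T \<subseteq> range y" "(\<Sum>v\<in>T. h (u v) * v) = 0" "\<exists>v\<in>T. u v \<noteq> 0"
    unfolding V.dependent_explicit by blast
  define C where "C = y -` T"
  have C: "finite C" "T = y ` C" using T(1,2) inj by (auto simp: C_def intro: finite_vimageI)
  have sum0: "(\<Sum>c\<in>C. h (u (y c)) * y c) = 0"
    using T(3) unfolding C(2) by (subst (asm) sum.reindex) (auto intro: inj_on_subset[OF inj])
  obtain c0 where c0: "c0 \<in> C" "u (y c0) \<noteq> 0" using T(4) C by blast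
  \<comment> \<open>Multiplying the relation by the product of all \<open>x - h d\<close> clears the
    inverses modulo \<open>M\<close> and leaves the value of \<open>p\<close> at \<open>x\<close>.
    As in Lagrange interpolation, \<open>p\<close> is nonzero because only the summand of
    \<open>c0\<close> survives at \<open>c0\<close>.\<close>
  define g where "g c = (\<Prod>d\<in>C - {c}. [:- d, 1:])" for c
  define p where "p = (\<Sum>c\<in>C. smult (u (y c)) (g c))"
  have "poly p c0 = (\<Sum>c\<in>C. if c = c0 then u (y c0) * (\<Prod>d\<in>C - {c0}. c0 - d) else 0)"
    unfolding p_def poly_sum
  proof (intro sum.cong refl)
    fix c assume c: "c \<in> C"
    have "poly (g c) c0 = (\<Prod>d\<in>C - {c}. c0 - d)" by (simp add: g_def poly_prod)
    also have "\<dots> = 0" if "c \<noteq> c0" using that c0 C by (intro prod_zero) auto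
    finally show "poly (smult (u (y c)) (g c)) c0 = (if c = c0 then u (y c0) * (\<Prod>d\<in>C - {c0}. c0 - d) else 0)"
      by (auto simp: g_def poly_prod)
  qed
  also have "\<dots> \<noteq> 0" using c0 C by auto
  finally have p0: "p \<noteq> 0" by auto
  have epg: "h.ep x (g c) \<in> A" for c unfolding g_def by (rule h.ep_in[OF A hA x])
  have "(\<Sum>c\<in>C. h (u (y c)) * h.ep x (g c) * (1 - y c * (x - h c))) \<in> M"
    by (intro ideal_sum[OF max_ideal[OF M]] m(5)[OF a(4)[OF hA epg]] y(2))
  also have "(\<Sum>c\<in>C. h (u (y c)) * h.ep x (g c) * (1 - y c * (x - h c)))
     = (\<Sum>c\<in>C. h (u (y c)) * h.ep x (g c)) - (\<Sum>c\<in>C. h (u (y c)) * y c) * (\<Prod>d\<in>C. (x - h d))"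
    unfolding sum_distrib_right sum_subtractf[symmetric]
  proof (intro sum.cong refl)
    fix c assume c: "c \<in> C"
    have "(\<Prod>d\<in>C. (x - h d)) = (x - h c) * (\<Prod>d\<in>C - {c}. (x - h d))" using c C by (simp add: prod.remove)
    also have "(\<Prod>d\<in>C - {c}. (x - h d)) = h.ep x (g c)"
      unfolding g_def h.ep_prod by (intro prod.cong refl) (simp add: h.ep_pCons h.ep_0 h.h_minus h.h_one)
    finally have e: "(\<Prod>d\<in>C. (x - h d)) = (x - h c) * h.ep x (g c)" .
    show "h (u (y c)) * h.ep x (g c) * (1 - y c * (x - h c))
      = h (u (y c)) * h.ep x (g c) - h (u (y c)) * y c * (\<Prod>d\<in>C. (x - h d))"
      unfolding e by (simp add: algebra_simps)
  qed
  also have "(\<Sum>c\<in>C. h (u (y c)) * h.ep x (g c)) = h.ep x p" by (simp add: p_def h.ep_sum h.ep_smult)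
  finally have "h.ep x p \<in> M" using sum0 by simp
  then show False using prime_linear_factor[OF h A P hA x p0] n by blast
qed

lemma exists_max_ideal:
  assumes J: "is_ideal UNIV J" "1 \<notin> J" shows "\<exists>M. is_max UNIV M \<and> J \<subseteq> M"
proof -
  let ?A = "{I. is_ideal UNIV I \<and> 1 \<notin> I \<and> J \<subseteq> I}"
  have "\<exists>M\<in>?A. \<forall>X\<in>?A. M \<subseteq> X \<longrightarrow> X = M"
  proof (rule subset_Zorn_nonempty)
    show "?A \<noteq> {}" using J by blast
    fix C assume C: "C \<noteq> {}" "subset.chain ?A C"
    then have CA: "\<And>I. I \<in> C \<Longrightarrow> is_ideal UNIV I \<and> 1 \<notin> I \<and> J \<subseteq> I" and tot: "\<And>I K. I \<in> C \<Longrightarrow> K \<in> C \<Longrightarrow> I \<subseteq> K \<or> K \<subseteq> I"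
      by (auto simp: subset_chain_def)
    have "is_ideal UNIV (\<Union>C)"
    proof (rule is_idealI)
      show "0 \<in> \<Union>C" using C(1) CA idealD(3)[OF _ subring_UNIV] by blast
      fix x y assume "x \<in> \<Union>C" "y \<in> \<Union>C"
      then obtain I K where "I \<in> C" "K \<in> C" "x \<in> I" "y \<in> K" by blast
      then show "x + y \<in> \<Union>C" using tot[of I K] CA idealD(4)[OF _ subring_UNIV] by blast
    next
      fix r x assume "x \<in> \<Union>C"
      then show "r * x \<in> \<Union>C" using CA idealD(5)[OF _ subring_UNIV] by blast
    qed simp
    then show "\<Union>C \<in> ?A" using C CA by blast
  qed
  then obtain M where M0: "M \<in> ?A" "\<forall>X\<in>?A. M \<subseteq> X \<longrightarrow> X = M" by (elim bexE)
  have M: "is_ideal UNIV M" "1 \<notin> M" "J \<subseteq> M" using M0(1) by simp_all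
  have mx: "X = M" if "is_ideal UNIV X" "1 \<notin> X" "J \<subseteq> X" "M \<subseteq> X" for X using M0(2) that by simp
  note m = idealD[OF M(1) subring_UNIV]
  have "\<exists>r. 1 - r * x \<in> M" if x: "x \<notin> M" for x
  proof (rule ccontr)
    assume n: "\<not> ?thesis"
    let ?X = "{r * x + y | r y. y \<in> M}"
    have "is_ideal UNIV ?X"
    proof (rule is_idealI)
      show "0 \<in> ?X" using m(3) by (intro CollectI exI[of _ 0]) auto
      fix a b assume "a \<in> ?X" "b \<in> ?X"
      then obtain r y r' y' where "a = r * x + y" "b = r' * x + y'" "y \<in> M" "y' \<in> M" by blast
      then show "a + b \<in> ?X" using m(4) by (intro CollectI exI[of _ "r + r'"] exI[of _ "y + y'"]) (auto simp: algebra_simps)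
    next
      fix c a assume "a \<in> ?X"
      then obtain r y where "a = r * x + y" "y \<in> M" by blast
      then show "c * a \<in> ?X" using m(5)[of c y] by (intro CollectI exI[of _ "c * r"] exI[of _ "c * y"]) (auto simp: algebra_simps)
    qed simp
    moreover have "1 \<notin> ?X"
    proof
      assume "1 \<in> ?X"
      then obtain r y where "1 = r * x + y" "y \<in> M" by blast
      then have "1 - r * x \<in> M" by (metis add_diff_cancel_left')
      then show False using n by blast
    qed
    moreover have MX: "M \<subseteq> ?X"
    proof
      fix y assume "y \<in> M"
      then show "y \<in> ?X" by (intro CollectI exI[of _ 0] exI[of _ y]) simp
    qed
    ultimately have "?X = M" using mx M(3) by blast
    moreover have "x \<in> ?X" using m(3) by (intro CollectI exI[of _ 1] exI[of _ 0]) auto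
    ultimately show False using x by blast
  qed
  then have "is_max UNIV M" using M by (simp add: is_max_def)
  then show ?thesis using M by blast
qed

section \<open>Smooth affine curves\<close>

locale curve =
  fixes s :: "complex \<Rightarrow> 'a::idom"
  assumes curve: "smooth_affine_curve s"
begin

lemma s_eval: "ring_eval s"
proof -
  have "s \<in> ring_hom (ring_of UNIV) (ring_of UNIV)" using curve by (simp add: smooth_affine_curve_def)
  then show ?thesis by unfold_locales (auto simp: ring_hom_def)
qed

sublocale s: ring_eval s by (rule s_eval)
sublocale V: vector_space "\<lambda>c x. s c * x" by (rule ring_eval_vector_space[OF s_eval])

lemma alg_induct:
  assumes "\<And>c. T (s c)" and "\<And>x y. T x \<Longrightarrow> T y \<Longrightarrow> T (x + y)" and "\<And>x y. T x \<Longrightarrow> T y \<Longrightarrow> T (x * y)"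
    and S: "generate_ring (ring_of UNIV) (range s \<union> S) = UNIV" "\<And>x. x \<in> S \<Longrightarrow> T x"
  shows "T x"
proof -
  have "x \<in> generate_ring (ring_of UNIV) (range s \<union> S)" using S by simp
  then show ?thesis
  proof (induction rule: generate_ring.induct)
    case one then show ?case using assms(1)[of 1] by (simp add: s.h_one)
  next
    case (a_inv h)
    have "T (s (- 1) * h)" using assms a_inv by blast
    then show ?case by (simp add: minus_ring_of s.h_minus s.h_one)
  qed (use assms in auto)
qed

lemma gens: obtains S where "finite S" "generate_ring (ring_of UNIV) (range s \<union> S) = UNIV"
  using curve unfolding smooth_affine_curve_def by blast

lemma countable_span: "\<exists>G. countable G \<and> V.span G = UNIV"
proof -
  obtain S where S: "finite S" "generate_ring (ring_of UNIV) (range s \<union> S) = UNIV" by (rule gens)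
  define G where "G = prod_list ` lists S"
  have "countable (lists S)" using S(1) by (intro countable_lists countable_finite)
  then have cG: "countable G" by (simp add: G_def)
  have one: "1 \<in> G" unfolding G_def by (rule image_eqI[of _ _ "[]"]) auto
  have Gm: "g * g' \<in> G" if "g \<in> G" "g' \<in> G" for g g'
  proof -
    obtain xs ys where "xs \<in> lists S" "ys \<in> lists S" "g = prod_list xs" "g' = prod_list ys" using \<open>g \<in> G\<close> \<open>g' \<in> G\<close> by (auto simp: G_def)
    then show ?thesis unfolding G_def by (intro image_eqI[of _ _ "xs @ ys"]) auto
  qed
  have m1: "g * y \<in> V.span G" if g: "g \<in> G" and y: "y \<in> V.span G" for g y
    using y
  proof (induction rule: V.span_induct_alt)
    case (step c z y)
    have "s c * (g * z) + g * y \<in> V.span G"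
      by (intro V.span_add V.span_scale V.span_base Gm g step)
    then show ?case by (simp add: algebra_simps)
  qed (simp add: V.span_zero)
  have m2: "x * y \<in> V.span G" if x: "x \<in> V.span G" and y: "y \<in> V.span G" for x y
    using x
  proof (induction rule: V.span_induct_alt)
    case (step c z x)
    have "s c * (z * y) + x * y \<in> V.span G"
      by (intro V.span_add V.span_scale m1 y step)
    then show ?case by (simp add: algebra_simps)
  qed (simp add: V.span_zero)
  have "x \<in> V.span G" for x
  proof (rule alg_induct[OF _ _ _ S(2)])
    show "s c \<in> V.span G" for c using V.span_scale[OF V.span_base[OF one], of c] by simp
    fix x assume "x \<in> S"
    then have "x \<in> G" unfolding G_def by (intro image_eqI[of _ _ "[x]"]) auto
    then show "x \<in> V.span G" by (rule V.span_base)
  qed (auto intro: V.span_add m2)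
  then show ?thesis using cG by blast
qed

lemma points_max: "(P :: 'a set) \<in> points UNIV \<longleftrightarrow> is_max UNIV P" by (rule points_iff) simp

lemma point_residue: assumes "is_max UNIV (P :: 'a set)" shows "\<exists>c. x - s c \<in> P"
proof -
  obtain G where G: "countable G" "V.span G = UNIV" using countable_span by blast
  show ?thesis by (rule residue_field[OF s_eval subring_UNIV _ assms G(1)]) (auto simp: G(2))
qed

lemma s_unit: assumes "is_prime UNIV (P :: 'a set)" "c \<noteq> 0" shows "s c \<notin> P"
proof
  assume "s c \<in> P"
  then have "s (inverse c) * s c \<in> P" using idealD(5)[OF prime_ideal[OF assms(1)] subring_UNIV] by blast
  moreover have "s (inverse c) * s c = 1" using assms by (simp add: s.h_mult[symmetric] s.h_one)
  ultimately show False using prime_one[OF assms(1)] by simp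
qed

text \<open>Modulo the ideal generated by the elements \<open>x - s (c x)\<close>, with
  \<open>x\<close> among the algebra generators, every function is constant, and a constant in
  \<open>P\<close> is 0.\<close>

lemma point_fg: assumes P: "is_max UNIV (P :: 'a set)" shows "\<exists>A. finite A \<and> P = idl UNIV A"
proof -
  obtain S where S: "finite S" "generate_ring (ring_of UNIV) (range s \<union> S) = UNIV" by (rule gens)
  obtain c where c: "\<And>x. x - s (c x) \<in> P" using point_residue[OF P] by metis
  let ?A = "(\<lambda>x. x - s (c x)) ` S"
  let ?I = "idl UNIV ?A"
  have I: "is_ideal UNIV ?I" by (rule idl_ideal) auto
  note i = idealD[OF I subring_UNIV]
  have IP: "?I \<subseteq> P" by (rule idl_least[OF subring_UNIV max_ideal[OF P]]) (use c in auto)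
  have T: "\<exists>a. x - s a \<in> ?I" for x
  proof (rule alg_induct[OF _ _ _ S(2)])
    show "\<exists>a. s c - s a \<in> ?I" for c using i(3) by (intro exI[of _ c]) simp
    show "\<exists>a. x - s a \<in> ?I" if "x \<in> S" for x
      using that by (intro exI[of _ "c x"] idl_self) auto
  next
    fix x y assume "\<exists>a. x - s a \<in> ?I" "\<exists>a. y - s a \<in> ?I"
    then obtain a b where ab: "x - s a \<in> ?I" "y - s b \<in> ?I" by blast
    have "(x - s a) + (y - s b) \<in> ?I" by (rule i(4)[OF ab])
    then show "\<exists>a. x + y - s a \<in> ?I" by (intro exI[of _ "a + b"]) (simp add: s.h_add algebra_simps)
    have "x * (y - s b) + s b * (x - s a) \<in> ?I" by (rule i(4)[OF i(5)[OF UNIV_I ab(2)] i(5)[OF UNIV_I ab(1)]])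
    then show "\<exists>a. x * y - s a \<in> ?I" by (intro exI[of _ "a * b"]) (simp add: s.h_mult algebra_simps)
  qed
  have "P \<subseteq> ?I"
  proof
    fix x assume x: "x \<in> P"
    obtain a where a: "x - s a \<in> ?I" using T by blast
    then have "s a \<in> P" using ideal_diff_cancel[OF max_ideal[OF P] subring_UNIV, of x "s a"] IP x by blast
    then have "a = 0" using s_unit[OF max_imp_prime[OF subring_UNIV P]] by blast
    then show "x \<in> ?I" using a by (simp add: s.h0)
  qed
  then show ?thesis using IP S(1) by (intro exI[of _ ?A]) auto
qed

text \<open>Otherwise the coordinate ring would be a field, against the chain of two primes that
  dimension one provides.\<close>

lemma point_nonzero: assumes P: "is_max UNIV (P :: 'a set)" shows "P \<noteq> {0}"
proof
  assume z: "P = {0}"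
  have "krull_dim (ring_of (UNIV :: 'a set)) = enat (Suc 0)"
    using curve by (simp add: smooth_affine_curve_def one_enat_def)
  then obtain Q where "prime_chain (UNIV :: 'a set) (Suc 0) Q" using krull_dim_chain[OF subring_UNIV] by blast
  then have Q: "is_prime UNIV (Q 0)" "is_prime UNIV (Q 1)" "Q 0 \<subset> Q 1" by (auto simp: prime_chain_def)
  then obtain x where "x \<in> Q 1" "x \<notin> Q 0" by blast
  then have "x \<notin> P" using z idealD(3)[OF prime_ideal[OF Q(1)] subring_UNIV] by auto
  then obtain r where "1 - r * x \<in> P" using P by (auto simp: is_max_def)
  then have "1 = r * x" using z by simp
  then have "1 \<in> Q 1" using idealD(5)[OF prime_ideal[OF Q(2)] subring_UNIV UNIV_I \<open>x \<in> Q 1\<close>, of r] by simp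
  then show False using prime_one[OF Q(2)] by simp
qed

end

section \<open>The discrete valuation at a point of the curve\<close>

locale curve_point = curve s + max_localization UNIV P for s :: "complex \<Rightarrow> 'a::idom" and P :: "'a set"
begin

lemma regular: "regular_local_ring (ring_of L)"
proof -
  have "P \<in> points UNIV" using points_max Mx by simp
  moreover have "Sing (UNIV :: 'a set) = {}" using curve by (simp add: smooth_affine_curve_def)
  ultimately show ?thesis unfolding Sing_def local_ring_eq by blast
qed

lemma noeth_L: "noeth L" using regular noeth_ring_of[OF L_subring] by (simp add: regular_local_ring_def)

lemma dim1: "krull_dim (ring_of L) = enat 1"
proof -
  have z: "is_prime UNIV {0 :: 'a}" by (auto simp: is_prime_def is_ideal_def)
  have "{0} \<subset> P" using point_nonzero[OF Mx] mc(3) by auto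
  then have "prime_chain UNIV 1 (\<lambda>i. if i = 0 then {0} else P)" using z M by (auto simp: prime_chain_def)
  then have "prime_chain L 1 (\<lambda>i. ext (if i = 0 then {0} else P))"
    by (rule loc_chain_ext) (use mc(3) in auto)
  moreover have "\<not> prime_chain L (Suc 1) Q" for Q
  proof
    assume "prime_chain L (Suc 1) Q"
    then have "prime_chain UNIV (Suc 1) (\<lambda>i. contr (Q i))" by (rule loc_chain_contr)
    moreover have "krull_dim (ring_of (UNIV :: 'a set)) = enat 1"
      using curve by (simp add: smooth_affine_curve_def one_enat_def)
    ultimately show False using krull_dim_no_chain[OF subring_UNIV] by blast
  qed
  ultimately show ?thesis by (rule krull_dim_eqI[OF L_subring])
qed

text \<open>Regularity in dimension one gives a maximal ideal with one generator. Its denominator is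
  dropped, so that the parameter comes from the coordinate ring and lies in the graded algebra in
  degree 0.\<close>

lemma uniformizer: "\<exists>t\<in>P. mm = idl L {F t 1}"
proof -
  obtain m S where S: "{I. maximalideal I (local_ring UNIV P)} = {m}" "finite S" "S \<subseteq> L" "m = idl L S" "enat (card S) = enat 1"
    using regular dim1 unfolding regular_local_ring_def local_ring_eq by auto
  then have "m = mm" using unique_max by auto
  obtain x where x: "S = {x}" using S(5) by (auto simp: card_1_singleton_iff one_enat_def)
  then have xm: "x \<in> mm" "mm = idl L {x}" "x \<in> L" using S \<open>m = mm\<close> idl_self[OF _ L_subring, of x "{x}"] by auto
  then obtain a b where ab: "x = F a b" "a \<in> P" "b \<in> UNIV - P" "b \<noteq> 0" unfolding mm_ext by (metis extE)
  have ax: "F a 1 = F b 1 * x" "x = F 1 b * F a 1" using ab by (auto simp: eq_fract)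
  have aL: "F a 1 \<in> L" by (rule loc1) simp
  have "idl L {F a 1} = idl L {x}"
  proof
    show "idl L {F a 1} \<subseteq> idl L {x}"
    proof (rule idl_least[OF L_subring idl_ideal[OF L_subring]])
      show "{F a 1} \<subseteq> idl L {x}" unfolding ax(1) idl_single[OF L_subring xm(3)] using loc1[of b] by auto
    qed (use xm in auto)
    show "idl L {x} \<subseteq> idl L {F a 1}"
    proof (rule idl_least[OF L_subring idl_ideal[OF L_subring]])
      show "{x} \<subseteq> idl L {F a 1}" unfolding idl_single[OF L_subring aL] using ax(2) locI[of 1 b] ab(3) by blast
    qed (use aL in auto)
  qed
  then show ?thesis using xm ab by auto
qed

definition tt :: 'a where "tt = (SOME t. t \<in> P \<and> mm = idl L {F t 1})"
abbreviation "T \<equiv> F tt 1"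

lemma tt: "tt \<in> P" "mm = idl L {T}"
  using someI_ex[of "\<lambda>t. t \<in> P \<and> mm = idl L {F t 1}"] uniformizer unfolding tt_def by blast+

lemma T_L: "T \<in> L" by (rule loc1) simp
lemma mm_T: "x \<in> mm \<longleftrightarrow> (\<exists>y\<in>L. x = y * T)" unfolding tt(2) idl_single[OF L_subring T_L] by auto
lemma T_mm: "T \<in> mm" using F1_mem_mm tt by simp
lemma T_nz: "T \<noteq> 0"
proof
  assume "T = 0"
  then have "mm = {0}" using mm_T idealD(3)[OF prime_ideal[OF mm_prime] L_subring] by auto
  obtain x where "x \<in> P" "x \<noteq> 0" using point_nonzero[OF Mx] mc(3) by blast
  then have "F x 1 \<in> mm" "F x 1 \<noteq> 0" using F1_mem_mm F_eq0[of 1] by auto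
  then show False using \<open>mm = {0}\<close> by auto
qed

lemmas lc = subringD[OF L_subring]
lemmas mmc = idealD[OF prime_ideal[OF mm_prime] L_subring]

lemma unit_inverse: "u \<in> L - mm \<Longrightarrow> inverse u \<in> L - mm"
proof -
  assume u: "u \<in> L - mm"
  then have "inverse u \<in> L" "u \<noteq> 0" using inverse_L mmc(3) by auto
  moreover have "inverse u \<notin> mm"
  proof
    assume "inverse u \<in> mm"
    then have "u * inverse u \<in> mm" using u mmc(5) by blast
    then show False using \<open>u \<noteq> 0\<close> prime_one[OF mm_prime] by simp
  qed
  ultimately show ?thesis by simp
qed

lemma unit_mult: "u \<in> L - mm \<Longrightarrow> w \<in> L - mm \<Longrightarrow> u * w \<in> L - mm"
  using lc(4) primeD[OF mm_prime] by blast

text \<open>If all \<open>f / T ^ n\<close> were in the local ring, the ascending ideals they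
  generate would stop at some \<open>m\<close> by noetherianity, and
  \<open>f / T ^ Suc m = y * (f / T ^ m)\<close> would make \<open>T\<close> a unit.\<close>

lemma krull_intersection: assumes f: "f \<in> L" "f \<noteq> 0" shows "\<exists>n. f / T ^ n \<in> L \<and> f / T ^ Suc n \<notin> L"
proof (rule ccontr)
  assume "\<not> ?thesis"
  then have st: "f / T ^ n \<in> L \<Longrightarrow> f / T ^ Suc n \<in> L" for n by blast
  have all: "f / T ^ n \<in> L" for n by (induction n) (use f st in auto)
  define J where "J = {y * (f / T ^ n) | y n. y \<in> L}"
  have mono: "\<exists>y\<in>L. f / T ^ n = y * (f / T ^ m)" if "n \<le> m" for n m
  proof
    have "T ^ m = T ^ (m - n) * T ^ n" using that by (simp add: power_add[symmetric])
    then show "f / T ^ n = T ^ (m - n) * (f / T ^ m)" using T_nz by simp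
    show "T ^ (m - n) \<in> L" using lc(7)[OF T_L] .
  qed
  have J: "is_ideal L J"
  proof (rule is_idealI)
    show "J \<subseteq> L" using all lc(4) unfolding J_def by blast
    show "0 \<in> J" using lc(2) unfolding J_def by (intro CollectI exI[of _ 0]) simp
    fix a b assume "a \<in> J" "b \<in> J"
    then obtain y n z m where *: "a = y * (f / T ^ n)" "b = z * (f / T ^ m)" "y \<in> L" "z \<in> L" by (auto simp: J_def)
    obtain p q where pq: "p \<in> L" "f / T ^ n = p * (f / T ^ max n m)" "q \<in> L" "f / T ^ m = q * (f / T ^ max n m)"
      using mono[of n "max n m"] mono[of m "max n m"] by auto
    have "a + b = (y * p + z * q) * (f / T ^ max n m)" unfolding *(1,2) pq(2,4) by (simp only: distrib_right mult.assoc)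
    then show "a + b \<in> J" using * pq lc(4,6) unfolding J_def by blast
  next
    fix r a assume "r \<in> L" "a \<in> J"
    then obtain y n where *: "a = y * (f / T ^ n)" "y \<in> L" by (auto simp: J_def)
    then have "r * a = (r * y) * (f / T ^ n)" by (simp only: mult.assoc)
    then show "r * a \<in> J" using \<open>r \<in> L\<close> * lc(4) unfolding J_def by blast
  qed
  then obtain A where A: "A \<subseteq> L" "finite A" "J = idl L A" using noeth_L unfolding noeth_def by blast
  have "A \<subseteq> J" using A idl_self[OF _ L_subring] by auto
  then have "\<forall>a\<in>A. \<exists>n. \<exists>y\<in>L. a = y * (f / T ^ n)" unfolding J_def by blast
  then obtain e where e: "\<And>a. a \<in> A \<Longrightarrow> \<exists>y\<in>L. a = y * (f / T ^ e a)" by metis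
  define m where "m = Max (insert 0 (e ` A))"
  have "A \<subseteq> idl L {f / T ^ m}"
  proof
    fix a assume a: "a \<in> A"
    obtain y where y: "y \<in> L" "a = y * (f / T ^ e a)" using e[OF a] by blast
    have "e a \<le> m" unfolding m_def using a A by (intro Max_ge) auto
    then obtain z where "z \<in> L" "f / T ^ e a = z * (f / T ^ m)" using mono by blast
    then show "a \<in> idl L {f / T ^ m}" unfolding idl_single[OF L_subring all] using y lc(4)
      by (intro CollectI exI[of _ "y * z"]) (auto simp: mult.assoc)
  qed
  then have "J \<subseteq> idl L {f / T ^ m}" unfolding A(3)
    by (intro idl_least[OF L_subring idl_ideal[OF L_subring]]) (use all in auto)
  moreover have "f / T ^ Suc m \<in> J" unfolding J_def using lc(1) by (intro CollectI exI[of _ 1] exI[of _ "Suc m"]) auto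
  ultimately obtain y where y: "y \<in> L" "f / T ^ Suc m = y * (f / T ^ m)" unfolding idl_single[OF L_subring all] by blast
  then have "1 = y * T" using T_nz f(2) by (simp add: field_simps)
  then have "1 \<in> mm" using mm_T y by blast
  then show False using prime_one[OF mm_prime] by simp
qed

lemma factor_L: assumes f: "f \<in> L" "f \<noteq> 0" shows "\<exists>n::nat. \<exists>u\<in>L - mm. f = T ^ n * u"
proof -
  obtain n where n: "f / T ^ n \<in> L" "f / T ^ Suc n \<notin> L" using krull_intersection[OF f] by blast
  have "f / T ^ n \<notin> mm"
  proof
    assume "f / T ^ n \<in> mm"
    then obtain y where "y \<in> L" "f / T ^ n = y * T" using mm_T by blast
    then have "f / T ^ Suc n = y" using T_nz by (simp add: field_simps)
    then show False using n \<open>y \<in> L\<close> by simp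
  qed
  then show ?thesis using n T_nz by (intro exI[of _ n] bexI[of _ "f / T ^ n"]) auto
qed

lemma factor: assumes "f \<noteq> 0" shows "\<exists>n::int. \<exists>u\<in>L - mm. f = T powi n * u"
proof -
  obtain a b where ab: "f = F a b" "b \<noteq> 0" by (cases f) auto
  then have f: "f = F a 1 / F b 1" "a \<noteq> 0" using assms by (auto simp: F_eq0)
  have "F a 1 \<noteq> 0" "F b 1 \<noteq> 0" using ab f by (simp_all add: F_eq0)
  then obtain n m :: nat and u w where *: "u \<in> L - mm" "F a 1 = T ^ n * u" "w \<in> L - mm" "F b 1 = T ^ m * w"
    using factor_L[OF loc1] by (metis UNIV_I)
  have "f = T powi (int n - int m) * (u * inverse w)"
    unfolding f(1) *(2,4) using T_nz by (simp add: power_int_diff field_simps)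
  then show ?thesis using unit_mult[OF *(1) unit_inverse[OF *(3)]] by blast
qed

lemma unit_nz: "u \<in> L - mm \<Longrightarrow> u \<noteq> 0" using mmc(3) by auto

lemma factor_unique_aux: assumes "T powi n * u = T powi m * w" "u \<in> L - mm" "w \<in> L - mm" shows "\<not> n < m"
proof
  assume nm: "n < m"
  define k where "k = nat (m - n)"
  have k: "m = n + int k" "k > 0" using nm by (simp_all add: k_def)
  have "u = T ^ k * w" using assms T_nz unfolding k by (simp add: power_int_add)
  also have "T ^ k = T * T ^ (k - 1)" using k(2) by (simp add: power_eq_if)
  finally have "u = (T ^ (k - 1) * w) * T" by (simp add: ac_simps)
  then have "u \<in> mm" using mm_T lc(4)[OF lc(7)[OF T_L]] assms(3) by blast
  then show False using assms by simp
qed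

lemma Units_L: "Units (ring_of L) = L - mm"
proof
  show "Units (ring_of L) \<subseteq> L - mm"
  proof
    fix x assume "x \<in> Units (ring_of L)"
    then obtain y where "x \<in> L" "y \<in> L" "y * x = 1" by (auto simp: Units_def)
    then show "x \<in> L - mm" using mmc(5) prime_one[OF mm_prime] by (metis DiffI)
  qed
  show "L - mm \<subseteq> Units (ring_of L)"
  proof
    fix x assume x: "x \<in> L - mm"
    then have "inverse x * x = 1" "x * inverse x = 1" using unit_nz by auto
    then show "x \<in> Units (ring_of L)" using x unit_inverse[OF x] by (auto simp: Units_def)
  qed
qed

lemma cgenideal_L: "t \<in> L \<Longrightarrow> PIdl\<^bsub>ring_of L\<^esub> t = idl L {t}"
  unfolding idl_single[OF L_subring] cgenideal_def by auto

text \<open>The definition of \<open>ord_at\<close> ranges over all local parameters. Any two of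
  them differ by a unit, so the exponent agrees with the one for the chosen
  \<open>T\<close>.\<close>

lemma ord_eq: assumes u: "u \<in> L - mm" shows "ord_at P (T powi n * u) = n"
  unfolding ord_at_def local_ring_eq
proof (rule the_equality)
  show "\<exists>t v. t \<in> carrier (ring_of L) \<and> PIdl\<^bsub>ring_of L\<^esub> t = mm \<and> v \<in> Units (ring_of L) \<and> T powi n * u = t powi n * v"
    using T_L tt(2)[symmetric] cgenideal_L[OF T_L] u unfolding Units_L by (intro exI[of _ T] exI[of _ u] conjI) simp_all
  fix m assume "\<exists>t v. t \<in> carrier (ring_of L) \<and> PIdl\<^bsub>ring_of L\<^esub> t = mm \<and> v \<in> Units (ring_of L) \<and> T powi n * u = t powi m * v"
  then obtain t w where t: "t \<in> L" "idl L {t} = mm" "w \<in> L - mm" "T powi n * u = t powi m * w"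
    unfolding Units_L using cgenideal_L by auto
  have "t \<in> mm" using t idl_self[OF _ L_subring, of t "{t}"] by simp
  then obtain y where y: "y \<in> L" "t = y * T" using mm_T by blast
  have "T \<in> idl L {t}" using t T_mm by simp
  then obtain z where z: "z \<in> L" "T = z * t" unfolding idl_single[OF L_subring t(1)] by blast
  have zy: "z * y = 1" using y z T_nz by (metis mult.assoc mult_cancel_right2)
  then have yu: "y \<in> L - mm" using y z mmc(5)[OF z(1), of y] prime_one[OF mm_prime] by auto
  have ypow: "y powi k \<in> L - mm" for k :: int
  proof -
    have p: "x ^ j \<in> L - mm" if x: "x \<in> L - mm" for x and j :: nat
    proof (induction j)
      case (Suc j)
      then show ?case using unit_mult[OF x] by simp
    qed (use lc(1) prime_one[OF mm_prime] in simp)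
    show ?thesis using p[OF yu] p[OF unit_inverse[OF yu]] by (auto simp: power_int_def)
  qed
  have "T powi n * u = T powi m * (y powi m * w)" using t(4) y by (simp add: power_int_mult_distrib ac_simps)
  then show "m = n"
    using factor_unique_aux[OF _ u unit_mult[OF ypow t(3)]] factor_unique_aux[OF _ unit_mult[OF ypow t(3)] u] 
    by (metis linorder_neqE)
qed

lemma ord_rep: assumes "f \<noteq> 0" shows "\<exists>u\<in>L - mm. f = T powi (ord_at P f) * u"
  using factor[OF assms] ord_eq by metis

lemma ord_ge0: assumes "f \<noteq> 0" shows "f \<in> L \<longleftrightarrow> ord_at P f \<ge> 0"
proof
  obtain u where u: "u \<in> L - mm" "f = T powi (ord_at P f) * u" using ord_rep[OF assms] by blast
  show "ord_at P f \<ge> 0" if "f \<in> L"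
  proof -
    obtain n :: nat and w where w: "w \<in> L - mm" "f = T powi (int n) * w" using factor_L[OF \<open>f \<in> L\<close> assms] by auto
    show ?thesis unfolding w(2) ord_eq[OF w(1)] by simp
  qed
  show "f \<in> L" if "ord_at P f \<ge> 0"
  proof -
    have "T powi (ord_at P f) = T ^ nat (ord_at P f)" using that by (simp add: power_int_def)
    then show ?thesis using u lc(4)[OF lc(7)[OF T_L]] by (metis DiffD1)
  qed
qed

lemma ord_mult: assumes "f \<noteq> 0" "g \<noteq> 0" shows "ord_at P (f * g) = ord_at P f + ord_at P g"
proof -
  obtain u w where *: "u \<in> L - mm" "f = T powi (ord_at P f) * u" "w \<in> L - mm" "g = T powi (ord_at P g) * w"
    using ord_rep assms by meson
  have "f * g = (T powi (ord_at P f) * u) * (T powi (ord_at P g) * w)" using *(2,4) by simp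
  also have "\<dots> = T powi (ord_at P f + ord_at P g) * (u * w)"
    using T_nz by (simp add: power_int_add ac_simps)
  finally show ?thesis using ord_eq[OF unit_mult[OF *(1,3)]] by simp
qed

lemma ord_T: "ord_at P T = 1" using ord_eq[of 1 1] lc(1) prime_one[OF mm_prime] by simp

lemma ord_unit: "u \<in> L - mm \<Longrightarrow> ord_at P u = 0" using ord_eq[of u 0] by simp

lemma ord_mm: assumes "f \<noteq> 0" shows "f \<in> mm \<longleftrightarrow> ord_at P f \<ge> 1"
proof
  assume "f \<in> mm"
  then obtain y where y: "y \<in> L" "f = y * T" using mm_T by blast
  then have "y \<noteq> 0" using assms by auto
  then show "ord_at P f \<ge> 1" using y ord_mult[OF _ T_nz, of y] ord_T ord_ge0[of y] by simp
next
  assume o: "ord_at P f \<ge> 1"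
  then show "f \<in> mm" using ord_ge0[OF assms] ord_unit[of f] by fastforce
qed

lemma ord_add: assumes "f \<noteq> 0" "g \<noteq> 0" "f + g \<noteq> 0" shows "min (ord_at P f) (ord_at P g) \<le> ord_at P (f + g)"
proof -
  define m where "m = min (ord_at P f) (ord_at P g)"
  have Tm: "T powi k \<noteq> 0" for k using T_nz by simp
  have ordT: "ord_at P (T powi k) = k" for k using ord_eq[of 1 k] lc(1) prime_one[OF mm_prime] by simp
  have div: "ord_at P (h * T powi (- m)) = ord_at P h - m" if "h \<noteq> 0" for h
    using ord_mult[OF that Tm, of "- m"] ordT by simp
  have "f * T powi (- m) \<in> L" "g * T powi (- m) \<in> L"
    using ord_ge0[of "f * T powi (- m)"] ord_ge0[of "g * T powi (- m)"] div assms Tm by (auto simp: m_def)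
  then have "(f + g) * T powi (- m) \<in> L" using lc(6) by (simp add: distrib_right)
  then have "0 \<le> ord_at P (f + g) - m" using ord_ge0[of "(f + g) * T powi (- m)"] div[OF assms(3)] assms(3) Tm by simp
  then show ?thesis by (simp add: m_def)
qed

lemma ord_F: assumes "a \<noteq> 0" shows "ord_at P (F a 1) \<ge> 0" "a \<in> P \<longleftrightarrow> ord_at P (F a 1) \<ge> 1"
proof -
  have "F a 1 \<noteq> 0" using assms by (simp add: F_eq0)
  then show "ord_at P (F a 1) \<ge> 0" "a \<in> P \<longleftrightarrow> ord_at P (F a 1) \<ge> 1"
    using ord_ge0 loc1 ord_mm F1_mem_mm by auto
qed

lemma residue_L: assumes "f \<in> L" shows "\<exists>c. f - F (s c) 1 \<in> mm"
proof -
  obtain r where r: "f - F r 1 \<in> ipow L mm (Suc 0)" using loc_approx[OF assms] by blast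
  obtain a where a: "r - s a \<in> P" using point_residue[OF Mx] by blast
  have "F (r - s a) 1 \<in> mm" using F1_mem_mm[of "r - s a"] a by blast
  then have "F r 1 - F (s a) 1 \<in> mm" by simp
  moreover have "f - F r 1 \<in> mm" using r ipow_1[OF L_subring prime_ideal[OF mm_prime]] by simp
  ultimately have "(f - F r 1) + (F r 1 - F (s a) 1) \<in> mm" by (intro mmc(4))
  then show ?thesis unfolding diff_telescope by blast
qed

lemma cdvr: "cdvr (ord_at P) T (\<lambda>c. F (s c) 1)"
proof
  show "ord_at P (F (s a) 1) = 0" if "a \<noteq> 0" for a
  proof -
    have "F (s a) 1 \<in> L - mm" using F1_mem_mm[of "s a"] loc1[of "s a"] s_unit[OF M that] by simp
    then show ?thesis by (rule ord_unit)
  qed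
  show "\<exists>a. x = F (s a) 1 \<or> 1 \<le> ord_at P (x - F (s a) 1)" if "x \<noteq> 0" "0 \<le> ord_at P x" for x
  proof -
    obtain c where "x - F (s c) 1 \<in> mm" using residue_L ord_ge0 \<open>x \<noteq> 0\<close> \<open>0 \<le> ord_at P x\<close> by blast
    then show ?thesis using ord_mm[of "x - F (s c) 1"] by (intro exI[of _ c]) auto
  qed
qed (auto simp: ord_mult ord_add ord_T T_nz s.h_add s.h_mult s.h_one One_fract_def[symmetric])

end

section \<open>Rational functions with prescribed poles\<close>

context curve
begin

abbreviation "FF \<equiv> Fraction_Field.Fract"

lemma cp: "is_max UNIV P \<Longrightarrow> curve_point s P"
  by unfold_locales (auto intro: max_imp_prime[OF subring_UNIV])

lemma ord_cdvr: assumes "is_max UNIV (P :: 'a set)" shows "\<exists>t. cdvr (ord_at P) t (\<lambda>c. FF (s c) 1)"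
  using curve_point.cdvr[OF cp[OF assms]] by blast

lemma ord_facts:
  fixes P :: "'a set"
  assumes P: "is_max UNIV P"
  shows "x \<noteq> 0 \<Longrightarrow> y \<noteq> 0 \<Longrightarrow> ord_at P (x * y) = ord_at P x + ord_at P y"
    and "x \<noteq> 0 \<Longrightarrow> y \<noteq> 0 \<Longrightarrow> ord_at P (x / y) = ord_at P x - ord_at P y"
    and "x \<noteq> 0 \<Longrightarrow> ord_at P (x ^ n) = int n * ord_at P x"
    and "a \<noteq> 0 \<Longrightarrow> 0 \<le> ord_at P (FF a 1)"
    and "a \<noteq> 0 \<Longrightarrow> a \<in> P \<longleftrightarrow> 1 \<le> ord_at P (FF a 1)"
    and "a \<noteq> 0 \<Longrightarrow> a \<notin> P \<Longrightarrow> ord_at P (FF a 1) = 0"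
proof -
  obtain t where "cdvr (ord_at P) t (\<lambda>c. FF (s c) 1)" using ord_cdvr[OF P] by blast
  then interpret D: cdvr "ord_at P" t "\<lambda>c. FF (s c) 1" .
  show "x \<noteq> 0 \<Longrightarrow> y \<noteq> 0 \<Longrightarrow> ord_at P (x * y) = ord_at P x + ord_at P y" by (rule D.v_mult)
  show "x \<noteq> 0 \<Longrightarrow> y \<noteq> 0 \<Longrightarrow> ord_at P (x / y) = ord_at P x - ord_at P y" by (rule D.v_divide)
  show "x \<noteq> 0 \<Longrightarrow> ord_at P (x ^ n) = int n * ord_at P x" by (rule D.v_power)
  show "a \<noteq> 0 \<Longrightarrow> 0 \<le> ord_at P (FF a 1)" "a \<noteq> 0 \<Longrightarrow> a \<in> P \<longleftrightarrow> 1 \<le> ord_at P (FF a 1)"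
    using curve_point.ord_F[OF cp[OF P]] by blast+
  then show "a \<noteq> 0 \<Longrightarrow> a \<notin> P \<Longrightarrow> ord_at P (FF a 1) = 0" by fastforce
qed

lemma FF_eq0: "FF a 1 = 0 \<longleftrightarrow> a = 0" by (simp add: Zero_fract_def eq_fract)

lemma max_subset_eq: "is_max UNIV P \<Longrightarrow> is_max UNIV Q \<Longrightarrow> P \<subseteq> Q \<Longrightarrow> P = Q" for P Q :: "'a set"
  using max_maximal[OF subring_UNIV, of P Q] by (auto simp: is_max_def)

text \<open>The denominators \<open>b\<close> that make \<open>FF b 1 * f\<close> a function on the
  curve form an ideal. A maximal ideal above it would contradict regularity of \<open>f\<close> at
  that point, so 1 is such a denominator.\<close>

lemma global_regular:
  fixes f :: "'a fract"
  assumes f: "f \<noteq> 0" and reg: "\<And>P. is_max UNIV P \<Longrightarrow> 0 \<le> ord_at P f"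
  shows "\<exists>a. f = FF a 1"
proof -
  define J where "J = {b. \<exists>a. FF b 1 * f = FF a 1}"
  have J: "is_ideal UNIV J"
  proof (rule is_idealI)
    have "FF 0 1 * f = FF 0 1" by (simp add: Zero_fract_def[symmetric])
    then show "0 \<in> J" unfolding J_def by blast
    fix x y assume "x \<in> J" "y \<in> J"
    then obtain a b where "FF x 1 * f = FF a 1" "FF y 1 * f = FF b 1" by (auto simp: J_def)
    moreover have "FF (x + y) 1 * f = FF x 1 * f + FF y 1 * f" by (simp add: distrib_right[symmetric])
    ultimately have "FF (x + y) 1 * f = FF (a + b) 1" by simp
    then show "x + y \<in> J" unfolding J_def by blast
  next
    fix r x assume "x \<in> J"
    then obtain a where "FF x 1 * f = FF a 1" by (auto simp: J_def)
    moreover have "FF (r * x) 1 * f = FF r 1 * (FF x 1 * f)" by (simp add: mult.assoc[symmetric])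
    ultimately have "FF (r * x) 1 * f = FF (r * a) 1" by simp
    then show "r * x \<in> J" unfolding J_def by blast
  qed simp
  show ?thesis
  proof (cases "1 \<in> J")
    case True
    then show ?thesis by (auto simp: J_def One_fract_def[symmetric])
  next
    case False
    then obtain P where P: "is_max UNIV P" "J \<subseteq> P" using exists_max_ideal[OF J] by blast
    interpret C: curve_point s P by (rule cp[OF P(1)])
    have "f \<in> C.L" using C.ord_ge0[OF f] reg[OF P(1)] by simp
    then obtain a b where ab: "f = FF a b" "b \<in> UNIV - P" "b \<noteq> 0" by (metis C.locE)
    have "FF b 1 * f = FF a 1" using ab by (simp add: eq_fract)
    then have "b \<in> J" by (auto simp: J_def)
    then show ?thesis using ab P by blast
  qed
qed

text \<open>The function is \<open>r / tt\<close>, where \<open>r\<close> is a unit at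
  \<open>P\<close> that carries \<open>P\<close> into the multiples of \<open>tt\<close>; such an
  \<open>r\<close> exists because \<open>P\<close> is finitely generated. At another point
  \<open>Q\<close> some \<open>p\<close> in \<open>P\<close> is a unit, and
  \<open>r / tt = y / p\<close> has no pole there.\<close>

lemma simple_pole:
  fixes P :: "'a set"
  assumes P: "is_max UNIV P"
  shows "\<exists>f. f \<noteq> 0 \<and> ord_at P f = -1 \<and> (\<forall>Q. is_max UNIV Q \<longrightarrow> Q \<noteq> P \<longrightarrow> 0 \<le> ord_at Q f)"
proof -
  interpret C: curve_point s P by (rule cp[OF P])
  obtain A where A: "finite A" "P = idl UNIV A" using point_fg[OF P] by blast
  have "\<exists>q y. q \<notin> P \<and> q * p = C.tt * y" if p: "p \<in> P" for p
  proof -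
    have "FF p 1 \<in> C.mm" using C.F1_mem_mm p by simp
    then obtain w where w: "w \<in> C.L" "FF p 1 = w * C.T" using C.mm_T by blast
    then obtain y q where yq: "w = FF y q" "q \<in> UNIV - P" "q \<noteq> 0" by (metis C.locE)
    then have "p * q = y * C.tt" using w(2) by (simp add: eq_fract)
    then show ?thesis using yq by (intro exI[of _ q] exI[of _ y]) (auto simp: mult.commute)
  qed
  then obtain q where q: "\<And>p. p \<in> P \<Longrightarrow> q p \<notin> P \<and> (\<exists>y. q p * p = C.tt * y)" by metis
  have AP: "A \<subseteq> P" using A idl_self[OF _ subring_UNIV] by blast
  define r where "r = prod q A"
  have "prod q B \<notin> P" if "finite B" "B \<subseteq> P" for B
    using that by (induction B rule: finite_induct) (use C.rc(1) prime_one[OF C.M] primeD[OF C.M] q in auto)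
  then have rP: "r \<notin> P" using A(1) AP by (simp add: r_def)
  let ?I = "{p. \<exists>y. r * p = C.tt * y}"
  have I: "is_ideal UNIV ?I"
  proof (rule is_idealI)
    show "0 \<in> ?I" by (intro CollectI exI[of _ 0]) simp
    fix x y assume "x \<in> ?I" "y \<in> ?I"
    then obtain a b where "r * x = C.tt * a" "r * y = C.tt * b" by blast
    then show "x + y \<in> ?I" by (intro CollectI exI[of _ "a + b"]) (simp add: distrib_left)
  next
    fix c x assume "x \<in> ?I"
    then obtain a where "r * x = C.tt * a" by blast
    then have "r * (c * x) = C.tt * (c * a)" by (metis mult.left_commute)
    then show "c * x \<in> ?I" by blast
  qed simp
  have "A \<subseteq> ?I"
  proof
    fix p assume p: "p \<in> A"
    then obtain y where "q p * p = C.tt * y" using q AP by blast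
    then have "r * p = C.tt * (prod q (A - {p}) * y)"
      using p A(1) by (simp add: r_def prod.remove[of A p] mult.left_commute mult.commute)
    then show "p \<in> ?I" by blast
  qed
  then have PI: "P \<subseteq> ?I" using idl_least[OF subring_UNIV I, of A] A(2) by simp
  have t0: "C.tt \<noteq> 0" using C.T_nz by (auto simp: Zero_fract_def)
  have r0: "r \<noteq> 0" using rP C.mc(3) by auto
  have nz: "FF r 1 / FF C.tt 1 \<noteq> 0" using r0 t0 by (simp add: FF_eq0 del: divide_fract)
  have "ord_at P (FF r 1 / FF C.tt 1) = -1"
    using ord_facts(2)[OF P, of "FF r 1" "FF C.tt 1"] ord_facts(6)[OF P r0 rP] C.ord_T r0 t0 by (simp add: FF_eq0 del: divide_fract)
  moreover have "0 \<le> ord_at Q (FF r 1 / FF C.tt 1)" if Q: "is_max UNIV Q" "Q \<noteq> P" for Q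
  proof -
    obtain p where p: "p \<in> P" "p \<notin> Q" using max_subset_eq[OF P Q(1)] Q(2) by blast
    then obtain y where y: "r * p = C.tt * y" using PI by blast
    have p0: "p \<noteq> 0" using p idealD(3)[OF max_ideal[OF Q(1)] subring_UNIV] by auto
    have y0: "y \<noteq> 0" using y r0 p0 by auto
    have "FF r 1 / FF C.tt 1 = FF y 1 / FF p 1" using t0 p0 y by (simp add: eq_fract mult.commute)
    then show ?thesis using ord_facts(2)[OF Q(1), of "FF y 1" "FF p 1"] ord_facts(4)[OF Q(1) y0] ord_facts(6)[OF Q(1) p0 p(2)] p0 y0
      by (simp add: FF_eq0 del: divide_fract)
  qed
  ultimately show ?thesis using nz by blast
qed

lemma avoid:
  fixes P :: "'a set"
  assumes P: "is_max UNIV P" and "finite Fs" and "\<And>Q. Q \<in> Fs \<Longrightarrow> is_max UNIV Q \<and> Q \<noteq> P"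
  shows "\<exists>b. b \<notin> P \<and> (\<forall>Q\<in>Fs. b \<in> Q)"
  using assms(2,3)
proof (induction Fs rule: finite_induct)
  case empty
  then show ?case using P by (auto simp: is_max_def)
next
  case (insert Q Fs)
  then obtain b where b: "b \<notin> P" "\<forall>Q\<in>Fs. b \<in> Q" by blast
  have Q: "is_max UNIV Q" "Q \<noteq> P" using insert by auto
  obtain c where c: "c \<in> Q" "c \<notin> P" using max_subset_eq[OF Q(1) P] Q(2) by blast
  have "b * c \<notin> P" using primeD[OF max_imp_prime[OF subring_UNIV P], of b c] b c by auto
  moreover have "b * c \<in> R" if "R \<in> insert Q Fs" for R
  proof -
    have R: "is_ideal UNIV R" using that insert.prems by (blast intro: max_ideal)
    have "b \<in> R \<or> c \<in> R" using that b c by blast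
    then show ?thesis using idealD(5,6)[OF R subring_UNIV UNIV_I] by blast
  qed
  ultimately show ?case by blast
qed

lemma section_ex:
  fixes P :: "'a set"
  assumes P: "is_max UNIV P" and Fs: "finite Fs" "\<And>Q. Q \<in> Fs \<Longrightarrow> is_max UNIV Q"
  shows "\<exists>f. f \<noteq> 0 \<and> ord_at P f = - int k \<and> (\<forall>Q. is_max UNIV Q \<longrightarrow> Q \<noteq> P \<longrightarrow> (if Q \<in> Fs then int N else 0) \<le> ord_at Q f)"
proof -
  obtain g where g: "g \<noteq> 0" "ord_at P g = -1" "\<And>Q. is_max UNIV Q \<Longrightarrow> Q \<noteq> P \<Longrightarrow> 0 \<le> ord_at Q g"
    using simple_pole[OF P] by blast
  obtain b where b: "b \<notin> P" "\<forall>Q\<in>Fs - {P}. b \<in> Q" using avoid[OF P, of "Fs - {P}"] Fs by blast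
  have b0: "b \<noteq> 0" using b(1) idealD(3)[OF max_ideal[OF P] subring_UNIV] by auto
  have bF: "FF b 1 \<noteq> 0" using b0 by (simp add: FF_eq0)
  \<comment> \<open>The pole at \<open>P\<close> comes from \<open>g\<close>, and the zeros at the
    other points of \<open>Fs\<close> come from \<open>b\<close>, which is a unit at
    \<open>P\<close>.\<close>
  define f where "f = g ^ k * FF b 1 ^ N"
  have ordf: "ord_at Q f = int k * ord_at Q g + int N * ord_at Q (FF b 1)" if "is_max UNIV Q" for Q
    using ord_facts(1)[OF that, of "g ^ k" "FF b 1 ^ N"] ord_facts(3)[OF that] g(1) bF by (simp add: f_def)
  have "f \<noteq> 0" using g bF by (simp add: f_def)
  moreover have "ord_at P f = - int k" using ordf[OF P] g ord_facts(6)[OF P b0 b(1)] by simp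
  moreover have "(if Q \<in> Fs then int N else 0) \<le> ord_at Q f" if Q: "is_max UNIV Q" "Q \<noteq> P" for Q
  proof -
    have 1: "0 \<le> int k * ord_at Q g" using g(3)[OF Q] by simp
    have 2: "0 \<le> int N * ord_at Q (FF b 1)" using ord_facts(4)[OF Q(1) b0] by simp
    have "int N * 1 \<le> int N * ord_at Q (FF b 1)" if "Q \<in> Fs"
      using ord_facts(5)[OF Q(1) b0] b(2) that Q by (intro mult_left_mono) auto
    then show ?thesis using ordf[OF Q(1)] 1 2 by auto
  qed
  ultimately show ?thesis by blast
qed

text \<open>For \<open>x = a / c\<close> take \<open>f\<close> with a pole at \<open>P\<close> of
  exactly the order of \<open>c\<close>. Then \<open>q = c * f\<close> is regular everywhere and a
  unit at \<open>P\<close>, and \<open>q * x = f * a\<close> inherits the zeros of \<open>f\<close>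
  at the points of \<open>Fs\<close>.\<close>

lemma clear_poles:
  fixes P :: "'a set"
  assumes P: "is_max UNIV P" and Fs: "finite Fs" "\<And>Q. Q \<in> Fs \<Longrightarrow> is_max UNIV Q" and x: "x \<noteq> 0"
  shows "\<exists>q. q \<notin> P \<and> (\<forall>Q. is_max UNIV Q \<longrightarrow> Q \<noteq> P \<longrightarrow> (if Q \<in> Fs then int N else 0) \<le> ord_at Q (FF q 1 * x))"
proof -
  obtain a c where ac: "x = FF a c" "c \<noteq> 0" by (cases x) auto
  have a0: "a \<noteq> 0" using x ac by (auto simp: Zero_fract_def eq_fract)
  have xa: "x = FF a 1 / FF c 1" using ac by simp
  define k where "k = nat (ord_at P (FF c 1))"
  have k: "ord_at P (FF c 1) = int k" using ord_facts(4)[OF P ac(2)] by (simp add: k_def)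
  obtain f where f: "f \<noteq> 0" "ord_at P f = - int k"
    "\<And>Q. is_max UNIV Q \<Longrightarrow> Q \<noteq> P \<Longrightarrow> (if Q \<in> Fs then int N else 0) \<le> ord_at Q f"
    using section_ex[OF P Fs] by blast
  have cF: "FF c 1 \<noteq> 0" and aF: "FF a 1 \<noteq> 0" using ac a0 by (simp_all add: FF_eq0)
  have cf: "FF c 1 * f \<noteq> 0" using cF f by simp
  have reg: "0 \<le> ord_at Q (FF c 1 * f)" if Q: "is_max UNIV Q" for Q
  proof (cases "Q = P")
    case False
    have "0 \<le> ord_at Q f" using f(3)[OF Q False] by (auto split: if_splits)
    then show ?thesis using ord_facts(1)[OF Q cF f(1)] ord_facts(4)[OF Q ac(2)] by simp
  qed (use ord_facts(1)[OF P cF f(1)] k f(2) in simp)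
  obtain q where q: "FF c 1 * f = FF q 1" using global_regular[OF cf reg] by blast
  have q0: "q \<noteq> 0" using q cf by (auto simp: FF_eq0)
  have "ord_at P (FF q 1) = 0" unfolding q[symmetric] using ord_facts(1)[OF P cF f(1)] k f(2) by simp
  then have "q \<notin> P" using ord_facts(5)[OF P q0] by simp
  moreover have "FF q 1 * x = f * FF a 1" unfolding q[symmetric] xa using cF by (simp add: field_simps del: mult_fract divide_fract)
  moreover have "(if Q \<in> Fs then int N else 0) \<le> ord_at Q (f * FF a 1)" if Q: "is_max UNIV Q" "Q \<noteq> P" for Q
    using f(3)[OF Q] ord_facts(1)[OF Q(1) f(1) aF] ord_facts(4)[OF Q(1) a0] by simp
  ultimately show ?thesis by metis
qed

end

section \<open>The graded algebra\<close>

locale dpd = curve s for s :: "complex \<Rightarrow> 'a::idom" +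
  fixes Dp Dm :: "'a set \<Rightarrow> rat"
  assumes Dp: "qdivisor Dp" and Dm: "qdivisor Dm" and neg: "\<forall>P \<in> points UNIV. Dp P + Dm P \<le> 0"
begin

abbreviation "A \<equiv> dpd_algebra Dp Dm"

text \<open>Both inequalities are imposed in every degree \<open>n\<close>, positive or negative. As
  the sum of the divisors is nonpositive, the one that belongs to the sign of \<open>n\<close>
  implies the other; this joins the two halves of the grading to a single cone.\<close>

definition Cond :: "'a set \<Rightarrow> int \<Rightarrow> int \<Rightarrow> bool" where
  "Cond P i n \<longleftrightarrow> 0 \<le> of_int i + of_int n * Dp P \<and> 0 \<le> of_int i - of_int n * Dm P"

definition Fs :: "'a set set" where "Fs = {P. Dp P \<noteq> 0} \<union> {P. Dm P \<noteq> 0}"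

lemma Fs: "finite Fs" "Q \<in> Fs \<Longrightarrow> is_max UNIV Q"
  using Dp Dm points_max by (auto simp: Fs_def qdivisor_def)

lemma floor_cond: "0 \<le> i + \<lfloor>x\<rfloor> \<longleftrightarrow> 0 \<le> of_int i + (x::rat)"
  using le_floor_iff[of "- i" x] by auto

lemma A_iff: "f \<in> A \<longleftrightarrow> (\<forall>n P. is_max UNIV P \<longrightarrow> lk f n = 0 \<or> Cond P (ord_at P (lk f n)) n)"
proof -
  have pos: "lk f (int m) \<in> global_sections (\<lambda>P. \<lfloor>of_nat m * Dp P\<rfloor>) \<longleftrightarrow>
      (\<forall>P. is_max UNIV P \<longrightarrow> lk f (int m) = 0 \<or> Cond P (ord_at P (lk f (int m))) (int m))" for m :: nat
  proof -
    have "0 \<le> ord_at P (lk f (int m)) + \<lfloor>of_nat m * Dp P\<rfloor> \<longleftrightarrow> Cond P (ord_at P (lk f (int m))) (int m)"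
      if P: "is_max UNIV P" for P
    proof -
      have "Dp P + Dm P \<le> 0" using neg points_max P by blast
      then have "of_nat m * (Dp P + Dm P) \<le> 0" by (simp add: mult_le_0_iff)
      then show ?thesis unfolding floor_cond Cond_def by (auto simp: distrib_left)
    qed
    then show ?thesis using points_max by (auto simp: global_sections_def)
  qed
  have negp: "lk f (- int m) \<in> global_sections (\<lambda>P. \<lfloor>of_nat m * Dm P\<rfloor>) \<longleftrightarrow>
      (\<forall>P. is_max UNIV P \<longrightarrow> lk f (- int m) = 0 \<or> Cond P (ord_at P (lk f (- int m))) (- int m))" for m :: nat
  proof -
    have "0 \<le> ord_at P (lk f (- int m)) + \<lfloor>of_nat m * Dm P\<rfloor> \<longleftrightarrow> Cond P (ord_at P (lk f (- int m))) (- int m)"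
      if P: "is_max UNIV P" for P
    proof -
      have "Dp P + Dm P \<le> 0" using neg points_max P by blast
      then have "of_nat m * (Dp P + Dm P) \<le> 0" by (simp add: mult_le_0_iff)
      then show ?thesis unfolding floor_cond Cond_def by (auto simp: distrib_left)
    qed
    then show ?thesis using points_max by (auto simp: global_sections_def)
  qed
  have "(\<forall>n. X n) \<longleftrightarrow> (\<forall>m::nat. X (int m)) \<and> (\<forall>m::nat. X (- int m))" for X
    by (metis int_cases2)
  from this[of "\<lambda>n. \<forall>P. is_max UNIV P \<longrightarrow> lk f n = 0 \<or> Cond P (ord_at P (lk f n)) n"]
  show ?thesis unfolding dpd_algebra_def mem_Collect_eq pos negp by blast
qed

lemma Cond_mono: "Cond P i n \<Longrightarrow> i \<le> j \<Longrightarrow> Cond P j n"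
proof -
  assume "Cond P i n" "i \<le> j"
  moreover then have "of_int i \<le> (of_int j :: rat)" by simp
  ultimately show ?thesis unfolding Cond_def by linarith
qed

lemma Cond_add: "Cond P i n \<Longrightarrow> Cond P j m \<Longrightarrow> Cond P (i + j) (n + m)"
  unfolding Cond_def by (simp add: distrib_right)

lemma A_single: "sg n x \<in> A \<longleftrightarrow> x = 0 \<or> (\<forall>P. is_max UNIV P \<longrightarrow> Cond P (ord_at P x) n)"
  unfolding A_iff by (auto simp: lookup_single when_def)

lemma A_comp: "f \<in> A \<Longrightarrow> sg n (lk f n) \<in> A"
  unfolding A_single unfolding A_iff by blast

lemma A_subring: "is_subring A"
proof -
  have LS: "f \<in> A \<longleftrightarrow> (\<forall>P. is_max UNIV P \<longrightarrow> (\<forall>n. lk f n = 0 \<or> Cond P (ord_at P (lk f n)) n))" for f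
    unfolding A_iff by blast
  have "f - g \<in> A \<and> f * g \<in> A" if f: "f \<in> A" and g: "g \<in> A" for f g
  proof -
    have "(\<forall>n. lk (f - g) n = 0 \<or> Cond P (ord_at P (lk (f - g) n)) n) \<and>
      (\<forall>n. lk (f * g) n = 0 \<or> Cond P (ord_at P (lk (f * g) n)) n)" if P: "is_max UNIV P" for P
    proof -
      obtain t where "cdvr (ord_at P) t (\<lambda>c. FF (s c) 1)" using ord_cdvr[OF P] by blast
      then interpret D: cdvr "ord_at P" t "\<lambda>c. FF (s c) 1" .
      have up: "D.up (Cond P)" unfolding D.up_def using Cond_mono by blast
      have fg: "f \<in> D.LS (Cond P)" "g \<in> D.LS (Cond P)" using f g P unfolding LS D.LS_def by blast+
      have "f - g \<in> D.LS (Cond P)" by (rule D.LS_diff[OF up fg])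
      moreover have "f * g \<in> D.LS (Cond P)" by (rule D.LS_mult[OF fg up Cond_add])
      ultimately show ?thesis unfolding D.LS_def by blast
    qed
    then show ?thesis unfolding LS by blast
  qed
  moreover have "1 \<in> A"
  proof -
    have "sg 0 (1 :: 'a fract) \<in> A" unfolding A_single
    proof (intro disjI2 allI impI)
      fix P :: "'a set" assume P: "is_max UNIV P"
      have "ord_at P (FF 1 1) = 0" using ord_facts(6)[OF P, of 1] P by (simp add: is_max_def)
      then show "Cond P (ord_at P 1) 0" by (simp add: Cond_def One_fract_def)
    qed
    then show ?thesis by simp
  qed
  ultimately show ?thesis by (auto simp: is_subring_def)
qed

lemmas Ac = subringD[OF A_subring]

lemma base_eval: "ring_eval (base_embed :: 'a \<Rightarrow> 'a laurent)"
  by unfold_locales (simp_all add: base_embed_def single_add[symmetric] mult_single One_fract_def[symmetric])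

sublocale b: ring_eval "base_embed :: 'a \<Rightarrow> 'a laurent" by (rule base_eval)

lemma base_A: "base_embed a \<in> A"
  unfolding base_embed_def A_single using ord_facts(4) by (auto simp: Cond_def FF_eq0)

lemma base_s_eval: "ring_eval (\<lambda>c. base_embed (s c))"
  by unfold_locales (simp_all add: b.h_add b.h_mult b.h_one s.h_add s.h_mult s.h_one)

lemma base_single: "base_embed a * sg n x = sg n (FF a 1 * x)"
  by (simp add: base_embed_def mult_single)

lemma bound: "\<exists>N::nat. \<forall>Q\<in>Fs. \<bar>of_int n * Dp Q\<bar> \<le> of_nat N \<and> \<bar>of_int n * Dm Q\<bar> \<le> of_nat N"
proof -
  have f1: "finite ((\<lambda>Q. nat \<lceil>\<bar>of_int n * Dp Q\<bar>\<rceil> + nat \<lceil>\<bar>of_int n * Dm Q\<bar>\<rceil>) ` Fs)" using Fs by simp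
  then obtain N where N: "\<forall>x\<in>(\<lambda>Q. nat \<lceil>\<bar>of_int n * Dp Q\<bar>\<rceil> + nat \<lceil>\<bar>of_int n * Dm Q\<bar>\<rceil>) ` Fs. x \<le> N"
    using finite_nat_set_iff_bounded_le by blast
  have "\<bar>of_int n * Dp Q\<bar> \<le> of_nat N \<and> \<bar>of_int n * Dm Q\<bar> \<le> of_nat N" if "Q \<in> Fs" for Q
  proof -
    have "nat \<lceil>\<bar>of_int n * Dp Q\<bar>\<rceil> \<le> N" "nat \<lceil>\<bar>of_int n * Dm Q\<bar>\<rceil> \<le> N" using N that by fastforce+
    then show ?thesis by (metis nat_le_iff ceiling_le_iff of_int_of_nat_eq)
  qed
  then show ?thesis by blast
qed

lemma Cond_from_bound:
  assumes N: "\<forall>Q\<in>Fs. \<bar>of_int n * Dp Q\<bar> \<le> of_nat N \<and> \<bar>of_int n * Dm Q\<bar> \<le> of_nat N"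
    and i: "(if Q \<in> Fs then int N else 0) \<le> i"
  shows "Cond Q i n"
proof (cases "Q \<in> Fs")
  case True
  then have "(of_nat N :: rat) \<le> of_int i" using i by (metis of_int_le_iff of_int_of_nat_eq)
  then show ?thesis using N True unfolding Cond_def by (auto simp: abs_le_iff)
next
  case False
  then show ?thesis using i by (simp add: Cond_def Fs_def)
qed

text \<open>The poles allowed in degree \<open>n\<close> lie on the finite set \<open>Fs\<close> and
  have order at most \<open>N\<close>, so the \<open>N\<close>-th power of a function vanishing on
  \<open>Fs\<close> cancels all of them. Each graded piece thereby inherits a countable spanning set
  from the curve.\<close>

lemma common_denominator: "\<exists>b. b \<noteq> 0 \<and> (\<forall>x. x \<noteq> 0 \<longrightarrow> sg n x \<in> A \<longrightarrow> (\<exists>a. FF b 1 * x = FF a 1))"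
proof -
  obtain N where N: "\<forall>Q\<in>Fs. \<bar>of_int n * Dp Q\<bar> \<le> of_nat N \<and> \<bar>of_int n * Dm Q\<bar> \<le> of_nat N" using bound by blast
  have "\<exists>c. c \<in> Q \<and> c \<noteq> 0" if "Q \<in> Fs" for Q
    using point_nonzero[OF Fs(2)[OF that]] idealD(3)[OF max_ideal[OF Fs(2)[OF that]] subring_UNIV] by blast
  then obtain c where c: "\<And>Q. Q \<in> Fs \<Longrightarrow> c Q \<in> Q \<and> c Q \<noteq> 0" by metis
  define e where "e = prod c Fs"
  have e0: "e \<noteq> 0" using c Fs(1) by (simp add: e_def)
  have eQ: "e \<in> Q" if Q: "Q \<in> Fs" for Q
  proof -
    have "e = c Q * prod c (Fs - {Q})" using Q Fs(1) by (simp add: e_def prod.remove)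
    then show ?thesis using idealD(6)[OF max_ideal[OF Fs(2)[OF Q]] subring_UNIV] c[OF Q] by simp
  qed
  have eF: "FF e 1 ^ N \<noteq> 0" using e0 by (simp add: FF_eq0)
  have pw: "FF e 1 ^ N = FF (e ^ N) 1" by (induction N) (auto simp: One_fract_def)
  have "\<exists>a. FF (e ^ N) 1 * x = FF a 1" if x: "x \<noteq> 0" "sg n x \<in> A" for x
  proof (rule global_regular)
    show "FF (e ^ N) 1 * x \<noteq> 0" using eF x pw by simp
    fix Q :: "'a set" assume Q: "is_max UNIV Q"
    have o: "ord_at Q (FF (e ^ N) 1 * x) = int N * ord_at Q (FF e 1) + ord_at Q x"
      using ord_facts(1)[OF Q eF x(1)] ord_facts(3)[OF Q, of "FF e 1" N] e0 by (simp add: pw FF_eq0)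
    have cond: "Cond Q (ord_at Q x) n" using x Q unfolding A_single by blast
    show "0 \<le> ord_at Q (FF (e ^ N) 1 * x)"
    proof (cases "Q \<in> Fs")
      case True
      then have "int N * 1 \<le> int N * ord_at Q (FF e 1)" using ord_facts(5)[OF Q e0] eQ by (intro mult_left_mono) auto
      moreover have "- (of_nat N) \<le> (of_int (ord_at Q x) :: rat)" using cond N True unfolding Cond_def by (auto simp: abs_le_iff)
      then have "- int N \<le> ord_at Q x" by (metis of_int_le_iff of_int_minus of_int_of_nat_eq)
      ultimately show ?thesis using o by simp
    next
      case False
      then have "0 \<le> ord_at Q x" using cond by (simp add: Cond_def Fs_def)
      then show ?thesis using o ord_facts(4)[OF Q e0] by simp
    qed
  qed
  then show ?thesis using e0 by (intro exI[of _ "e ^ N"]) auto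
qed

lemma A_residue: assumes M: "is_max A M" and f: "f \<in> A" shows "\<exists>c. f - base_embed (s c) \<in> M"
proof -
  interpret U: vector_space "\<lambda>c x. base_embed (s c) * x" by (rule ring_eval_vector_space[OF base_s_eval])
  obtain G where G: "countable G" "V.span G = UNIV" using countable_span by blast
  obtain d where d: "\<And>n. d n \<noteq> 0" "\<And>n x. x \<noteq> 0 \<Longrightarrow> sg n x \<in> A \<Longrightarrow> \<exists>a. FF (d n) 1 * x = FF a 1"
    using common_denominator by metis
  \<comment> \<open>In each degree, the countable spanning set of the curve divided by the common
    denominator.\<close>
  define H where "H = (\<Union>n. (\<lambda>g. sg n (FF g 1 / FF (d n) 1)) ` G)"
  have cH: "countable H" unfolding H_def using G(1) by (intro countable_UN) auto
  have lin: "sg n (FF a 1 / FF (d n) 1) \<in> U.span H" for n :: int and a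
  proof -
    have "a \<in> V.span G" using G by simp
    then show ?thesis
    proof (induction rule: V.span_induct_alt)
      case base
      then show ?case by (simp add: Zero_fract_def[symmetric] U.span_zero)
    next
      case (step c x y)
      have "base_embed (s c) * sg n (FF x 1 / FF (d n) 1) + sg n (FF y 1 / FF (d n) 1) \<in> U.span H"
      proof -
        have "sg n (FF x 1 / FF (d n) 1) \<in> H" unfolding H_def using step(1) by blast
        then show ?thesis by (rule U.span_add[OF U.span_scale[OF U.span_base] step(2)])
      qed
      also have "base_embed (s c) * sg n (FF x 1 / FF (d n) 1) + sg n (FF y 1 / FF (d n) 1)
         = sg n ((FF (s c) 1 * FF x 1 + FF y 1) / FF (d n) 1)"
        unfolding base_single single_add[symmetric] by (simp only: times_divide_eq_right add_divide_distrib)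
      also have "FF (s c) 1 * FF x 1 + FF y 1 = FF (s c * x + y) 1" by simp
      finally show ?case .
    qed
  qed
  have "A \<subseteq> U.span H"
  proof
    fix f assume f: "f \<in> A"
    have "sg n (lk f n) \<in> U.span H" for n
    proof (cases "lk f n = 0")
      case False
      obtain a where a: "FF (d n) 1 * lk f n = FF a 1" using d(2)[OF False A_comp[OF f]] by blast
      have "FF (d n) 1 \<noteq> 0" using d(1) by (simp add: FF_eq0)
      then have "lk f n = FF a 1 / FF (d n) 1" unfolding a[symmetric] by simp
      then show ?thesis using lin by metis
    qed (simp add: U.span_zero)
    then have "(\<Sum>n\<in>Poly_Mapping.keys f. sg n (lk f n)) \<in> U.span H" by (intro U.span_sum)
    then show "f \<in> U.span H" using poly_mapping_sum_single[of f] by simp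
  qed
  then show ?thesis by (rule residue_field[OF base_s_eval A_subring base_A M cH _ f])
qed

text \<open>Every residue at \<open>M\<close> is a constant and constants come from the base, so the
  base already maps onto the residue field.\<close>

lemma proj_max: assumes M: "is_max A M" shows "is_max UNIV (proj M)"
proof -
  note m = idealD[OF max_ideal[OF M] A_subring]
  have P: "is_prime A M" by (rule max_imp_prime[OF A_subring M])
  have I: "is_ideal UNIV (proj M)"
  proof (rule is_idealI)
    show "0 \<in> proj M" using m(3) by (simp add: proj_def b.h0)
    show "x \<in> proj M \<Longrightarrow> y \<in> proj M \<Longrightarrow> x + y \<in> proj M" for x y using m(4) by (simp add: proj_def b.h_add)
    show "x \<in> proj M \<Longrightarrow> r * x \<in> proj M" for r x using m(5)[OF base_A] by (simp add: proj_def b.h_mult)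
  qed simp
  have 1: "1 \<notin> proj M" using prime_one[OF P] by (simp add: proj_def b.h_one)
  have "\<exists>r. 1 - r * x \<in> proj M" if x: "x \<notin> proj M" for x
  proof -
    obtain c where c: "base_embed x - base_embed (s c) \<in> M" using A_residue[OF M base_A] by blast
    then have xc: "x - s c \<in> proj M" by (simp add: proj_def b.h_diff)
    then have "c \<noteq> 0" using x by (auto simp: s.h0)
    then have "s (inverse c) * s c = 1" by (simp add: s.h_mult[symmetric] s.h_one)
    then have "1 - s (inverse c) * x = - (s (inverse c) * (x - s c))" by (simp add: right_diff_distrib)
    also have "\<dots> \<in> proj M" using idealD(5,7)[OF I subring_UNIV] xc by blast
    finally show ?thesis by blast
  qed
  then show ?thesis using I 1 by (simp add: is_max_def)
qed

end

section \<open>Localization of the surface over a point of the curve\<close>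

context dpd
begin

lemma cond_cone:
  assumes "a1 > 0" "b1 > 0" "Dp P = of_int a2 / of_int a1" "Dm P = - (of_int b2 / of_int b1)"
  shows "Cond P i n \<longleftrightarrow> 0 \<le> a1 * i + a2 * n \<and> 0 \<le> b1 * i + b2 * n"
proof -
  have "0 \<le> of_int i + of_int n * Dp P \<longleftrightarrow> (0::rat) \<le> of_int (a1 * i + a2 * n)"
    using assms(1) unfolding assms(3) by (simp add: field_simps)
  moreover have "0 \<le> of_int i - of_int n * Dm P \<longleftrightarrow> (0::rat) \<le> of_int (b1 * i + b2 * n)"
    using assms(2) unfolding assms(4) by (simp add: field_simps)
  ultimately show ?thesis unfolding Cond_def of_int_0_le_iff by simp
qed

end

locale dpd_point = dpd s Dp Dm + PT: curve_point s P +
    K: cone "ord_at P" "Fraction_Field.Fract (curve_point.tt P) 1" "\<lambda>c. Fraction_Field.Fract (s c) 1" a1 a2 b1 b2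
  for s :: "complex \<Rightarrow> 'a::idom" and Dp Dm and P :: "'a set" and a1 a2 b1 b2 +
  fixes M :: "'a laurent set"
  assumes Mmax: "is_max A M" and P_def: "P = proj M"
    and DpP: "Dp P = of_int a2 / of_int a1" and DmP: "Dm P = - (of_int b2 / of_int b1)"
begin

lemma condB: "K.inB = Cond P"
  by (intro ext) (simp add: K.inB_def K.al_def K.be_def cond_cone[OF K.a1 K.b1 DpP DmP])

lemma Pmax: "is_max UNIV P" by (rule PT.Mx)
lemma MP: "is_prime A M" by (rule max_imp_prime[OF A_subring Mmax])
lemmas Mc = idealD[OF prime_ideal[OF MP] A_subring]

lemma base_M: "base_embed a \<in> M \<longleftrightarrow> a \<in> P" unfolding P_def proj_def by simp

lemma A_B: "A \<subseteq> K.B"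
proof
  fix f assume "f \<in> A"
  then show "f \<in> K.B" using Pmax unfolding K.B_def K.LS_def condB A_iff by blast
qed

lemma sc_base: "K.sc c = base_embed (s c)" by (simp add: K.sc_def base_embed_def)

lemma base_mult_P: "q \<notin> P \<Longrightarrow> r \<notin> P \<Longrightarrow> q * r \<notin> P"
  using primeD[OF PT.M, of q r] by auto

text \<open>A homogeneous element of \<open>B\<close> satisfies the conditions at \<open>P\<close>;
  a function \<open>q\<close> that is a unit at \<open>P\<close> can be chosen with enough zeros to
  satisfy them at the other points. Hence \<open>B\<close> is a localization of the algebra.\<close>

lemma clearB: assumes "f \<in> K.B" shows "\<exists>q. q \<notin> P \<and> base_embed q * f \<in> A"
  using assms unfolding K.B_def
proof (rule K.LS_induct)
  show "\<exists>q. q \<notin> P \<and> base_embed q * 0 \<in> A" using Ac(2) prime_one[OF PT.M] by (intro exI[of _ 1]) simp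
  fix n x assume x: "x \<noteq> 0" "K.inB (ord_at P x) n"
  obtain N where N: "\<forall>Q\<in>Fs. \<bar>of_int n * Dp Q\<bar> \<le> of_nat N \<and> \<bar>of_int n * Dm Q\<bar> \<le> of_nat N" using bound by blast
  obtain q where q: "q \<notin> P" "\<And>Q. is_max UNIV Q \<Longrightarrow> Q \<noteq> P \<Longrightarrow> (if Q \<in> Fs then int N else 0) \<le> ord_at Q (FF q 1 * x)"
    using clear_poles[OF Pmax Fs x(1)] by blast
  have q0: "q \<noteq> 0" using q(1) PT.mc(3) by auto
  have "Cond Q (ord_at Q (FF q 1 * x)) n" if Q: "is_max UNIV Q" for Q
  proof (cases "Q = P")
    case True
    have "ord_at P (FF q 1 * x) = ord_at P x"
      using ord_facts(1)[OF Pmax _ x(1), of "FF q 1"] ord_facts(6)[OF Pmax q0 q(1)] q0 by (simp add: FF_eq0)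
    then show ?thesis using x True condB by simp
  next
    case False
    then show ?thesis using Cond_from_bound[OF N] q(2)[OF Q] by blast
  qed
  then have "base_embed q * sg n x \<in> A" unfolding base_single A_single by blast
  then show "\<exists>q. q \<notin> P \<and> base_embed q * sg n x \<in> A" using q(1) by blast
next
  fix f g assume "\<exists>q. q \<notin> P \<and> base_embed q * f \<in> A" "\<exists>q. q \<notin> P \<and> base_embed q * g \<in> A"
  then obtain q r where *: "q \<notin> P" "base_embed q * f \<in> A" "r \<notin> P" "base_embed r * g \<in> A" by blast
  have "base_embed (q * r) * (f + g) = base_embed r * (base_embed q * f) + base_embed q * (base_embed r * g)"
    by (simp add: b.h_mult algebra_simps)
  also have "\<dots> \<in> A" by (rule Ac(6)[OF Ac(4)[OF base_A *(2)] Ac(4)[OF base_A *(4)]])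
  finally show "\<exists>q. q \<notin> P \<and> base_embed q * (f + g) \<in> A" using base_mult_P[OF *(1,3)] by blast
qed

text \<open>The extension of \<open>M\<close> to \<open>B\<close>, which arises from the algebra by
  inverting the functions on the curve that do not vanish at \<open>P\<close>.\<close>

definition N :: "'a laurent set" where "N = {f \<in> K.B. \<exists>q. q \<notin> P \<and> base_embed q * f \<in> M}"

lemma N_A: assumes "f \<in> A" shows "f \<in> N \<longleftrightarrow> f \<in> M"
proof
  assume "f \<in> N"
  then obtain q where "q \<notin> P" "base_embed q * f \<in> M" by (auto simp: N_def)
  then show "f \<in> M" using primeD[OF MP _ base_A assms] base_M by blast
next
  assume "f \<in> M"
  then have "base_embed 1 * f \<in> M" by (simp add: b.h_one)
  then show "f \<in> N" using assms A_B prime_one[OF PT.M] unfolding N_def by blast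
qed

lemma N_ideal: "is_ideal K.B N"
proof (rule is_idealI)
  show "N \<subseteq> K.B" by (auto simp: N_def)
  show "0 \<in> N" using N_A[OF Ac(2)] Mc(3) by simp
  fix f g assume "f \<in> N" "g \<in> N"
  then obtain q r where *: "q \<notin> P" "base_embed q * f \<in> M" "r \<notin> P" "base_embed r * g \<in> M" "f \<in> K.B" "g \<in> K.B"
    by (auto simp: N_def)
  have "base_embed (q * r) * (f + g) = base_embed r * (base_embed q * f) + base_embed q * (base_embed r * g)"
    by (simp add: b.h_mult algebra_simps)
  also have "\<dots> \<in> M" by (rule Mc(4)[OF Mc(5)[OF base_A *(2)] Mc(5)[OF base_A *(4)]])
  finally show "f + g \<in> N" using base_mult_P[OF *(1,3)] K.bc(6)[OF *(5,6)] unfolding N_def by blast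
next
  fix f g assume f: "f \<in> K.B" and "g \<in> N"
  then obtain q where q: "q \<notin> P" "base_embed q * g \<in> M" "g \<in> K.B" by (auto simp: N_def)
  obtain r where r: "r \<notin> P" "base_embed r * f \<in> A" using clearB[OF f] by blast
  have "base_embed (r * q) * (f * g) = (base_embed r * f) * (base_embed q * g)"
    by (simp add: b.h_mult algebra_simps)
  also have "\<dots> \<in> M" by (rule Mc(5)[OF r(2) q(2)])
  finally show "f * g \<in> N" using base_mult_P[OF r(1) q(1)] K.bc(4)[OF f q(3)] unfolding N_def by blast
qed

lemma N_max: "is_max K.B N"
proof -
  have "\<exists>r\<in>K.B. 1 - r * f \<in> N" if f: "f \<in> K.B - N" for f
  proof -
    obtain q where q: "q \<notin> P" "base_embed q * f \<in> A" using clearB f by blast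
    have "base_embed q * f \<notin> M" using f q(1) unfolding N_def by blast
    then obtain r where r: "r \<in> A" "1 - r * (base_embed q * f) \<in> M" using Mmax[unfolded is_max_def] q(2) by blast
    have "1 - r * (base_embed q * f) \<in> N" using N_A Mc(2) r(2) by blast
    moreover have "r * base_embed q \<in> K.B" using Ac(4)[OF r(1) base_A] A_B by blast
    ultimately show ?thesis by (metis mult.assoc)
  qed
  moreover have "1 \<notin> N" using N_A[OF Ac(1)] prime_one[OF MP] by simp
  ultimately show ?thesis using N_ideal by (simp add: is_max_def)
qed

lemma N_prime: "is_prime K.B N" by (rule max_imp_prime[OF K.B_subring N_max])

lemma tN: "K.mon 1 0 \<in> N"
proof -
  have "K.mon 1 0 = base_embed PT.tt" by (simp add: K.mon_def base_embed_def)
  then show ?thesis using N_A[OF base_A] base_M PT.tt(1) by simp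
qed

lemma loc_eq: "loc A M = loc K.B N"
proof
  show "loc A M \<subseteq> loc K.B N" unfolding loc_def using A_B N_A by blast
  show "loc K.B N \<subseteq> loc A M"
  proof
    fix x assume "x \<in> loc K.B N"
    then obtain a c where ac: "x = Fraction_Field.Fract a c" "a \<in> K.B" "c \<in> K.B - N" by (auto simp: loc_def)
    obtain q where q: "q \<notin> P" "base_embed q * a \<in> A" using clearB ac by blast
    obtain r where r: "r \<notin> P" "base_embed r * c \<in> A" using clearB ac by blast
    have rM: "base_embed r * c \<notin> M" using ac r(1) unfolding N_def by blast
    have "base_embed r * (base_embed q * a) \<in> A" by (rule Ac(4)[OF base_A q(2)])
    moreover have "base_embed q * (base_embed r * c) \<in> A - M"
      using Ac(4)[OF base_A r(2)] primeD[OF MP _ base_A r(2)] base_M q(1) rM by blast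
    moreover have "x = Fraction_Field.Fract (base_embed r * (base_embed q * a)) (base_embed q * (base_embed r * c))"
    proof -
      have "c \<noteq> 0" using ac idealD(3)[OF N_ideal K.B_subring] by auto
      moreover have "base_embed q \<noteq> 0" "base_embed r \<noteq> 0" using q r base_M Mc(3) by metis+
      ultimately show ?thesis unfolding ac(1) by (simp add: eq_fract)
    qed
    ultimately show "x \<in> loc A M" unfolding loc_def by blast
  qed
qed

lemma local_max_eq: "local_max A M = local_max K.B N"
proof -
  interpret LA: max_localization A M by unfold_locales (rule A_subring, rule MP, rule Mmax)
  interpret LB: max_localization K.B N by unfold_locales (rule K.B_subring, rule N_prime, rule N_max)
  have "{local_max A M} = {local_max K.B N}"
    unfolding LA.unique_max[symmetric] LB.unique_max[symmetric] local_ring_eq loc_eq ..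
  then show ?thesis by simp
qed

lemma local_ring_AB: "local_ring A M = local_ring K.B N" by (simp add: local_ring_eq loc_eq)

lemma quotient_singularity_AB:
  "quotient_singularity (\<lambda>c. base_embed (s c)) A M d e \<longleftrightarrow> quotient_singularity K.sc K.B N d e"
  by (simp add: quotient_singularity_def completed_local_ring_def completed_embed_def local_ring_AB local_max_eq sc_base)

lemma single_N: assumes "x \<noteq> 0" "sg n x \<in> A" "sg n x \<notin> M"
  shows "K.inB (ord_at P x) n" "K.mon (ord_at P x) n \<notin> N"
proof -
  show "K.inB (ord_at P x) n" using assms Pmax unfolding A_single condB by blast
  show "K.mon (ord_at P x) n \<notin> N"
  proof
    assume "K.mon (ord_at P x) n \<in> N"
    then have "sg n x \<in> N" by (rule K.comp_Q[OF N_prime tN assms(1)])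
    then show False using assms N_A by blast
  qed
qed

lemma regular_if_moved:
  assumes "n \<noteq> 0" "sg n x \<in> A" "sg n x \<notin> M"
  shows "regular_local_ring (local_ring A M)"
proof -
  have "x \<noteq> 0" using assms(3) Mc(3) by auto
  then show ?thesis unfolding local_ring_AB
    using K.regular_nonfixed[OF N_max tN single_N(1)[OF _ assms(2,3)] _ single_N(2)[OF _ assms(2,3)]] assms(1) by blast
qed

lemma mon_fixed:
  assumes hom: "\<And>n x. n \<noteq> 0 \<Longrightarrow> sg n x \<in> A \<Longrightarrow> sg n x \<in> M" and ij: "K.inB i n" "(i, n) \<noteq> (0, 0)"
  shows "K.mon i n \<in> N"
proof (cases "n = 0")
  case True
  then have "1 \<le> i" using ij K.inB_0 by auto
  then have "K.mon (i - 1) 0 \<in> K.B" using K.mon_B K.inB_0 by simp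
  then have "K.mon (i - 1) 0 * K.mon 1 0 \<in> N" using idealD(5)[OF N_ideal K.B_subring _ tN] by blast
  then show ?thesis using True by (simp add: K.mon_mult)
next
  case False
  have B: "K.mon i n \<in> K.B" using ij K.mon_B by blast
  \<comment> \<open>A monomial of \<open>B\<close> may have poles at other points, so the hypothesis
    is applied after multiplication by a function that is a unit at \<open>P\<close>.\<close>
  obtain q where q: "q \<notin> P" "base_embed q * K.mon i n \<in> A" using clearB[OF B] by blast
  then have "base_embed q * K.mon i n \<in> M" using hom[OF False] unfolding K.mon_def base_single by blast
  then show ?thesis using q B unfolding N_def by blast
qed

end

section \<open>Fixed points and their singularity types\<close>

context dpd
begin

lemma dpd_pointI:
  assumes M: "is_max A M" and a: "a1 > 0" "b1 > 0" "coprime a1 a2" "coprime b1 b2"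
    and D: "Dp (proj M) = of_int a2 / of_int a1" "Dm (proj M) = - (of_int b2 / of_int b1)"
  shows "dpd_point s Dp Dm (proj M) a1 a2 b1 b2 M"
proof -
  have P: "is_max UNIV (proj M)" by (rule proj_max[OF M])
  interpret PT: curve_point s "proj M" by (rule cp[OF P])
  have c: "cdvr (ord_at (proj M)) (FF PT.tt 1) (\<lambda>c. FF (s c) 1)" by (rule PT.cdvr)
  interpret K: cone "ord_at (proj M)" "FF PT.tt 1" "\<lambda>c. FF (s c) 1" a1 a2 b1 b2
    by (intro cone.intro cone_axioms.intro c a)
  show ?thesis by unfold_locales (simp_all add: M D)
qed

lemma dpd_point_ex:
  assumes M: "is_max A M" shows "\<exists>a1 a2 b1 b2. dpd_point s Dp Dm (proj M) a1 a2 b1 b2 M"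
proof -
  obtain a2 a1 where a: "quotient_of (Dp (proj M)) = (a2, a1)" by (cases "quotient_of (Dp (proj M))")
  obtain b2 b1 where b: "quotient_of (- Dm (proj M)) = (b2, b1)" by (cases "quotient_of (- Dm (proj M))")
  have 1: "Dp (proj M) = of_int a2 / of_int a1" by (rule quotient_of_div[OF a])
  have "- Dm (proj M) = of_int b2 / of_int b1" by (rule quotient_of_div[OF b])
  then have 2: "Dm (proj M) = - (of_int b2 / of_int b1)" by simp
  show ?thesis
    using dpd_pointI[OF M quotient_of_denom_pos[OF a] quotient_of_denom_pos[OF b] _ _ 1 2]
      quotient_of_coprime[OF a] quotient_of_coprime[OF b] by (metis coprime_commute)
qed

text \<open>The working form of a fixed point: it amounts to invariance under the torus by
  \<open>fixed_iff\<close>, and to containment of the ideal \<open>fixed_ideal A\<close> by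
  \<open>fixed_ideal_iff\<close>.\<close>

definition hom_pt :: "'a laurent set \<Rightarrow> bool" where
  "hom_pt M \<longleftrightarrow> is_max A M \<and> (\<forall>n x. n \<noteq> 0 \<longrightarrow> sg n x \<in> A \<longrightarrow> sg n x \<in> M)"

lemma hom_pt_zero_part:
  assumes M: "hom_pt M" and f: "f \<in> A" shows "f \<in> M \<longleftrightarrow> sg 0 (lk f 0) \<in> M"
proof -
  have I: "is_ideal A M" using M by (simp add: hom_pt_def is_max_def)
  let ?K = "Poly_Mapping.keys f - {0}"
  have "(\<Sum>n\<in>?K. sg n (lk f n)) \<in> M"
    using M A_comp[OF f] by (intro ideal_sum[OF I]) (auto simp: hom_pt_def)
  moreover have "f - sg 0 (lk f 0) = (\<Sum>n\<in>?K. sg n (lk f n))"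
  proof (cases "0 \<in> Poly_Mapping.keys f")
    case True
    then have "f = sg 0 (lk f 0) + (\<Sum>n\<in>?K. sg n (lk f n))"
      by (subst poly_mapping_sum_single) (simp add: sum.remove)
    then show ?thesis by (metis add_diff_cancel_left')
  next
    case False
    then show ?thesis using poly_mapping_sum_single[of f] by (simp add: in_keys_iff)
  qed
  ultimately show ?thesis using ideal_diff_cancel[OF I A_subring] by metis
qed

lemma points_A: "M \<in> points A \<longleftrightarrow> is_max A M" by (rule points_iff[OF A_subring])

lemma torus_lookup: "lk (torus_act s z f) n = FF (s (z powi n)) 1 * lk f n"
  by (auto simp: torus_act_def lookup_mapp when_def in_keys_iff)

lemma torus_A: assumes "z \<noteq> 0" "f \<in> A" shows "torus_act s z f \<in> A"
proof -
  have "sg n (lk (torus_act s z f) n) \<in> A" for n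
    using Ac(4)[OF base_A A_comp[OF assms(2)], of "s (z powi n)" n] by (simp add: torus_lookup base_single)
  then have "(\<Sum>n\<in>Poly_Mapping.keys (torus_act s z f). sg n (lk (torus_act s z f) n)) \<in> A"
    by (intro subring_sum[OF A_subring])
  then show ?thesis using poly_mapping_sum_single by metis
qed

lemma fixed_iff: "M \<in> fixed_points s A \<longleftrightarrow> hom_pt M"
proof
  assume F: "M \<in> fixed_points s A"
  then have M: "is_max A M" and fx: "\<And>z. z \<noteq> 0 \<Longrightarrow> {f \<in> A. torus_act s z f \<in> M} = M"
    by (auto simp: fixed_points_def points_A torus_act_point_def)
  have P: "is_prime A M" by (rule max_imp_prime[OF A_subring M])
  note m = idealD[OF prime_ideal[OF P] A_subring]
  have "sg n x \<in> M" if n: "n \<noteq> 0" and x: "sg n x \<in> A" for n x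
  proof -
    \<comment> \<open>The element is congruent to a constant \<open>c\<close>. The torus element 2
      shows that \<open>2 powi n\<close> times it is congruent to \<open>c\<close> as well, so
      \<open>2 powi n - 1\<close> times it lies in \<open>M\<close>. Any \<open>z\<close> that is no
      root of unity would do in place of 2.\<close>
    obtain c where c: "sg n x - base_embed (s c) \<in> M" using A_residue[OF M x] by blast
    have ne: "(2::complex) powi n \<noteq> 1"
    proof
      assume "(2::complex) powi n = 1"
      then have "norm ((2::complex) powi n) = 1" by simp
      then have "(2::real) powi n = 1" by (simp add: norm_power_int)
      then have "(2::real) ^ nat \<bar>n\<bar> = 1" by (cases "0 \<le> n") (auto simp: power_int_def field_simps)
      moreover have "1 < (2::real) ^ nat \<bar>n\<bar>" using n by (intro one_less_power) auto
      ultimately show False by simp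
    qed
    have "torus_act s 2 (sg n x - base_embed (s c)) \<in> M" using fx[of 2] c by auto
    also have "torus_act s 2 (sg n x - base_embed (s c)) = base_embed (s (2 powi n)) * sg n x - base_embed (s c)"
      by (rule poly_mapping_eqI, unfold base_single, unfold base_embed_def)
        (auto simp: torus_lookup lookup_minus lookup_single when_def s.h_one One_fract_def[symmetric] simp del: mult_fract)
    finally have 1: "base_embed (s (2 powi n)) * sg n x - base_embed (s c) \<in> M" .
    have "(base_embed (s (2 powi n)) * sg n x - base_embed (s c)) - (sg n x - base_embed (s c)) \<in> M" by (rule m(8)[OF 1 c])
    also have "(base_embed (s (2 powi n)) * sg n x - base_embed (s c)) - (sg n x - base_embed (s c))
      = base_embed (s (2 powi n - 1)) * sg n x"
      by (simp add: s.h_diff s.h_one b.h_diff b.h_one left_diff_distrib)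
    finally have 2: "base_embed (s (2 powi n - 1)) * sg n x \<in> M" .
    have "base_embed (s (inverse (2 powi n - 1))) * (base_embed (s (2 powi n - 1)) * sg n x) \<in> M" by (rule m(5)[OF base_A 2])
    moreover have "base_embed (s (inverse (2 powi n - 1))) * (base_embed (s (2 powi n - 1)) * sg n x) = sg n x"
      using ne by (simp add: mult.assoc[symmetric] b.h_mult[symmetric] s.h_mult[symmetric] s.h_one b.h_one)
    ultimately show ?thesis by simp
  qed
  then show "hom_pt M" using M by (simp add: hom_pt_def)
next
  assume H: "hom_pt M"
  then have M: "is_max A M" by (simp add: hom_pt_def)
  have "{f \<in> A. torus_act s z f \<in> M} = M" if z: "z \<noteq> 0" for z
  proof -
    have "torus_act s z f \<in> M \<longleftrightarrow> f \<in> M" if f: "f \<in> A" for f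
      using hom_pt_zero_part[OF H f] hom_pt_zero_part[OF H torus_A[OF z f]]
      by (simp add: torus_lookup s.h_one One_fract_def[symmetric] del: mult_fract)
    then show ?thesis using is_idealD1[OF max_ideal[OF M]] by blast
  qed
  then show "M \<in> fixed_points s A" using M by (simp add: fixed_points_def points_A torus_act_point_def)
qed

lemma fixed_ideal_iff: assumes M: "is_max A M" shows "fixed_ideal A \<subseteq> M \<longleftrightarrow> hom_pt M"
proof -
  have I: "is_ideal A M" by (rule max_ideal[OF M])
  note m = idealD[OF I A_subring]
  have set: "fixed_ideal A = {x + y | x y. x \<in> idl A (positive_part A) \<and> y \<in> idl A (negative_part A)}"
    by (auto simp: fixed_ideal_def set_add_def' set_mult_def)
  have pA: "positive_part A \<subseteq> A" "negative_part A \<subseteq> A" by (auto simp: positive_part_def negative_part_def)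
  have z: "0 \<in> idl A (positive_part A)" "0 \<in> idl A (negative_part A)"
    using idealD(3)[OF idl_ideal[OF A_subring] A_subring] pA by blast+
  show ?thesis
  proof
    assume F: "fixed_ideal A \<subseteq> M"
    have "sg n x \<in> M" if n: "n \<noteq> 0" and x: "sg n x \<in> A" for n x
    proof (cases "n > 0")
      case True
      then have "sg n x \<in> positive_part A" using x by (auto simp: positive_part_def lookup_single when_def)
      then have "sg n x \<in> idl A (positive_part A)" by (rule idl_self[OF _ A_subring])
      then have "sg n x + 0 \<in> fixed_ideal A" unfolding set using z(2) by blast
      then show ?thesis using F by auto
    next
      case False
      then have "sg n x \<in> negative_part A" using x n by (auto simp: negative_part_def lookup_single when_def)
      then have "sg n x \<in> idl A (negative_part A)" by (rule idl_self[OF _ A_subring])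
      then have "0 + sg n x \<in> fixed_ideal A" unfolding set using z(1) by blast
      then show ?thesis using F by auto
    qed
    then show "hom_pt M" using M by (simp add: hom_pt_def)
  next
    assume H: "hom_pt M"
    have "f \<in> M" if "f \<in> A" "lk f 0 = 0" for f
      using hom_pt_zero_part[OF H that(1)] that(2) m(3) by simp
    then have "positive_part A \<subseteq> M" "negative_part A \<subseteq> M" by (auto simp: positive_part_def negative_part_def)
    then have "idl A (positive_part A) \<subseteq> M" "idl A (negative_part A) \<subseteq> M" using idl_least[OF A_subring I] by blast+
    then show "fixed_ideal A \<subseteq> M" unfolding set using m(4) by blast
  qed
qed

lemma fixed_zero_locus: "fixed_points s A = zero_locus A (fixed_ideal A)"
proof (rule Set.set_eqI)
  fix M
  have "M \<in> zero_locus A (fixed_ideal A) \<longleftrightarrow> is_max A M \<and> fixed_ideal A \<subseteq> M" by (simp add: zero_locus_def points_A)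
  also have "\<dots> \<longleftrightarrow> hom_pt M" using fixed_ideal_iff[of M] by (cases "is_max A M") (simp_all add: hom_pt_def)
  finally show "M \<in> fixed_points s A \<longleftrightarrow> M \<in> zero_locus A (fixed_ideal A)" by (simp add: fixed_iff)
qed

lemma Sing_fixed: "Sing A \<subseteq> fixed_points s A"
proof
  fix M assume "M \<in> Sing A"
  then have M: "is_max A M" and sing: "\<not> regular_local_ring (local_ring A M)" by (auto simp: Sing_def points_A)
  obtain a1 a2 b1 b2 where "dpd_point s Dp Dm (proj M) a1 a2 b1 b2 M" using dpd_point_ex[OF M] by blast
  then have "hom_pt M" using dpd_point.regular_if_moved sing M unfolding hom_pt_def by blast
  then show "M \<in> fixed_points s A" by (simp add: fixed_iff)
qed

lemma A_degree_zero: assumes "f \<in> A" shows "\<exists>a. lk f 0 = FF a 1"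
proof (cases "lk f 0 = 0")
  case True
  then show ?thesis by (intro exI[of _ 0]) (simp add: Zero_fract_def)
next
  case False
  have "0 \<le> ord_at P (lk f 0)" if "is_max UNIV P" for P
  proof -
    have "Cond P (ord_at P (lk f 0)) 0" using assms that False unfolding A_iff by blast
    then show ?thesis by (simp add: Cond_def)
  qed
  then show ?thesis by (rule global_regular[OF False])
qed

lemma hom_pt_iff: assumes "hom_pt M" "f \<in> A" "lk f 0 = FF a 1" shows "f \<in> M \<longleftrightarrow> a \<in> proj M"
  using hom_pt_zero_part[OF assms(1,2)] assms(3) by (simp add: proj_def base_embed_def)

text \<open>Membership in a fixed point is decided by the degree-zero part, which is a function on
  the curve.\<close>

lemma proj_inj: "inj_on proj (fixed_points s A)"
proof (rule inj_onI)
  fix M M' assume "M \<in> fixed_points s A" "M' \<in> fixed_points s A" and e: "proj M = proj M'"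
  then have H: "hom_pt M" "hom_pt M'" by (simp_all add: fixed_iff)
  then have "M \<subseteq> A" "M' \<subseteq> A" by (auto simp: hom_pt_def is_max_def is_ideal_def)
  moreover have "f \<in> M \<longleftrightarrow> f \<in> M'" if "f \<in> A" for f
    using A_degree_zero[OF that] hom_pt_iff[OF H(1) that] hom_pt_iff[OF H(2) that] e by auto
  ultimately show "M = M'" by blast
qed

text \<open>If the sum vanishes at the point, the forms \<open>al\<close> and \<open>be\<close> are
  proportional and the cone is a half plane. Its boundary carries two opposite monomials of nonzero
  degree; one of them lies in \<open>N\<close>, and so does their product 1.\<close>

lemma fixed_neg: assumes "hom_pt M" shows "Dp (proj M) + Dm (proj M) < 0"
proof (rule ccontr)
  have M: "is_max A M" using assms by (simp add: hom_pt_def)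
  obtain a1 a2 b1 b2 where "dpd_point s Dp Dm (proj M) a1 a2 b1 b2 M" using dpd_point_ex[OF M] by blast
  then interpret X: dpd_point s Dp Dm "proj M" a1 a2 b1 b2 M .
  assume "\<not> ?thesis"
  then have "Dp (proj M) + Dm (proj M) = 0" using neg points_max X.Pmax by force
  then have "(of_int a2 / of_int a1 :: rat) = of_int b2 / of_int b1" using X.DpP X.DmP by simp
  then have "(of_int (a2 * b1) :: rat) = of_int (b2 * a1)"
    using X.K.a1 X.K.b1 by (simp add: frac_eq_eq)
  then have e: "a2 * b1 = b2 * a1" by (simp only: of_int_eq_iff)
  have in1: "X.K.inB (- a2) a1" and in2: "X.K.inB a2 (- a1)"
    using e by (simp_all add: X.K.inB_def X.K.al_def X.K.be_def mult.commute)
  have hom: "\<And>n x. n \<noteq> 0 \<Longrightarrow> sg n x \<in> A \<Longrightarrow> sg n x \<in> M" using assms by (simp add: hom_pt_def)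
  have "X.K.mon (- a2) a1 \<in> X.N" using X.mon_fixed[OF hom in1] X.K.a1 by simp
  then have "X.K.mon a2 (- a1) * X.K.mon (- a2) a1 \<in> X.N"
    using idealD(5)[OF X.N_ideal X.K.B_subring] in2 X.K.mon_B by blast
  then have "1 \<in> X.N" by (simp add: X.K.mon_mult X.K.mon_0)
  then show False using prime_one[OF X.N_prime] by simp
qed

text \<open>Products of opposite degrees vanish at \<open>P\<close>: adding the two conditions
  bounds \<open>i + j\<close> below by \<open>\<bar>n\<bar>\<close> times the negative of
  \<open>Dp P + Dm P\<close>.\<close>

lemma Cond_opposite:
  assumes "Cond P i n" "Cond P j (- n)" "n \<noteq> 0" "Dp P + Dm P < 0" shows "1 \<le> i + j"
proof -
  have "0 < (of_int (i + j) :: rat)"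
  proof (cases "0 < n")
    case True
    then have "of_int n * (Dp P + Dm P) < 0" using assms(4) by (simp add: mult_pos_neg)
    then show ?thesis using assms(1,2) by (simp add: Cond_def distrib_left)
  next
    case False
    then have "0 < of_int n * (Dp P + Dm P)" using assms(3,4) by (simp add: mult_neg_neg)
    then show ?thesis using assms(1,2) by (simp add: Cond_def distrib_left)
  qed
  then show ?thesis by simp
qed

text \<open>The candidate for the fixed point over \<open>P\<close>. Negativity of the divisor sum
  enters in the closure under multiplication, through \<open>Cond_opposite\<close>.\<close>

definition vertex :: "'a set \<Rightarrow> 'a laurent set" where
  "vertex P = {f \<in> A. lk f 0 = 0 \<or> 1 \<le> ord_at P (lk f 0)}"

lemma vertex_iff:
  assumes P: "is_max UNIV P" and f: "f \<in> A" "lk f 0 = FF a 1"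
  shows "f \<in> vertex P \<longleftrightarrow> a \<in> P"
proof (cases "a = 0")
  case True
  then show ?thesis using f idealD(3)[OF max_ideal[OF P] subring_UNIV] by (simp add: vertex_def FF_eq0)
next
  case False
  then show ?thesis using f ord_facts(5)[OF P False] by (simp add: vertex_def FF_eq0)
qed

lemma vertex_hom:
  assumes P: "is_max UNIV P" and D: "Dp P + Dm P < 0" shows "hom_pt (vertex P)" "proj (vertex P) = P"
proof -
  obtain t where "cdvr (ord_at P) t (\<lambda>c. FF (s c) 1)" using ord_cdvr[OF P] by blast
  then interpret V: cdvr "ord_at P" t "\<lambda>c. FF (s c) 1" .
  have v: "f \<in> vertex P \<longleftrightarrow> f \<in> A \<and> V.ge (lk f 0) 1" for f by (simp add: vertex_def V.ge_def)
  have I: "is_ideal A (vertex P)"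
  proof (rule is_idealI)
    show "vertex P \<subseteq> A" by (auto simp: vertex_def)
    show "0 \<in> vertex P" using Ac(2) by (simp add: vertex_def)
    show "f \<in> vertex P \<Longrightarrow> g \<in> vertex P \<Longrightarrow> f + g \<in> vertex P" for f g
      unfolding v using Ac(6) V.ge_add by (simp add: lookup_add)
    fix r f assume r: "r \<in> A" and f: "f \<in> vertex P"
    have fA: "f \<in> A" using f v by blast
    have "V.ge (lk r n * lk f (0 - n)) 1" for n
    proof (cases "n = 0")
      case True
      obtain a where "lk r 0 = FF a 1" using A_degree_zero[OF r] by blast
      then have "V.ge (lk r 0) 0" using ord_facts(4)[OF P, of a] by (cases "a = 0") (auto simp: V.ge_def FF_eq0)
      then show ?thesis using V.ge_mult[of "lk r 0" 0 "lk f 0" 1] f v True by simp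
    next
      case False
      show ?thesis
      proof (cases "lk r n = 0 \<or> lk f (- n) = 0")
        case nz: False
        then have "Cond P (ord_at P (lk r n)) n" "Cond P (ord_at P (lk f (- n))) (- n)"
          using r fA P unfolding A_iff by blast+
        then have "1 \<le> ord_at P (lk r n) + ord_at P (lk f (- n))" using Cond_opposite False D by blast
        then show ?thesis using nz V.v_mult by (simp add: V.ge_def)
      qed auto
    qed
    then have "V.ge (lk (r * f) 0) 1" unfolding V.lookup_mult_sum by (intro V.ge_sum) simp
    then show "r * f \<in> vertex P" unfolding v using Ac(4)[OF r fA] by blast
  qed
  have one: "1 \<notin> vertex P"
    using vertex_iff[OF P Ac(1), of 1] prime_one[OF max_imp_prime[OF subring_UNIV P]]
    by (simp add: lookup_one One_fract_def)
  have "\<exists>r\<in>A. 1 - r * f \<in> vertex P" if f: "f \<in> A - vertex P" for f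
  proof -
    obtain a where a: "lk f 0 = FF a 1" using A_degree_zero f by blast
    then have "a \<notin> P" using vertex_iff[OF P] f by blast
    then obtain r where r: "1 - r * a \<in> P" using P by (auto simp: is_max_def)
    have "1 - base_embed r * f \<in> A" using Ac(3)[OF Ac(1) Ac(4)[OF base_A]] f by blast
    moreover have "lk (1 - base_embed r * f) 0 = FF (1 - r * a) 1"
    proof -
      have "lk (base_embed r * f) 0 = FF r 1 * lk f 0"
        by (simp add: V.lookup_mult_sum base_embed_def)
      then show ?thesis using a by (simp add: lookup_minus lookup_one One_fract_def)
    qed
    ultimately have "1 - base_embed r * f \<in> vertex P" using vertex_iff[OF P] r by blast
    then show ?thesis using base_A by blast
  qed
  then show "hom_pt (vertex P)" using I one
    by (auto simp: hom_pt_def is_max_def vertex_def lookup_single when_def)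
  have "base_embed a \<in> vertex P \<longleftrightarrow> a \<in> P" for a
    by (rule vertex_iff[OF P base_A]) (simp add: base_embed_def)
  then show "proj (vertex P) = P" by (auto simp: proj_def)
qed

lemma proj_image: "proj ` fixed_points s A = {P \<in> points UNIV. Dp P + Dm P < 0}"
proof
  show "proj ` fixed_points s A \<subseteq> {P \<in> points UNIV. Dp P + Dm P < 0}"
    using fixed_neg proj_max by (auto simp: fixed_iff points_max hom_pt_def)
  show "{P \<in> points UNIV. Dp P + Dm P < 0} \<subseteq> proj ` fixed_points s A"
  proof
    fix P assume "P \<in> {P \<in> points UNIV. Dp P + Dm P < 0}"
    then have "is_max UNIV P" "Dp P + Dm P < 0" by (auto simp: points_max)
    then show "P \<in> proj ` fixed_points s A" using vertex_hom[of P] fixed_iff by (metis image_eqI)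
  qed
qed

lemma fixed_point_type:
  assumes M: "M \<in> fixed_points s A"
    and D: "Dp (proj M) = - (of_int ep / of_int mp)" "Dm (proj M) = of_int em / of_int mm"
    and m: "mp > 0" "mm < 0" "gcd ep mp = 1" "gcd em mm = 1" and pq: "det2 p ep q mp = 1"
  shows "(\<exists>d e :: nat. int d = - det2 ep em mp mm \<and> [int e = det2 p em q mm] (mod int d)
        \<and> quotient_singularity (\<lambda>c. base_embed (s c)) A M d e)
     \<and> (M \<in> Sing A \<longleftrightarrow> - det2 ep em mp mm \<noteq> 1)"
proof -
  have H: "hom_pt M" using M fixed_iff by simp
  then have Mm: "is_max A M" by (simp add: hom_pt_def)
  have cop: "coprime mp (- ep)" "coprime (- mm) em" using m by (simp_all add: coprime_iff_gcd_eq_1 gcd.commute)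
  \<comment> \<open>The sign change at \<open>mm\<close> gives the form \<open>be\<close> a positive
    leading coefficient. With these signs \<open>\<Delta>\<close> is the determinant of
    \<open>al\<close> and \<open>be\<close>, and it is positive because the divisor sum is
    negative.\<close>
  interpret X: dpd_point s Dp Dm "proj M" mp "- ep" "- mm" em M
    by (rule dpd_pointI[OF Mm]) (use m cop D in simp_all)
  define \<Delta> where "\<Delta> = - det2 ep em mp mm"
  have \<Delta>: "\<Delta> = mp * em - (- ep) * (- mm)" by (simp add: \<Delta>_def det2_def algebra_simps)
  have "Dp (proj M) + Dm (proj M) = - (of_int \<Delta> / of_int (mp * (- mm)))"
    using m unfolding D \<Delta> by (simp add: field_simps)
  then have "0 < (of_int \<Delta> / of_int (mp * (- mm)) :: rat)" using fixed_neg[OF H] by simp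
  moreover have "0 < mp * (- mm)" by (rule mult_pos_pos) (use m in simp_all)
  then have "0 < (of_int (mp * (- mm)) :: rat)" by (simp only: of_int_0_less_iff)
  moreover have "0 < a / b \<Longrightarrow> 0 < b \<Longrightarrow> 0 < a" for a b :: rat by (simp add: zero_less_divide_iff)
  ultimately have "0 < (of_int \<Delta> :: rat)" by blast
  then have \<Delta>0: "0 < \<Delta>" by simp
  have hom: "\<And>n x. n \<noteq> 0 \<Longrightarrow> sg n x \<in> A \<Longrightarrow> sg n x \<in> M" using H by (simp add: hom_pt_def)
  interpret Y: cone_fixed "ord_at (proj M)" "FF (curve_point.tt (proj M)) 1" "\<lambda>c. FF (s c) 1" mp "- ep" "- mm" em X.N \<Delta>
    by unfold_locales (use \<Delta> \<Delta>0 X.N_max X.mon_fixed[OF hom] in blast)+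
  have alpq: "X.K.al p q = 1" using pq by (simp add: X.K.al_def det2_def mult.commute)
  have bepq: "X.K.be p q = - det2 p em q mm" by (simp add: X.K.be_def det2_def mult.commute)
  define d where "d = nat \<Delta>"
  have d: "int d = \<Delta>" using \<Delta>0 by (simp add: d_def)
  \<comment> \<open>By \<open>bepq\<close> this is the residue of \<open>- be p q\<close>, the sign
    that the description of the semigroup requires.\<close>
  define e where "e = nat (det2 p em q mm mod \<Delta>)"
  have e: "int e = det2 p em q mm mod \<Delta>" using \<Delta>0 by (simp add: e_def)
  have ed: "e < d" using pos_mod_bound[OF \<Delta>0, of "det2 p em q mm"] e d by linarith
  have eb: "\<Delta> dvd int e + X.K.be p q" unfolding bepq e by (simp add: mod_eq_dvd_iff[symmetric])
  \<comment> \<open>Since \<open>al p q = 1\<close>, both \<open>mm\<close> and \<open>em\<close>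
    are combinations of \<open>be p q\<close> and \<open>\<Delta>\<close>. A common divisor of
    \<open>e\<close> and \<open>\<Delta>\<close> divides \<open>be p q\<close>, hence these two
    coprime numbers.\<close>
  have "coprime (int e) \<Delta>"
  proof (rule coprimeI)
    fix c assume c: "c dvd int e" "c dvd \<Delta>"
    then have cb: "c dvd X.K.be p q" using eb by (metis dvd_add_right_iff dvd_trans)
    have al: "mp * p - ep * q = 1" using alpq by (simp add: X.K.al_def)
    have "(mp * p - ep * q) * (- mm) = mp * X.K.be p q - q * \<Delta>"
      "(mp * p - ep * q) * em = (- ep) * X.K.be p q + p * \<Delta>"
      unfolding X.K.be_def \<Delta> by (simp_all add: algebra_simps)
    then have "- mm = mp * X.K.be p q - q * \<Delta>" "em = (- ep) * X.K.be p q + p * \<Delta>" unfolding al by simp_all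
    moreover have "c dvd mp * X.K.be p q - q * \<Delta>" "c dvd (- ep) * X.K.be p q + p * \<Delta>"
      by (intro dvd_diff dvd_add dvd_mult cb c(2))+
    ultimately have "c dvd - mm" "c dvd em" by metis+
    then show "is_unit c" using cop(2) by (meson coprime_common_divisor)
  qed
  then have cop_ed: "coprime e d" unfolding d[symmetric] by simp
  have "quotient_singularity X.K.sc X.K.B X.N d e"
    by (rule Y.vertex_quotient[OF alpq d eb ed cop_ed])
  then have 1: "quotient_singularity (\<lambda>c. base_embed (s c)) A M d e" by (simp add: X.quotient_singularity_AB)
  have 2: "[int e = det2 p em q mm] (mod int d)" unfolding d e by (simp add: cong_def)
  have 3: "M \<in> Sing A \<longleftrightarrow> \<Delta> \<noteq> 1"
  proof -
    have "M \<in> Sing A \<longleftrightarrow> \<not> regular_local_ring (local_ring X.K.B X.N)"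
      using Mm by (simp add: Sing_def points_A X.local_ring_AB)
    moreover have "regular_local_ring (local_ring X.K.B X.N)" if "\<Delta> = 1" by (rule Y.vertex_regular[OF that])
    moreover have "\<not> regular_local_ring (local_ring X.K.B X.N)" if "\<Delta> \<noteq> 1"
      by (rule Y.vertex_singular[OF alpq d eb cop_ed]) (use that \<Delta>0 d in linarith)
    ultimately show ?thesis by blast
  qed
  show ?thesis using 1 2 3 d unfolding \<Delta>_def by blast
qed

end

theorem theorem4p15:
  fixes s :: "complex \<Rightarrow> 'a::idom"
    and Dp Dm :: "'a set \<Rightarrow> rat"
  assumes "smooth_affine_curve s"
    and "qdivisor Dp" and "qdivisor Dm"
    and "\<forall>P \<in> points UNIV. Dp P + Dm P \<le> 0"
  shows
    "(Sing (dpd_algebra Dp Dm) \<subseteq> fixed_points s (dpd_algebra Dp Dm)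
      \<and> fixed_points s (dpd_algebra Dp Dm) =
          zero_locus (dpd_algebra Dp Dm) (fixed_ideal (dpd_algebra Dp Dm)))
     \<and>
     (inj_on proj (fixed_points s (dpd_algebra Dp Dm))
      \<and> proj ` fixed_points s (dpd_algebra Dp Dm) = {P \<in> points UNIV. Dp P + Dm P < 0})
     \<and>
     (\<forall>M \<in> fixed_points s (dpd_algebra Dp Dm).
       \<forall>ep mp em mm p q :: int.
         Dp (proj M) = - (of_int ep / of_int mp) \<and> Dm (proj M) = of_int em / of_int mm
         \<and> mp > 0 \<and> mm < 0 \<and> gcd ep mp = 1 \<and> gcd em mm = 1
         \<and> (Dp (proj M) = 0 \<longrightarrow> mp = 1) \<and> (Dm (proj M) = 0 \<longrightarrow> mm = -1)
         \<and> det2 p ep q mp = 1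
         \<longrightarrow>
         (\<exists>d e :: nat. int d = - det2 ep em mp mm \<and> [int e = det2 p em q mm] (mod int d)
            \<and> quotient_singularity (\<lambda>c. base_embed (s c)) (dpd_algebra Dp Dm) M d e)
         \<and> (M \<in> Sing (dpd_algebra Dp Dm) \<longleftrightarrow> - det2 ep em mp mm \<noteq> 1))"
proof -
  interpret dpd s Dp Dm by unfold_locales (use assms in auto)
  show ?thesis
  proof (intro conjI ballI allI impI)
    fix M and ep mp em mm p q :: int
    assume M: "M \<in> fixed_points s A"
      and h: "Dp (proj M) = - (of_int ep / of_int mp) \<and> Dm (proj M) = of_int em / of_int mm
         \<and> mp > 0 \<and> mm < 0 \<and> gcd ep mp = 1 \<and> gcd em mm = 1
         \<and> (Dp (proj M) = 0 \<longrightarrow> mp = 1) \<and> (Dm (proj M) = 0 \<longrightarrow> mm = -1)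
         \<and> det2 p ep q mp = 1"
    have t: "(\<exists>d e :: nat. int d = - det2 ep em mp mm \<and> [int e = det2 p em q mm] (mod int d)
        \<and> quotient_singularity (\<lambda>c. base_embed (s c)) A M d e)
      \<and> (M \<in> Sing A \<longleftrightarrow> - det2 ep em mp mm \<noteq> 1)"
      by (rule fixed_point_type[OF M]) (use h in blast)+
    from t show "\<exists>d e :: nat. int d = - det2 ep em mp mm \<and> [int e = det2 p em q mm] (mod int d)
        \<and> quotient_singularity (\<lambda>c. base_embed (s c)) A M d e" by blast
    from t show "M \<in> Sing A \<longleftrightarrow> - det2 ep em mp mm \<noteq> 1" by blast
  qed (rule Sing_fixed fixed_zero_locus proj_inj proj_image)+
qed

end
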